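(* Let $R_1,R_2$ be real operator systems and let $G\subseteq\mathcal S(R_1)$ be a convex domain. If a free function $f:G\to\mathcal S(R_2)$ is matrix convex and locally bounded, then $f$ analytically continues to the tube $$T(G)=\{X+iY: X\in G\text{ and }Y=Y^*\}.$$
   Context: A real operator system is a real linear subspace $R$, containing $1$, of the self-adjoint elements of a unital $C^*$-algebra $\mathcal A$. Put $\mathcal M(R)=\bigcup_n M_n(\mathbb C)\otimes_{\mathbb R}R$ and $\mathcal S(R)=\bigcup_n S_n(\mathbb C)\otimes_{\mathbb R}R$ (disjoint unions), where $S_n(\mathbb C)$ is the space of Hermitian $n\times n$ matrices. Level $n$ sits inside $M_n(\mathcal A)$, from which it inherits norm and order; $A\le B$ means $B-A$ is positive semidefinite. For a subset $V$, $V_n$ is its part at level $n$. A (free) domain in $\mathcal S(R)$ is a subset $G$ such that: $X\oplus Y\in G\iff X,Y\in G$; $X\in G_n$ implies $U^*XU\in G$ for every $n\times n$ unitary $U$; each $G_n$ is open in $S_n(\mathbb C)\otimes R$. It is convex if each $G_n$ is convex. A free function $f:G\to\mathcal S(R_2)$ maps level $n$ to level $n$, satisfies $f(X\oplus Y)=f(X)\oplus f(Y)$, and $S^{-1}f(X)S=f(S^{-1}XS)$ whenever $S\in M_n(\mathbb C)$ is invertible and $X,S^{-1}XS\in G_n$. On a convex domain, $f$ is matrix convex if $f\left(\frac{A+B}{2}\right)\le\frac{f(A)+f(B)}{2}$ for all $A,B\in G$ of the same size. In the tube, $X\in G_n$ and $Y\in S_n(\mathbb C)\otimes R_1$ for the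 same $n$, so $T(G)_n\subseteq\mathcal M(R_1)_n$ is open. "Analytically continues to $T(G)$" means that at each level $n$ there is an analytic function on $T(G)_n$, with values in $M_n(\mathcal A_2)$ where $\mathcal A_2$ is the ambient $C^*$-algebra (or $\mathcal B(\mathcal K)$) containing $R_2$, that agrees with $f$ on $G_n$. *)

theory Defs
  imports Complex_Main "Jordan_Normal_Form.Matrix"
begin

section \<open>Unital C*-algebras\<close>

class cstar_algebra = real_normed_algebra_1 + banach +
  fixes scaleC :: "complex \<Rightarrow> 'a \<Rightarrow> 'a"  (infixr \<open>*\<^sub>C\<close> 75)
    and star :: "'a \<Rightarrow> 'a"
  assumes scaleC_add_right: "z *\<^sub>C (x + y) = z *\<^sub>C x + z *\<^sub>C y"
    and scaleC_add_left: "(z + w) *\<^sub>C x = z *\<^sub>C x + w *\<^sub>C x"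
    and scaleC_scaleC: "z *\<^sub>C (w *\<^sub>C x) = (z * w) *\<^sub>C x"
    and scaleC_of_real: "complex_of_real r *\<^sub>C x = r *\<^sub>R x"
    and mult_scaleC_left: "(z *\<^sub>C x) * y = z *\<^sub>C (x * y)"
    and mult_scaleC_right: "x * (z *\<^sub>C y) = z *\<^sub>C (x * y)"
    and norm_scaleC: "norm (z *\<^sub>C x) = cmod z * norm x"
    and star_star: "star (star x) = x"
    and star_add: "star (x + y) = star x + star y"
    and star_scaleC: "star (z *\<^sub>C x) = cnj z *\<^sub>C star x"
    and star_mult: "star (x * y) = star y * star x"
    and cstar_identity: "norm (star x * x) = (norm x)\<^sup>2"

instantiation complex :: cstar_algebra
begin

definition scaleC_complex :: "complex \<Rightarrow> complex \<Rightarrow> complex" where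
  "scaleC_complex z x = z * x"

definition star_complex :: "complex \<Rightarrow> complex" where
  "star_complex = cnj"

instance
  by standard
    (simp_all add: scaleC_complex_def star_complex_def algebra_simps norm_mult
      power2_eq_square scaleR_conv_of_real)

end

section \<open>The C*-algebra of square matrices over a C*-algebra\<close>

definition mat_scaleC :: "complex \<Rightarrow> 'a::cstar_algebra mat \<Rightarrow> 'a mat"  (infixr \<open>*\<^sub>C\<^sub>m\<close> 75) where
  "z *\<^sub>C\<^sub>m X = map_mat (\<lambda>x. z *\<^sub>C x) X"

text \<open>For complex matrices this is the conjugate transpose.\<close>

definition mat_star :: "'a::cstar_algebra mat \<Rightarrow> 'a mat" where
  "mat_star X = mat (dim_col X) (dim_row X) (\<lambda>(i, j). star (X $$ (j, i)))"

text \<open>The C*-norm on the \<open>n \<times> n\<close> matrices over \<open>\<A>\<close> is the operator norm of the action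
  on the Hilbert \<open>\<A>\<close>-module \<open>\<A>\<^sup>n\<close>, whose norm is
  \<open>\<parallel>v\<parallel> = \<parallel>\<Sum>\<^sub>i v\<^sub>i\<^sup>* v\<^sub>i\<parallel>\<^sup>1\<^sup>/\<^sup>2\<close>.  The quotient form, with \<open>0 / 0 = 0\<close>, follows \<open>onorm\<close>.\<close>

definition module_norm :: "'a::cstar_algebra vec \<Rightarrow> real" where
  "module_norm v = sqrt (norm (\<Sum>i<dim_vec v. star (vec_index v i) * vec_index v i))"

definition mat_norm :: "'a::cstar_algebra mat \<Rightarrow> real" where
  "mat_norm X = (SUP v \<in> carrier_vec (dim_col X). module_norm (X *\<^sub>v v) / module_norm v)"

text \<open>Positive elements of a C*-algebra are those of the form \<open>Y\<^sup>* Y\<close>.\<close>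

definition mat_pos :: "nat \<Rightarrow> 'a::cstar_algebra mat \<Rightarrow> bool" where
  "mat_pos n P \<longleftrightarrow> (\<exists>Y \<in> carrier_mat n n. P = mat_star Y * Y)"

definition mat_le :: "nat \<Rightarrow> 'a::cstar_algebra mat \<Rightarrow> 'a mat \<Rightarrow> bool" where
  "mat_le n A B \<longleftrightarrow> mat_pos n (B - A)"

text \<open>The canonical copy \<open>S \<otimes> 1\<close> of a complex matrix \<open>S\<close>.\<close>

definition embed_cmat :: "complex mat \<Rightarrow> 'a::cstar_algebra mat" where
  "embed_cmat S = map_mat (\<lambda>z. z *\<^sub>C 1) S"

definition unitary_cmat :: "nat \<Rightarrow> complex mat \<Rightarrow> bool" where
  "unitary_cmat n U \<longleftrightarrow>
     U \<in> carrier_mat n n \<and> mat_star U * U = 1\<^sub>m n \<and> U * mat_star U = 1\<^sub>m n"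

definition dsum :: "'a::zero mat \<Rightarrow> 'a mat \<Rightarrow> 'a mat"  (infixr \<open>\<oplus>\<^sub>m\<close> 65) where
  "X \<oplus>\<^sub>m Y = four_block_mat X (0\<^sub>m (dim_row X) (dim_col Y)) (0\<^sub>m (dim_row Y) (dim_col X)) Y"

section \<open>Real operator systems and their matrix levels\<close>

definition real_operator_system :: "'a::cstar_algebra set \<Rightarrow> bool" where
  "real_operator_system R \<longleftrightarrow> subspace R \<and> 1 \<in> R \<and> (\<forall>x\<in>R. star x = x)"

definition hermitian_cmats :: "nat \<Rightarrow> complex mat set" where
  "hermitian_cmats n = {H \<in> carrier_mat n n. mat_star H = H}"

text \<open>The image in the matrix algebra of the algebraic tensor product over the reals: finite sums of
  elementary tensors \<open>H \<otimes> r\<close>, the matrix with entries \<open>H\<^sub>i\<^sub>j r\<close>.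
  Real coefficients are absorbed into the factors, which are taken from real subspaces.\<close>

definition tensor_level :: "nat \<Rightarrow> complex mat set \<Rightarrow> 'a::cstar_algebra set \<Rightarrow> 'a mat set" where
  "tensor_level n V R =
     {mat n n (\<lambda>(i, j). \<Sum>k<m. (H k $$ (i, j)) *\<^sub>C r k) | (m::nat) H r.
        \<forall>k<m. H k \<in> V \<and> r k \<in> R}"

definition M_level :: "'a::cstar_algebra set \<Rightarrow> nat \<Rightarrow> 'a mat set" where
  "M_level R n = tensor_level n (carrier_mat n n) R"

definition S_level :: "'a::cstar_algebra set \<Rightarrow> nat \<Rightarrow> 'a mat set" where
  "S_level R n = tensor_level n (hermitian_cmats n) R"

text \<open>Disjointness of the union is automatic, since a matrix carries its size.\<close>

definition S_union :: "'a::cstar_algebra set \<Rightarrow> 'a mat set" where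
  "S_union R = (\<Union>n\<in>{1..}. S_level R n)"

definition level :: "'a mat set \<Rightarrow> nat \<Rightarrow> 'a mat set" where
  "level V n = V \<inter> carrier_mat n n"

section \<open>Free domains and free functions\<close>

definition free_domain :: "'a::cstar_algebra set \<Rightarrow> 'a mat set \<Rightarrow> bool" where
  "free_domain R G \<longleftrightarrow>
     G \<subseteq> S_union R \<and>
     (\<forall>X\<in>S_union R. \<forall>Y\<in>S_union R. X \<oplus>\<^sub>m Y \<in> G \<longleftrightarrow> X \<in> G \<and> Y \<in> G) \<and>
     (\<forall>n. \<forall>X\<in>level G n. \<forall>U. unitary_cmat n U \<longrightarrow>
        embed_cmat (mat_star U) * X * embed_cmat U \<in> G) \<and>
     (\<forall>n. \<forall>X\<in>level G n. \<exists>\<epsilon>>0. \<forall>Z\<in>S_level R n. mat_norm (Z - X) < \<epsilon> \<longrightarrow> Z \<in> G)"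

definition levelwise_convex :: "'a::cstar_algebra mat set \<Rightarrow> bool" where
  "levelwise_convex G \<longleftrightarrow>
     (\<forall>n. \<forall>X\<in>level G n. \<forall>Y\<in>level G n. \<forall>t::real. 0 \<le> t \<and> t \<le> 1 \<longrightarrow>
        complex_of_real (1 - t) *\<^sub>C\<^sub>m X + complex_of_real t *\<^sub>C\<^sub>m Y \<in> G)"

definition free_function ::
  "'a::cstar_algebra mat set \<Rightarrow> 'b::cstar_algebra set \<Rightarrow> ('a mat \<Rightarrow> 'b mat) \<Rightarrow> bool" where
  "free_function G R\<^sub>2 f \<longleftrightarrow>
     (\<forall>n. \<forall>X\<in>level G n. f X \<in> S_level R\<^sub>2 n) \<and>
     (\<forall>X\<in>G. \<forall>Y\<in>G. f (X \<oplus>\<^sub>m Y) = f X \<oplus>\<^sub>m f Y) \<and>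
     (\<forall>n. \<forall>X\<in>level G n. \<forall>S\<in>carrier_mat n n. \<forall>S'\<in>carrier_mat n n.
        inverts_mat S S' \<and> inverts_mat S' S \<and> embed_cmat S' * X * embed_cmat S \<in> G \<longrightarrow>
        embed_cmat S' * f X * embed_cmat S = f (embed_cmat S' * X * embed_cmat S))"

definition matrix_convex ::
  "'a::cstar_algebra mat set \<Rightarrow> ('a mat \<Rightarrow> 'b::cstar_algebra mat) \<Rightarrow> bool" where
  "matrix_convex G f \<longleftrightarrow>
     (\<forall>n. \<forall>A\<in>level G n. \<forall>B\<in>level G n.
        mat_le n (f ((1/2) *\<^sub>C\<^sub>m (A + B))) ((1/2) *\<^sub>C\<^sub>m (f A + f B)))"

definition locally_bounded ::
  "'a::cstar_algebra mat set \<Rightarrow> ('a mat \<Rightarrow> 'b::cstar_algebra mat) \<Rightarrow> bool" where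
  "locally_bounded G f \<longleftrightarrow>
     (\<forall>n. \<forall>X\<in>level G n. \<exists>\<epsilon>>0. \<exists>K. \<forall>Z\<in>level G n.
        mat_norm (Z - X) < \<epsilon> \<longrightarrow> mat_norm (f Z) \<le> K)"

section \<open>Analytic continuation to the tube\<close>

definition tube :: "'a::cstar_algebra set \<Rightarrow> 'a mat set \<Rightarrow> 'a mat set" where
  "tube R G = (\<Union>n. {X + \<i> *\<^sub>C\<^sub>m Y | X Y. X \<in> level G n \<and> Y \<in> S_level R n})"

definition bounded_clinear_level ::
  "'a::cstar_algebra set \<Rightarrow> nat \<Rightarrow> ('a mat \<Rightarrow> 'b::cstar_algebra mat) \<Rightarrow> bool" where
  "bounded_clinear_level R n D \<longleftrightarrow>
     (\<forall>H\<in>M_level R n. D H \<in> carrier_mat n n) \<and>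
     (\<forall>H\<in>M_level R n. \<forall>K\<in>M_level R n. D (H + K) = D H + D K) \<and>
     (\<forall>H\<in>M_level R n. \<forall>z. D (z *\<^sub>C\<^sub>m H) = z *\<^sub>C\<^sub>m D H) \<and>
     (\<exists>C. \<forall>H\<in>M_level R n. mat_norm (D H) \<le> C * mat_norm H)"

text \<open>Analyticity on a subset \<open>T\<close> of level \<open>n\<close> of the complex normed space
  \<open>M\<^sub>n(\<complex>) \<otimes> R\<close>: complex Frechet differentiability at every point, in
  line with the library's \<open>holomorphic_on\<close>.  The derivative is two-sided: every small
  increment \<open>H\<close> of the whole level is required to stay in \<open>T\<close>, so \<open>T\<close> is forced to be open.\<close>

definition analytic_level ::
  "'a::cstar_algebra set \<Rightarrow> nat \<Rightarrow> 'a mat set \<Rightarrow> ('a mat \<Rightarrow> 'b::cstar_algebra mat) \<Rightarrow> bool" where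
  "analytic_level R n T F \<longleftrightarrow>
     T \<subseteq> M_level R n \<and>
     (\<forall>Z\<in>T. F Z \<in> carrier_mat n n) \<and>
     (\<forall>Z\<in>T. \<exists>D. bounded_clinear_level R n D \<and>
        (\<forall>\<epsilon>>0. \<exists>\<delta>>0. \<forall>H\<in>M_level R n. mat_norm H < \<delta> \<longrightarrow>
           Z + H \<in> T \<and> mat_norm (F (Z + H) - F Z - D H) \<le> \<epsilon> * mat_norm H))"

definition continues_analytically_to_tube ::
  "'a::cstar_algebra set \<Rightarrow> 'a mat set \<Rightarrow> ('a mat \<Rightarrow> 'b::cstar_algebra mat) \<Rightarrow> bool" where
  "continues_analytically_to_tube R G f \<longleftrightarrow>
     (\<forall>n\<ge>1. \<exists>F. analytic_level R n (level (tube R G) n) F \<and> (\<forall>X\<in>level G n. F X = f X))"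

end

theory Submission
  imports Defs "HOL-Complex_Analysis.Complex_Analysis" "HOL-Computational_Algebra.Computational_Algebra"
    "Jordan_Normal_Form.Determinant"
begin

text \<open>The proof reduces the statement to functions of one real variable and glues the resulting
  continuations together again.

  A matrix convex free function satisfies a Jensen inequality for compressions: conjugate a block
  diagonal matrix by an orthogonal matrix, which \<open>f\<close> respects, and average the result with its
  conjugate under \<open>diag(1, \<dots>, 1, -1)\<close>; if the average is again block diagonal, convexity at this
  one midpoint compares the values of \<open>f\<close> at the two families of blocks (\<open>jensen\<close>). For blocks on a
  line \<open>X + t Y\<close> there is an orthogonal matrix, built from the Lagrange polynomials of equispaced
  nodes, for which Jensen's inequality says that the differences of order \<open>2N\<close> of
  \<open>P\<^sup>2 \<phi>\<close> are nonnegative for every polynomial \<open>P\<close> of degree less than \<open>N\<close>. Here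
  \<open>\<phi>(t) = \<omega>(v\<^sup>* f(X + t Y) v)\<close> for a positive functional \<open>\<omega>\<close> and a vector \<open>v\<close>
  (\<open>kraus_of_matrix_convex\<close>).

  In one variable this inequality forces analyticity, as in Kraus' theorem. Bernstein polynomials
  inherit the nonnegative even differences, so \<open>\<phi>\<close> is a power series near \<open>0\<close>; its coefficients
  of order at least two form a positive Hankel form with bounded even entries, i.e. they behave as the
  moments of a measure on \<open>[-1, 1]\<close>. Expanding the Cauchy transform of that measure in Chebyshev
  polynomials yields a holomorphic function of \<open>w\<close> in the unit disc that agrees with
  \<open>\<phi>(2w / (1 + w\<^sup>2))\<close> for small real \<open>w\<close>, and whose bound depends only on the supremum of \<open>|\<phi>|\<close>
  (\<open>kraus_disc\<close>). The map \<open>2w / (1 + w\<^sup>2)\<close> covers the strip \<open>|Re t| < 1\<close>. A short real segment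
  on which \<open>f\<close> is bounded thus suffices to continue \<open>t \<mapsto> f(X + t Y)\<close> to a whole vertical strip; this
  is why the imaginary part in the tube may be arbitrarily large. The value at \<open>t = \<i>\<close> is the
  continued function at \<open>X + \<i> Y\<close>.

  Positive functionals detect norms and elements of the target algebra, once it is known that
  \<open>y\<^sup>* y\<close> lies in a cone to which the Hahn--Banach theorem applies (\<open>cpos_star_mult\<close>,
  \<open>norm_le_of_states\<close>); so the scalar continuations assemble to elements of the algebra.

  It remains to see that the values at different points fit together. Along a self-adjoint direction
  \<open>U\<close> the function \<open>u(t, s) = \<omega>(f(X + t Y + s U))\<close> continues in each variable separately.
  Polynomial interpolation in \<open>s\<close> and the two-constants theorem in \<open>t\<close> give a joint continuation, and
  with it that \<open>\<zeta> \<mapsto> F(X + \<i> Y + \<zeta> U)\<close> is holomorphic (\<open>continuation_along_lines\<close>). Two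
  applications of the Schwarz lemma turn separate holomorphy in two such directions into an estimate
  with quadratic remainder, which is complex differentiability on the tube.\<close>

section \<open>The involution and complex scalars\<close>

lemma star_zero [simp]: "star (0::'a::cstar_algebra) = 0"
  using star_add[of "0::'a" 0] by simp

lemma star_one [simp]: "star (1::'a::cstar_algebra) = 1"
proof -
  have "star (star (1::'a) * 1) = star 1 * star (star 1)" by (rule star_mult)
  then show ?thesis by (simp add: star_star)
qed

lemma star_minus [simp]: "star (- x) = - star (x::'a::cstar_algebra)"
  using star_add[of x "-x"] by (simp add: eq_neg_iff_add_eq_0 add.commute)

lemma star_diff: "star (x - y) = star x - star (y::'a::cstar_algebra)"
  using star_add[of x "-y"] by simp

lemma star_scaleR: "star (r *\<^sub>R x) = r *\<^sub>R star (x::'a::cstar_algebra)"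
  using star_scaleC[of "complex_of_real r" x] by (simp add: scaleC_of_real)

lemma star_of_real [simp]: "star (of_real r :: 'a::cstar_algebra) = of_real r"
  by (simp add: of_real_def star_scaleR)

lemma norm_star [simp]: "norm (star x) = norm (x::'a::cstar_algebra)"
proof -
  have le: "norm y \<le> norm (star y)" for y :: 'a
  proof (cases "y = 0")
    case False
    have "norm y * norm y \<le> norm (star y) * norm y"
      using cstar_identity[of y] norm_mult_ineq[of "star y" y] by (simp add: power2_eq_square)
    then show ?thesis using False by simp
  qed simp
  show ?thesis using le[of x] le[of "star x"] by (simp add: star_star)
qed

lemma bounded_linear_star: "bounded_linear (star :: 'a::cstar_algebra \<Rightarrow> 'a)"
  by (rule bounded_linear_intro[where K=1]) (simp_all add: star_add star_scaleR)

lemma star_power: "star (x ^ k) = star (x::'a::cstar_algebra) ^ k"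
  by (induction k) (simp_all add: star_mult power_commutes)

lemma scaleC_one [simp]: "1 *\<^sub>C x = (x::'a::cstar_algebra)"
  using scaleC_of_real[of 1 x] by simp

lemma scaleC_scaleR: "z *\<^sub>C (r *\<^sub>R x) = r *\<^sub>R (z *\<^sub>C (x::'a::cstar_algebra))"
  using scaleC_scaleC[of z "complex_of_real r" x] scaleC_scaleC[of "complex_of_real r" z x]
  by (simp add: scaleC_of_real mult.commute)

lemma scaleC_zero_left [simp]: "0 *\<^sub>C x = (0::'a::cstar_algebra)"
  using scaleC_of_real[of 0 x] by simp

lemma scaleC_zero_right [simp]: "z *\<^sub>C (0::'a::cstar_algebra) = 0"
  using scaleC_add_right[of z "0::'a" 0] by simp

lemma scaleC_minus_left: "(- z) *\<^sub>C x = - (z *\<^sub>C (x::'a::cstar_algebra))"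
  using scaleC_add_left[of z "-z" x] by (simp add: eq_neg_iff_add_eq_0 add.commute)

lemma scaleC_minus_right: "z *\<^sub>C (- x) = - (z *\<^sub>C (x::'a::cstar_algebra))"
  using scaleC_add_right[of z x "-x"] by (simp add: eq_neg_iff_add_eq_0 add.commute)

lemma scaleC_diff_right: "z *\<^sub>C (x - y) = z *\<^sub>C x - z *\<^sub>C (y::'a::cstar_algebra)"
  using scaleC_add_right[of z x "-y"] by (simp add: scaleC_minus_right)

lemma scaleC_sum_right: "z *\<^sub>C (\<Sum>i\<in>I. g i) = (\<Sum>i\<in>I. z *\<^sub>C (g i::'a::cstar_algebra))"
  by (induction I rule: infinite_finite_induct) (simp_all add: scaleC_add_right)

lemma scaleC_sum_left: "(\<Sum>i\<in>I. g i) *\<^sub>C x = (\<Sum>i\<in>I. g i *\<^sub>C (x::'a::cstar_algebra))"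
  by (induction I rule: infinite_finite_induct) (simp_all add: scaleC_add_left)

lemma star_sum: "star (\<Sum>i\<in>I. g i) = (\<Sum>i\<in>I. star (g i::'a::cstar_algebra))"
  by (induction I rule: infinite_finite_induct) (simp_all add: star_add)

lemma norm_eq_sqrt_of_star_mult:
  assumes "star x = (x::'a::cstar_algebra)" shows "norm (x * x) = (norm x)\<^sup>2"
  using cstar_identity[of x] assms by simp

section \<open>Square roots and the positive cone\<close>

text \<open>The coefficients of \<open>(1 - x)\<^sup>1\<^sup>/\<^sup>2\<close>. Only the constant one is positive and they sum to
  \<open>0\<close>, so the series converges absolutely on the closed unit ball.\<close>

definition sqrt_coeff :: "nat \<Rightarrow> real" where
  "sqrt_coeff k = (-1) ^ k * ((1/2) gchoose k)"

lemma sqrt_coeff_0 [simp]: "sqrt_coeff 0 = 1"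
  by (simp add: sqrt_coeff_def)

lemma sqrt_coeff_Suc: "sqrt_coeff (Suc k) = sqrt_coeff k * ((real k - 1/2) / (real k + 1))"
proof -
  have "((1/2::real) gchoose Suc k) = ((1/2) gchoose k) * ((1/2 - real k) / (real k + 1))"
    using gbinomial_absorb_comp[of "1/2::real" k] gbinomial_mult_1[of "1/2::real" k]
    by (simp add: field_simps)
  then show ?thesis unfolding sqrt_coeff_def by (simp only: power_Suc) (simp add: field_simps)
qed

lemma sqrt_coeff_nonpos: "k \<ge> 1 \<Longrightarrow> sqrt_coeff k \<le> 0"
proof (induction k rule: nat_induct_at_least)
  case base then show ?case using sqrt_coeff_Suc[of 0] by simp
next
  case (Suc k)
  then show ?case unfolding sqrt_coeff_Suc
    by (intro mult_nonpos_nonneg divide_nonneg_pos) auto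
qed

text \<open>The partial sums are the binomial coefficients \<open>(-1)\<^sup>n (-1/2 choose n)\<close>, products of positive
  factors.\<close>

lemma sum_sqrt_coeff_nonneg: "(\<Sum>k\<le>n. sqrt_coeff k) \<ge> 0"
proof -
  have "(\<Sum>k\<le>n. sqrt_coeff k) = (-1) ^ n * ((1/2 - 1) gchoose n)"
    using gbinomial_sum_lower_neg[of "1/2::real" n] by (simp add: sqrt_coeff_def mult.commute)
  also have "\<dots> \<ge> 0"
  proof (induction n)
    case (Suc n)
    have "((-1/2::real) gchoose Suc n) = ((-1/2) gchoose n) * ((-1/2 - real n) / (real n + 1))"
      using gbinomial_absorb_comp[of "-1/2::real" n] gbinomial_mult_1[of "-1/2::real" n]
      by (simp add: field_simps)
    moreover have "1/2 - 1 = (-1/2::real)" by simp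
    ultimately have "(-1) ^ Suc n * ((1/2 - 1) gchoose Suc n) =
        ((-1) ^ n * ((1/2 - 1) gchoose n)) * ((1/2 + real n) / (real n + 1))"
      by (simp only: power_Suc) (simp only: divide_simps ring_distribs; simp add: algebra_simps)
    then show ?case using Suc by (simp add: mult_nonneg_nonneg)
  qed simp
  finally show ?thesis .
qed

lemma summable_abs_sqrt_coeff: "summable (\<lambda>k. \<bar>sqrt_coeff k\<bar>)"
proof (rule bounded_imp_summable[where B=2])
  fix n
  have "(\<Sum>k\<le>n. \<bar>sqrt_coeff k\<bar>) = 2 - (\<Sum>k\<le>n. sqrt_coeff k)"
    by (induction n) (use sqrt_coeff_nonpos in \<open>auto simp: abs_of_nonpos\<close>)
  then show "(\<Sum>k\<le>n. \<bar>sqrt_coeff k\<bar>) \<le> 2" using sum_sqrt_coeff_nonneg[of n] by simp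
qed auto

definition sqrt1m :: "'a::cstar_algebra \<Rightarrow> 'a" where
  "sqrt1m x = (\<Sum>k. sqrt_coeff k *\<^sub>R x ^ k)"

lemma summable_norm_sqrt1m:
  assumes "norm (x::'a::cstar_algebra) \<le> 1"
  shows "summable (\<lambda>k. norm (sqrt_coeff k *\<^sub>R x ^ k))"
proof (rule summable_comparison_test[OF _ summable_abs_sqrt_coeff], intro exI allI impI)
  fix k
  have "norm (x ^ k) \<le> 1"
    using norm_power_ineq[of x k] power_le_one[OF norm_ge_zero assms, of k] by linarith
  then show "norm (norm (sqrt_coeff k *\<^sub>R x ^ k)) \<le> \<bar>sqrt_coeff k\<bar>"
    by (simp add: mult_left_le)
qed

text \<open>The Cauchy product of the series with itself has the coefficients of \<open>1 - x\<close>, by Vandermonde's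
  identity for \<open>1/2 + 1/2 = 1\<close>.\<close>

lemma sqrt1m_square:
  assumes "norm (x::'a::cstar_algebra) \<le> 1"
  shows "sqrt1m x * sqrt1m x = 1 - x"
proof -
  let ?a = "\<lambda>k. sqrt_coeff k *\<^sub>R x ^ k"
  have "(\<lambda>k. \<Sum>i\<le>k. ?a i * ?a (k - i)) sums (sqrt1m x * sqrt1m x)"
    unfolding sqrt1m_def by (rule Cauchy_product_sums; rule summable_norm_sqrt1m[OF assms])
  moreover have "(\<Sum>i\<le>k. ?a i * ?a (k - i)) = ((-1) ^ k * (1 gchoose k)) *\<^sub>R x ^ k" for k
  proof -
    have "(\<Sum>i\<le>k. ?a i * ?a (k - i)) = (\<Sum>i\<le>k. (sqrt_coeff i * sqrt_coeff (k - i)) *\<^sub>R x ^ k)"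
      by (intro sum.cong) (auto simp: power_add[symmetric])
    also have "\<dots> = (\<Sum>i\<le>k. sqrt_coeff i * sqrt_coeff (k - i)) *\<^sub>R x ^ k"
      by (simp add: scaleR_sum_left)
    also have "(\<Sum>i\<le>k. sqrt_coeff i * sqrt_coeff (k - i))
        = (\<Sum>i\<le>k. (-1) ^ k * (((1/2) gchoose i) * ((1/2) gchoose (k - i))))"
    proof (intro sum.cong refl)
      fix i assume "i \<in> {..k}"
      then have "(-1::real) ^ k = (-1) ^ i * (-1) ^ (k - i)" by (simp add: power_add[symmetric])
      then show "sqrt_coeff i * sqrt_coeff (k - i)
          = (-1) ^ k * (((1/2) gchoose i) * ((1/2) gchoose (k - i)))"
        unfolding sqrt_coeff_def by (simp only: ac_simps)
    qed
    also have "\<dots> = (-1) ^ k * (1 gchoose k)"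
      using gbinomial_Vandermonde[of "1/2::real" "1/2" k]
      by (simp add: sum_distrib_left[symmetric] atLeast0AtMost)
    finally show ?thesis .
  qed
  ultimately have *: "(\<lambda>k. ((-1) ^ k * (1 gchoose k)) *\<^sub>R x ^ k) sums (sqrt1m x * sqrt1m x)" by simp
  have "(\<lambda>k. ((-1) ^ k * ((1::real) gchoose k)) *\<^sub>R x ^ k) sums
      (\<Sum>k\<in>{0,1}. ((-1) ^ k * ((1::real) gchoose k)) *\<^sub>R x ^ k)"
  proof (rule sums_finite)
    fix k :: nat assume "k \<notin> {0,1}"
    then have "((1::real) gchoose k) = 0"
      using binomial_gbinomial[of 1 k, where ?'a=real] by (simp add: binomial_eq_0)
    then show "((-1) ^ k * ((1::real) gchoose k)) *\<^sub>R x ^ k = 0" by simp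
  qed simp
  then have "(\<lambda>k. ((-1) ^ k * ((1::real) gchoose k)) *\<^sub>R x ^ k) sums (1 - x)" by simp
  then show ?thesis using * sums_unique2 by blast
qed

lemma sqrt1m_commute:
  assumes "norm (x::'a::cstar_algebra) \<le> 1" "y * x = x * y"
  shows "y * sqrt1m x = sqrt1m x * y"
proof -
  have s: "summable (\<lambda>k. sqrt_coeff k *\<^sub>R x ^ k)"
    by (rule summable_norm_cancel[OF summable_norm_sqrt1m[OF assms(1)]])
  have "y * x ^ k = x ^ k * y" for k
    by (induction k) (simp_all add: assms(2) mult.assoc[symmetric], simp add: assms(2) mult.assoc)
  then show ?thesis unfolding sqrt1m_def
    by (simp add: suminf_mult[OF s, symmetric] suminf_mult2[OF s])
qed

lemma sqrt1m_selfadjoint: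
  assumes "norm (x::'a::cstar_algebra) \<le> 1" "star x = x"
  shows "star (sqrt1m x) = sqrt1m x"
  unfolding sqrt1m_def
  using bounded_linear.suminf[OF bounded_linear_star
      summable_norm_cancel[OF summable_norm_sqrt1m[OF assms(1)]]]
  by (simp add: star_scaleR star_power assms(2))

text \<open>This places \<open>sqrt1m x\<close> in the positive cone defined below, with radius \<open>1\<close>.\<close>

lemma norm_one_minus_sqrt1m:
  assumes "norm (x::'a::cstar_algebra) \<le> 1" shows "norm (1 - sqrt1m x) \<le> 1"
proof -
  let ?a = "\<lambda>k. sqrt_coeff k *\<^sub>R x ^ k"
  note s = summable_norm_sqrt1m[OF assms]
  have "norm (x ^ k) \<le> 1" for k
    using norm_power_ineq[of x k] power_le_one[OF norm_ge_zero assms, of k] by linarith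
  then have le: "norm (?a k) \<le> \<bar>sqrt_coeff k\<bar>" for k by (simp add: mult_left_le)
  have s1: "summable (\<lambda>k. norm (?a (Suc k)))" using s by (subst summable_Suc_iff)
  have s2: "summable (\<lambda>k. \<bar>sqrt_coeff (Suc k)\<bar>)"
    using summable_abs_sqrt_coeff by (subst summable_Suc_iff)
  have "sqrt1m x - 1 = (\<Sum>k. ?a (Suc k))"
    unfolding sqrt1m_def using suminf_split_head[OF summable_norm_cancel[OF s]] by simp
  then have "norm (sqrt1m x - 1) \<le> (\<Sum>k. norm (?a (Suc k)))" using summable_norm[OF s1] by simp
  also have "\<dots> \<le> (\<Sum>k. \<bar>sqrt_coeff (Suc k)\<bar>)" by (rule suminf_le[OF le s1 s2])
  also have "\<dots> \<le> 1"
  proof (rule suminf_le_const[OF s2])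
    fix n
    have "(\<Sum>k<n. \<bar>sqrt_coeff (Suc k)\<bar>) = 1 - (\<Sum>k\<le>n. sqrt_coeff k)"
      by (induction n) (use sqrt_coeff_nonpos in \<open>auto simp: abs_of_nonpos\<close>)
    then show "(\<Sum>k<n. \<bar>sqrt_coeff (Suc k)\<bar>) \<le> 1" using sum_sqrt_coeff_nonneg[of n] by simp
  qed
  finally show ?thesis by (simp add: norm_minus_commute)
qed

text \<open>Since \<open>u = x + \<i> y\<close> satisfies \<open>u\<^sup>* u = t\<^sup>2\<close>, the C*-identity gives \<open>norm u = t\<close>, and \<open>x\<close> is the
  mean of \<open>u\<close> and \<open>u\<^sup>*\<close>. This replaces all arguments with the joint spectrum.\<close>

lemma norm_le_of_sum_of_squares:
  fixes x y :: "'a::cstar_algebra"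
  assumes "star x = x" "star y = y" "x * y = y * x" "x * x + y * y = of_real (t\<^sup>2)" "t \<ge> 0"
  shows "norm x \<le> t"
proof -
  let ?u = "x + \<i> *\<^sub>C y" and ?v = "x - \<i> *\<^sub>C y"
  have st: "star ?u = ?v"
    using assms by (simp add: star_add star_scaleC scaleC_minus_left)
  have "?v * ?u = x * x + y * y"
    using assms(3)
    by (simp add: algebra_simps mult_scaleC_left mult_scaleC_right scaleC_scaleC scaleC_minus_left
        scaleC_diff_right scaleC_add_right)
  then have "(norm ?u)\<^sup>2 = t\<^sup>2"
    using cstar_identity[of ?u] st assms(4) by (simp del: of_real_power)
  then have u: "norm ?u = t" using assms(5) power2_eq_iff_nonneg[of "norm ?u" t] by simp
  have v: "norm ?v = t" using u st norm_star[of ?u] by simp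
  have "2 *\<^sub>R x = ?u + ?v" by (simp add: scaleR_2)
  then have "2 * norm x \<le> norm ?u + norm ?v"
    using norm_triangle_ineq[of ?u ?v] by (metis abs_numeral norm_scaleR)
  then show ?thesis using u v by simp
qed

text \<open>Positivity without the spectrum: a self-adjoint element is positive if it is at most \<open>t\<close> away
  from the scalar \<open>t\<close>. In this form it is evident that sums are positive; that squares and the elements
  \<open>y\<^sup>* y\<close> are positive is not, and is proved below.\<close>

definition cpos :: "'a::cstar_algebra \<Rightarrow> bool" where
  "cpos a \<longleftrightarrow> star a = a \<and> (\<exists>t\<ge>0. norm (of_real t - a) \<le> t)"

lemma cpos_mono:
  assumes "norm (of_real t - (a::'a::cstar_algebra)) \<le> t" "t \<le> s"
  shows "norm (of_real s - a) \<le> s"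
proof -
  have "of_real s - a = of_real (s - t) + (of_real t - a)" by simp
  then have "norm (of_real s - a) \<le> norm (of_real (s - t)::'a) + norm (of_real t - a)"
    by (metis norm_triangle_ineq)
  moreover have "norm (of_real (s - t)::'a) = s - t" using assms(2) by (simp only: norm_of_real)
  ultimately show ?thesis using assms by linarith
qed

lemma cpos_add: assumes "cpos a" "cpos b" shows "cpos (a + b)"
proof -
  obtain s t where st: "s \<ge> 0" "t \<ge> 0" "norm (of_real s - a) \<le> s" "norm (of_real t - b) \<le> t"
    using assms by (auto simp: cpos_def)
  have "of_real (s + t) - (a + b) = (of_real s - a) + (of_real t - b)" by simp
  then have "norm (of_real (s + t) - (a + b)) \<le> s + t"
    using norm_triangle_ineq[of "of_real s - a" "of_real t - b"] st by (metis add_mono order_trans)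
  then show ?thesis using assms st by (auto simp: cpos_def star_add intro!: exI[of _ "s + t"])
qed

lemma cpos_scaleR: assumes "cpos a" "r \<ge> 0" shows "cpos (r *\<^sub>R a)"
proof -
  obtain s where s: "s \<ge> 0" "norm (of_real s - a) \<le> s" using assms by (auto simp: cpos_def)
  have "of_real (r * s) - r *\<^sub>R a = r *\<^sub>R (of_real s - a)"
    by (simp add: scaleR_diff_right of_real_def)
  then have "norm (of_real (r * s) - r *\<^sub>R a) \<le> r * s"
    using s assms by (simp add: mult_left_mono)
  then show ?thesis using assms s
    by (auto simp: cpos_def star_scaleR intro!: exI[of _ "r * s"])
qed

lemma cpos_of_real: "r \<ge> 0 \<Longrightarrow> cpos (of_real r :: 'a::cstar_algebra)"
  unfolding cpos_def by (intro conjI exI[of _ r]) auto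

lemma cpos_sum: "(\<And>i. i \<in> I \<Longrightarrow> cpos (g i)) \<Longrightarrow> cpos (\<Sum>i\<in>I. g i)"
  using cpos_of_real[of 0]
  by (induction I rule: infinite_finite_induct) (auto intro: cpos_add)

text \<open>For \<open>norm b = 1\<close> the element \<open>c = (1 - b\<^sup>2)\<^sup>1\<^sup>/\<^sup>2\<close> satisfies \<open>c\<^sup>2 + b\<^sup>2 = 1\<close>, so \<open>1 - b\<^sup>2 = c\<^sup>2\<close> has
  norm at most \<open>1\<close>.\<close>

lemma cpos_square:
  assumes "star a = (a::'a::cstar_algebra)" shows "cpos (a * a)"
proof (cases "a = 0")
  case False
  define r where "r = norm a"
  have r: "r > 0" using False by (simp add: r_def)
  define b where "b = (1/r) *\<^sub>R a"
  have b: "star b = b" "norm b = 1" using r assms by (auto simp: b_def star_scaleR r_def)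
  have nb: "norm (b * b) \<le> 1" using norm_mult_ineq[of b b] b by simp
  define c where "c = sqrt1m (b * b)"
  have c: "star c = c" "c * c = 1 - b * b" "c * b = b * c"
    using sqrt1m_selfadjoint[OF nb] sqrt1m_square[OF nb] sqrt1m_commute[OF nb, of b] b
    by (simp_all add: c_def star_mult mult.assoc)
  have "norm c \<le> 1"
    by (rule norm_le_of_sum_of_squares[of c b]) (use b c in auto)
  then have "norm (1 - b * b) \<le> 1"
    using norm_eq_sqrt_of_star_mult[OF c(1)] c(2) by (simp add: power_le_one)
  then have "cpos (b * b)" using b by (auto simp: cpos_def star_mult intro!: exI[of _ 1])
  moreover have "a * a = (r * r) *\<^sub>R (b * b)" using r by (simp add: b_def)
  ultimately show ?thesis using cpos_scaleR[of "b * b" "r * r"] by simp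
qed (use cpos_of_real[of 0] in simp)

text \<open>The root is a norm limit of polynomials in \<open>a\<close>; hence it commutes with everything that commutes
  with \<open>a\<close>.\<close>

lemma cpos_sqrt:
  assumes "cpos (a::'a::cstar_algebra)"
  obtains c where "star c = c" "c * c = a" "cpos c" "\<And>y. y * a = a * y \<Longrightarrow> y * c = c * y"
proof -
  obtain t0 where t0: "t0 \<ge> 0" "norm (of_real t0 - a) \<le> t0" using assms by (auto simp: cpos_def)
  define t where "t = t0 + 1"
  have t: "t > 0" "norm (of_real t - a) \<le> t"
    using t0 cpos_mono[of t0 a t] by (auto simp: t_def)
  define x where "x = 1 - (1/t) *\<^sub>R a"
  have "x = (1/t) *\<^sub>R (of_real t - a)" using t by (simp add: x_def of_real_def scaleR_diff_right)
  then have nx: "norm x \<le> 1" using t by simp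
  have sx: "star x = x" using assms by (simp add: x_def star_diff star_scaleR cpos_def)
  define c where "c = sqrt t *\<^sub>R sqrt1m x"
  have 1: "star c = c" by (simp add: c_def star_scaleR sqrt1m_selfadjoint[OF nx sx])
  have "c * c = t *\<^sub>R (sqrt1m x * sqrt1m x)" using t by (simp add: c_def)
  then have 2: "c * c = a" using t by (simp only: sqrt1m_square[OF nx]) (simp add: x_def)
  have 3: "y * c = c * y" if "y * a = a * y" for y
  proof -
    have "y * x = x * y" using that by (simp add: x_def algebra_simps)
    then show ?thesis using sqrt1m_commute[OF nx, of y] by (simp add: c_def)
  qed
  have "cpos (sqrt1m x)"
    using norm_one_minus_sqrt1m[OF nx] sqrt1m_selfadjoint[OF nx sx]
    by (auto simp: cpos_def intro!: exI[of _ 1])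
  then have "cpos c" using t by (simp add: c_def cpos_scaleR)
  then show thesis using that 1 2 3 by blast
qed

text \<open>With roots \<open>c\<close> of \<open>t - a\<close> and \<open>d\<close> of \<open>t + a\<close> one has \<open>a\<^sup>2 + (c d)\<^sup>2 = t\<^sup>2\<close>.\<close>

lemma norm_le_of_cpos:
  assumes "cpos (of_real t - a)" "cpos (of_real t + (a::'a::cstar_algebra))" "t \<ge> 0"
  shows "norm a \<le> t"
proof -
  have "star (of_real t - a) = of_real t - a" using assms(1) by (simp add: cpos_def)
  then have sa: "star a = a" by (simp add: star_diff)
  obtain c where c: "star c = c" "c * c = of_real t - a"
    "\<And>y. y * (of_real t - a) = (of_real t - a) * y \<Longrightarrow> y * c = c * y" using cpos_sqrt[OF assms(1)] by metis
  obtain d where d: "star d = d" "d * d = of_real t + a"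
    "\<And>y. y * (of_real t + a) = (of_real t + a) * y \<Longrightarrow> y * d = d * y" using cpos_sqrt[OF assms(2)] by metis
  have com: "of_real t * a = a * (of_real t :: 'a)" by (simp add: of_real_def)
  have ac: "a * c = c * a" by (rule c(3)) (simp add: algebra_simps com)
  have ad: "a * d = d * a" by (rule d(3)) (simp add: algebra_simps com)
  have cd: "c * d = d * c" by (rule d(3)) (simp add: algebra_simps ac of_real_def)
  have "(c * d) * (c * d) = (c * c) * (d * d)" by (metis cd mult.assoc)
  also have "\<dots> = of_real (t\<^sup>2) - a * a"
    by (simp add: c d algebra_simps com power2_eq_square)
  finally have eq: "a * a + (c * d) * (c * d) = of_real (t\<^sup>2)" by simp
  show ?thesis
    by (rule norm_le_of_sum_of_squares[OF sa _ _ eq assms(3)])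
       (simp_all add: star_mult c d cd, metis ac ad mult.assoc cd)
qed

text \<open>Any radius \<open>t\<close> above the norm witnesses positivity, because \<open>t - a\<close> lies between \<open>-t\<close> and
  \<open>t\<close>.\<close>

lemma cpos_norm_bound:
  assumes "cpos a" "norm a \<le> t" shows "norm (of_real t - (a::'a::cstar_algebra)) \<le> t"
proof -
  obtain c where c: "star c = c" "c * c = a" using cpos_sqrt[OF assms(1)] by metis
  have "t \<ge> 0" using assms(2) norm_ge_zero order_trans by blast
  obtain s where s: "s \<ge> 0" "norm (of_real s - a) \<le> s" using assms(1) by (auto simp: cpos_def)
  show ?thesis
  proof (cases "s \<le> t")
    case True then show ?thesis using cpos_mono s by blast
  next
    case False
    show ?thesis
    proof (rule norm_le_of_cpos)
      show "cpos (of_real t - (of_real t - a))" using assms(1) by simp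
      have "cpos (of_real t - a)"
        unfolding cpos_def using assms \<open>t \<ge> 0\<close> by (auto simp: cpos_def star_diff intro!: exI[of _ t])
      then show "cpos (of_real t + (of_real t - a))" using cpos_add[OF cpos_of_real[OF \<open>t \<ge> 0\<close>]] by blast
    qed (fact \<open>t \<ge> 0\<close>)
  qed
qed

lemma cpos_of_norm:
  assumes "star a = a" "norm a \<le> t" shows "cpos (of_real t - (a::'a::cstar_algebra))"
  using assms order_trans[OF norm_ge_zero assms(2)] unfolding cpos_def
  by (intro conjI exI[of _ t]) (auto simp: star_diff)

lemma cpos_closed:
  assumes "\<And>e. e > 0 \<Longrightarrow> cpos (a + of_real e)" shows "cpos (a::'a::cstar_algebra)"
proof -
  have "star (a + of_real 1) = a + of_real 1" using assms[of 1] by (simp add: cpos_def)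
  then have sa: "star a = a" by (simp add: star_add)
  define t where "t = norm a + 1"
  have "norm (of_real t - a) \<le> t + e" if e: "0 < e" "e \<le> 1/2" for e
  proof -
    have "norm (a + of_real (e/2)) \<le> norm a + e/2"
      using norm_triangle_ineq[of a "of_real (e/2)"] e by simp
    then have "norm (of_real t - (a + of_real (e/2))) \<le> t"
      using cpos_norm_bound[OF assms[of "e/2"], of t] e by (simp add: t_def)
    moreover have "of_real t - a = (of_real t - (a + of_real (e/2))) + of_real (e/2)" by simp
    ultimately show ?thesis
      using norm_triangle_ineq[of "of_real t - (a + of_real (e/2))" "of_real (e/2)"] e by simp
  qed
  then have "norm (of_real t - a) \<le> t + min e (1/2)" if "0 < e" for e using that by simp
  then have "norm (of_real t - a) \<le> t + e" if "0 < e" for e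
    using that by (meson add_left_mono min.cobounded1 order_trans)
  then have "norm (of_real t - a) \<le> t" by (rule field_le_epsilon)
  then show ?thesis using sa unfolding cpos_def t_def by (intro conjI exI[of _ "norm a + 1"]) auto
qed

subsection \<open>Elements of the form \<open>y\<^sup>* y\<close>\<close>

lemma square_mult_commute:
  fixes x y :: "'a::monoid_mult"
  assumes "x * y = y * x" shows "(x * y) * (x * y) = (x * x) * (y * y)"
proof -
  have "(x * y) * (x * y) = x * (y * x) * y" by (simp only: mult.assoc)
  then show ?thesis by (simp only: assms[symmetric] mult.assoc)
qed

lemma commute_mult:
  fixes x y z :: "'a::monoid_mult"
  assumes "z * x = x * z" "z * y = y * z" shows "z * (x * y) = (x * y) * z"
proof -
  have "z * (x * y) = x * (z * y)" by (simp only: mult.assoc[symmetric] assms(1))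
  then show ?thesis by (simp only: mult.assoc assms(2))
qed

lemma commute_add_of_real:
  fixes x z :: "'a::real_algebra_1"
  assumes "z * x = x * z" shows "z * (x + of_real r) = (x + of_real r) * z"
  by (simp add: distrib_left distrib_right assms of_real_def)

lemma inverse_of_one_minus:
  assumes "norm (x::'a::cstar_algebra) < 1"
  obtains i where "(1 - x) * i = 1" "i * (1 - x) = 1"
proof -
  have s: "summable (\<lambda>k. x ^ k)"
    by (rule summable_norm_cancel, rule summable_comparison_test[OF _ summable_geometric[of "norm x"]])
       (use assms in \<open>auto intro!: exI[of _ 0] norm_power_ineq\<close>)
  define i where "i = (\<Sum>k. x ^ k)"
  have "i = 1 + (\<Sum>k. x ^ Suc k)"
    unfolding i_def using suminf_split_head[OF s] by simp
  moreover have "(\<Sum>k. x ^ Suc k) = x * i" "(\<Sum>k. x ^ Suc k) = i * x"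
    unfolding i_def using suminf_mult[OF s, of x] suminf_mult2[OF s, of x]
    by (simp_all add: power_commutes)
  ultimately have "(1 - x) * i = 1" "i * (1 - x) = 1"
    by (simp_all add: algebra_simps)
  then show thesis using that by blast
qed

lemma inverse_of_cpos_plus:
  assumes "cpos (x::'a::cstar_algebra)" "e > 0"
  obtains i where "(x + of_real e) * i = 1" "i * (x + of_real e) = 1"
proof -
  obtain t where t: "t \<ge> 0" "norm (of_real t - x) \<le> t" using assms by (auto simp: cpos_def)
  define s where "s = t + e"
  define y where "y = (1/s) *\<^sub>R (of_real t - x)"
  have s: "s > 0" using t assms by (simp add: s_def)
  have "norm y = norm (of_real t - x) / s" using s by (simp add: y_def)
  also have "\<dots> < 1" using t assms s by (simp add: s_def)
  finally have "norm y < 1" .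
  then obtain i where i: "(1 - y) * i = 1" "i * (1 - y) = 1" using inverse_of_one_minus by blast
  have "x + of_real e = s *\<^sub>R (1 - y)"
    using s by (simp add: y_def s_def of_real_def scaleR_diff_right scaleR_add_left)
  then show thesis using that[of "(1/s) *\<^sub>R i"] i s by simp
qed

lemma inverse_commute:
  fixes x i y :: "'a::cstar_algebra"
  assumes "x * i = 1" "i * x = 1" "y * x = x * y" shows "y * i = i * y"
  by (metis assms mult.assoc mult_1 mult_1_right)

lemma star_inverse:
  fixes x i :: "'a::cstar_algebra"
  assumes "x * i = 1" "i * x = 1" "star x = x" shows "star i = i"
proof -
  have "star i * x = 1" using assms star_mult[of x i] by simp
  then show ?thesis by (metis assms(1) mult.assoc mult_1 mult_1_right)
qed

text \<open>A positive invertible element stays positive after subtracting a small scalar: multiply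
  \<open>1 - e i \<ge> 0\<close>, where \<open>i\<close> is the inverse, from both sides by the root of \<open>x\<close>.\<close>

lemma cpos_invertible_bound:
  fixes x :: "'a::cstar_algebra"
  assumes "cpos x" "x * i = 1" "i * x = 1" "b > 0"
  obtains e where "0 < e" "e \<le> b" "cpos (x - of_real e)"
proof -
  obtain c where c: "star c = c" "c * c = x" "\<And>y. y * x = x * y \<Longrightarrow> y * c = c * y"
    using cpos_sqrt[OF assms(1)] by metis
  have sx: "star x = x" using assms(1) by (simp add: cpos_def)
  have si: "star i = i" using star_inverse[OF assms(2,3) sx] .
  define e where "e = min b (1 / (norm i + 1))"
  have e: "0 < e" "e \<le> b" using assms(4) by (auto simp: e_def add_nonneg_pos)
  have "e * norm i \<le> 1 / (norm i + 1) * norm i" by (intro mult_right_mono) (auto simp: e_def)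
  also have "\<dots> \<le> 1" by (simp add: divide_simps add_nonneg_pos)
  finally have "norm (e *\<^sub>R i) \<le> 1" using e by simp
  then have "cpos (1 - e *\<^sub>R i)" using cpos_of_norm[of "e *\<^sub>R i" 1] si by (simp add: star_scaleR)
  then obtain d where d: "star d = d" "d * d = 1 - e *\<^sub>R i"
    "\<And>y. y * (1 - e *\<^sub>R i) = (1 - e *\<^sub>R i) * y \<Longrightarrow> y * d = d * y"
    using cpos_sqrt by metis
  have "c * x = x * c" using c(2) by (metis mult.assoc)
  then have "c * i = i * c" by (rule inverse_commute[OF assms(2,3)])
  then have cd: "c * d = d * c" by (intro d(3)) (simp add: algebra_simps)
  have "(c * d) * (c * d) = (c * c) * (d * d)" by (rule square_mult_commute[OF cd])
  also have "\<dots> = x - of_real e"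
    using assms(2) by (simp add: c d algebra_simps of_real_def)
  finally have "cpos (x - of_real e)"
    using cpos_square[of "c * d"] c(1) d(1) cd by (simp add: star_mult)
  then show thesis using that e by blast
qed

text \<open>The nonzero spectra of \<open>a b\<close> and \<open>b a\<close> agree; the inverse is
  \<open>(1 - b (a b + l)\<^sup>-\<^sup>1 a) / l\<close>.\<close>

lemma inverse_swap:
  fixes a b r :: "'a::cstar_algebra"
  assumes "(a * b + of_real l) * r = 1" "r * (a * b + of_real l) = 1" "l \<noteq> 0"
  obtains s where "(b * a + of_real l) * s = 1" "s * (b * a + of_real l) = 1"
proof -
  define s where "s = (1/l) *\<^sub>R (1 - b * r * a)"
  have 1: "a * b * r = 1 - l *\<^sub>R r" "r * a * b = 1 - l *\<^sub>R r"
    using assms(1,2) by (simp_all add: algebra_simps of_real_def eq_diff_eq)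
  have 2: "b * (a * b * r) * a = b * a - l *\<^sub>R (b * r * a)" "b * (r * a * b) * a = b * a - l *\<^sub>R (b * r * a)"
    unfolding 1 by (simp_all add: algebra_simps)
  have "(b * a + of_real l) * (1 - b * r * a) = b * a + of_real l - b * (a * b * r) * a - l *\<^sub>R (b * r * a)"
    by (simp add: algebra_simps of_real_def)
  also have "\<dots> = of_real l" by (simp only: 2) simp
  finally have A: "(b * a + of_real l) * s = 1" using assms(3) by (simp add: s_def of_real_def)
  have "(1 - b * r * a) * (b * a + of_real l) = b * a + of_real l - b * (r * a * b) * a - l *\<^sub>R (b * r * a)"
    by (simp add: algebra_simps of_real_def)
  also have "\<dots> = of_real l" by (simp only: 2) simp
  finally have B: "s * (b * a + of_real l) = 1" using assms(3) by (simp add: s_def of_real_def)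
  show thesis using that A B by blast
qed

lemma cpos_of_real_iff: "cpos (of_real r :: 'a::cstar_algebra) \<longleftrightarrow> r \<ge> 0"
proof
  assume "cpos (of_real r :: 'a)"
  then obtain t where "t \<ge> 0" "norm (of_real t - of_real r :: 'a) \<le> t" by (auto simp: cpos_def)
  then have "\<bar>t - r\<bar> \<le> t" by (metis norm_of_real of_real_diff)
  then show "r \<ge> 0" by simp
qed (rule cpos_of_real)

text \<open>The two squares are those of the real and imaginary part of \<open>z\<close>.\<close>

lemma star_mult_plus_mult_star:
  fixes z :: "'a::cstar_algebra"
  shows "\<exists>p q. star p = p \<and> star q = q \<and> z * star z + star z * z = 2 *\<^sub>R (p * p) + 2 *\<^sub>R (q * q)"
proof -
  define p where "p = (1/2) *\<^sub>R (z + star z)"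
  define q where "q = (1/2) *\<^sub>R (\<i> *\<^sub>C (star z - z))"
  have p: "star p = p" by (simp add: p_def star_scaleR star_add star_star add.commute)
  have q: "star q = q"
    by (simp add: q_def star_scaleR star_scaleC star_diff star_star scaleC_minus_left scaleC_diff_right)
  have "q * q = (1/4) *\<^sub>R (\<i> *\<^sub>C (\<i> *\<^sub>C ((star z - z) * (star z - z))))"
    by (simp add: q_def mult_scaleC_left mult_scaleC_right scaleC_scaleR)
  also have "\<dots> = (1/4) *\<^sub>R (- ((star z - z) * (star z - z)))"
    by (simp only: scaleC_scaleC i_squared scaleC_minus_left scaleC_one)
  finally have qq: "q * q = (1/4) *\<^sub>R (- ((star z - z) * (star z - z)))" .
  have "2 *\<^sub>R (p * p) + 2 *\<^sub>R (q * q) = (1/2) *\<^sub>R ((z + star z) * (z + star z) - (star z - z) * (star z - z))"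
    by (simp add: p_def qq scaleR_diff_right)
  also have "(z + star z) * (z + star z) - (star z - z) * (star z - z) = 2 *\<^sub>R (z * star z + star z * z)"
    by (simp add: algebra_simps scaleR_2)
  finally have "z * star z + star z * z = 2 *\<^sub>R (p * p) + 2 *\<^sub>R (q * q)" by simp
  then show ?thesis using p q by metis
qed

text \<open>The Kelley--Vaught theorem. Without a continuous functional calculus the negative part of
  \<open>h = y\<^sup>* y\<close> is replaced by half of \<open>k = (h\<^sup>2 + e\<^sup>2)\<^sup>1\<^sup>/\<^sup>2 - h\<close>, which is positive with a root \<open>d\<close> commuting
  with \<open>h\<close>. For \<open>z = y d\<close> the element \<open>z\<^sup>* z = h k = (e\<^sup>2 - k\<^sup>2) / 2\<close> is bounded above by
  \<open>e\<^sup>2 / 2\<close>, while \<open>z z\<^sup>* + z\<^sup>* z\<close> is positive; so \<open>z z\<^sup>* \<ge> - e\<^sup>2 / 2\<close>. Exchanging the factors does not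
  change the nonzero spectrum, which leaves no room for a large \<open>k\<^sup>2\<close>: the norm of \<open>k\<close> is at most
  \<open>2 e\<close>. As \<open>h + k\<close> is positive, so is \<open>h\<close> in the limit.\<close>

theorem cpos_star_mult: "cpos (star y * (y::'a::cstar_algebra))"
proof (rule cpos_closed)
  fix e' :: real assume "e' > 0"
  define e where "e = e' / 2"
  have e: "e > 0" using \<open>e' > 0\<close> by (simp add: e_def)
  define h where "h = star y * y"
  have sh: "star h = h" by (simp add: h_def star_mult star_star)
  have "cpos (h * h)" by (rule cpos_square[OF sh])
  \<comment> \<open>the inverse of \<open>a = (h\<^sup>2 + e\<^sup>2)\<^sup>1\<^sup>/\<^sup>2\<close> is obtained as \<open>a (h\<^sup>2 + e\<^sup>2)\<^sup>-\<^sup>1\<close>\<close>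
  obtain j where j: "(h * h + of_real (e\<^sup>2)) * j = 1" "j * (h * h + of_real (e\<^sup>2)) = 1"
    using inverse_of_cpos_plus[OF \<open>cpos (h*h)\<close>, of "e\<^sup>2"] e by auto
  have "cpos (h * h + of_real (e\<^sup>2))" by (intro cpos_add \<open>cpos (h*h)\<close> cpos_of_real) simp
  then obtain a where a: "star a = a" "a * a = h * h + of_real (e\<^sup>2)" "cpos a"
    "\<And>y. y * (h * h + of_real (e\<^sup>2)) = (h * h + of_real (e\<^sup>2)) * y \<Longrightarrow> y * a = a * y"
    using cpos_sqrt by metis
  have ha: "h * a = a * h" by (rule a(4)) (intro commute_add_of_real commute_mult refl)
  have "a * (h * h + of_real (e\<^sup>2)) = (h * h + of_real (e\<^sup>2)) * a"
    by (intro commute_add_of_real commute_mult) (simp_all add: ha)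
  then have ja: "a * j = j * a" by (rule inverse_commute[OF j])
  define ia where "ia = j * a"
  have ia: "a * ia = 1" "ia * a = 1"
    using j(2) unfolding a(2)[symmetric] ia_def
    by (simp_all only: mult.assoc[symmetric] ja)
  have sia: "star ia = ia" by (rule star_inverse[OF ia a(1)])
  have hia: "h * ia = ia * h" by (rule inverse_commute[OF ia ha])
  \<comment> \<open>\<open>a - h = a (1 - c)\<close> with \<open>c = h / a\<close>, and \<open>c\<^sup>2 + (e / a)\<^sup>2 = 1\<close> shows \<open>c \<le> 1\<close>\<close>
  define c where "c = h * ia"
  have sc: "star c = c" by (simp add: c_def star_mult sia sh hia)
  have "c * c + (e *\<^sub>R ia) * (e *\<^sub>R ia) = (h * h + of_real (e\<^sup>2)) * (ia * ia)"
  proof -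
    have "c * c = h * h * (ia * ia)" unfolding c_def by (rule square_mult_commute[OF hia])
    then show ?thesis by (simp add: algebra_simps of_real_def power2_eq_square)
  qed
  also have "\<dots> = a * (a * ia) * ia" by (simp only: a(2)[symmetric] mult.assoc)
  also have "\<dots> = of_real (1\<^sup>2)" by (simp add: ia)
  finally have cc: "c * c + (e *\<^sub>R ia) * (e *\<^sub>R ia) = of_real (1\<^sup>2)" .
  have cia: "c * ia = ia * c" unfolding c_def by (rule commute_mult[symmetric]) (simp_all add: hia)
  have "norm c \<le> 1"
    by (rule norm_le_of_sum_of_squares[OF sc _ _ cc]) (auto simp: star_scaleR sia cia)
  then have "cpos (1 - c)" using cpos_of_norm[OF sc, of 1] by simp
  then obtain d0 where d0: "star d0 = d0" "d0 * d0 = 1 - c"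
    "\<And>y. y * (1 - c) = (1 - c) * y \<Longrightarrow> y * d0 = d0 * y"
    using cpos_sqrt by metis
  obtain b where b: "star b = b" "b * b = a" "\<And>y. y * a = a * y \<Longrightarrow> y * b = b * y"
    using cpos_sqrt[OF a(3)] by metis
  have hc: "h * c = c * h" unfolding c_def by (rule commute_mult) (simp_all add: hia)
  have ac: "a * c = c * a" unfolding c_def by (rule commute_mult) (simp_all add: ha ia)
  have hd0: "h * d0 = d0 * h" by (rule d0(3)) (simp add: algebra_simps hc)
  have ad0: "a * d0 = d0 * a" by (rule d0(3)) (simp add: algebra_simps ac)
  have hb: "h * b = b * h" by (rule b(3)[OF ha])
  have bd0: "d0 * b = b * d0" by (rule b(3)[OF ad0[symmetric]])
  define k where "k = a - h"
  define d where "d = b * d0"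
  have sd: "star d = d" by (simp add: d_def star_mult b d0 bd0)
  have hd: "h * d = d * h" unfolding d_def by (rule commute_mult[OF hb hd0])
  have "d * d = (b * b) * (d0 * d0)" unfolding d_def by (rule square_mult_commute[OF bd0[symmetric]])
  also have "\<dots> = a - a * c" by (simp add: b d0 algebra_simps)
  also have "a * c = h" unfolding c_def by (simp only: hia mult.assoc[symmetric] ia) simp
  finally have dd: "d * d = k" by (simp add: k_def)
  have sk: "star k = k" by (simp add: k_def star_diff a sh)
  have hk_com: "h * k = k * h" by (simp add: k_def algebra_simps ha)
  have "(k + h) * (k + h) = h * h + of_real (e\<^sup>2)" by (simp add: k_def a(2))
  then have hk: "2 *\<^sub>R (h * k) = of_real (e\<^sup>2) - k * k"
    by (simp add: algebra_simps hk_com scaleR_2)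
  define z where "z = y * d"
  have "star z * z = d * h * d" by (simp add: z_def star_mult sd h_def mult.assoc)
  also have "\<dots> = h * k" by (simp add: hd[symmetric] mult.assoc dd)
  finally have g: "star z * z = h * k" .
  obtain p q where pq: "star p = p" "star q = q"
    "z * star z + star z * z = 2 *\<^sub>R (p * p) + 2 *\<^sub>R (q * q)"
    using star_mult_plus_mult_star by metis
  have hk2: "h * k = of_real (e\<^sup>2/2) - (1/2) *\<^sub>R (k * k)"
  proof -
    have "h * k = (1/2) *\<^sub>R (2 *\<^sub>R (h * k))" by simp
    also have "\<dots> = of_real (e\<^sup>2/2) - (1/2) *\<^sub>R (k * k)"
      unfolding hk by (simp add: of_real_def scaleR_diff_right)
    finally show ?thesis .
  qed
  have "z * star z = (2 *\<^sub>R (p * p) + 2 *\<^sub>R (q * q)) - star z * z" using pq(3) by (simp add: eq_diff_eq)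
  then have "z * star z + of_real (e\<^sup>2/2) = 2 *\<^sub>R (p * p) + 2 *\<^sub>R (q * q) + (1/2) *\<^sub>R (k * k)"
    unfolding g hk2 by simp
  moreover have "cpos \<dots>" by (intro cpos_add cpos_scaleR cpos_square pq sk) auto
  ultimately have ep: "cpos (z * star z + of_real (e\<^sup>2/2))" by simp
  have skk: "star (k * k) = k * k" by (simp add: star_mult sk)
  have kk: "norm (k * k) \<le> 2 * e\<^sup>2"
  proof (rule ccontr)
    assume neg: "\<not> norm (k * k) \<le> 2 * e\<^sup>2"
    define \<beta> where "\<beta> = norm (k * k)"
    have \<beta>: "\<beta> > 2 * e\<^sup>2" using neg by (simp add: \<beta>_def)
    \<comment> \<open>\<open>z z\<^sup>* + l\<close> is invertible as \<open>l > e\<^sup>2 / 2\<close>; by the swap so is \<open>z\<^sup>* z + l = (\<beta> - k\<^sup>2) / 2\<close>\<close>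
    define l where "l = \<beta>/2 - e\<^sup>2/2"
    have e2: "e\<^sup>2 > 0" using e by simp
    have l: "l - e\<^sup>2/2 > 0" using \<beta> by (simp add: l_def)
    obtain r where r: "(z * star z + of_real (e\<^sup>2/2) + of_real (l - e\<^sup>2/2)) * r = 1"
      "r * (z * star z + of_real (e\<^sup>2/2) + of_real (l - e\<^sup>2/2)) = 1"
      using inverse_of_cpos_plus[OF ep l] by blast
    have "z * star z + of_real (e\<^sup>2/2) + of_real (l - e\<^sup>2/2) = z * star z + of_real l" by simp
    with r have "(z * star z + of_real l) * r = 1" "r * (z * star z + of_real l) = 1" by simp_all
    moreover have "l \<noteq> 0" using l e2 by linarith
    ultimately obtain s where s: "(star z * z + of_real l) * s = 1" "s * (star z * z + of_real l) = 1"
      using inverse_swap by blast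
    have "star z * z + of_real l = (1/2) *\<^sub>R (of_real \<beta> - k * k)"
      unfolding g hk2 by (simp add: l_def of_real_def scaleR_diff_right scaleR_diff_left algebra_simps)
    with s have s': "(of_real \<beta> - k * k) * ((1/2) *\<^sub>R s) = 1" "((1/2) *\<^sub>R s) * (of_real \<beta> - k * k) = 1"
      by simp_all
    have "cpos (of_real \<beta> - k * k)" by (rule cpos_of_norm[OF skk]) (simp add: \<beta>_def)
    moreover have "\<beta> > 0" using \<beta> e2 by linarith
    ultimately obtain \<eta> where \<eta>: "0 < \<eta>" "\<eta> \<le> \<beta>" "cpos (of_real \<beta> - k * k - of_real \<eta>)"
      using cpos_invertible_bound[OF _ s'] by metis
    have "norm (k * k) \<le> \<beta> - \<eta>"
    proof (rule norm_le_of_cpos)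
      show "cpos (of_real (\<beta> - \<eta>) - k * k)" using \<eta>(3) by (simp add: algebra_simps)
      show "cpos (of_real (\<beta> - \<eta>) + k * k)"
        using \<eta>(2) by (intro cpos_add cpos_of_real cpos_square sk) auto
    qed (use \<eta> in auto)
    then show False using \<eta>(1) by (simp add: \<beta>_def)
  qed
  have "2 * e\<^sup>2 \<le> (2 * e)\<^sup>2" by (simp add: power_mult_distrib)
  then have "(norm k)\<^sup>2 \<le> (2 * e)\<^sup>2" using kk norm_eq_sqrt_of_star_mult[OF sk] by linarith
  then have "norm k \<le> e'" using e by (simp add: e_def power2_le_iff_abs_le)
  then have "cpos (a + (of_real e' - k))" by (intro cpos_add a cpos_of_norm sk)
  then show "cpos (star y * y + of_real e')" by (simp add: k_def h_def[symmetric] algebra_simps)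
qed

lemma norm_le_of_cpos_le:
  assumes "cpos (a::'a::cstar_algebra)" "cpos (b - a)" shows "norm a \<le> norm b"
proof (rule norm_le_of_cpos)
  have "star (b - a) + star a = b" using assms by (simp add: cpos_def)
  then have "star b = b" by (simp add: star_diff)
  then have "cpos (of_real (norm b) - b)" using cpos_of_norm by blast
  then have "cpos ((of_real (norm b) - b) + (b - a))" by (intro cpos_add assms)
  then show "cpos (of_real (norm b) - a)" by simp
  show "cpos (of_real (norm b) + a)" by (intro cpos_add cpos_of_real assms) simp
qed simp

section \<open>Sublinear functionals and states\<close>

definition sublinear :: "('v::real_vector \<Rightarrow> real) \<Rightarrow> bool" where
  "sublinear p \<longleftrightarrow> (\<forall>x y. p (x + y) \<le> p x + p y) \<and> (\<forall>t x. t \<ge> 0 \<longrightarrow> p (t *\<^sub>R x) = t * p x)"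

lemma sublinearI:
  assumes "\<And>x y. p (x + y) \<le> p x + p y" "p 0 = 0" "\<And>t x. t > 0 \<Longrightarrow> p (t *\<^sub>R x) \<le> t * p x"
  shows "sublinear p"
  unfolding sublinear_def
proof (intro conjI allI impI)
  fix t :: real and x assume "t \<ge> 0"
  show "p (t *\<^sub>R x) = t * p x"
  proof (cases "t = 0")
    case False
    then have t: "t > 0" using \<open>t \<ge> 0\<close> by simp
    have "p ((1/t) *\<^sub>R (t *\<^sub>R x)) \<le> (1/t) * p (t *\<^sub>R x)" using t by (intro assms(3)) simp
    then have "t * p x \<le> p (t *\<^sub>R x)" using t by (simp add: field_simps)
    then show ?thesis using assms(3)[OF t, of x] by simp
  qed (simp add: assms(2))
qed (rule assms(1))

lemma sublinear_zero: "sublinear p \<Longrightarrow> p 0 = 0"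
  unfolding sublinear_def by (metis mult_zero_left order_refl scaleR_zero_left)

lemma sublinear_lower: "sublinear p \<Longrightarrow> - p (- x) \<le> p x"
  using sublinear_zero[of p] unfolding sublinear_def by (metis add.right_inverse neg_le_iff_le add.commute
      le_add_same_cancel1 minus_le_iff add_neg_numeral_special(7) diff_0 diff_le_eq)

text \<open>The largest sublinear functional below \<open>p\<close> that has the same value at \<open>y\<close> and is linear on the
  line spanned by \<open>y\<close>. A minimal sublinear functional coincides with all its shrinkings and is
  therefore linear.\<close>

definition shrink :: "('v::real_vector \<Rightarrow> real) \<Rightarrow> 'v \<Rightarrow> 'v \<Rightarrow> real" where
  "shrink p y x = (INF t\<in>{0..}. p (x + t *\<^sub>R y) - t * p y)"

lemma shrink_bdd:
  assumes "sublinear p" shows "bdd_below ((\<lambda>t. p (x + t *\<^sub>R y) - t * p y) ` {0..})"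
proof (rule bdd_belowI2)
  fix t :: real assume "t \<in> {0..}"
  then have "t * p y = p (t *\<^sub>R y)" using assms by (simp add: sublinear_def)
  also have "\<dots> = p ((x + t *\<^sub>R y) + (- x))" by simp
  also have "\<dots> \<le> p (x + t *\<^sub>R y) + p (- x)" using assms unfolding sublinear_def by blast
  finally show "- p (- x) \<le> p (x + t *\<^sub>R y) - t * p y" by simp
qed

lemma shrink_le: "sublinear p \<Longrightarrow> t \<ge> 0 \<Longrightarrow> shrink p y x \<le> p (x + t *\<^sub>R y) - t * p y"
  unfolding shrink_def by (rule cINF_lower[OF shrink_bdd]) auto

lemma shrink_greatest:
  "(\<And>t. t \<ge> 0 \<Longrightarrow> c \<le> p (x + t *\<^sub>R y) - t * p y) \<Longrightarrow> c \<le> shrink p y x"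
  unfolding shrink_def by (rule cINF_greatest) auto

lemma shrink_le_self: "sublinear p \<Longrightarrow> shrink p y x \<le> p x"
  using shrink_le[of p 0 y x] by simp

lemma shrink_minus: "sublinear p \<Longrightarrow> shrink p y (- y) \<le> - p y"
  using shrink_le[of p 1 y "-y"] sublinear_zero[of p] by simp

lemma sublinear_shrink:
  assumes p: "sublinear p" shows "sublinear (shrink p y)"
proof (rule sublinearI)
  have add: "p (a + b) \<le> p a + p b" and scale: "t \<ge> 0 \<Longrightarrow> p (t *\<^sub>R a) = t * p a" for a b t
    using p by (auto simp: sublinear_def)
  fix u v
  have "shrink p y (u + v) - (p (u + s *\<^sub>R y) - s * p y) \<le> shrink p y v" if s: "s \<ge> 0" for s
  proof (rule shrink_greatest)
    fix t :: real assume t: "t \<ge> 0"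
    have "shrink p y (u + v) \<le> p ((u + v) + (s + t) *\<^sub>R y) - (s + t) * p y"
      using s t by (intro shrink_le p) simp
    also have "(u + v) + (s + t) *\<^sub>R y = (u + s *\<^sub>R y) + (v + t *\<^sub>R y)" by (simp add: algebra_simps)
    also have "p \<dots> \<le> p (u + s *\<^sub>R y) + p (v + t *\<^sub>R y)" by (rule add)
    finally show "shrink p y (u + v) - (p (u + s *\<^sub>R y) - s * p y) \<le> p (v + t *\<^sub>R y) - t * p y"
      by (simp add: algebra_simps)
  qed
  then have "shrink p y (u + v) - shrink p y v \<le> shrink p y u"
    by (intro shrink_greatest) (simp add: algebra_simps)
  then show "shrink p y (u + v) \<le> shrink p y u + shrink p y v" by simp
next
  have "shrink p y 0 \<le> 0" using shrink_le_self[OF p, of y 0] sublinear_zero[OF p] by simp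
  moreover have "0 \<le> shrink p y 0" by (rule shrink_greatest) (use p in \<open>simp add: sublinear_def\<close>)
  ultimately show "shrink p y 0 = 0" by simp
next
  fix s :: real and x assume s: "s > 0"
  have "shrink p y (s *\<^sub>R x) / s \<le> shrink p y x"
  proof (rule shrink_greatest)
    fix t :: real assume t: "t \<ge> 0"
    have "shrink p y (s *\<^sub>R x) \<le> p (s *\<^sub>R x + (s * t) *\<^sub>R y) - (s * t) * p y"
      using s t by (intro shrink_le p) simp
    also have "s *\<^sub>R x + (s * t) *\<^sub>R y = s *\<^sub>R (x + t *\<^sub>R y)" by (simp add: algebra_simps)
    also have "p \<dots> = s * p (x + t *\<^sub>R y)" using p s by (simp add: sublinear_def)
    finally show "shrink p y (s *\<^sub>R x) / s \<le> p (x + t *\<^sub>R y) - t * p y"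
      using s by (simp add: field_simps)
  qed
  then show "shrink p y (s *\<^sub>R x) \<le> s * shrink p y x" using s by (simp add: field_simps)
qed

lemma minimal_sublinear:
  fixes p :: "'v::real_vector \<Rightarrow> real"
  assumes "sublinear p"
  obtains m where "sublinear m" "m \<le> p" "\<And>q. sublinear q \<Longrightarrow> q \<le> m \<Longrightarrow> q = m"
proof -
  define S where "S = {q. sublinear q \<and> q \<le> p}"
  have low: "- p (- x) \<le> q x" if "q \<in> S" for q x
    using that sublinear_lower[of q x] le_funD[of q p "-x"] unfolding S_def by fastforce
  have "\<exists>m\<in>S. \<forall>a\<in>S. a \<le> m \<longrightarrow> a = m"
  proof (rule predicate_Zorn)
    show "partial_order_on S (relation_of (\<lambda>x y. y \<le> x) S)"
      by (rule partial_order_on_relation_ofI) auto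
    fix C assume C: "C \<in> Chains (relation_of (\<lambda>x y. y \<le> x) S)"
    then have CS: "C \<subseteq> S" and tot: "\<And>a b. a \<in> C \<Longrightarrow> b \<in> C \<Longrightarrow> a \<le> b \<or> b \<le> a"
      by (auto simp: Chains_def relation_of_def)
    show "\<exists>u\<in>S. \<forall>a\<in>C. u \<le> a"
    proof (cases "C = {}")
      case True then show ?thesis using assms by (auto simp: S_def)
    next
      case False
      define u where "u x = (INF q\<in>C. q x)" for x
      have bdd: "bdd_below ((\<lambda>q. q x) ` C)" for x
        by (rule bdd_belowI2[of _ "- p (- x)"]) (use low CS in auto)
      have ule: "u x \<le> q x" if "q \<in> C" for q x unfolding u_def by (rule cINF_lower[OF bdd that])
      have ug: "c \<le> u x" if "\<And>q. q \<in> C \<Longrightarrow> c \<le> q x" for c x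
        unfolding u_def using False that by (intro cINF_greatest) auto
      have sub: "sublinear q" if "q \<in> C" for q using that CS by (auto simp: S_def)
      have "sublinear u"
      proof (rule sublinearI)
        fix x y
        have "u (x + y) \<le> q1 x + q2 y" if q: "q1 \<in> C" "q2 \<in> C" for q1 q2
        proof -
          obtain q where q': "q \<in> C" "q \<le> q1" "q \<le> q2" using tot[OF q] q by blast
          have "u (x + y) \<le> q (x + y)" by (rule ule[OF q'(1)])
          also have "\<dots> \<le> q x + q y" using sub[OF q'(1)] by (simp add: sublinear_def)
          also have "\<dots> \<le> q1 x + q2 y" using q' by (intro add_mono) (auto simp: le_fun_def)
          finally show ?thesis .
        qed
        then have "u (x + y) - q1 x \<le> q2 y" if "q1 \<in> C" "q2 \<in> C" for q1 q2
          using that by (simp only: diff_le_eq add.commute[of "q2 y"])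
        then have "u (x + y) - q1 x \<le> u y" if "q1 \<in> C" for q1
          using that by (intro ug) blast
        then have "u (x + y) - u y \<le> q1 x" if "q1 \<in> C" for q1
          using that by (simp only: diff_le_eq add.commute[of "u y"])
        then have "u (x + y) - u y \<le> u x" by (intro ug) blast
        then show "u (x + y) \<le> u x + u y" by simp
      next
        obtain q where q: "q \<in> C" using False by blast
        have "u 0 \<le> 0" using ule[OF q, of 0] sublinear_zero[OF sub[OF q]] by simp
        moreover have "0 \<le> u 0" by (rule ug) (simp add: sublinear_zero[OF sub])
        ultimately show "u 0 = 0" by simp
      next
        fix s :: real and x assume s: "s > 0"
        have "u (s *\<^sub>R x) / s \<le> u x"
        proof (rule ug)
          fix q assume q: "q \<in> C"
          have "u (s *\<^sub>R x) \<le> s * q x" using ule[OF q, of "s *\<^sub>R x"] sub[OF q] s by (simp add: sublinear_def)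
          then show "u (s *\<^sub>R x) / s \<le> q x" using s by (simp add: field_simps)
        qed
        then show "u (s *\<^sub>R x) \<le> s * u x" using s by (simp add: field_simps)
      qed
      moreover obtain q where q: "q \<in> C" using False by blast
      moreover have "u \<le> p"
      proof (rule le_funI)
        fix x
        have "u x \<le> q x" by (rule ule[OF q])
        also have "\<dots> \<le> p x" using q CS by (auto simp: S_def le_fun_def)
        finally show "u x \<le> p x" .
      qed
      ultimately have "u \<in> S" by (simp add: S_def)
      then show ?thesis using ule by (intro bexI[of _ u]) (auto simp: le_fun_def)
    qed
  qed
  then obtain m where m: "m \<in> S" "\<And>a. a \<in> S \<Longrightarrow> a \<le> m \<Longrightarrow> a = m" by blast
  show thesis
  proof (rule that[of m])
    show "q = m" if "sublinear q" "q \<le> m" for q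
      using m that order_trans[OF that(2), of p] by (auto simp: S_def)
  qed (use m in \<open>auto simp: S_def\<close>)
qed

text \<open>Starting the minimisation at \<open>shrink p x0\<close> instead of \<open>p\<close> keeps the value at \<open>x0\<close>.\<close>

theorem sublinear_dominates_linear:
  fixes p :: "'v::real_vector \<Rightarrow> real"
  assumes "sublinear p"
  obtains f where "linear f" "\<And>x. f x \<le> p x" "f x0 = p x0"
proof -
  obtain f where f: "sublinear f" "f \<le> shrink p x0" "\<And>q. sublinear q \<Longrightarrow> q \<le> f \<Longrightarrow> q = f"
    using minimal_sublinear[OF sublinear_shrink[OF assms]] by metis
  have eq: "shrink f y = f" for y
    by (rule f(3)[OF sublinear_shrink[OF f(1)]]) (simp add: le_fun_def shrink_le_self f(1))
  have minus: "f (- y) = - f y" for y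
    using shrink_minus[OF f(1), of y] sublinear_lower[OF f(1), of "-y"] by (simp add: eq)
  have sub: "f (x + y) \<le> f x + f y" and sc: "t \<ge> 0 \<Longrightarrow> f (t *\<^sub>R x) = t * f x" for x y t
    using f(1) by (auto simp: sublinear_def)
  have add: "f (x + y) = f x + f y" for x y
    using sub[of x y] sub[of "x + y" "- y"] minus[of y] by simp
  have scale: "f (t *\<^sub>R x) = t * f x" for t x
    using sc[of t x] sc[of "-t" x] minus[of "t *\<^sub>R x"] by (cases "t \<ge> 0") auto
  have le: "f x \<le> p x" for x
    using f(2) shrink_le_self[OF assms, of x0 x] by (simp add: le_fun_def) (meson order_trans)
  have "f (- x0) \<le> - p x0" using f(2) shrink_minus[OF assms, of x0] by (meson le_funD order_trans)
  then have "f x0 = p x0" using le[of x0] minus[of x0] by simp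
  moreover have "linear f" by (rule linearI) (simp_all add: add scale)
  ultimately show thesis using that le by blast
qed

text \<open>Positive hermitian functionals; the constant \<open>2\<close> in the bound comes from building the functional
  out of its real part.\<close>

definition state :: "('a::cstar_algebra \<Rightarrow> complex) \<Rightarrow> bool" where
  "state \<omega> \<longleftrightarrow> (\<forall>x y. \<omega> (x + y) = \<omega> x + \<omega> y) \<and> (\<forall>z x. \<omega> (z *\<^sub>C x) = z * \<omega> x)
     \<and> (\<forall>x. \<omega> (star x) = cnj (\<omega> x)) \<and> (\<forall>x. cmod (\<omega> x) \<le> 2 * norm x)
     \<and> (\<forall>y. 0 \<le> Re (\<omega> (star y * y)))"

text \<open>The upper end of the numerical range of the self-adjoint part.\<close>

definition upper_bound :: "'a::cstar_algebra \<Rightarrow> real" where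
  "upper_bound x = Inf {t. cpos (of_real t - (1/2) *\<^sub>R (x + star x))}"

lemma upper_bound_lower:
  assumes "cpos (of_real t - (1/2) *\<^sub>R (x + star (x::'a::cstar_algebra)))"
  shows "- norm x \<le> t"
proof -
  let ?r = "(1/2) *\<^sub>R (x + star x)"
  have "star (- ?r) = - ?r" by (simp add: star_scaleR star_add star_star add.commute)
  moreover have n: "norm (- ?r) \<le> norm x" using norm_triangle_ineq[of x "star x"] by simp
  ultimately have "cpos (of_real (norm x) - - ?r)" by (rule cpos_of_norm)
  then have "cpos ((of_real (norm x) - - ?r) + (of_real t - ?r))" using assms by (rule cpos_add)
  then have "cpos (of_real (norm x + t) :: 'a)" by simp
  then have "norm x + t \<ge> 0" by (simp only: cpos_of_real_iff)
  then show ?thesis by simp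
qed

lemma upper_bound_bdd: "bdd_below {t. cpos (of_real t - (1/2) *\<^sub>R (x + star (x::'a::cstar_algebra)))}"
  using upper_bound_lower[of _ x] by (intro bdd_belowI[of _ "- norm x"]) auto

lemma upper_bound_le:
  "cpos (of_real t - (1/2) *\<^sub>R (x + star (x::'a::cstar_algebra))) \<Longrightarrow> upper_bound x \<le> t"
  unfolding upper_bound_def by (rule cInf_lower[OF _ upper_bound_bdd]) simp

lemma norm_in_upper_bound:
  "cpos (of_real (norm x) - (1/2) *\<^sub>R (x + star (x::'a::cstar_algebra)))"
  using norm_triangle_ineq[of x "star x"]
  by (intro cpos_of_norm) (auto simp: star_scaleR star_add star_star add.commute)

lemma upper_bound_greatest:
  assumes "\<And>t. cpos (of_real t - (1/2) *\<^sub>R (x + star (x::'a::cstar_algebra))) \<Longrightarrow> c \<le> t"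
  shows "c \<le> upper_bound x"
  unfolding upper_bound_def using norm_in_upper_bound[of x] assms by (intro cInf_greatest) auto

lemma upper_bound_less:
  assumes "upper_bound x < t"
  shows "cpos (of_real t - (1/2) *\<^sub>R (x + star (x::'a::cstar_algebra)))"
proof -
  obtain s where s: "cpos (of_real s - (1/2) *\<^sub>R (x + star x))" "s < t"
    using assms upper_bound_greatest[of x t] by (meson linorder_not_le)
  have "cpos ((of_real s - (1/2) *\<^sub>R (x + star x)) + of_real (t - s))"
    using s by (intro cpos_add cpos_of_real) auto
  then show ?thesis by simp
qed

lemma sublinear_upper_bound: "sublinear (upper_bound :: 'a::cstar_algebra \<Rightarrow> real)"
proof (rule sublinearI)
  fix x y :: 'a
  have "upper_bound (x + y) \<le> s + t" if "cpos (of_real s - (1/2) *\<^sub>R (x + star x))"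
    "cpos (of_real t - (1/2) *\<^sub>R (y + star y))" for s t
  proof (rule upper_bound_le)
    have "of_real (s + t) - (1/2) *\<^sub>R (x + y + star (x + y))
      = (of_real s - (1/2) *\<^sub>R (x + star x)) + (of_real t - (1/2) *\<^sub>R (y + star y))"
      by (simp add: star_add algebra_simps)
    then show "cpos (of_real (s + t) - (1/2) *\<^sub>R (x + y + star (x + y)))"
      using cpos_add[OF that] by metis
  qed
  then have "upper_bound (x + y) - s \<le> t" if "cpos (of_real s - (1/2) *\<^sub>R (x + star x))"
    "cpos (of_real t - (1/2) *\<^sub>R (y + star y))" for s t
    using that by (simp only: diff_le_eq add.commute[of t])
  then have "upper_bound (x + y) - s \<le> upper_bound y" if "cpos (of_real s - (1/2) *\<^sub>R (x + star x))" for s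
    using that by (intro upper_bound_greatest) blast
  then have "upper_bound (x + y) - upper_bound y \<le> s" if "cpos (of_real s - (1/2) *\<^sub>R (x + star x))" for s
    using that by (simp only: diff_le_eq add.commute[of "upper_bound y"])
  then have "upper_bound (x + y) - upper_bound y \<le> upper_bound x"
    by (intro upper_bound_greatest) blast
  then show "upper_bound (x + y) \<le> upper_bound x + upper_bound y" by simp
next
  have "upper_bound (0::'a) \<le> 0" by (rule upper_bound_le) (simp add: cpos_of_real[of 0, simplified])
  moreover have "0 \<le> upper_bound (0::'a)"
    by (rule upper_bound_greatest) (simp add: cpos_of_real_iff)
  ultimately show "upper_bound (0::'a) = 0" by simp
next
  fix s :: real and x :: 'a assume s: "s > 0"
  have "upper_bound (s *\<^sub>R x) / s \<le> upper_bound x"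
  proof (rule upper_bound_greatest)
    fix t assume "cpos (of_real t - (1/2) *\<^sub>R (x + star x))"
    then have "cpos (s *\<^sub>R (of_real t - (1/2) *\<^sub>R (x + star x)))" using s by (intro cpos_scaleR) auto
    also have "s *\<^sub>R (of_real t - (1/2) *\<^sub>R (x + star x))
        = of_real (s * t) - (1/2) *\<^sub>R (s *\<^sub>R x + star (s *\<^sub>R x))"
      by (simp add: of_real_def star_scaleR algebra_simps)
    finally have "upper_bound (s *\<^sub>R x) \<le> s * t" by (rule upper_bound_le)
    then show "upper_bound (s *\<^sub>R x) / s \<le> t" using s by (simp add: field_simps)
  qed
  then show "upper_bound (s *\<^sub>R x) \<le> s * upper_bound x" using s by (simp add: field_simps)
qed

text \<open>The dominated real functional vanishes on skew elements, because the upper bound only sees the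
  self-adjoint part, and is nonnegative on the cone; its complexification is a state.\<close>

lemma exists_state:
  fixes a :: "'a::cstar_algebra"
  assumes "star a = a"
  obtains \<omega> where "state \<omega>" "Re (\<omega> a) = upper_bound a"
proof -
  obtain f where f: "linear f" "\<And>x. f x \<le> upper_bound x" "f a = upper_bound a"
    using sublinear_dominates_linear[OF sublinear_upper_bound] by metis
  note lin = linear_add[OF f(1)] linear_scale[OF f(1)] linear_neg[OF f(1)]
  have le: "f x \<le> norm x" for x
    using f(2)[of x] upper_bound_le[OF norm_in_upper_bound] by (meson order_trans)
  have abs: "\<bar>f x\<bar> \<le> norm x" for x using le[of x] le[of "-x"] lin(3)[of x] by simp
  have skew: "f x = 0" if "star x = - x" for x
  proof -
    have "f y \<le> 0" if "star y = - y" for y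
    proof -
      have "upper_bound y \<le> 0" by (rule upper_bound_le) (simp add: that cpos_of_real[of 0, simplified])
      then show ?thesis using f(2)[of y] by simp
    qed
    from this[of x] this[of "-x"] show ?thesis using that lin(3)[of x] by simp
  qed
  have fstar: "f (star x) = f x" for x
  proof -
    have "f (star x + - x) = 0" by (rule skew) (simp add: star_add star_diff star_star)
    then show ?thesis by (simp only: lin)
  qed
  have pos: "f x \<ge> 0" if "cpos x" for x
  proof -
    have "star x = x" using that by (simp add: cpos_def)
    then have "upper_bound (- x) \<le> 0" using that
      by (intro upper_bound_le) (simp add: scaleR_2[symmetric] scaleR_add_right[symmetric] flip: scaleR_minus_right)
    then show ?thesis using f(2)[of "-x"] lin(3)[of x] by simp
  qed
  define \<omega> where "\<omega> x = Complex (f x) (- f (\<i> *\<^sub>C x))" for x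
  have sc: "z *\<^sub>C x = Re z *\<^sub>R x + Im z *\<^sub>R (\<i> *\<^sub>C x)" for z x
    using scaleC_add_left[of "complex_of_real (Re z)" "complex_of_real (Im z) * \<i>" x]
    by (simp add: scaleC_scaleC[symmetric] scaleC_of_real complex_eq[symmetric] mult.commute scaleC_scaleR)
  have "\<omega> (x + y) = \<omega> x + \<omega> y" for x y by (simp add: \<omega>_def scaleC_add_right lin complex_eq_iff)
  moreover have "\<omega> (z *\<^sub>C x) = z * \<omega> x" for z x
  proof -
    have 1: "f (z *\<^sub>C x) = Re z * f x + Im z * f (\<i> *\<^sub>C x)" by (subst sc) (simp only: lin real_scaleR_def)
    have 2: "f (\<i> *\<^sub>C (z *\<^sub>C x)) = - Im z * f x + Re z * f (\<i> *\<^sub>C x)"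
      by (subst scaleC_scaleC, subst sc) (simp add: lin linear_diff[OF f(1)])
    show ?thesis by (simp add: \<omega>_def 1 2 complex_eq_iff)
  qed
  moreover have "\<omega> (star x) = cnj (\<omega> x)" for x
  proof -
    have "\<i> *\<^sub>C star x = - star (\<i> *\<^sub>C x)" by (simp add: star_scaleC scaleC_minus_left)
    then show ?thesis by (simp add: \<omega>_def complex_eq_iff lin fstar)
  qed
  moreover have "cmod (\<omega> x) \<le> 2 * norm x" for x
    using cmod_le[of "\<omega> x"] abs[of x] abs[of "\<i> *\<^sub>C x"] by (simp add: \<omega>_def norm_scaleC)
  moreover have "0 \<le> Re (\<omega> (star y * y))" for y
    using pos[OF cpos_star_mult] by (simp add: \<omega>_def)
  ultimately have "state \<omega>" by (simp add: state_def)
  moreover have "Re (\<omega> a) = upper_bound a" by (simp add: \<omega>_def f(3))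
  ultimately show thesis using that by blast
qed

lemma norm_le_of_states_selfadjoint:
  fixes a :: "'a::cstar_algebra"
  assumes "star a = a" "\<And>\<omega>. state \<omega> \<Longrightarrow> cmod (\<omega> a) \<le> B" "B \<ge> 0"
  shows "norm a \<le> B"
proof (rule field_le_epsilon)
  fix e :: real assume e: "e > 0"
  have half: "(1/2) *\<^sub>R (x + x) = x" for x :: 'a by (simp add: scaleR_2[symmetric])
  have "upper_bound a \<le> B"
    using exists_state[OF assms(1)] assms(2) complex_Re_le_cmod order_trans by metis
  then have 1: "cpos (of_real (B + e) - a)"
    using upper_bound_less[of a "B + e"] e assms(1) by (simp only: half)
  have "star (- a) = - a" using assms(1) by simp
  then obtain \<omega> where \<omega>: "state \<omega>" "Re (\<omega> (- a)) = upper_bound (- a)" using exists_state by metis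
  have "\<omega> (- a) = - \<omega> a"
    using \<omega>(1) scaleC_minus_left[of 1 a] unfolding state_def by (metis mult_minus1 scaleC_one)
  then have "upper_bound (- a) \<le> B"
    using \<omega>(2) assms(2)[OF \<omega>(1)] complex_Re_le_cmod[of "\<omega> (- a)"] by simp
  then have 2: "cpos (of_real (B + e) - (- a))"
    using upper_bound_less[of "-a" "B + e"] e \<open>star (- a) = - a\<close> by (simp only: half)
  show "norm a \<le> B + e" by (rule norm_le_of_cpos) (use 1 2 e assms(3) in auto)
qed

text \<open>For self-adjoint elements the constant is \<open>1\<close>; the factor \<open>2\<close> pays for splitting into real and
  imaginary part.\<close>

theorem norm_le_of_states:
  fixes x :: "'a::cstar_algebra"
  assumes B: "\<And>\<omega>. state \<omega> \<Longrightarrow> cmod (\<omega> x) \<le> B"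
  shows "norm x \<le> 2 * B"
proof -
  obtain \<omega>0 :: "'a \<Rightarrow> complex" where "state \<omega>0" using exists_state[OF star_zero] by blast
  then have B0: "B \<ge> 0" using B norm_ge_zero order_trans by blast
  have st: "\<omega> (u + v) = \<omega> u + \<omega> v" "\<omega> (z *\<^sub>C u) = z * \<omega> u" "\<omega> (star u) = cnj (\<omega> u)"
    if "state \<omega>" for \<omega> u v z using that by (auto simp: state_def)
  define a where "a = (1/2) *\<^sub>C (x + star x)"
  define b where "b = (- \<i>/2) *\<^sub>C (x + (-1) *\<^sub>C star x)"
  have a: "star a = a" by (simp add: a_def star_scaleC star_add star_star add.commute)
  have b: "star b = b"
    by (simp add: b_def star_scaleC star_add star_star scaleC_add_right scaleC_scaleC scaleC_minus_left star_diff
        scaleC_diff_right)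
  have "norm a \<le> B"
  proof (rule norm_le_of_states_selfadjoint[OF a _ B0])
    fix \<omega> :: "'a \<Rightarrow> complex" assume w: "state \<omega>"
    have "cmod (\<omega> x + cnj (\<omega> x)) \<le> B + B"
      using norm_triangle_le[of "\<omega> x" "cnj (\<omega> x)" "B + B"] B[OF w] by simp
    then show "cmod (\<omega> a) \<le> B" by (simp add: a_def st[OF w] norm_mult norm_divide)
  qed
  moreover have "norm b \<le> B"
  proof (rule norm_le_of_states_selfadjoint[OF b _ B0])
    fix \<omega> :: "'a \<Rightarrow> complex" assume w: "state \<omega>"
    have "cmod (\<omega> x - cnj (\<omega> x)) \<le> B + B"
      using norm_triangle_ineq4[of "\<omega> x" "cnj (\<omega> x)"] B[OF w] by simp
    then show "cmod (\<omega> b) \<le> B" by (simp add: b_def st[OF w] norm_mult norm_divide)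
  qed
  moreover have "x = a + \<i> *\<^sub>C b"
  proof -
    have "a + \<i> *\<^sub>C b = (1/2 + 1/2) *\<^sub>C x + (1/2 - 1/2) *\<^sub>C star x"
      unfolding a_def b_def by (simp only: scaleC_add_right scaleC_scaleC scaleC_add_left)
        (simp add: scaleC_add_left[symmetric] scaleC_minus_left scaleC_of_real[of "1/2", simplified])
    then show ?thesis by simp
  qed
  ultimately show ?thesis using norm_triangle_ineq[of a "\<i> *\<^sub>C b"] by (simp add: norm_scaleC)
qed

lemma eq_of_states:
  assumes "\<And>\<omega>. state \<omega> \<Longrightarrow> \<omega> x = \<omega> (y::'a::cstar_algebra)" shows "x = y"
proof -
  have "norm (x - y) \<le> 2 * 0"
  proof (rule norm_le_of_states)
    fix \<omega> :: "'a \<Rightarrow> complex" assume w: "state \<omega>"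
    have "\<omega> ((x - y) + y) = \<omega> (x - y) + \<omega> y" using w unfolding state_def by blast
    then show "cmod (\<omega> (x - y)) \<le> 0" using assms[OF w] by simp
  qed
  then show ?thesis by simp
qed

section \<open>Interpolation and finite differences\<close>

lemma poly_eq_of_agree:
  fixes p q :: "'a::idom poly"
  assumes "finite I" "inj_on x I" "degree p < card I" "degree q < card I"
    "\<And>i. i \<in> I \<Longrightarrow> poly p (x i) = poly q (x i)"
  shows "p = q"
proof (rule ccontr)
  assume "p \<noteq> q"
  then have nz: "p - q \<noteq> 0" by simp
  have "card I = card (x ` I)" using assms(2) by (simp add: card_image)
  also have "\<dots> \<le> card {z. poly (p - q) z = 0}"
    using assms(5) by (intro card_mono poly_roots_finite nz) auto
  also have "\<dots> \<le> degree (p - q)" by (rule card_poly_roots_bound[OF nz])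
  also have "\<dots> < card I" using assms(3,4) degree_diff_le_max[of p q] by linarith
  finally show False by simp
qed

definition lagrange_poly :: "('i \<Rightarrow> 'a::field) \<Rightarrow> 'i set \<Rightarrow> 'i \<Rightarrow> 'a poly" where
  "lagrange_poly x I i = smult (1 / (\<Prod>l\<in>I-{i}. x i - x l)) (\<Prod>l\<in>I-{i}. [:- x l, 1:])"

lemma prod_monic_degree:
  "degree (\<Prod>l\<in>J. [:- x l, 1:] :: 'a::field poly) = card J" "lead_coeff (\<Prod>l\<in>J. [:- x l, 1:] :: 'a poly) = 1"
proof -
  have nz: "(\<Prod>l\<in>J. [:- x l, 1:] :: 'a poly) \<noteq> 0"
    by (cases "finite J") auto
  show "lead_coeff (\<Prod>l\<in>J. [:- x l, 1:] :: 'a poly) = 1" by (simp add: lead_coeff_prod)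
  have "degree (\<Prod>l\<in>J. [:- x l, 1:] :: 'a poly) = (\<Sum>l\<in>J. degree ([:- x l, 1:] :: 'a poly))"
    by (rule degree_prod_eq_sum_degree) auto
  then show "degree (\<Prod>l\<in>J. [:- x l, 1:] :: 'a poly) = card J" by simp
qed

lemma degree_lagrange_poly: "finite I \<Longrightarrow> i \<in> I \<Longrightarrow> degree (lagrange_poly x I i) < card I"
proof -
  assume "finite I" "i \<in> I"
  then have "card (I - {i}) < card I" by (rule card_Diff1_less)
  then show ?thesis
    unfolding lagrange_poly_def using degree_smult_le prod_monic_degree(1)[of x "I-{i}"]
    by (metis le_less_trans)
qed

lemma coeff_lagrange_poly:
  assumes "finite I" "i \<in> I" "card I = Suc m"
  shows "coeff (lagrange_poly x I i) m = 1 / (\<Prod>l\<in>I-{i}. x i - x l)"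
proof -
  have "card (I - {i}) = m" using assms by simp
  then show ?thesis
    using prod_monic_degree[of x "I-{i}"] by (simp add: lagrange_poly_def)
qed

lemma poly_lagrange_poly:
  "poly (lagrange_poly x I i) t = (\<Prod>l\<in>I-{i}. (t - x l) / (x i - x l))"
  by (simp add: lagrange_poly_def poly_prod prod_dividef)

lemma poly_lagrange_poly_node:
  assumes "finite I" "inj_on x I" "i \<in> I" "k \<in> I"
  shows "poly (lagrange_poly x I i) (x k) = (if k = i then 1 else 0)"
proof (cases "k = i")
  case True
  have "x i - x l \<noteq> 0" if "l \<in> I - {i}" for l using that assms by (auto simp: inj_on_def)
  then show ?thesis using True by (simp add: poly_lagrange_poly)
next
  case False
  then show ?thesis using assms by (auto simp: poly_lagrange_poly intro!: prod_zero)
qed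

theorem lagrange_interpolation:
  fixes Q :: "'a::field poly"
  assumes "finite I" "inj_on x I" "degree Q < card I"
  shows "Q = (\<Sum>i\<in>I. smult (poly Q (x i)) (lagrange_poly x I i))"
proof (rule poly_eq_of_agree[OF assms])
  have c: "card I > 0" using assms(3) by simp
  have "degree (\<Sum>i\<in>I. smult (poly Q (x i)) (lagrange_poly x I i)) \<le> card I - 1"
    using c by (intro degree_sum_le assms(1) order_trans[OF degree_smult_le])
      (use degree_lagrange_poly[OF assms(1), of _ x] in fastforce)
  then show "degree (\<Sum>i\<in>I. smult (poly Q (x i)) (lagrange_poly x I i)) < card I"
    using c by linarith
  fix k assume k: "k \<in> I"
  have "poly (\<Sum>i\<in>I. smult (poly Q (x i)) (lagrange_poly x I i)) (x k)
      = (\<Sum>i\<in>I. if k = i then poly Q (x i) else 0)"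
    using assms k by (simp add: poly_sum poly_lagrange_poly_node if_distrib cong: if_cong)
  then show "poly Q (x k) = poly (\<Sum>i\<in>I. smult (poly Q (x i)) (lagrange_poly x I i)) (x k)"
    using assms(1) k by simp
qed

text \<open>Compare the leading coefficients in Lagrange's formula.\<close>

lemma divided_difference:
  fixes Q :: "'a::field poly"
  assumes "finite I" "inj_on x I" "card I = Suc m" "degree Q \<le> m"
  shows "(\<Sum>i\<in>I. poly Q (x i) / (\<Prod>l\<in>I-{i}. x i - x l)) = coeff Q m"
proof -
  have "coeff Q m = coeff (\<Sum>i\<in>I. smult (poly Q (x i)) (lagrange_poly x I i)) m"
    using lagrange_interpolation[OF assms(1,2), of Q] assms by simp
  also have "\<dots> = (\<Sum>i\<in>I. poly Q (x i) / (\<Prod>l\<in>I-{i}. x i - x l))"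
    unfolding coeff_sum using assms(1,3) by (intro sum.cong) (simp_all add: coeff_lagrange_poly)
  finally show ?thesis by simp
qed

lemma prod_nat_nodes:
  assumes "i \<le> m"
  shows "(\<Prod>l\<in>{..m}-{i}. of_nat i - of_nat l :: 'a::field_char_0) = (-1) ^ (m - i) * fact i * fact (m - i)"
proof -
  have split: "{..m} - {i} = {..<i} \<union> {Suc i..m}" using assms by auto
  have "(\<Prod>l\<in>{..m}-{i}. of_nat i - of_nat l :: 'a) =
      (\<Prod>l<i. of_nat i - of_nat l) * (\<Prod>l\<in>{Suc i..m}. of_nat i - of_nat l)"
    unfolding split by (rule prod.union_disjoint) auto
  also have "(\<Prod>l<i. of_nat i - of_nat l :: 'a) = (\<Prod>l<i. of_nat (Suc l))"
    by (rule prod.reindex_bij_witness[of _ "\<lambda>l. i - Suc l" "\<lambda>l. i - Suc l"])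
      (auto simp: of_nat_diff)
  also have "\<dots> = fact i" by (simp add: fact_prod_Suc atLeast0LessThan)
  also have "(\<Prod>l\<in>{Suc i..m}. of_nat i - of_nat l :: 'a) = (\<Prod>l<m-i. - of_nat (Suc l))"
    using assms by (intro prod.reindex_bij_witness[of _ "\<lambda>l. l + Suc i" "\<lambda>l. l - Suc i"]) auto
  also have "\<dots> = (-1) ^ (m - i) * fact (m - i)"
    by (simp only: prod_uminus) (simp add: fact_prod_Suc atLeast0LessThan)
  finally show ?thesis by (simp add: ac_simps)
qed

lemma finite_difference_poly:
  fixes Q :: "'a::field_char_0 poly"
  assumes "degree Q \<le> m"
  shows "(\<Sum>i\<le>m. (-1) ^ (m - i) * of_nat (m choose i) * poly Q (of_nat i)) = fact m * coeff Q m"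
proof -
  have "fact m * coeff Q m = fact m * (\<Sum>i\<in>{..m}. poly Q (of_nat i) / (\<Prod>l\<in>{..m}-{i}. of_nat i - of_nat l))"
    by (subst divided_difference) (use assms in \<open>auto simp: inj_on_def\<close>)
  also have "\<dots> = (\<Sum>i\<le>m. (-1) ^ (m - i) * of_nat (m choose i) * poly Q (of_nat i))"
    unfolding sum_distrib_left
  proof (intro sum.cong refl)
    fix i assume "i \<in> {..m}"
    then have i: "i \<le> m" by simp
    have "(-1::'a) ^ (m - i) * (-1) ^ (m - i) = 1" by (simp flip: power_mult_distrib)
    then have "1 / (-1::'a) ^ (m - i) = (-1) ^ (m - i)" by (metis divide_eq_eq mult_zero_left zero_neq_one)
    then show "fact m * (poly Q (of_nat i) / (\<Prod>l\<in>{..m}-{i}. of_nat i - of_nat l))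
       = (-1) ^ (m - i) * of_nat (m choose i) * poly Q (of_nat i)"
      using i by (simp add: prod_nat_nodes binomial_fact field_simps)
  qed
  finally show ?thesis by simp
qed

text \<open>The interpolation weights of the nodes \<open>0, \<dots>, 2N\<close> alternate in sign. Read as an identity
  between the even and the odd nodes, this is the source of the orthogonal matrix used for Jensen's
  inequality.\<close>

lemma alternating_sum_even:
  fixes Q :: "real poly"
  assumes "degree Q < 2 * N"
  shows "(\<Sum>i\<le>2*N. (-1) ^ i * real (2*N choose i) * poly Q (real i)) = 0"
proof -
  have "(\<Sum>i\<le>2*N. (-1) ^ i * real (2*N choose i) * poly Q (real i))
      = (\<Sum>i\<le>2*N. (-1) ^ (2*N - i) * real (2*N choose i) * poly Q (real i))"
    by (intro sum.cong) (auto simp: minus_one_power_iff)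
  also have "\<dots> = 0"
    using assms finite_difference_poly[of Q "2*N"] by (simp add: coeff_eq_0)
  finally show ?thesis .
qed

lemma finite_difference_power:
  assumes "j \<le> m"
  shows "(\<Sum>i\<le>m. (-1) ^ (m - i) * of_nat (m choose i) * (of_nat i :: 'a::field_char_0) ^ j)
    = (if j = m then fact m else 0)"
  using assms finite_difference_poly[of "monom (1::'a) j" m] by (simp add: poly_monom degree_monom_eq)

text \<open>Finite differences recover the coefficients, with an error that depends only on the bound for the
  coefficients; for functions that depend on a parameter it is uniform.\<close>

lemma finite_difference_series:
  fixes c :: "nat \<Rightarrow> complex"
  assumes c: "\<And>j. cmod (c j) \<le> B * 2 ^ j" and e: "0 < e" "4 * real (Suc m) * e \<le> 1"
    and S: "\<And>i. i \<le> m \<Longrightarrow> S (real i * e) = (\<Sum>j. c j * of_real (real i * e) ^ j)"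
  shows "cmod ((\<Sum>i\<le>m. (-1) ^ (m - i) * of_nat (m choose i) * S (real i * e)) / of_real e ^ m - fact m * c m)
     \<le> B * (2 * (8 * real (Suc m)) ^ Suc m) * e"
proof -
  have B: "B \<ge> 0" using order_trans[OF norm_ge_zero c[of 0]] by simp
  have e4: "real (Suc m) * e \<le> 1/4" using e(2) by (simp only: mult.assoc)
  define T where "T j = (\<Sum>i\<le>m. (-1) ^ (m - i) * of_nat (m choose i) * (of_nat i :: complex) ^ j)" for j
  have Tlow: "T j = 0" if "j < m" for j using finite_difference_power[of j m, where ?'a=complex] that by (simp add: T_def)
  have Tm: "T m = fact m" using finite_difference_power[of m m, where ?'a=complex] by (simp add: T_def)
  have Tb: "cmod (T j) \<le> 2 ^ m * real (Suc m) ^ j" for j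
  proof -
    have "cmod (T j) \<le> (\<Sum>i\<le>m. real (m choose i) * real (Suc m) ^ j)"
      unfolding T_def
    proof (rule order_trans[OF norm_sum sum_mono])
      fix i assume "i \<in> {..m}"
      then have "real i ^ j \<le> real (Suc m) ^ j" by (intro power_mono) auto
      then show "cmod ((-1) ^ (m - i) * of_nat (m choose i) * of_nat i ^ j) \<le> real (m choose i) * real (Suc m) ^ j"
        by (simp add: norm_mult norm_power mult_left_mono)
    qed
    also have "\<dots> = 2 ^ m * real (Suc m) ^ j"
      using choose_row_sum[of m] by (simp flip: sum_distrib_right of_nat_sum)
    finally show ?thesis .
  qed
  have sm: "summable (\<lambda>j. c j * of_real (real i * e) ^ j)" if "i \<le> m" for i
  proof (rule summable_comparison_test[OF _ summable_mult[OF summable_geometric[of "1/2::real"]]], intro exI allI impI)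
    fix j
    have "real i * e \<le> real (Suc m) * e" using that e by (intro mult_right_mono) auto
    then have "real i * e \<le> 1/4" using e4 by linarith
    then have "(real i * e) ^ j \<le> (1/4) ^ j" using e by (intro power_mono) auto
    then have "cmod (c j) * (real i * e) ^ j \<le> (B * 2 ^ j) * (1/4) ^ j"
      using c[of j] B e by (intro mult_mono) auto
    also have "\<dots> = B * (1/2) ^ j" by (simp only: mult.assoc flip: power_mult_distrib) simp
    finally show "cmod (c j * of_real (real i * e) ^ j) \<le> B * (1/2) ^ j"
      using e by (simp add: norm_mult norm_power)
  qed simp
  have sm': "summable (\<lambda>j. (-1) ^ (m - i) * of_nat (m choose i) * (c j * of_real (real i * e) ^ j))"
    if "i \<in> {..m}" for i using that by (intro summable_mult sm) simp
  have swap: "(\<Sum>i\<le>m. (-1) ^ (m - i) * of_nat (m choose i) * (c j * of_real (real i * e) ^ j))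
      = c j * of_real e ^ j * T j" for j
    unfolding T_def sum_distrib_left
    by (intro sum.cong refl) (simp only: of_real_mult of_real_of_nat_eq power_mult_distrib mult_ac)
  have "(\<Sum>i\<le>m. (-1) ^ (m - i) * of_nat (m choose i) * S (real i * e))
     = (\<Sum>i\<le>m. \<Sum>j. (-1) ^ (m - i) * of_nat (m choose i) * (c j * of_real (real i * e) ^ j))"
    by (intro sum.cong refl) (simp only: S suminf_mult[OF sm] atMost_iff)
  also have "\<dots> = (\<Sum>j. \<Sum>i\<le>m. (-1) ^ (m - i) * of_nat (m choose i) * (c j * of_real (real i * e) ^ j))"
    by (rule suminf_sum[symmetric]) (rule sm')
  also have "\<dots> = (\<Sum>j. c j * of_real e ^ j * T j)"
    by (simp only: swap)
  finally have eq: "(\<Sum>i\<le>m. (-1) ^ (m - i) * of_nat (m choose i) * S (real i * e)) = (\<Sum>j. c j * of_real e ^ j * T j)" .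
  have smT: "summable (\<lambda>j. c j * of_real e ^ j * T j)"
  proof -
    have "summable (\<lambda>j. \<Sum>i\<le>m. (-1) ^ (m - i) * of_nat (m choose i) * (c j * of_real (real i * e) ^ j))"
      by (intro summable_sum sm')
    also have "(\<lambda>j. \<Sum>i\<le>m. (-1) ^ (m - i) * of_nat (m choose i) * (c j * of_real (real i * e) ^ j))
       = (\<lambda>j. c j * of_real e ^ j * T j)"
      by (simp only: swap)
    finally show ?thesis .
  qed
  define R where "R = (\<Sum>j. c (j + Suc m) * of_real e ^ (j + Suc m) * T (j + Suc m))"
  have "(\<Sum>j. c j * of_real e ^ j * T j) = R + (\<Sum>j<Suc m. c j * of_real e ^ j * T j)"
    unfolding R_def by (rule suminf_split_initial_segment[OF smT])
  also have "(\<Sum>j<Suc m. c j * of_real e ^ j * T j) = c m * of_real e ^ m * fact m"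
    by (simp add: Tlow Tm)
  finally have eq2: "(\<Sum>j. c j * of_real e ^ j * T j) = R + c m * of_real e ^ m * fact m" .
  have bound: "cmod (c (j + Suc m) * of_real e ^ (j + Suc m) * T (j + Suc m))
      \<le> (B * (8 * real (Suc m)) ^ Suc m * e ^ Suc m) * (1/2) ^ j" for j
  proof -
    have "cmod (c (j + Suc m) * of_real e ^ (j + Suc m) * T (j + Suc m))
      \<le> (B * 2 ^ (j + Suc m)) * e ^ (j + Suc m) * (2 ^ m * real (Suc m) ^ (j + Suc m))"
      unfolding norm_mult norm_power using e B
      by (intro mult_mono c Tb mult_nonneg_nonneg) auto
    also have "\<dots> = B * 2 ^ m * (2 * real (Suc m) * e) ^ (j + Suc m)"
      by (simp only: power_mult_distrib ac_simps)
    also have "\<dots> = (B * 2 ^ m * (2 * real (Suc m)) ^ Suc m * e ^ Suc m) * (2 * real (Suc m) * e) ^ j"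
      by (simp only: power_mult_distrib power_add ac_simps)
    also have "\<dots> \<le> (B * 2 ^ m * (2 * real (Suc m)) ^ Suc m * e ^ Suc m) * (1/2) ^ j"
    proof (intro mult_left_mono power_mono)
      show "2 * real (Suc m) * e \<le> 1/2" using e4 by linarith
    qed (use e B in auto)
    also have "\<dots> \<le> (B * (8 * real (Suc m)) ^ Suc m * e ^ Suc m) * (1/2) ^ j"
    proof (intro mult_right_mono)
      have "(2::real) ^ m * (2 * real (Suc m)) ^ Suc m \<le> 4 ^ Suc m * (2 * real (Suc m)) ^ Suc m"
        using order_trans[OF power_mono[of "2::real" 4 m] power_increasing[of m "Suc m" "4::real"]]
        by (intro mult_right_mono zero_le_power) simp_all
      also have "\<dots> = (4 * (2 * real (Suc m))) ^ Suc m" by (simp only: power_mult_distrib)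
      also have "4 * (2 * real (Suc m)) = 8 * real (Suc m)" by simp
      finally show "B * 2 ^ m * (2 * real (Suc m)) ^ Suc m \<le> B * (8 * real (Suc m)) ^ Suc m"
        using B by (simp only: mult.assoc mult_left_mono)
    qed (use e in auto)
    finally show ?thesis .
  qed
  have geo: "(\<lambda>j. (B * (8 * real (Suc m)) ^ Suc m * e ^ Suc m) * (1/2) ^ j) sums
      ((B * (8 * real (Suc m)) ^ Suc m * e ^ Suc m) * 2)"
    using sums_mult[OF geometric_sums[of "1/2::real"]] by simp
  have "cmod R \<le> (\<Sum>j. (B * (8 * real (Suc m)) ^ Suc m * e ^ Suc m) * (1/2) ^ j)"
  proof -
    have sn: "summable (\<lambda>j. cmod (c (j + Suc m) * of_real e ^ (j + Suc m) * T (j + Suc m)))"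
      by (rule summable_comparison_test'[OF sums_summable[OF geo], of 0]) (simp only: real_norm_def abs_norm_cancel, rule bound)
    show ?thesis unfolding R_def
      by (rule order_trans[OF summable_norm[OF sn] suminf_le[OF bound sn sums_summable[OF geo]]])
  qed
  then have R: "cmod R \<le> (B * (8 * real (Suc m)) ^ Suc m * e ^ Suc m) * 2"
    using sums_unique[OF geo] by simp
  have "(\<Sum>i\<le>m. (-1) ^ (m - i) * of_nat (m choose i) * S (real i * e)) / of_real e ^ m - fact m * c m = R / of_real e ^ m"
    unfolding eq eq2 using e(1) by (simp add: add_divide_distrib)
  also have "cmod \<dots> = cmod R / e ^ m" using e by (simp add: norm_divide norm_power)
  also have "\<dots> \<le> ((B * (8 * real (Suc m)) ^ Suc m * e ^ Suc m) * 2) / e ^ m"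
    using R e by (intro divide_right_mono) auto
  also have "\<dots> = (B * (8 * real (Suc m)) ^ Suc m * 2) * (e ^ Suc m / e ^ m)"
    by (simp only: times_divide_eq_right times_divide_eq_left mult_ac)
  also have "e ^ Suc m / e ^ m = e" using e by simp
  also have "B * (8 * real (Suc m)) ^ Suc m * 2 * e = B * (2 * (8 * real (Suc m)) ^ Suc m) * e"
    by (simp only: mult_ac)
  finally show ?thesis .
qed

section \<open>Kraus functions of one variable\<close>

text \<open>Kraus' condition for matrix convexity in terms of differences: \<open>P\<^sup>2 \<phi>\<close> has nonnegative differences of order \<open>2N\<close>. As \<open>e\<close> tends to \<open>0\<close> this becomes positivity of the Hankel
  matrices formed by the Taylor coefficients of \<open>\<phi>\<close> of order two and higher.\<close>

definition kraus :: "(real \<Rightarrow> real) \<Rightarrow> bool" where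
  "kraus \<phi> \<longleftrightarrow> (\<forall>N x e P. degree P < N \<longrightarrow> 0 < e \<longrightarrow> -2 \<le> x \<longrightarrow> x + real (2 * N) * e \<le> 2 \<longrightarrow>
     0 \<le> (\<Sum>i\<le>2*N. (-1) ^ i * real (2*N choose i) * (poly P (real i))\<^sup>2 * \<phi> (x + real i * e)))"

lemma krausD:
  assumes "kraus \<phi>" "degree P < N" "0 < e" "-2 \<le> x" "x + real (2 * N) * e \<le> 2"
  shows "0 \<le> (\<Sum>i\<le>2*N. (-1) ^ i * real (2*N choose i) * (poly P (real i))\<^sup>2 * \<phi> (x + real i * e))"
  using assms unfolding kraus_def by blast

lemma kraus_midpoint:
  assumes "kraus \<phi>" "a \<in> {-2..2}" "b \<in> {-2..2}"
  shows "2 * \<phi> ((a + b) / 2) \<le> \<phi> a + \<phi> b"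
proof -
  have *: "2 * \<phi> ((a + b) / 2) \<le> \<phi> a + \<phi> b" if "a < b" "a \<in> {-2..2}" "b \<in> {-2..2}" for a b
  proof -
    define e where "e = (b - a) / 2"
    have e: "a + e = (a + b) / 2" "a + 2 * e = b" "e > 0" using that by (simp_all add: e_def field_simps)
    have "0 \<le> (\<Sum>i\<le>2*1. (-1) ^ i * real (2*1 choose i) * (poly 1 (real i))\<^sup>2 * \<phi> (a + real i * e))"
      using that e by (intro krausD[OF assms(1)]) auto
    then show ?thesis by (simp add: numeral_2_eq_2 e(1)) (simp add: e(2)[simplified])
  qed
  show ?thesis
    using *[of a b] *[of b a] assms(2,3) by (cases a b rule: linorder_cases) (auto simp: add.commute)
qed

text \<open>Midpoint convexity and boundedness imply continuity in the interior.\<close>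

lemma kraus_continuous:
  assumes k: "kraus \<phi>" and M: "\<And>t. t \<in> {-2..2} \<Longrightarrow> \<bar>\<phi> t\<bar> \<le> M"
  shows "continuous_on {-1..1} \<phi>"
proof -
  have up: "\<phi> (x + h) - \<phi> x \<le> 2 * M / 2 ^ n" if "x \<in> {-1..1}" "\<bar>h\<bar> \<le> 1 / 2 ^ n" for x h n
    using that(2)
  proof (induction n arbitrary: h)
    case 0
    then show ?case using M[of "x + h"] M[of x] that(1) by (auto simp: abs_le_iff)
  next
    case (Suc n)
    have h2: "\<bar>2 * h\<bar> \<le> 1 / 2 ^ n" using Suc.prems by (simp add: field_simps abs_mult)
    have "1 / 2 ^ n \<le> (1::real)" by simp
    then have "x + 2 * h \<in> {-2..2}" using h2 that(1) unfolding atLeastAtMost_iff by linarith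
    then have "2 * \<phi> ((x + (x + 2 * h)) / 2) \<le> \<phi> x + \<phi> (x + 2 * h)"
      using that(1) by (intro kraus_midpoint[OF k]) auto
    also have "(x + (x + 2 * h)) / 2 = x + h" by simp
    finally have "2 * (\<phi> (x + h) - \<phi> x) \<le> \<phi> (x + 2 * h) - \<phi> x" by simp
    also have "\<dots> \<le> 2 * M / 2 ^ n" by (rule Suc.IH[OF h2])
    finally show ?case by simp
  qed
  have both: "\<bar>\<phi> (x + h) - \<phi> x\<bar> \<le> 2 * M / 2 ^ n" if x: "x \<in> {-1..1}" and h: "\<bar>h\<bar> \<le> 1 / 2 ^ n" for x h n
  proof -
    have "\<bar>h\<bar> \<le> 1" using h order_trans[of "\<bar>h\<bar>" "1 / 2 ^ n" 1] by simp
    then have "2 * \<phi> ((x + h + (x - h)) / 2) \<le> \<phi> (x + h) + \<phi> (x - h)"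
      using x by (intro kraus_midpoint[OF k]) (auto simp: abs_le_iff)
    moreover have "(x + h + (x - h)) / 2 = x" by simp
    ultimately show ?thesis using up[OF x h] up[OF x, of "-h" n] h by (simp add: abs_le_iff)
  qed
  show ?thesis
    unfolding continuous_on_iff
  proof (intro ballI allI impI)
    fix x e :: real assume x: "x \<in> {-1..1}" and e: "e > 0"
    obtain n where "2 * M / e < 2 ^ n" using real_arch_pow[of 2 "2 * M / e"] by auto
    then have n: "2 * M / 2 ^ n < e" using e by (simp add: field_simps)
    show "\<exists>d>0. \<forall>x'\<in>{-1..1}. dist x' x < d \<longrightarrow> dist (\<phi> x') (\<phi> x) < e"
    proof (intro exI[of _ "1/2^n"] conjI ballI impI)
      fix y assume "dist y x < 1 / 2 ^ n"
      then have "\<bar>\<phi> (x + (y - x)) - \<phi> x\<bar> \<le> 2 * M / 2 ^ n"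
        by (intro both x) (simp add: dist_real_def)
      then show "dist (\<phi> y) (\<phi> x) < e" using n by (simp add: dist_real_def)
    qed simp
  qed
qed

subsection \<open>Bernstein polynomials on the symmetric interval\<close>

definition bern :: "nat \<Rightarrow> (nat \<Rightarrow> real) \<Rightarrow> real poly" where
  "bern n c = (\<Sum>k\<le>n. smult (c k * real (n choose k)) ([:1/2, 1/2:] ^ k * [:1/2, -(1/2):] ^ (n - k)))"

lemma poly_bern: "poly (bern n c) t = (\<Sum>k\<le>n. c k * Bernstein n k ((1 + t) / 2))"
proof -
  have 1: "(1 + t) / 2 = 1/2 + t/2" and 2: "1 - (1 + t) / 2 = 1/2 - t/2" by (simp_all add: field_simps)
  show ?thesis
    unfolding bern_def poly_sum Bernstein_def 2 unfolding 1 by (simp add: mult.assoc)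
qed

definition fdiff :: "(nat \<Rightarrow> real) \<Rightarrow> nat \<Rightarrow> real" where
  "fdiff c k = c (Suc k) - c k"

lemma pderiv_of_sum: "pderiv (\<Sum>i\<in>I. g i) = (\<Sum>i\<in>I. pderiv (g i))"
  by (induction I rule: infinite_finite_induct) (simp_all add: pderiv_add)

lemma smult_of_sum: "smult a (\<Sum>i\<in>I. g i) = (\<Sum>i\<in>I. smult a (g i))"
  by (induction I rule: infinite_finite_induct) (simp_all add: smult_add_right)

lemma pderiv_bern: "pderiv (bern (Suc n) c) = smult (real (Suc n) / 2) (bern n (fdiff c))"
proof -
  let ?X = "[:1/2, 1/2:] :: real poly" and ?Y = "[:1/2, -(1/2):] :: real poly"
  have pX: "pderiv ?X = [:1/2:]" and pY: "pderiv ?Y = [:-(1/2):]" by (simp_all add: pderiv_pCons)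
  have deriv_term: "pderiv (?X ^ k * ?Y ^ l) = smult (real k / 2) (?X ^ (k - 1) * ?Y ^ l)
      - smult (real l / 2) (?X ^ k * ?Y ^ (l - 1))" for k l
    by (simp add: pderiv_mult pderiv_power pX pY ac_simps smult_minus_left)
  have "pderiv (bern (Suc n) c) = (\<Sum>k\<le>Suc n. smult (c k * real (Suc n choose k))
      (pderiv (?X ^ k * ?Y ^ (Suc n - k))))"
    unfolding bern_def by (simp only: pderiv_of_sum pderiv_smult)
  also have "\<dots> = (\<Sum>k\<le>Suc n. smult (c k * real (Suc n choose k) * (real k / 2)) (?X ^ (k - 1) * ?Y ^ (Suc n - k)))
     - (\<Sum>k\<le>Suc n. smult (c k * real (Suc n choose k) * (real (Suc n - k) / 2)) (?X ^ k * ?Y ^ (Suc n - k - 1)))"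
    by (simp only: deriv_term smult_diff_right smult_smult sum_subtractf)
  also have "(\<Sum>k\<le>Suc n. smult (c k * real (Suc n choose k) * (real k / 2)) (?X ^ (k - 1) * ?Y ^ (Suc n - k)))
     = (\<Sum>k\<le>n. smult (real (Suc n) / 2 * (c (Suc k) * real (n choose k))) (?X ^ k * ?Y ^ (n - k)))"
  proof -
    have "real (Suc n choose Suc k) * real (Suc k) = real (Suc n) * real (n choose k)" for k
      using Suc_times_binomial_eq[of n k] by (metis of_nat_mult)
    then have eqn: "c (Suc k) * real (Suc n choose Suc k) * (real (Suc k) / 2)
        = real (Suc n) / 2 * (c (Suc k) * real (n choose k))" for k
      by (metis (no_types, opaque_lifting) mult.assoc mult.commute times_divide_eq_left times_divide_eq_right)
    show ?thesis by (simp only: sum.atMost_Suc_shift eqn diff_Suc_Suc) simp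
  qed
  also have "(\<Sum>k\<le>Suc n. smult (c k * real (Suc n choose k) * (real (Suc n - k) / 2)) (?X ^ k * ?Y ^ (Suc n - k - 1)))
     = (\<Sum>k\<le>n. smult (real (Suc n) / 2 * (c k * real (n choose k))) (?X ^ k * ?Y ^ (n - k)))"
  proof -
    have "real (Suc n - k) * real (Suc n choose k) = real (Suc n) * real (n choose k)" for k
      using binomial_absorb_comp[of "Suc n" k] by (metis of_nat_mult diff_Suc_1)
    then have eqn: "c k * real (Suc n choose k) * (real (Suc n - k) / 2)
        = real (Suc n) / 2 * (c k * real (n choose k))" for k
      by (metis (no_types, opaque_lifting) mult.assoc mult.commute times_divide_eq_left times_divide_eq_right)
    show ?thesis by (simp only: sum.atMost_Suc eqn) (simp add: binomial_eq_0)
  qed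
  also have "(\<Sum>k\<le>n. smult (real (Suc n) / 2 * (c (Suc k) * real (n choose k))) (?X ^ k * ?Y ^ (n - k)))
     - (\<Sum>k\<le>n. smult (real (Suc n) / 2 * (c k * real (n choose k))) (?X ^ k * ?Y ^ (n - k)))
     = smult (real (Suc n) / 2) (bern n (fdiff c))"
    unfolding bern_def fdiff_def smult_of_sum sum_subtractf[symmetric]
    by (intro sum.cong refl) (simp only: smult_smult left_diff_distrib right_diff_distrib smult_diff_left smult_diff_right)
  finally show ?thesis .
qed

lemma higher_pderiv_smult: "(pderiv ^^ j) (smult a p) = smult a ((pderiv ^^ j) p)"
  by (induction j) (simp_all add: pderiv_smult)

text \<open>Differentiating a Bernstein polynomial differences its coefficients.\<close>

lemma higher_pderiv_bern_nonneg:
  assumes "\<And>k. k + j \<le> n \<Longrightarrow> (fdiff ^^ j) c k \<ge> 0" "t \<in> {-1..1}"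
  shows "poly ((pderiv ^^ j) (bern n c)) t \<ge> 0"
  using assms(1)
proof (induction j arbitrary: n c)
  case 0
  then show ?case using assms(2)
    by (auto simp: poly_bern intro!: sum_nonneg mult_nonneg_nonneg Bernstein_nonneg)
next
  case (Suc j)
  show ?case
  proof (cases n)
    case 0
    then have "pderiv (bern n c) = 0" by (simp add: bern_def pderiv_smult pderiv_pCons)
    then show ?thesis by (simp add: funpow_Suc_right del: funpow.simps)
  next
    case (Suc n')
    have "poly ((pderiv ^^ j) (bern n' (fdiff c))) t \<ge> 0"
      by (rule Suc.IH) (use Suc.prems Suc in \<open>auto simp: funpow_Suc_right simp del: funpow.simps\<close>)
    then show ?thesis
      using Suc by (simp add: funpow_Suc_right pderiv_bern higher_pderiv_smult del: funpow.simps)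
  qed
qed

lemma fdiff_power: "(fdiff ^^ j) c k = (\<Sum>i\<le>j. (-1) ^ (j + i) * real (j choose i) * c (k + i))"
proof (induction j arbitrary: k)
  case (Suc j)
  define e where "e j i = (-1) ^ (j + i) * real (j choose i)" for j i
  have IH: "(fdiff ^^ j) c k = (\<Sum>i\<le>j. e j i * c (k + i))" for k by (simp add: Suc e_def)
  have 0: "e (Suc j) 0 = - e j 0" by (simp add: e_def)
  have S: "e (Suc j) (Suc i) = e j i - e j (Suc i)" for i by (simp add: e_def algebra_simps)
  have "(\<Sum>i\<le>Suc j. e (Suc j) i * c (k + i)) = - e j 0 * c k + (\<Sum>i\<le>j. (e j i - e j (Suc i)) * c (k + Suc i))"
    by (subst sum.atMost_Suc_shift) (simp add: 0 S)
  also have "\<dots> = (\<Sum>i\<le>j. e j i * c (Suc k + i)) - (e j 0 * c k + (\<Sum>i\<le>j. e j (Suc i) * c (k + Suc i)))"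
    by (simp add: left_diff_distrib sum_subtractf)
  also have "e j 0 * c k + (\<Sum>i\<le>j. e j (Suc i) * c (k + Suc i)) = (\<Sum>i\<le>Suc j. e j i * c (k + i))"
    by (subst sum.atMost_Suc_shift) simp
  also have "\<dots> = (\<Sum>i\<le>j. e j i * c (k + i))" by (simp add: e_def)
  finally have "(\<Sum>i\<le>Suc j. e (Suc j) i * c (k + i)) = (fdiff ^^ j) c (Suc k) - (fdiff ^^ j) c k"
    by (simp only: IH)
  also have "\<dots> = (fdiff ^^ Suc j) c k" by (simp add: fdiff_def[of "(fdiff ^^ j) c" k])
  finally show ?case by (simp only: e_def)
qed simp

subsection \<open>Polynomials with nonnegative even derivatives\<close>

lemma higher_pderiv_at_0: "poly ((pderiv ^^ k) p) 0 = fact k * coeff (p :: real poly) k"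
proof (induction k arbitrary: p)
  case (Suc k)
  show ?case using Suc[of "pderiv p"] by (simp add: funpow_Suc_right coeff_pderiv algebra_simps del: funpow.simps)
qed (simp add: poly_0_coeff_0)

lemma higher_pderiv_shift:
  "(pderiv ^^ k) (p \<circ>\<^sub>p [:x, 1:]) = ((pderiv ^^ k) (p :: real poly)) \<circ>\<^sub>p [:x, 1:]"
  by (induction k) (simp_all add: pderiv_pcompose pderiv_pCons)

lemma poly_taylor:
  fixes p :: "real poly"
  obtains n d where "\<And>s. poly p (x + s) = (\<Sum>k\<le>n. d k * s ^ k)"
    "\<And>k. d k = poly ((pderiv ^^ k) p) x / fact k"
proof (rule that)
  let ?q = "p \<circ>\<^sub>p [:x, 1:]"
  show "poly p (x + s) = (\<Sum>k\<le>degree ?q. coeff ?q k * s ^ k)" for s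
    unfolding poly_altdef[symmetric] by (simp add: poly_pcompose)
  show "coeff ?q k = poly ((pderiv ^^ k) p) x / fact k" for k
    using higher_pderiv_at_0[of k ?q] by (simp add: higher_pderiv_shift poly_pcompose)
qed

text \<open>The mean of \<open>p\<close> at \<open>x + s\<close> and \<open>x - s\<close> is a sum of even Taylor terms, all nonnegative except
  possibly the first; so each later one is at most the mean minus the first.\<close>

lemma even_derivative_bound:
  fixes p :: "real poly"
  assumes pos: "\<And>j x. j \<ge> 1 \<Longrightarrow> x \<in> {-1..1} \<Longrightarrow> poly ((pderiv ^^ (2*j)) p) x \<ge> 0"
    and M: "\<And>x. x \<in> {-1..1} \<Longrightarrow> \<bar>poly p x\<bar> \<le> M"
    and s: "\<bar>x\<bar> + s \<le> 1" "s > 0" and j: "j \<ge> 1"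
  shows "poly ((pderiv ^^ (2*j)) p) x / fact (2*j) * s ^ (2*j) \<le> 2 * M"
proof -
  obtain n d where d: "\<And>s. poly p (x + s) = (\<Sum>k\<le>n. d k * s ^ k)"
    "\<And>k. d k = poly ((pderiv ^^ k) p) x / fact k"
    using poly_taylor[of p x] by metis
  have x: "x \<in> {-1..1}" "x + s \<in> {-1..1}" "x - s \<in> {-1..1}" using s by auto
  have dp: "d k \<ge> 0" if k: "even k" "k \<noteq> 0" for k
  proof -
    obtain j where "k = 2 * j" using k(1) by (rule evenE)
    then show ?thesis using pos[of j x] x k(2) by (simp add: d(2))
  qed
  have d0: "d 0 = poly p x" by (simp add: d(2))
  have dbig: "d k = 0" if "k > max n (degree p)" for k
  proof -
    have "(pderiv ^^ k) p = 0" if "k > degree p" for k and p :: "real poly"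
      using that
    proof (induction k arbitrary: p)
      case (Suc k)
      show ?case
      proof (cases "degree p = 0")
        case True
        then have "pderiv p = 0" by (simp add: pderiv_eq_0_iff)
        then show ?thesis by (simp add: funpow_Suc_right del: funpow.simps)
      next
        case False
        then have "k > degree (pderiv p)" using Suc.prems by (simp add: degree_pderiv)
        then show ?thesis using Suc.IH by (simp add: funpow_Suc_right del: funpow.simps)
      qed
    qed simp
    then show ?thesis using that by (simp add: d(2))
  qed
  have sum: "(poly p (x + s) + poly p (x - s)) / 2 = (\<Sum>k\<le>n. if even k then d k * s ^ k else 0)"
  proof -
    have "poly p (x + s) + poly p (x - s) = (\<Sum>k\<le>n. d k * s ^ k + d k * (- s) ^ k)"
      using d(1)[of s] d(1)[of "-s"] by (simp add: sum.distrib)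
    also have "\<dots> = (\<Sum>k\<le>n. 2 * (if even k then d k * s ^ k else 0))"
      by (intro sum.cong) auto
    finally show ?thesis by (simp add: sum_distrib_left[symmetric])
  qed
  show ?thesis
  proof (cases "2 * j \<le> n")
    case True
    have "d 0 * s ^ 0 + d (2*j) * s ^ (2*j) = (\<Sum>k\<in>{0, 2*j}. if even k then d k * s ^ k else 0)"
      using j by simp
    also have "\<dots> \<le> (\<Sum>k\<le>n. if even k then d k * s ^ k else 0)"
      using True dp s by (intro sum_mono2) (auto simp: zero_le_mult_iff)
    finally have "poly p x + d (2*j) * s ^ (2*j) \<le> (poly p (x + s) + poly p (x - s)) / 2"
      unfolding sum by (simp add: d0)
    moreover have "poly p (x + s) \<le> M" "poly p (x - s) \<le> M" "- poly p x \<le> M"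
      using M[OF x(1)] M[OF x(2)] M[OF x(3)] by (simp_all add: abs_le_iff)
    moreover from this have "(poly p (x + s) + poly p (x - s)) / 2 \<le> M" by simp
    ultimately have "d (2*j) * s ^ (2*j) \<le> M + M" by (smt (verit))
    then have "d (2*j) * s ^ (2*j) \<le> 2 * M" by simp
    then show ?thesis by (simp add: d(2))
  next
    case False
    have "d (2*j) = 0"
    proof -
      have "coeff (p \<circ>\<^sub>p [:x, 1:]) k = coeff (\<Sum>k\<le>n. monom (d k) k) k" for k
      proof -
        have "p \<circ>\<^sub>p [:x, 1:] = (\<Sum>k\<le>n. monom (d k) k)"
          by (rule poly_ext) (simp add: poly_pcompose d(1)[symmetric] poly_sum poly_monom)
        then show ?thesis by simp
      qed
      from this[of "2*j"] have "coeff (p \<circ>\<^sub>p [:x, 1:]) (2*j) = 0" using False by (simp add: coeff_sum)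
      then show ?thesis using higher_pderiv_at_0[of "2*j" "p \<circ>\<^sub>p [:x, 1:]"]
        by (simp add: d(2) higher_pderiv_shift poly_pcompose)
    qed
    then show ?thesis using M[OF x(1)] by (simp add: d(2)[symmetric])
  qed
qed

lemma tangent_bound:
  fixes q :: "real poly"
  assumes "\<And>x. x \<in> {-1..1} \<Longrightarrow> poly (pderiv (pderiv q)) x \<ge> 0" "0 < h" "h \<le> 1"
  shows "h * \<bar>poly (pderiv q) 0\<bar> \<le> max (poly q h) (poly q (-h)) - poly q 0"
proof -
  obtain a where a: "0 < a" "a < h" "poly q h - poly q 0 = (h - 0) * poly (pderiv q) a"
    using poly_MVT[OF assms(2), of q] by blast
  obtain a' where a': "0 < a'" "a' < a" "poly (pderiv q) a - poly (pderiv q) 0 = (a - 0) * poly (pderiv (pderiv q)) a'"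
    using poly_MVT[OF a(1), of "pderiv q"] by blast
  obtain b where b: "- h < b" "b < 0" "poly q 0 - poly q (-h) = (0 - - h) * poly (pderiv q) b"
    using poly_MVT[of "-h" 0 q] assms(2) by auto
  obtain b' where b': "b < b'" "b' < 0" "poly (pderiv q) 0 - poly (pderiv q) b = (0 - b) * poly (pderiv (pderiv q)) b'"
    using poly_MVT[OF b(2), of "pderiv q"] by blast
  have "(a - 0) * poly (pderiv (pderiv q)) a' \<ge> 0" using a a' assms by (intro mult_nonneg_nonneg) auto
  then have 1: "h * poly (pderiv q) 0 \<le> poly q h - poly q 0"
    unfolding a(3) a'(3)[symmetric] using assms(2) by simp
  have "(0 - b) * poly (pderiv (pderiv q)) b' \<ge> 0" using b b' assms by (intro mult_nonneg_nonneg) auto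
  then have "h * poly (pderiv q) b \<le> h * poly (pderiv q) 0"
    unfolding b'(3)[symmetric] using assms(2) by simp
  then have 2: "- (h * poly (pderiv q) 0) \<le> poly q (-h) - poly q 0" using b(3) by simp
  show ?thesis using 1 2 by (cases "poly (pderiv q) 0 \<ge> 0") auto
qed

text \<open>Even coefficients are bounded directly. An odd one is the slope at \<open>0\<close> of a convex function,
  the even derivative before it, which is controlled by its values at \<open>1/2\<close> and \<open>-1/2\<close>.\<close>

lemma even_convex_coeff_bounds:
  fixes p :: "real poly"
  assumes pos: "\<And>j x. j \<ge> 1 \<Longrightarrow> x \<in> {-1..1} \<Longrightarrow> poly ((pderiv ^^ (2*j)) p) x \<ge> 0"
    and M: "\<And>x. x \<in> {-1..1} \<Longrightarrow> \<bar>poly p x\<bar> \<le> M"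
  shows "\<bar>coeff p k\<bar> \<le> 2 * M * 2 ^ k" "j \<ge> 1 \<Longrightarrow> 0 \<le> coeff p (2*j) \<and> coeff p (2*j) \<le> 2 * M"
    "\<bar>coeff p 0\<bar> \<le> M"
proof -
  have M0: "M \<ge> 0" using M[of 0] by simp
  show c0: "\<bar>coeff p 0\<bar> \<le> M" using M[of 0] by (simp add: poly_0_coeff_0)
  have even: "0 \<le> coeff p (2*j) \<and> coeff p (2*j) \<le> 2 * M" if "j \<ge> 1" for j
    using even_derivative_bound[OF pos M, of 0 1 j] that pos[of j 0]
      mult_le_cancel_left_pos[of "fact (2*j)" 0 "coeff p (2*j)"]
    by (simp add: higher_pderiv_at_0)
  then show "j \<ge> 1 \<Longrightarrow> 0 \<le> coeff p (2*j) \<and> coeff p (2*j) \<le> 2 * M" .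
  show "\<bar>coeff p k\<bar> \<le> 2 * M * 2 ^ k"
  proof (cases "even k")
    case True
    then obtain j where k: "k = 2 * j" by (auto elim: evenE)
    have "\<bar>coeff p k\<bar> \<le> 2 * M" using even[of j] c0 M0 k by (cases "j = 0") auto
    also have "\<dots> \<le> 2 * M * 2 ^ k" using M0 mult_left_mono[of 1 "2 ^ k" "2 * M"] by simp
    finally show ?thesis .
  next
    case False
    then obtain j where k: "k = Suc (2 * j)" by (auto elim: oddE)
    define q where "q = (pderiv ^^ (2*j)) p"
    have qb: "poly q x - poly q 0 \<le> fact (2*j) * (2 * M * 4 ^ j)" if "x = 1/2 \<or> x = -1/2" for x
    proof (cases "j = 0")
      case True
      then show ?thesis using M[of x] M[of 0] that by (auto simp: q_def abs_le_iff)
    next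
      case False
      have "poly q x / fact (2*j) * (1/2) ^ (2*j) \<le> 2 * M"
        unfolding q_def using that False by (intro even_derivative_bound[OF pos M]) auto
      moreover have "(1/2::real) ^ (2*j) = 1 / 4 ^ j" by (simp add: power_mult power_divide)
      ultimately have "poly q x \<le> fact (2*j) * (2 * M * 4 ^ j)" by (simp add: field_simps)
      moreover have "poly q 0 \<ge> 0" unfolding q_def using pos[of j 0] False by simp
      ultimately show ?thesis by simp
    qed
    have "pderiv (pderiv q) = (pderiv ^^ (2 * Suc j)) p" by (simp add: q_def)
    then have "1/2 * \<bar>poly (pderiv q) 0\<bar> \<le> max (poly q (1/2)) (poly q (-(1/2))) - poly q 0"
      using pos[of "Suc j"] by (intro tangent_bound) auto
    also have "\<dots> \<le> fact (2*j) * (2 * M * 4 ^ j)" using qb[of "1/2"] qb[of "-(1/2)"] by auto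
    finally have 1: "\<bar>poly (pderiv q) 0\<bar> \<le> fact (2*j) * (4 * M * 4 ^ j)" by simp
    have "poly (pderiv q) 0 = fact k * coeff p k"
      using higher_pderiv_at_0[of k p] by (simp add: q_def k)
    then have "fact k * \<bar>coeff p k\<bar> \<le> fact (2*j) * (4 * M * 4 ^ j)" using 1 by (simp add: abs_mult)
    also have "\<dots> \<le> fact k * (4 * M * 4 ^ j)"
      using M0 by (intro mult_right_mono fact_mono) (auto simp: k)
    finally have "\<bar>coeff p k\<bar> \<le> 4 * M * 4 ^ j" by (simp add: mult_le_cancel_left)
    also have "(4::real) ^ j = 2 ^ (2*j)" by (simp add: power_mult)
    finally show ?thesis by (simp add: k)
  qed
qed

subsection \<open>Power series of a Kraus function\<close>

lemma Cauchy_of_approx: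
  fixes x :: "nat \<Rightarrow> 'a::metric_space"
  assumes "\<And>e. e > 0 \<Longrightarrow> \<exists>y. Cauchy y \<and> (\<exists>N. \<forall>n\<ge>N. dist (x n) (y n) \<le> e)"
  shows "Cauchy x"
proof (rule metric_CauchyI)
  fix e :: real assume "e > 0"
  then obtain y N where y: "Cauchy y" "\<And>n. n \<ge> N \<Longrightarrow> dist (x n) (y n) \<le> e/4"
    using assms[of "e/4"] by auto
  obtain K where K: "\<And>m n. m \<ge> K \<Longrightarrow> n \<ge> K \<Longrightarrow> dist (y m) (y n) < e/4"
    using metric_CauchyD[OF y(1), of "e/4"] \<open>e > 0\<close> by auto
  have "dist (x m) (x n) < e" if "m \<ge> max N K" "n \<ge> max N K" for m n
  proof -
    have "dist (x m) (x n) \<le> dist (x m) (y m) + dist (y m) (y n) + dist (x n) (y n)"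
      using dist_triangle[of "x m" "x n" "y m"] dist_triangle[of "y m" "x n" "y n"]
      by (simp add: dist_commute)
    then show ?thesis using y(2)[of m] y(2)[of n] K[of m n] that \<open>e > 0\<close> by simp
  qed
  then show "\<exists>M. \<forall>m\<ge>M. \<forall>n\<ge>M. dist (x m) (x n) < e" by blast
qed

lemma finite_difference_real:
  fixes c :: "nat \<Rightarrow> real"
  assumes c: "\<And>j. \<bar>c j\<bar> \<le> B * 2 ^ j" and e: "0 < e" "4 * real (Suc m) * e \<le> 1"
    and S: "\<And>i. i \<le> m \<Longrightarrow> (\<lambda>j. c j * (real i * e) ^ j) sums S (real i * e)"
  shows "\<bar>(\<Sum>i\<le>m. (-1) ^ (m - i) * real (m choose i) * S (real i * e)) / e ^ m - fact m * c m\<bar>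
     \<le> B * (2 * (8 * real (Suc m)) ^ Suc m) * e"
proof -
  have "cmod ((\<Sum>i\<le>m. (-1) ^ (m - i) * of_nat (m choose i) * of_real (S (real i * e))) / of_real e ^ m
      - fact m * of_real (c m)) \<le> B * (2 * (8 * real (Suc m)) ^ Suc m) * e"
  proof (rule finite_difference_series[OF _ e])
    fix i assume "i \<le> m"
    have "(\<lambda>j. complex_of_real (c j * (real i * e) ^ j)) sums of_real (S (real i * e))"
      unfolding sums_of_real_iff by (rule S) fact
    then show "of_real (S (real i * e)) = (\<Sum>j. of_real (c j) * complex_of_real (real i * e) ^ j)"
      by (simp add: sums_iff)
  qed (simp add: c)
  also have "(\<Sum>i\<le>m. (-1) ^ (m - i) * of_nat (m choose i) * of_real (S (real i * e))) / of_real e ^ m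
      - fact m * of_real (c m) = complex_of_real ((\<Sum>i\<le>m. (-1) ^ (m - i) * real (m choose i) * S (real i * e)) / e ^ m - fact m * c m)"
    by simp
  finally show ?thesis by (simp only: norm_of_real)
qed

text \<open>The coefficients of the Bernstein polynomials are uniformly bounded. They converge, because each is
  a finite difference of values, and those converge by Bernstein's theorem, up to an error that is small
  uniformly in the degree.\<close>

theorem kraus_power_series:
  assumes k: "kraus \<phi>" and M: "\<And>t. t \<in> {-2..2} \<Longrightarrow> \<bar>\<phi> t\<bar> \<le> M"
  shows "\<exists>a. (\<forall>j. \<bar>a j\<bar> \<le> 2 * M * 2 ^ j) \<and> \<bar>a 0\<bar> \<le> M
    \<and> (\<forall>j\<ge>1. 0 \<le> a (2*j) \<and> a (2*j) \<le> 2 * M)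
    \<and> (\<forall>t. \<bar>t\<bar> \<le> 1/4 \<longrightarrow> (\<lambda>j. a j * t ^ j) sums \<phi> t)"
proof -
  have M0: "M \<ge> 0" using M[of 0] by simp
  define p where "p n = bern n (\<lambda>k. \<phi> (2 * (real k / real n) - 1))" for n
  have pb: "\<bar>poly (p n) t\<bar> \<le> M" if t: "t \<in> {-1..1}" and n: "n \<ge> 1" for t n
  proof -
    have "\<bar>poly (p n) t\<bar> \<le> (\<Sum>k\<le>n. M * Bernstein n k ((1 + t) / 2))"
      unfolding p_def poly_bern
    proof (rule order_trans[OF sum_abs sum_mono])
      fix k assume "k \<in> {..n}"
      then have "2 * (real k / real n) - 1 \<in> {-2..2}" using n by (auto simp: field_simps)
      then show "\<bar>\<phi> (2 * (real k / real n) - 1) * Bernstein n k ((1 + t) / 2)\<bar> \<le> M * Bernstein n k ((1 + t) / 2)"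
        using t Bernstein_nonneg[of "(1+t)/2" n k] M by (simp add: abs_mult mult_right_mono)
    qed
    then show ?thesis by (simp add: sum_distrib_left[symmetric])
  qed
  have pos: "poly ((pderiv ^^ (2*j)) (p n)) x \<ge> 0" if j: "j \<ge> 1" and x: "x \<in> {-1..1}" and n: "n \<ge> 1" for j x n
    unfolding p_def
  proof (rule higher_pderiv_bern_nonneg[OF _ x])
    fix l assume l: "l + 2 * j \<le> n"
    have "2 * ((real l + 2 * real j) / real n) \<le> 2"
      using l n of_nat_mono[OF l, where ?'a=real] by (simp add: field_simps)
    then have "0 \<le> (\<Sum>i\<le>2*j. (-1) ^ i * real (2*j choose i) * (poly 1 (real i))\<^sup>2 *
        \<phi> ((2 * (real l / real n) - 1) + real i * (2 / real n)))"
      using j n by (intro krausD[OF k]) (auto simp: field_simps)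
    also have "\<dots> = (fdiff ^^ (2*j)) (\<lambda>k. \<phi> (2 * (real k / real n) - 1)) l"
      unfolding fdiff_power
    proof (intro sum.cong refl)
      fix i
      have eq: "(2 * (real l / real n) - 1) + real i * (2 / real n) = 2 * (real (l + i) / real n) - 1"
        by (simp add: add_divide_distrib)
      show "(-1) ^ i * real (2*j choose i) * (poly 1 (real i))\<^sup>2 *
        \<phi> ((2 * (real l / real n) - 1) + real i * (2 / real n))
        = (-1) ^ (2 * j + i) * real (2 * j choose i) * \<phi> (2 * (real (l + i) / real n) - 1)"
        unfolding eq by (simp add: power_add)
    qed
    finally show "0 \<le> (fdiff ^^ (2*j)) (\<lambda>k. \<phi> (2 * (real k / real n) - 1)) l" .
  qed
  have cb: "\<bar>coeff (p n) j\<bar> \<le> 2 * M * 2 ^ j" "i \<ge> 1 \<Longrightarrow> 0 \<le> coeff (p n) (2*i) \<and> coeff (p n) (2*i) \<le> 2 * M"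
    "\<bar>coeff (p n) 0\<bar> \<le> M" if n: "n \<ge> 1" for n i j
    using even_convex_coeff_bounds[of "p n" M, OF pos[OF _ _ n] pb[OF _ n]] by blast+
  have conv: "(\<lambda>n. poly (p n) t) \<longlonglongrightarrow> \<phi> t" if t: "t \<in> {-1..1}" for t
  proof (rule LIMSEQ_I)
    fix e :: real assume "e > 0"
    have "continuous_on {0..1} (\<lambda>x. \<phi> (2 * x - 1))"
      by (rule continuous_on_compose2[OF kraus_continuous[OF k M]]) (auto intro!: continuous_intros)
    then obtain N where N: "\<And>n x. N \<le> n \<Longrightarrow> x \<in> {0..1} \<Longrightarrow>
        \<bar>\<phi> (2 * x - 1) - (\<Sum>k\<le>n. \<phi> (2 * (real k / real n) - 1) * Bernstein n k x)\<bar> < e"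
      using Bernstein_Weierstrass[of "\<lambda>x. \<phi> (2 * x - 1)" e] \<open>e > 0\<close> by auto
    have "2 * ((1 + t) / 2) - 1 = t" by (simp add: field_simps)
    then show "\<exists>N. \<forall>n\<ge>N. norm (poly (p n) t - \<phi> t) < e"
      using N[of _ "(1 + t) / 2"] t unfolding p_def poly_bern
      by (intro exI[of _ N]) (auto simp: abs_minus_commute)
  qed
  have psums: "(\<lambda>j. coeff (p n) j * t ^ j) sums poly (p n) t" for n t
    using sums_finite[of "{..degree (p n)}" "\<lambda>j. coeff (p n) j * t ^ j"]
    by (simp add: poly_altdef coeff_eq_0)
  have Cau: "Cauchy (\<lambda>n. coeff (p n) m)" for m
  proof (rule Cauchy_of_approx)
    fix d :: real assume d: "d > 0"
    define K where "K = 2 * M * (2 * (8 * real (Suc m)) ^ Suc m)"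
    define e where "e = min (1 / (4 * real (Suc m))) (d / (K + 1))"
    have K: "K \<ge> 0" using M0 by (simp add: K_def)
    have e: "0 < e" "4 * real (Suc m) * e \<le> 1"
    proof -
      show "0 < e" using d K by (simp add: e_def)
      have "4 * real (Suc m) * e \<le> 4 * real (Suc m) * (1 / (4 * real (Suc m)))"
        by (intro mult_left_mono) (auto simp: e_def)
      then show "4 * real (Suc m) * e \<le> 1" by simp
    qed
    have "K * e \<le> K * (d / (K + 1))" using K by (intro mult_left_mono) (auto simp: e_def)
    also have "\<dots> \<le> d" using K d by (simp add: field_simps)
    finally have Ke: "K * e \<le> d" .
    define y where "y n = (\<Sum>i\<le>m. (-1) ^ (m - i) * real (m choose i) * poly (p n) (real i * e)) / e ^ m / fact m" for n
    have ie: "real i * e \<in> {-1..1}" if "i \<le> m" for i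
    proof -
      have "real i * e \<le> real (Suc m) * e" using that e by (intro mult_right_mono) auto
      moreover have "4 * (real (Suc m) * e) \<le> 1" using e(2) by (simp only: mult.assoc)
      moreover have "0 \<le> real (Suc m) * e" using e(1) by simp
      moreover have "real i * e \<ge> 0" using e by simp
      ultimately show ?thesis unfolding atLeastAtMost_iff by linarith
    qed
    have "convergent y"
      unfolding convergent_def y_def
      by (intro exI) (rule tendsto_intros conv ie | use e in simp)+
    then have "Cauchy y" by (rule convergent_Cauchy)
    moreover have "dist (coeff (p n) m) (y n) \<le> d" if n: "n \<ge> 1" for n
    proof -
      have "\<bar>(\<Sum>i\<le>m. (-1) ^ (m - i) * real (m choose i) * poly (p n) (real i * e)) / e ^ m - fact m * coeff (p n) m\<bar> \<le> K * e"
        unfolding K_def by (rule finite_difference_real[OF _ e]) (use cb(1)[OF n] psums in auto)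
      also have "(\<Sum>i\<le>m. (-1) ^ (m - i) * real (m choose i) * poly (p n) (real i * e)) / e ^ m - fact m * coeff (p n) m
          = fact m * (y n - coeff (p n) m)" by (simp add: y_def field_simps)
      finally have "fact m * \<bar>y n - coeff (p n) m\<bar> \<le> d" using Ke by (simp add: abs_mult)
      moreover have "1 * \<bar>y n - coeff (p n) m\<bar> \<le> fact m * \<bar>y n - coeff (p n) m\<bar>"
        by (intro mult_right_mono) (auto simp: fact_ge_1)
      ultimately show ?thesis by (simp add: dist_real_def abs_minus_commute)
    qed
    ultimately show "\<exists>y. Cauchy y \<and> (\<exists>N. \<forall>n\<ge>N. dist (coeff (p n) m) (y n) \<le> d)" by blast
  qed
  define a where "a m = lim (\<lambda>n. coeff (p n) m)" for m
  have a: "(\<lambda>n. coeff (p n) m) \<longlonglongrightarrow> a m" for m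
    using Cau[of m] unfolding a_def by (simp add: Cauchy_convergent_iff convergent_LIMSEQ_iff)
  have a': "(\<lambda>n. \<bar>coeff (p n) m\<bar>) \<longlonglongrightarrow> \<bar>a m\<bar>" for m by (intro tendsto_intros a)
  have 1: "\<bar>a j\<bar> \<le> 2 * M * 2 ^ j" for j
    by (rule LIMSEQ_le_const2[OF a']) (use cb(1) in blast)
  have 2: "\<bar>a 0\<bar> \<le> M" by (rule LIMSEQ_le_const2[OF a']) (use cb(3) in blast)
  have 3: "0 \<le> a (2*j) \<and> a (2*j) \<le> 2 * M" if "j \<ge> 1" for j
    using LIMSEQ_le_const[OF a, of 0 "2*j"] LIMSEQ_le_const2[OF a, of "2*j" "2*M"] cb(2) that by blast
  have 4: "(\<lambda>j. a j * t ^ j) sums \<phi> t" if t: "\<bar>t\<bar> \<le> 1/4" for t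
  proof -
    have tn: "norm (coeff (p n) j * t ^ j) \<le> 2 * M * (1/2) ^ j" if "n \<ge> 1" for n j
    proof -
      have "\<bar>coeff (p n) j\<bar> * \<bar>t\<bar> ^ j \<le> (2 * M * 2 ^ j) * (1/4) ^ j"
        using M0 t cb(1)[OF that] by (intro mult_mono power_mono) auto
      also have "\<dots> = 2 * M * (1/2) ^ j" by (simp only: mult.assoc flip: power_mult_distrib) simp
      finally show ?thesis by (simp add: abs_mult power_abs)
    qed
    have ev: "eventually (\<lambda>(j,n). norm (coeff (p n) j * t ^ j) \<le> 2 * M * (1/2) ^ j) (at_top \<times>\<^sub>F sequentially)"
      unfolding eventually_prod_filter
      by (intro exI[of _ "\<lambda>_. True"] exI[of _ "\<lambda>n. n \<ge> 1"] conjI) (use tn in \<open>auto intro: eventually_ge_at_top\<close>)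
    have sm: "summable (\<lambda>j. 2 * M * (1/2::real) ^ j)" by (intro summable_mult summable_geometric) simp
    have T: "summable (\<lambda>j. norm (a j * t ^ j)) \<and>
       (\<lambda>n. \<Sum>j. coeff (p n) j * t ^ j) \<longlonglongrightarrow> (\<Sum>j. a j * t ^ j)"
      using tannerys_theorem[of "\<lambda>j n. coeff (p n) j * t ^ j" "\<lambda>j. a j * t ^ j" sequentially,
          OF tendsto_mult_right[OF a] ev sm] by simp
    have "(\<lambda>n. \<Sum>j. coeff (p n) j * t ^ j) = (\<lambda>n. poly (p n) t)"
      using psums by (auto simp: sums_iff)
    then have "(\<lambda>n. poly (p n) t) \<longlonglongrightarrow> (\<Sum>j. a j * t ^ j)" using T by (simp only:)
    moreover have "t \<in> {-1..1}" using t by auto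
    ultimately have "(\<Sum>j. a j * t ^ j) = \<phi> t" using LIMSEQ_unique conv by blast
    moreover have "summable (\<lambda>j. a j * t ^ j)" by (rule summable_norm_cancel) (use T in blast)
    ultimately show ?thesis by (simp add: sums_iff)
  qed
  show ?thesis using 1 2 3 4 by blast
qed

subsection \<open>The moment functional\<close>

definition moment :: "(nat \<Rightarrow> real) \<Rightarrow> real poly \<Rightarrow> real" where
  "moment m p = (\<Sum>k\<le>degree p. coeff p k * m k)"

lemma moment_eq: "degree p \<le> n \<Longrightarrow> moment m p = (\<Sum>k\<le>n. coeff p k * m k)"
  unfolding moment_def by (rule sum.mono_neutral_left) (auto simp: coeff_eq_0)

lemma moment_add: "moment m (p + q) = moment m p + moment m q"
proof -
  let ?n = "max (degree p) (degree q)"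
  have "moment m (p + q) = (\<Sum>k\<le>?n. coeff (p + q) k * m k)"
    by (rule moment_eq) (simp add: degree_add_le)
  then show ?thesis by (simp add: moment_eq[of p ?n] moment_eq[of q ?n] distrib_right sum.distrib)
qed

lemma moment_smult: "moment m (smult c p) = c * moment m p"
  using moment_eq[of "smult c p" "degree p" m] by (simp add: moment_def sum_distrib_left mult.assoc degree_smult_le)

lemma moment_diff: "moment m (p - q) = moment m p - moment m q"
proof -
  have eq: "p - q = p + smult (-1) q" by simp
  show ?thesis unfolding eq moment_add moment_smult by simp
qed

lemma moment_sum: "moment m (\<Sum>i\<in>I. g i) = (\<Sum>i\<in>I. moment m (g i))"
  by (induction I rule: infinite_finite_induct) (simp_all add: moment_add, simp_all add: moment_def)

lemma moment_monom: "moment m (monom c k) = c * m k"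
proof -
  have "moment m (monom c k) = (\<Sum>j\<le>k. coeff (monom c k) j * m j)"
    by (rule moment_eq) (rule degree_monom_le)
  also have "\<dots> = (\<Sum>j\<le>k. if j = k then c * m k else 0)" by (intro sum.cong) auto
  finally show ?thesis by simp
qed

lemma moment_one: "moment m 1 = m 0"
  by (simp add: moment_def)

lemma quadratic_nonneg_discrim:
  fixes a b c :: real
  assumes "\<And>s. a + 2 * s * b + s\<^sup>2 * c \<ge> 0" "c \<ge> 0"
  shows "b\<^sup>2 \<le> a * c"
proof (cases "c = 0")
  case True
  have "b = 0"
  proof (rule ccontr)
    assume "b \<noteq> 0"
    then show False using assms(1)[of "-(a+1)/(2*b)"] True by (simp add: field_simps)
  qed
  then show ?thesis using True by simp
next
  case False
  then have "c > 0" using assms(2) by simp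
  then show ?thesis using assms(1)[of "- b / c"] by (simp add: field_simps power2_eq_square)
qed

text \<open>Once a log-convex sequence increases it grows at least geometrically.\<close>

lemma log_convex_bounded_le:
  fixes s :: "nat \<Rightarrow> real"
  assumes "\<And>j. s j \<ge> 0" "\<And>j. (s (Suc j))\<^sup>2 \<le> s j * s (Suc (Suc j))" "\<And>j. s j \<le> K"
  shows "s 1 \<le> s 0"
proof (rule ccontr)
  assume "\<not> s 1 \<le> s 0"
  then have lt: "s 0 < s 1" by simp
  have s0: "s 0 > 0"
  proof (rule ccontr)
    assume "\<not> s 0 > 0"
    then have "s 0 = 0" using assms(1)[of 0] by simp
    then show False using assms(2)[of 0] lt by simp
  qed
  define r where "r = s 1 / s 0"
  have r: "r > 1" using lt s0 by (simp add: r_def)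
  have step: "s j > 0 \<and> s (Suc j) \<ge> r * s j" for j
  proof (induction j)
    case 0 then show ?case using s0 by (simp add: r_def)
  next
    case (Suc j)
    have "0 < r * s j" using Suc r by (intro mult_pos_pos) auto
    then have pos: "s (Suc j) > 0" using Suc by linarith
    have "r * s j * s (Suc j) \<le> s (Suc j) * s (Suc j)" using Suc pos by (intro mult_right_mono) auto
    also have "\<dots> \<le> s j * s (Suc (Suc j))" using assms(2)[of j] by (simp add: power2_eq_square)
    finally have "s j * (r * s (Suc j)) \<le> s j * s (Suc (Suc j))" by (simp add: mult_ac)
    then show ?case using Suc pos by simp
  qed
  have grow: "s j \<ge> r ^ j * s 0" for j
  proof (induction j)
    case (Suc j)
    have "r ^ Suc j * s 0 = r * (r ^ j * s 0)" by simp
    also have "\<dots> \<le> r * s j" using Suc r by (intro mult_left_mono) auto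
    finally show ?case using step[of j] by simp
  qed simp
  obtain n where "K / s 0 < r ^ n" using real_arch_pow[OF r] by blast
  then have "K < r ^ n * s 0" using s0 by (simp add: field_simps)
  then show False using grow[of n] assms(3)[of n] by linarith
qed

text \<open>Moment sequences of measures on \<open>[-1, 1]\<close>, characterised by positivity of the Hankel form and
  boundedness of the even moments. The measure itself is never constructed, only the functional
  \<open>p \<mapsto> \<integral> p\<close> is used.\<close>

locale moment_sequence =
  fixes m :: "nat \<Rightarrow> real" and C :: real
  assumes square: "\<And>q. moment m (q * q) \<ge> 0" and even_le: "\<And>k. m (2*k) \<le> C"
begin

lemma cauchy_schwarz: "(moment m (p * q))\<^sup>2 \<le> moment m (p * p) * moment m (q * q)"
proof (rule quadratic_nonneg_discrim)
  fix s
  have "(p + smult s q) * (p + smult s q) = p * p + (smult (2 * s) (p * q) + smult (s\<^sup>2) (q * q))"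
  proof -
    have eq: "smult (2 * s) (p * q) = smult s (p * q) + smult s (q * p)"
      unfolding mult_2 smult_add_left by (simp add: mult.commute)
    show ?thesis unfolding eq by (simp add: distrib_left distrib_right power2_eq_square add.assoc smult_add_right)
  qed
  then show "0 \<le> moment m (p * p) + 2 * s * moment m (p * q) + s\<^sup>2 * moment m (q * q)"
    using square[of "p + smult s q"] by (simp add: moment_add moment_smult)
qed (rule square)

lemma moment_power_square: "moment m (monom 1 k * monom 1 k) = m (2*k)"
  by (simp add: mult_monom moment_monom mult_2)

lemma even_nonneg: "m (2*k) \<ge> 0"
  using square[of "monom 1 k"] by (simp add: moment_power_square)

lemma abs_le: "\<bar>m k\<bar> \<le> C"
proof (cases "even k")
  case True
  then obtain j where "k = 2 * j" by (rule evenE)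
  then show ?thesis using even_nonneg[of j] even_le[of j] by simp
next
  case False
  then obtain j where k: "k = 2 * j + 1" by (rule oddE)
  have "moment m (monom 1 j * monom 1 (Suc j)) = m k"
    by (simp add: mult_monom moment_monom mult_2 k)
  then have "(m k)\<^sup>2 \<le> m (2*j) * m (2 * Suc j)"
    using cauchy_schwarz[of "monom 1 j" "monom 1 (Suc j)"] by (simp only: moment_power_square)
  also have "\<dots> \<le> C * C"
    using even_le[of j] even_le[of "Suc j"] even_nonneg[of j] even_nonneg[of "Suc j"]
    by (intro mult_mono) linarith+
  finally have "\<bar>m k\<bar>\<^sup>2 \<le> C\<^sup>2" by (simp add: power2_eq_square)
  moreover have "C \<ge> 0" using even_le[of 0] even_nonneg[of 0] by linarith
  ultimately show ?thesis using power2_le_imp_le by blast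
qed

text \<open>The measure behind the moments lives on \<open>[-1, 1]\<close>: a larger support would make the
  even moments of \<open>q\<^sup>2\<close> grow geometrically.\<close>

lemma contraction: "moment m (monom 1 2 * (q * q)) \<le> moment m (q * q)"
proof -
  define s where "s j = moment m ((monom 1 j * q) * (monom 1 j * q))" for j
  have "s 1 \<le> s 0"
  proof (rule log_convex_bounded_le)
    show "s j \<ge> 0" for j unfolding s_def by (rule square)
    show "(s (Suc j))\<^sup>2 \<le> s j * s (Suc (Suc j))" for j
    proof -
      have "(monom 1 (Suc j) * q) * (monom 1 (Suc j) * q) = (monom 1 j * q) * (monom 1 (Suc (Suc j)) * q)"
      proof -
        have "monom 1 (Suc j) * monom 1 (Suc j) = monom (1::real) j * monom 1 (Suc (Suc j))"
          by (simp add: mult_monom)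
        moreover have "(x * q) * (y * q) = (x * y) * (q * q)" for x y by (simp only: mult_ac)
        ultimately show ?thesis by (simp only:)
      qed
      then show ?thesis unfolding s_def using cauchy_schwarz by metis
    qed
    fix j
    let ?Q = "q * q"
    have "(monom 1 j * q) * (monom 1 j * q) = (monom 1 j * monom 1 j) * ?Q" by (simp only: mult_ac)
    also have "monom 1 j * monom 1 j = monom (1::real) (2*j)" by (simp add: mult_monom mult_2)
    also have "monom 1 (2*j) * ?Q = (\<Sum>l\<le>degree ?Q. monom (coeff ?Q l) (2*j + l))"
    proof -
      have "monom 1 (2*j) * ?Q = monom 1 (2*j) * (\<Sum>l\<le>degree ?Q. monom (coeff ?Q l) l)"
        by (simp only: poly_as_sum_of_monoms)
      then show ?thesis by (simp add: sum_distrib_left mult_monom)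
    qed
    finally have eq: "s j = moment m (\<Sum>l\<le>degree ?Q. monom (coeff ?Q l) (2*j + l))" by (simp add: s_def)
    have "s j = (\<Sum>l\<le>degree ?Q. coeff ?Q l * m (2*j + l))" by (simp add: eq moment_sum moment_monom)
    also have "\<dots> \<le> (\<Sum>l\<le>degree ?Q. \<bar>coeff ?Q l\<bar> * C)"
      by (rule sum_mono, rule order_trans[OF abs_ge_self]) (simp add: abs_mult mult_left_mono abs_le)
    finally show "s j \<le> (\<Sum>l\<le>degree ?Q. \<bar>coeff ?Q l\<bar> * C)" .
  qed
  moreover have "s 0 = moment m (q * q)" by (simp add: s_def)
  moreover have "s 1 = moment m (monom 1 2 * (q * q))"
  proof -
    have "(monom 1 1 * q) * (monom 1 1 * q) = (monom 1 1 * monom 1 1) * (q * q)" by (simp only: mult_ac)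
    then show ?thesis unfolding s_def by (simp only:) (simp add: mult_monom numeral_2_eq_2)
  qed
  ultimately show ?thesis by simp
qed

end

subsection \<open>Chebyshev polynomials\<close>

text \<open>The recursion is the addition theorem for \<open>cos (k x)\<close> and \<open>sin (k x) / sin x\<close> in terms of
  \<open>cos x\<close>.\<close>

primrec cheb :: "nat \<Rightarrow> real poly \<times> real poly" where
  "cheb 0 = (1, 0)"
| "cheb (Suc k) = (monom 1 1 * fst (cheb k) - (1 - monom 1 2) * snd (cheb k),
     monom 1 1 * snd (cheb k) + fst (cheb k))"

abbreviation "chebT k \<equiv> fst (cheb k)"
abbreviation "chebV k \<equiv> snd (cheb k)"

lemma monom_1_2: "monom (1::real) 2 = monom 1 1 * monom 1 1"
  by (simp add: mult_monom numeral_2_eq_2)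

lemma cheb_pell: "chebT k * chebT k + (1 - monom 1 2) * (chebV k * chebV k) = 1"
proof (induction k)
  case (Suc k)
  have "(x * t - (1 - x * x) * v) * (x * t - (1 - x * x) * v) + (1 - x * x) * ((x * v + t) * (x * v + t))
      = t * t + (1 - x * x) * (v * v)" for x t v :: "real poly" by (simp add: algebra_simps)
  then show ?case using Suc by (simp add: monom_1_2)
qed simp

lemma cheb_rec: "chebT (Suc (Suc k)) = smult 2 (monom 1 1 * chebT (Suc k)) - chebT k"
proof -
  have "x * (x * t - (1 - x * x) * v) - (1 - x * x) * (x * v + t)
     = (x * (x * t - (1 - x * x) * v)) + (x * (x * t - (1 - x * x) * v)) - t" for x t v :: "real poly" by (simp add: algebra_simps)
  moreover have "smult 2 p = p + p" for p :: "real poly" using smult_add_left[of 1 1 p] by simp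
  ultimately show ?thesis by (simp only: cheb.simps fst_conv snd_conv monom_1_2)
qed

context moment_sequence begin

definition tau :: "nat \<Rightarrow> nat \<Rightarrow> real" where
  "tau i k = moment m (monom 1 i * chebT k)"

lemma tau_0: "tau i 0 = m i" by (simp add: tau_def moment_monom)

lemma tau_1: "tau i (Suc 0) = m (Suc i)" by (simp add: tau_def mult_monom moment_monom)

lemma tau_rec: "tau i (Suc (Suc k)) = 2 * tau (Suc i) (Suc k) - tau i k"
proof -
  have "monom 1 i * chebT (Suc (Suc k)) = smult 2 (monom 1 (Suc i) * chebT (Suc k)) - monom 1 i * chebT k"
    unfolding cheb_rec by (simp add: right_diff_distrib mult_monom flip: mult.assoc)
  then show ?thesis unfolding tau_def by (simp only: moment_diff moment_smult)
qed

text \<open>By Cauchy--Schwarz it suffices to bound \<open>X\<^sup>2\<^sup>i\<close> and \<open>T\<^sub>k\<^sup>2\<close>, and Pell's equation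
  \<open>T\<^sub>k\<^sup>2 + (1 - X\<^sup>2) V\<^sub>k\<^sup>2 = 1\<close> leaves out a term that is nonnegative by \<open>contraction\<close>.\<close>

lemma tau_bound: "\<bar>tau i k\<bar> \<le> m 0"
proof -
  have m0: "m 0 \<ge> 0" using even_nonneg[of 0] by simp
  have "m (2*i) \<le> m 0"
  proof (induction i)
    case (Suc i)
    have "monom 1 2 * (monom 1 i * monom 1 i) = monom (1::real) (Suc i) * monom 1 (Suc i)"
      by (simp add: mult_monom)
    then show ?case using contraction[of "monom 1 i"] Suc by (simp add: moment_power_square)
  qed simp
  moreover have "moment m (chebT k * chebT k) \<le> m 0"
  proof -
    have "moment m (chebT k * chebT k) + moment m ((1 - monom 1 2) * (chebV k * chebV k)) = m 0"
      using cheb_pell[of k] moment_one[of m] by (metis moment_add)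
    moreover have "moment m ((1 - monom 1 2) * (chebV k * chebV k)) \<ge> 0"
      using contraction[of "chebV k"] by (simp add: left_diff_distrib moment_diff)
    ultimately show ?thesis by simp
  qed
  ultimately have "moment m (monom 1 i * monom 1 i) * moment m (chebT k * chebT k) \<le> m 0 * m 0"
    using square[of "chebT k"] even_nonneg[of i] m0 by (intro mult_mono) (simp_all add: moment_power_square)
  then have "\<bar>tau i k\<bar>\<^sup>2 \<le> (m 0)\<^sup>2"
    using cauchy_schwarz[of "monom 1 i" "chebT k"] by (simp add: tau_def power2_eq_square)
  then show ?thesis using m0 power2_le_imp_le by blast
qed

definition gen :: "nat \<Rightarrow> complex \<Rightarrow> complex" where
  "gen i w = (\<Sum>k. of_real (tau i k) * w ^ k)"

lemma gen_sums: "cmod w < 1 \<Longrightarrow> (\<lambda>k. of_real (tau i k) * w ^ k) sums gen i w"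
  and gen_bound: "cmod w < 1 \<Longrightarrow> cmod (gen i w) \<le> m 0 / (1 - cmod w)"
proof -
  assume w: "cmod w < 1"
  have geo: "(\<lambda>k. m 0 * cmod w ^ k) sums (m 0 / (1 - cmod w))"
    using sums_mult[OF geometric_sums[of "cmod w"], of "m 0"] w by simp
  have le: "norm (of_real (tau i k) * w ^ k) \<le> m 0 * cmod w ^ k" for k
    using tau_bound[of i k] by (simp add: norm_mult norm_power mult_right_mono)
  have sn: "summable (\<lambda>k. norm (of_real (tau i k) * w ^ k))"
    by (rule summable_comparison_test'[OF sums_summable[OF geo], of 0]) (use le in simp)
  show "(\<lambda>k. of_real (tau i k) * w ^ k) sums gen i w"
    unfolding gen_def by (rule summable_sums[OF summable_norm_cancel[OF sn]])
  show "cmod (gen i w) \<le> m 0 / (1 - cmod w)"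
    unfolding gen_def using order_trans[OF summable_norm[OF sn] suminf_le[OF le sn sums_summable[OF geo]]]
      sums_unique[OF geo] by simp
qed

lemma gen_holomorphic: "gen i holomorphic_on ball 0 1"
proof (rule power_series_holomorphic)
  fix w :: complex assume "w \<in> ball 0 1"
  then have "cmod w < 1" by simp
  from gen_sums[OF this] show "(\<lambda>k. of_real (tau i k) * (w - 0) ^ k) sums gen i w" by simp
qed

lemma gen_rec:
  assumes w: "cmod w < 1"
  shows "(1 + w\<^sup>2) * gen i w - 2 * w * gen (Suc i) w = of_real (m i) - w * of_real (m (Suc i))"
proof -
  let ?t = "\<lambda>i k. complex_of_real (tau i k)"
  have A: "(\<lambda>k. ?t i (Suc (Suc k)) * w ^ Suc (Suc k)) sums (gen i w - of_real (m i) - of_real (m (Suc i)) * w)"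
    using sums_Suc_iff[of "\<lambda>k. ?t i (Suc k) * w ^ Suc k" "gen i w - of_real (m i) - of_real (m (Suc i)) * w"]
      sums_Suc_iff[of "\<lambda>k. ?t i k * w ^ k" "gen i w - of_real (m i)"] gen_sums[OF w, of i]
    by (simp add: tau_0 tau_1)
  have "(\<lambda>k. ?t (Suc i) (Suc k) * w ^ Suc k) sums (gen (Suc i) w - of_real (m (Suc i)))"
    using sums_Suc_iff[of "\<lambda>k. ?t (Suc i) k * w ^ k" "gen (Suc i) w - of_real (m (Suc i))"] gen_sums[OF w, of "Suc i"]
    by (simp add: tau_0)
  from sums_diff[OF sums_mult[OF this, of "2 * w"] sums_mult[OF gen_sums[OF w, of i], of "w\<^sup>2"]]
  have "(\<lambda>k. 2 * w * (?t (Suc i) (Suc k) * w ^ Suc k) - w\<^sup>2 * (?t i k * w ^ k))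
     sums (2 * w * (gen (Suc i) w - of_real (m (Suc i))) - w\<^sup>2 * gen i w)" .
  moreover have "2 * w * (?t (Suc i) (Suc k) * w ^ Suc k) - w\<^sup>2 * (?t i k * w ^ k)
      = ?t i (Suc (Suc k)) * w ^ Suc (Suc k)" for k
    by (simp add: tau_rec algebra_simps power2_eq_square)
  ultimately have "gen i w - of_real (m i) - of_real (m (Suc i)) * w
     = 2 * w * (gen (Suc i) w - of_real (m (Suc i))) - w\<^sup>2 * gen i w"
    using sums_unique2[OF A] by simp
  then show ?thesis by (simp add: algebra_simps)
qed

text \<open>The Cauchy transform \<open>\<integral> x\<^sup>i / (1 - x z) d\<mu>(x)\<close> at \<open>z = 2w / (1 + w\<^sup>2)\<close>, expanded by
  \<open>(1 - w\<^sup>2) / (1 - 2xw + w\<^sup>2) = 1 + 2 \<Sum>\<^sub>k T\<^sub>k(x) w\<^sup>k\<close>, the sum being over \<open>k \<ge> 1\<close>.\<close>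

definition stieltjes :: "nat \<Rightarrow> complex \<Rightarrow> complex" where
  "stieltjes i w = (1 + w\<^sup>2) / (1 - w\<^sup>2) * (2 * gen i w - of_real (m i))"

lemma one_pm_square_bounds:
  assumes "cmod w < 1"
  shows "1 - cmod w \<le> cmod (1 + w\<^sup>2)" "1 - cmod w \<le> cmod (1 - w\<^sup>2)" "1 + w\<^sup>2 \<noteq> 0" "1 - w\<^sup>2 \<noteq> 0"
proof -
  have "(cmod w)\<^sup>2 \<le> cmod w" using assms by (simp add: power2_eq_square mult_left_le)
  then show 1: "1 - cmod w \<le> cmod (1 + w\<^sup>2)" and 2: "1 - cmod w \<le> cmod (1 - w\<^sup>2)"
    using norm_triangle_ineq2[of 1 "- w\<^sup>2"] norm_triangle_ineq2[of 1 "w\<^sup>2"] by (simp_all add: norm_power)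
  show "1 + w\<^sup>2 \<noteq> 0" "1 - w\<^sup>2 \<noteq> 0" using 1 2 assms by auto
qed

lemma stieltjes_rec:
  assumes w: "cmod w < 1"
  shows "stieltjes i w = of_real (m i) + 2 * w / (1 + w\<^sup>2) * stieltjes (Suc i) w"
proof -
  note nz = one_pm_square_bounds(3,4)[OF w]
  have "(1 + w\<^sup>2) * (2 * gen i w - of_real (m i)) = (1 - w\<^sup>2) * of_real (m i) + 2 * w * (2 * gen (Suc i) w - of_real (m (Suc i)))"
  proof -
    let ?g = "gen i w" and ?h = "gen (Suc i) w"
    have "(1 + w\<^sup>2) * (2 * ?g - of_real (m i)) - ((1 - w\<^sup>2) * of_real (m i) + 2 * w * (2 * ?h - of_real (m (Suc i))))
      = 2 * (((1 + w\<^sup>2) * ?g - 2 * w * ?h) - (of_real (m i) - w * of_real (m (Suc i))))"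
      by (simp add: algebra_simps)
    then show ?thesis unfolding gen_rec[OF w, of i] by simp
  qed
  moreover have "a / d * x = b + c / a * (a / d * y)" if "a * x = d * b + c * y" "a \<noteq> 0" "d \<noteq> 0" for a b c d x y :: complex
  proof -
    have "a / d * x = (d * b + c * y) / d" by (simp add: that(1)[symmetric])
    also have "\<dots> = b + c / a * (a / d * y)" using that(2,3) by (simp add: add_divide_distrib)
    finally show ?thesis .
  qed
  ultimately show ?thesis using nz unfolding stieltjes_def by blast
qed

lemma stieltjes_bound:
  assumes w: "cmod w < 1"
  shows "cmod (stieltjes i w) \<le> 6 * C / (1 - cmod w)\<^sup>2"
proof -
  have C: "m 0 \<le> C" "C \<ge> 0" using abs_le[of 0] by auto
  have 1: "cmod (2 * gen i w - of_real (m i)) \<le> 3 * C / (1 - cmod w)"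
  proof -
    have "cmod (2 * gen i w - of_real (m i)) \<le> 2 * cmod (gen i w) + \<bar>m i\<bar>"
      using norm_triangle_ineq4[of "2 * gen i w" "of_real (m i)"] by (simp add: norm_mult)
    also have "\<dots> \<le> 2 * (C / (1 - cmod w)) + C / (1 - cmod w)"
    proof (intro add_mono mult_left_mono)
      show "cmod (gen i w) \<le> C / (1 - cmod w)"
        using gen_bound[OF w, of i] C w by (meson divide_right_mono diff_ge_0_iff_ge less_imp_le order_trans)
      have "C \<le> C / (1 - cmod w)" using C w by (simp add: field_simps mult_left_le)
      then show "\<bar>m i\<bar> \<le> C / (1 - cmod w)" using abs_le[of i] by linarith
    qed simp
    finally show ?thesis by simp
  qed
  have "cmod (1 + w\<^sup>2) \<le> 2" using norm_triangle_ineq[of 1 "w\<^sup>2"] w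
    by (simp add: norm_power) (smt (verit) power_le_one norm_ge_zero)
  then have 2: "cmod ((1 + w\<^sup>2) / (1 - w\<^sup>2)) \<le> 2 / (1 - cmod w)"
    unfolding norm_divide using one_pm_square_bounds[OF w] w by (intro frac_le) auto
  have "cmod (stieltjes i w) \<le> (2 / (1 - cmod w)) * (3 * C / (1 - cmod w))"
    unfolding stieltjes_def norm_mult using 1 2 w by (intro mult_mono) auto
  then show ?thesis by (simp add: power2_eq_square)
qed

text \<open>Iterating the recursion \<open>n\<close> times produces the partial sum of the series with remainder
  \<open>z\<^sup>n stieltjes n w\<close>.\<close>

lemma stieltjes_sums:
  assumes w: "cmod w < 1" and p: "cmod (2 * w / (1 + w\<^sup>2)) < 1"
  shows "(\<lambda>k. of_real (m k) * (2 * w / (1 + w\<^sup>2)) ^ k) sums stieltjes 0 w"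
proof -
  define z where "z = 2 * w / (1 + w\<^sup>2)"
  have z: "cmod z < 1" using p by (simp only: z_def)
  have eq: "(\<Sum>k<n. of_real (m k) * z ^ k) = stieltjes 0 w - z ^ n * stieltjes n w" for n
  proof (induction n)
    case (Suc n)
    then show ?case using stieltjes_rec[OF w, of n, folded z_def] by (simp add: algebra_simps)
  qed simp
  have "(\<lambda>n. z ^ n * stieltjes n w) \<longlonglongrightarrow> 0"
  proof (rule tendsto_norm_zero_cancel, rule tendsto_sandwich[where f = "\<lambda>_. 0"])
    show "(\<lambda>n. cmod z ^ n * (6 * C / (1 - cmod w)\<^sup>2)) \<longlonglongrightarrow> 0"
      by (intro tendsto_mult_left_zero LIMSEQ_power_zero) (use z in simp)
    show "\<forall>\<^sub>F n in sequentially. norm (z ^ n * stieltjes n w) \<le> cmod z ^ n * (6 * C / (1 - cmod w)\<^sup>2)"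
      using mult_left_mono[OF stieltjes_bound[OF w]] by (intro always_eventually allI) (simp add: norm_mult norm_power)
  qed auto
  then have "(\<lambda>n. stieltjes 0 w - z ^ n * stieltjes n w) \<longlonglongrightarrow> stieltjes 0 w - 0"
    by (intro tendsto_diff tendsto_const)
  then show ?thesis unfolding sums_def z_def[symmetric] eq by simp
qed

lemma stieltjes_holomorphic: "stieltjes i holomorphic_on ball 0 1"
proof -
  have "1 - w\<^sup>2 \<noteq> 0" if "w \<in> ball 0 1" for w :: complex
    using one_pm_square_bounds(4)[of w] that by simp
  then show ?thesis
    unfolding stieltjes_def
    by (intro holomorphic_on_mult holomorphic_on_divide holomorphic_on_add holomorphic_on_diff
        holomorphic_on_power holomorphic_on_const holomorphic_on_ident gen_holomorphic) auto
qed

end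

subsection \<open>Continuation of a Kraus function to the disc\<close>

definition series_mult :: "real poly \<Rightarrow> (nat \<Rightarrow> real) \<Rightarrow> nat \<Rightarrow> real" where
  "series_mult p a j = (\<Sum>l\<le>j. coeff p l * a (j - l))"

lemma series_mult_sums:
  assumes a: "\<And>j. \<bar>a j\<bar> \<le> B * 2 ^ j" and s: "\<And>t. \<bar>t\<bar> \<le> 1/4 \<Longrightarrow> (\<lambda>j. a j * t ^ j) sums \<phi> t"
  shows "(\<exists>B'. \<forall>j. \<bar>series_mult p a j\<bar> \<le> B' * 2 ^ j) \<and>
    (\<forall>t. \<bar>t\<bar> \<le> 1/4 \<longrightarrow> (\<lambda>j. series_mult p a j * t ^ j) sums (poly p t * \<phi> t))"
proof (induction p)
  case 0
  then show ?case by (auto simp: series_mult_def intro!: exI[of _ 0])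
next
  case (pCons c p)
  obtain B' where B': "\<And>j. \<bar>series_mult p a j\<bar> \<le> B' * 2 ^ j" using pCons by blast
  have 0: "series_mult (pCons c p) a 0 = c * a 0" by (simp add: series_mult_def)
  have S: "series_mult (pCons c p) a (Suc j) = c * a (Suc j) + series_mult p a j" for j
    unfolding series_mult_def by (subst sum.atMost_Suc_shift) simp
  have B'0: "B' \<ge> 0" using order_trans[OF abs_ge_zero B'[of 0]] by simp
  have "\<bar>series_mult (pCons c p) a j\<bar> \<le> (\<bar>c\<bar> * B + B') * 2 ^ j" for j
  proof (cases j)
    case 0
    then show ?thesis using mult_left_mono[OF a[of 0], of "\<bar>c\<bar>"] B'0
      by (simp add: \<open>series_mult (pCons c p) a 0 = c * a 0\<close> abs_mult)
  next
    case (Suc i)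
    have "\<bar>series_mult (pCons c p) a j\<bar> \<le> \<bar>c\<bar> * \<bar>a j\<bar> + \<bar>series_mult p a i\<bar>"
      unfolding Suc S using abs_triangle_ineq[of "c * a (Suc i)" "series_mult p a i"] by (simp add: abs_mult)
    also have "\<dots> \<le> \<bar>c\<bar> * (B * 2 ^ j) + B' * 2 ^ i" by (intro add_mono mult_left_mono a B') simp
    also have "\<dots> \<le> \<bar>c\<bar> * (B * 2 ^ j) + B' * 2 ^ j" using B'0 Suc by (intro add_left_mono mult_left_mono) auto
    finally show ?thesis by (simp add: algebra_simps)
  qed
  moreover have "(\<lambda>j. series_mult (pCons c p) a j * t ^ j) sums (poly (pCons c p) t * \<phi> t)" if t: "\<bar>t\<bar> \<le> 1/4" for t
  proof -
    have "(\<lambda>j. c * (a j * t ^ j)) sums (c * \<phi> t)" by (rule sums_mult[OF s[OF t]])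
    then have 1: "(\<lambda>j. c * (a (Suc j) * t ^ Suc j)) sums (c * \<phi> t - c * a 0)"
      by (subst sums_Suc_iff[of "\<lambda>j. c * (a j * t ^ j)"]) simp
    have 2: "(\<lambda>j. t * (series_mult p a j * t ^ j)) sums (t * (poly p t * \<phi> t))"
      using pCons t by (intro sums_mult) blast
    have "(\<lambda>j. series_mult (pCons c p) a (Suc j) * t ^ Suc j) sums (c * \<phi> t - c * a 0 + t * (poly p t * \<phi> t))"
      using sums_add[OF 1 2] by (simp add: S algebra_simps)
    then have "(\<lambda>j. series_mult (pCons c p) a j * t ^ j) sums (c * \<phi> t - c * a 0 + t * (poly p t * \<phi> t) + series_mult (pCons c p) a 0 * t ^ 0)"
      by (rule sums_Suc)
    then show ?thesis by (simp add: 0 algebra_simps)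
  qed
  ultimately show ?case by blast
qed

text \<open>For the reversed polynomial \<open>P\<close> of \<open>q\<close> the coefficient of \<open>t\<^sup>2\<^sup>N\<close> in \<open>P\<^sup>2 \<phi>\<close>, where
  \<open>N = degree q + 1\<close>, is the moment of \<open>q\<^sup>2\<close> for the sequence shifted by two. Up to a factorial it is the
  limit of the nonnegative differences of order \<open>2N\<close>.\<close>

lemma kraus_moment_nonneg:
  assumes k: "kraus \<phi>" and a: "\<And>j. \<bar>a j\<bar> \<le> B * 2 ^ j"
    and s: "\<And>t. \<bar>t\<bar> \<le> 1/4 \<Longrightarrow> (\<lambda>j. a j * t ^ j) sums \<phi> t"
  shows "moment (\<lambda>j. a (Suc (Suc j))) (q * q) \<ge> 0"
proof (cases "q = 0")
  case False
  define d where "d = degree q"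
  define N where "N = Suc d"
  define P where "P = reflect_poly q"
  define c where "c = series_mult (P * P) a (2 * N)"
  have dP: "degree P < N" using degree_reflect_poly_le[of q] by (simp add: P_def N_def d_def)
  have PP: "P * P = reflect_poly (q * q)" by (simp add: P_def reflect_poly_mult)
  have dq: "degree (q * q) = 2 * d" using False by (simp add: degree_mult_eq d_def)
  have ceq: "c = moment (\<lambda>j. a (Suc (Suc j))) (q * q)"
  proof -
    have "c = (\<Sum>l\<le>2*d. coeff (P * P) l * a (2 * N - l))"
      unfolding c_def series_mult_def
      by (rule sum.mono_neutral_right) (auto simp: N_def PP coeff_reflect_poly dq)
    also have "\<dots> = (\<Sum>l\<le>2*d. coeff (q * q) l * a (Suc (Suc l)))"
      by (rule sum.reindex_bij_witness[of _ "\<lambda>l. 2 * d - l" "\<lambda>l. 2 * d - l"])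
         (auto simp: PP coeff_reflect_poly dq N_def Suc_diff_le)
    finally show ?thesis by (simp add: moment_def dq)
  qed
  obtain B' where B': "\<And>j. \<bar>series_mult (P * P) a j\<bar> \<le> B' * 2 ^ j"
    and sm: "\<And>t. \<bar>t\<bar> \<le> 1/4 \<Longrightarrow> (\<lambda>j. series_mult (P * P) a j * t ^ j) sums (poly (P * P) t * \<phi> t)"
    using series_mult_sums[of a B \<phi> "P * P", OF a s] by blast
  define K where "K = B' * (2 * (8 * real (Suc (2*N))) ^ Suc (2*N))"
  have K: "K \<ge> 0" using order_trans[OF abs_ge_zero B'[of 0]] by (simp add: K_def)
  have "- (fact (2*N) * c) \<le> 0"
  proof (rule field_le_epsilon)
    fix \<delta> :: real assume \<delta>: "\<delta> > 0"
    define e where "e = min (1 / (4 * real (Suc (2*N)))) (\<delta> / (K + 1))"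
    have e0: "0 < e" using \<delta> K by (simp add: e_def)
    have "4 * real (Suc (2*N)) * e \<le> 4 * real (Suc (2*N)) * (1 / (4 * real (Suc (2*N))))"
      by (intro mult_left_mono) (auto simp: e_def)
    then have e1: "4 * real (Suc (2*N)) * e \<le> 1" by simp
    have e2: "real i * e \<le> 1/4" if "i \<le> Suc (2*N)" for i
    proof -
      have "real i * e \<le> real (Suc (2*N)) * e" using that e0 by (intro mult_right_mono of_nat_mono) auto
      moreover have "4 * (real (Suc (2*N)) * e) \<le> 1" using e1 by (simp only: mult.assoc)
      ultimately show ?thesis by linarith
    qed
    have "K * e \<le> K * (\<delta> / (K + 1))" using K by (intro mult_left_mono) (auto simp: e_def)
    also have "\<dots> \<le> \<delta>" using K \<delta> by (simp add: field_simps)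
    finally have Ke: "K * e \<le> \<delta>" .
    define E where "E = (\<Sum>i\<le>2*N. (-1) ^ (2*N - i) * real (2*N choose i) * (poly (P * P) (real i * e) * \<phi> (real i * e)))"
    have "\<bar>E / e ^ (2*N) - fact (2*N) * c\<bar> \<le> K * e"
      unfolding K_def c_def E_def
    proof (rule finite_difference_real[OF B' e0 e1])
      fix i assume "i \<le> 2 * N"
      then have "\<bar>real i * e\<bar> \<le> 1/4" using e2[of i] e0 by simp
      then show "(\<lambda>j. series_mult (P * P) a j * (real i * e) ^ j) sums (poly (P * P) (real i * e) * \<phi> (real i * e))"
        by (rule sm)
    qed
    moreover have "E \<ge> 0"
    proof -
      have "0 \<le> (\<Sum>i\<le>2*N. (-1) ^ i * real (2*N choose i) * (poly (P \<circ>\<^sub>p [:0, e:]) (real i))\<^sup>2 * \<phi> (0 + real i * e))"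
      proof (rule krausD[OF k])
        show "degree (P \<circ>\<^sub>p [:0, e:]) < N" using dP e0 by (simp add: degree_pcompose)
        show "0 + real (2 * N) * e \<le> 2" using e2[of "2*N"] by simp
      qed (use e0 in auto)
      also have "\<dots> = E"
        unfolding E_def
        by (intro sum.cong refl) (auto simp: poly_pcompose power2_eq_square minus_one_power_iff mult.commute[of e])
      finally show ?thesis .
    qed
    then have "E / e ^ (2*N) \<ge> 0" using e0 by simp
    ultimately show "- (fact (2*N) * c) \<le> 0 + \<delta>" using Ke by linarith
  qed
  then have "c \<ge> 0" using mult_le_cancel_left_pos[of "fact (2*N)" 0 c] by simp
  then show ?thesis using ceq by simp
qed (simp add: moment_def)

text \<open>With the moments \<open>m\<^sub>j = a\<^sub>j\<^sub>+\<^sub>2\<close> the power series is \<open>a\<^sub>0 + a\<^sub>1 t + t\<^sup>2 \<Sum>\<^sub>j m\<^sub>j t\<^sup>j\<close>, and the last factor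
  is a Cauchy transform.\<close>

theorem kraus_disc:
  assumes k: "kraus \<phi>" and M: "\<And>t. t \<in> {-2..2} \<Longrightarrow> \<bar>\<phi> t\<bar> \<le> M"
  obtains h where "h holomorphic_on ball 0 1"
    "\<And>w. cmod w < 1 \<Longrightarrow> cmod (h w) \<le> 57 * M / (1 - cmod w) ^ 4"
    "\<And>w. \<bar>w\<bar> \<le> 1/8 \<Longrightarrow> h (complex_of_real w) = complex_of_real (\<phi> (2 * w / (1 + w\<^sup>2)))"
proof -
  obtain a where a: "\<And>j. \<bar>a j\<bar> \<le> 2 * M * 2 ^ j" "\<bar>a 0\<bar> \<le> M"
    "\<And>j. j \<ge> 1 \<Longrightarrow> 0 \<le> a (2*j) \<and> a (2*j) \<le> 2 * M"
    "\<And>t. \<bar>t\<bar> \<le> 1/4 \<Longrightarrow> (\<lambda>j. a j * t ^ j) sums \<phi> t"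
    using kraus_power_series[OF k M] by blast
  have M0: "M \<ge> 0" using a(2) by linarith
  define m where "m j = a (Suc (Suc j))" for j
  interpret moment_sequence m "2 * M"
  proof
    show "moment m (q * q) \<ge> 0" for q
      using kraus_moment_nonneg[OF k a(1) a(4)] by (simp add: m_def[abs_def])
    show "m (2 * j) \<le> 2 * M" for j using a(3)[of "Suc j"] by (simp add: m_def)
  qed
  define \<psi> where "\<psi> w = 2 * w / (1 + w\<^sup>2)" for w :: complex
  define h where "h w = of_real (a 0) + of_real (a 1) * \<psi> w + (\<psi> w)\<^sup>2 * stieltjes 0 w" for w
  have "h holomorphic_on ball 0 1"
  proof -
    have "1 + w\<^sup>2 \<noteq> 0" if "w \<in> ball 0 1" for w :: complex
      using one_pm_square_bounds(3)[of w] that by simp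
    then show ?thesis
      unfolding h_def \<psi>_def
      by (intro holomorphic_on_mult holomorphic_on_divide holomorphic_on_add
          holomorphic_on_power holomorphic_on_const holomorphic_on_ident stieltjes_holomorphic) auto
  qed
  moreover have "cmod (h w) \<le> 57 * M / (1 - cmod w) ^ 4" if w: "cmod w < 1" for w
  proof -
    define x where "x = 1 / (1 - cmod w)"
    have x: "x \<ge> 1" using w by (simp add: x_def)
    have "cmod (\<psi> w) \<le> 2 / (1 - cmod w)"
      unfolding \<psi>_def norm_divide using one_pm_square_bounds[OF w] w
      by (intro frac_le) (auto simp: norm_mult)
    then have psi: "cmod (\<psi> w) \<le> 2 * x" by (simp add: x_def)
    have st: "cmod (stieltjes 0 w) \<le> 12 * M * x\<^sup>2"
      using stieltjes_bound[OF w, of 0] by (simp add: x_def power_one_over divide_inverse power_inverse)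
    have "cmod (h w) \<le> \<bar>a 0\<bar> + \<bar>a 1\<bar> * cmod (\<psi> w) + (cmod (\<psi> w))\<^sup>2 * cmod (stieltjes 0 w)"
      unfolding h_def
      by (intro order_trans[OF norm_triangle_ineq] add_mono) (simp_all add: norm_mult norm_power)
    also have "\<dots> \<le> M + (4 * M) * (2 * x) + (2 * x)\<^sup>2 * (12 * M * x\<^sup>2)"
      using a(1)[of 1] a(2) psi st M0 x by (intro add_mono mult_mono power_mono) auto
    also have "\<dots> = M + 8 * M * x + 48 * M * x ^ 4" by (simp add: power2_eq_square power4_eq_xxxx)
    also have "\<dots> \<le> M * x ^ 4 + 8 * M * x ^ 4 + 48 * M * x ^ 4"
      using M0 x power_increasing[of 1 4 x] one_le_power[OF x, of 4]
      by (intro add_mono mult_left_mono order_refl) (auto simp: mult_le_cancel_left1)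
    also have "\<dots> = 57 * M / (1 - cmod w) ^ 4" by (simp add: x_def power_one_over)
    finally show ?thesis .
  qed
  moreover have "h (complex_of_real w) = complex_of_real (\<phi> (2 * w / (1 + w\<^sup>2)))" if w: "\<bar>w\<bar> \<le> 1/8" for w
  proof -
    define t where "t = 2 * w / (1 + w\<^sup>2)"
    have "\<bar>t\<bar> = 2 * \<bar>w\<bar> / (1 + w\<^sup>2)" by (simp add: t_def abs_mult)
    also have "\<dots> \<le> 2 * \<bar>w\<bar> / 1" by (rule divide_left_mono) (auto simp: add_pos_nonneg)
    finally have t: "\<bar>t\<bar> \<le> 1/4" using w by simp
    have pt: "\<psi> (of_real w) = of_real t" by (simp add: \<psi>_def t_def)
    have "(\<lambda>j. of_real (m j) * \<psi> (of_real w) ^ j) sums stieltjes 0 (of_real w)"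
      unfolding \<psi>_def by (rule stieltjes_sums) (use w t pt in \<open>simp_all flip: \<psi>_def\<close>)
    then have "(\<lambda>j. of_real (a (Suc (Suc j))) * (of_real t) ^ j) sums stieltjes 0 (complex_of_real w)"
      by (simp add: pt m_def)
    from sums_mult[OF this, of "(of_real t)\<^sup>2"]
    have 1: "(\<lambda>j. complex_of_real (a (Suc (Suc j)) * t ^ Suc (Suc j))) sums ((of_real t)\<^sup>2 * stieltjes 0 (of_real w))"
      by (simp add: power2_eq_square ac_simps)
    have "(\<lambda>j. a (Suc j) * t ^ Suc j) sums (\<phi> t - a 0)"
      using a(4)[OF t] by (subst sums_Suc_iff[of "\<lambda>j. a j * t ^ j"]) simp
    then have "(\<lambda>j. a (Suc (Suc j)) * t ^ Suc (Suc j)) sums (\<phi> t - a 0 - a 1 * t)"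
      by (subst sums_Suc_iff[of "\<lambda>j. a (Suc j) * t ^ Suc j"]) simp
    then have "(\<lambda>j. complex_of_real (a (Suc (Suc j)) * t ^ Suc (Suc j))) sums of_real (\<phi> t - a 0 - a 1 * t)"
      by (simp only: sums_of_real_iff)
    then have "(of_real t)\<^sup>2 * stieltjes 0 (of_real w) = complex_of_real (\<phi> t - a 0 - a 1 * t)"
      using 1 sums_unique2 by blast
    then show ?thesis by (simp add: h_def pt t_def[symmetric])
  qed
  ultimately show thesis using that by blast
qed

section \<open>Continuation to strips\<close>

definition strip :: "real \<Rightarrow> complex set" where
  "strip a = {z. \<bar>Re z\<bar> < a}"

lemma strip_Int: "strip a = {z. Re z < a} \<inter> {z. - a < Re z}"
  by (auto simp: strip_def)

lemma open_strip: "open (strip a)"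
  unfolding strip_Int by (intro open_Int open_halfspace_Re_lt open_halfspace_Re_gt)

lemma convex_strip: "convex (strip a)"
  unfolding strip_Int by (intro convex_Int convex_halfspace_Re_lt convex_halfspace_Re_gt)

text \<open>The identity theorem from a real neighbourhood of \<open>0\<close>.\<close>

lemma holomorphic_eq_of_real:
  assumes "f holomorphic_on S" "g holomorphic_on S" "open S" "convex S" "0 \<in> S" "z \<in> S" "r > 0"
    "\<And>t. \<bar>t\<bar> < r \<Longrightarrow> f (complex_of_real t) = g (complex_of_real t)"
  shows "f z = g z"
proof -
  obtain e where e: "e > 0" "ball 0 e \<subseteq> S" using assms(3,5) open_contains_ball by blast
  define U where "U = complex_of_real ` {-min r e<..<min r e}"
  have "f z - g z = 0"
  proof (rule analytic_continuation[of "\<lambda>z. f z - g z" S U 0])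
    show "U \<subseteq> S"
    proof
      fix x assume "x \<in> U"
      then obtain t where "x = of_real t" "\<bar>t\<bar> < e" by (auto simp: U_def abs_less_iff)
      then have "x \<in> ball 0 e" by simp
      then show "x \<in> S" using e(2) by blast
    qed
    show "0 islimpt U"
      unfolding islimpt_approachable
    proof (intro allI impI)
      fix d :: real assume d: "d > 0"
      define t where "t = min d (min r e) / 2"
      have t: "0 < t" "t < d" "t < min r e" using d e(1) assms(7) by (auto simp: t_def)
      then show "\<exists>x'\<in>U. x' \<noteq> 0 \<and> dist x' 0 < d"
        by (intro bexI[of _ "complex_of_real t"]) (auto simp: U_def)
    qed
  qed (use assms in \<open>auto simp: U_def convex_connected intro!: holomorphic_intros\<close>)
  then show ?thesis by simp
qed

text \<open>The inverse Joukowski map: \<open>2w / (1 + w\<^sup>2)\<close> maps the unit disc onto the plane slit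
  along the real half-lines outside \<open>(-1, 1)\<close>.\<close>

definition jouk :: "complex \<Rightarrow> complex" where
  "jouk z = z / (1 + csqrt (1 - z\<^sup>2))"

lemma jouk_arg:
  assumes "\<bar>Re z\<bar> < 1" shows "1 - z\<^sup>2 \<notin> \<real>\<^sub>\<le>\<^sub>0"
proof
  assume "1 - z\<^sup>2 \<in> \<real>\<^sub>\<le>\<^sub>0"
  then have "Re (z\<^sup>2) \<ge> 1" by (auto simp: complex_nonpos_Reals_iff)
  moreover have "Re (z\<^sup>2) \<le> (Re z)\<^sup>2" by (simp add: power2_eq_square)
  moreover have "(Re z)\<^sup>2 < 1" using assms by (simp add: abs_square_less_1)
  ultimately show False by linarith
qed

lemma Re_csqrt_pos:
  assumes "z \<notin> \<real>\<^sub>\<le>\<^sub>0" shows "Re (csqrt z) > 0"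
proof (rule ccontr)
  assume "\<not> Re (csqrt z) > 0"
  then have 0: "Re (csqrt z) = 0" using csqrt_principal[of z] by auto
  define s where "s = csqrt z"
  have s: "Re s = 0" "s\<^sup>2 = z" using 0 by (simp_all only: s_def power2_csqrt)
  have "s\<^sup>2 = of_real (- (Im s)\<^sup>2)"
    using s(1) by (simp add: complex_eq_iff power2_eq_square)
  then have "z = of_real (- (Im s)\<^sup>2)" using s(2) by simp
  then have "z \<in> \<real>\<^sub>\<le>\<^sub>0" by (metis neg_le_0_iff_le nonpos_Reals_of_real_iff zero_le_power2)
  then show False using assms by simp
qed

text \<open>With \<open>s = (1 - z\<^sup>2)\<^sup>1\<^sup>/\<^sup>2\<close> in the right half-plane, \<open>jouk z\<close> squares to \<open>(1 - s) / (1 + s)\<close>.\<close>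

lemma jouk:
  assumes "\<bar>Re z\<bar> < 1"
  shows "cmod (jouk z) < 1" "2 * jouk z / (1 + (jouk z)\<^sup>2) = z"
proof -
  define s where "s = csqrt (1 - z\<^sup>2)"
  have s: "Re s > 0" unfolding s_def by (rule Re_csqrt_pos[OF jouk_arg[OF assms]])
  have s2: "z\<^sup>2 = (1 - s) * (1 + s)" by (simp add: s_def algebra_simps flip: power2_eq_square)
  have nz: "1 + s \<noteq> 0" using s by (auto simp: complex_eq_iff)
  have lt: "cmod (1 - s) < cmod (1 + s)"
    using s by (simp add: cmod_def power2_eq_square algebra_simps)
  have w: "jouk z = z / (1 + s)" by (simp add: jouk_def s_def)
  have w2: "(jouk z)\<^sup>2 = (1 - s) / (1 + s)"
    using nz by (simp add: w power_divide s2) (simp add: power2_eq_square)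
  have "(cmod (jouk z))\<^sup>2 < 1" unfolding norm_power[symmetric] w2 norm_divide using lt nz by simp
  then show "cmod (jouk z) < 1" by (simp add: abs_square_less_1)
  have "1 + (jouk z)\<^sup>2 = 2 / (1 + s)" unfolding w2 using nz by (simp add: field_simps)
  then show "2 * jouk z / (1 + (jouk z)\<^sup>2) = z" using nz by (simp add: w)
qed

lemma jouk_holomorphic: "jouk holomorphic_on strip 1"
proof -
  have "1 + csqrt (1 - z\<^sup>2) \<noteq> 0" if "z \<in> strip 1" for z
  proof -
    have "Re (1 + csqrt (1 - z\<^sup>2)) > 0"
      using Re_csqrt_pos[OF jouk_arg[of z]] that by (simp add: strip_def del: csqrt.simps)
    then show ?thesis by (metis zero_complex.sel(1) less_irrefl)
  qed
  then show ?thesis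
    unfolding jouk_def using jouk_arg
    by (intro holomorphic_on_divide holomorphic_on_csqrt' holomorphic_intros) (auto simp: strip_def)
qed

lemma jouk_of_real:
  assumes "\<bar>t\<bar> \<le> 1"
  shows "\<exists>w. jouk (complex_of_real t) = complex_of_real w \<and> \<bar>w\<bar> \<le> \<bar>t\<bar>"
proof (intro exI conjI)
  have "t\<^sup>2 \<le> 1" using assms by (simp add: abs_square_le_1)
  then have "csqrt (1 - (complex_of_real t)\<^sup>2) = complex_of_real (sqrt (1 - t\<^sup>2))"
    using csqrt_of_real_nonneg[of "1 - t\<^sup>2"] by simp
  then show "jouk (complex_of_real t) = complex_of_real (t / (1 + sqrt (1 - t\<^sup>2)))"
    by (simp add: jouk_def)
  have "1 \<le> 1 + sqrt (1 - t\<^sup>2)" using \<open>t\<^sup>2 \<le> 1\<close> by simp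
  then have "\<bar>t\<bar> / (1 + sqrt (1 - t\<^sup>2)) \<le> \<bar>t\<bar> / 1" by (intro divide_left_mono) (auto intro!: add_pos_nonneg simp: \<open>t\<^sup>2 \<le> 1\<close>)
  then show "\<bar>t / (1 + sqrt (1 - t\<^sup>2))\<bar> \<le> \<bar>t\<bar>" using \<open>t\<^sup>2 \<le> 1\<close> by (simp add: abs_divide)
qed

subsection \<open>Two constants on a rectangle\<close>

text \<open>A lower bound, on the rectangle \<open>|Re z| \<le> a/2\<close>, \<open>0 \<le> Im z \<le> 3/2\<close>, for the harmonic function in
  \<open>two_constants_upper\<close>.\<close>

definition two_const :: "real \<Rightarrow> real" where
  "two_const a = cos (pi/4) * sinh (pi / (2*a) / 2) / sinh (2 * (pi / (2*a)))"

lemma two_const_pos: "a > 0 \<Longrightarrow> two_const a > 0"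
  unfolding two_const_def by (intro divide_pos_pos mult_pos_pos) (auto simp: cos_45)

text \<open>The harmonic function \<open>\<sigma> = cos (c x) sinh (c (2 - y)) / sinh (2c)\<close> vanishes on three sides of the
  rectangle and is at most \<open>1\<close> on the real side. Multiplying \<open>h\<close> by the exponential of a function with
  real part \<open>ln (M / m) \<sigma>\<close> makes it bounded by \<open>M\<close> on the whole boundary.\<close>

lemma two_constants_upper:
  assumes a: "a > 0" and h: "h holomorphic_on strip (2*a)"
    and M: "\<And>z. \<bar>Re z\<bar> \<le> a \<Longrightarrow> 0 \<le> Im z \<Longrightarrow> Im z \<le> 2 \<Longrightarrow> cmod (h z) \<le> M"
    and m: "\<And>x. \<bar>x\<bar> \<le> a \<Longrightarrow> cmod (h (of_real x)) \<le> m" and mM: "0 < m" "m \<le> M"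
    and z: "\<bar>Re z\<bar> \<le> a/2" "0 \<le> Im z" "Im z \<le> 3/2"
  shows "cmod (h z) \<le> M * (m / M) powr two_const a"
proof -
  define c where "c = pi / (2 * a)"
  define \<kappa> where "\<kappa> = ln (M / m)"
  have c: "c > 0" using a by (simp add: c_def)
  have sh: "sinh (2 * c) > 0" using c by simp
  have \<kappa>: "\<kappa> \<ge> 0" using mM by (simp add: \<kappa>_def)
  have M0: "M > 0" using mM by simp
  define q where "q z = \<i> * sin (of_real c * (z - 2 * \<i>)) / of_real (sinh (2 * c))" for z
  define \<sigma> where "\<sigma> z = cos (c * Re z) * sinh (c * (2 - Im z)) / sinh (2 * c)" for z
  have Req: "Re (q z) = \<sigma> z" for z
  proof -
    have "Im (sin (of_real c * (z - 2 * \<i>))) = - (cos (c * Re z) * sinh (c * (2 - Im z)))"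
      by (simp add: Im_sin sinh_field_def field_simps)
    then show ?thesis by (simp add: q_def \<sigma>_def)
  qed
  define S where "S = cbox (Complex (-a) 0) (Complex a 2)"
  have inS: "z \<in> S \<longleftrightarrow> \<bar>Re z\<bar> \<le> a \<and> 0 \<le> Im z \<and> Im z \<le> 2" for z
    by (auto simp: S_def in_cbox_complex_iff)
  have Ssub: "S \<subseteq> strip (2*a)" using a by (auto simp: inS strip_def)
  define H where "H z = h z * exp (of_real \<kappa> * q z)" for z
  have Hhol: "H holomorphic_on strip (2*a)"
    unfolding H_def q_def by (intro holomorphic_intros h) (use sh in auto)
  have nH: "cmod (H z) = cmod (h z) * exp (\<kappa> * \<sigma> z)" for z
    by (simp add: H_def norm_mult Req)
  have "cmod (H z) \<le> M"
  proof (rule maximum_modulus_frontier[of H S])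
    show "H holomorphic_on interior S"
      using Hhol Ssub interior_subset by (meson holomorphic_on_subset order_trans)
    have "closure S = S" by (simp add: S_def)
    then show "continuous_on (closure S) H"
      using Hhol Ssub by (metis holomorphic_on_imp_continuous_on holomorphic_on_subset)
    show "bounded S" by (simp add: S_def)
    show "z \<in> S" using z a by (auto simp: inS)
    fix x assume "x \<in> frontier S"
    then have x: "x \<in> S" "x \<notin> box (Complex (-a) 0) (Complex a 2)"
      by (auto simp: S_def frontier_cbox)
    consider "Im x = 0" | "\<bar>Re x\<bar> = a" | "Im x = 2"
      using x by (fastforce simp: inS in_box_complex_iff)
    then show "cmod (H x) \<le> M"
    proof cases
      case 1
      have "x = of_real (Re x)" using 1 by (simp add: complex_eq_iff)
      then have "cmod (h x) \<le> m" using m[of "Re x"] x by (simp add: inS)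
      moreover have "\<sigma> x \<le> 1" using 1 sh by (simp add: \<sigma>_def mult.commute)
      then have "exp (\<kappa> * \<sigma> x) \<le> exp \<kappa>" using \<kappa> by (simp add: mult_left_le)
      ultimately have "cmod (H x) \<le> m * exp \<kappa>" unfolding nH using mM by (intro mult_mono) auto
      then show ?thesis using mM by (simp add: \<kappa>_def)
    next
      case 2
      have "c * a = pi / 2" using a by (simp add: c_def)
      then have "c * Re x = pi / 2 \<or> c * Re x = - (pi / 2)" using 2 by (auto simp: abs_if split: if_splits)
      then have "cos (c * Re x) = 0" by (elim disjE) (simp_all only: cos_minus cos_pi_half)
      then show ?thesis using M[of x] x by (simp add: nH \<sigma>_def inS)
    next
      case 3
      then show ?thesis using M[of x] x by (simp add: nH \<sigma>_def inS)
    qed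
  qed
  moreover have "\<sigma> z \<ge> two_const a"
    unfolding \<sigma>_def two_const_def c_def[symmetric]
  proof (intro divide_right_mono mult_mono)
    have "\<bar>c * Re z\<bar> \<le> c * (a/2)" unfolding abs_mult using z c by (intro mult_mono) auto
    also have "c * (a/2) = pi/4" using a by (simp add: c_def)
    finally have *: "\<bar>c * Re z\<bar> \<le> pi/4" .
    have "cos (pi/4) \<le> cos \<bar>c * Re z\<bar>" by (rule cos_monotone_0_pi_le) (use * in auto)
    then show ge: "cos (pi/4) \<le> cos (c * Re z)" by (cases "c * Re z \<ge> 0") auto
    have "0 \<le> cos (pi/4)" by (simp add: cos_45)
    then show "0 \<le> cos (c * Re z)" using ge by (rule order_trans)
    show "sinh (c / 2) \<le> sinh (c * (2 - Im z))"
      using z c mult_left_mono[of "1/2" "2 - Im z" c] by simp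
    show "0 \<le> sinh (c / 2)" using c by simp
  qed (use sh in simp)
  then have "exp (\<kappa> * two_const a) \<le> exp (\<kappa> * \<sigma> z)" using \<kappa> by (simp add: mult_left_mono)
  then have "cmod (h z) * exp (\<kappa> * two_const a) \<le> cmod (H z)" unfolding nH by (rule mult_left_mono) simp
  ultimately have "cmod (h z) * exp (\<kappa> * two_const a) \<le> M" by simp
  then have "cmod (h z) \<le> M * exp (- (\<kappa> * two_const a))" by (simp add: exp_minus field_simps)
  also have "exp (- (\<kappa> * two_const a)) = (m / M) powr two_const a"
    using mM by (simp add: powr_def \<kappa>_def ln_div algebra_simps)
  finally show ?thesis .
qed

lemma two_constants:
  assumes a: "a > 0" and h: "h holomorphic_on strip (2*a)"
    and M: "\<And>z. \<bar>Re z\<bar> \<le> a \<Longrightarrow> \<bar>Im z\<bar> \<le> 2 \<Longrightarrow> cmod (h z) \<le> M"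
    and m: "\<And>x. \<bar>x\<bar> \<le> a \<Longrightarrow> cmod (h (of_real x)) \<le> m" and mM: "0 < m" "m \<le> M"
    and z: "\<bar>Re z\<bar> \<le> a/2" "\<bar>Im z\<bar> \<le> 3/2"
  shows "cmod (h z) \<le> M * (m / M) powr two_const a"
proof (cases "Im z \<ge> 0")
  case True
  then show ?thesis using z by (intro two_constants_upper[OF a h _ m mM] M) auto
next
  case False
  have h': "(\<lambda>z. h (- z)) holomorphic_on strip (2*a)"
    using holomorphic_on_compose_gen[of uminus "strip (2*a)" h "strip (2*a)"] h
    by (simp add: o_def strip_def holomorphic_on_minus holomorphic_on_ident image_subset_iff)
  have "cmod (h (- (- z))) \<le> M * (m / M) powr two_const a"
  proof (rule two_constants_upper[OF a h' _ _ mM])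
    show "cmod (h (- of_real x)) \<le> m" if "\<bar>x\<bar> \<le> a" for x using m[of "-x"] that by simp
  qed (use False z M in auto)
  then show ?thesis by simp
qed

subsection \<open>Interpolation at equispaced nodes\<close>

definition node :: "real \<Rightarrow> nat \<Rightarrow> nat \<Rightarrow> real" where
  "node d N i = d * (2 * real i / real N - 1)"

definition lag :: "real \<Rightarrow> nat \<Rightarrow> nat \<Rightarrow> complex \<Rightarrow> complex" where
  "lag d N i z = poly (lagrange_poly (\<lambda>i. complex_of_real (node d N i)) {..N} i) z"

lemma lag_holomorphic: "lag d N i holomorphic_on S"
  unfolding lag_def[abs_def] by (intro holomorphic_intros)

lemma abs_node_le: "d > 0 \<Longrightarrow> N \<ge> 1 \<Longrightarrow> i \<le> N \<Longrightarrow> \<bar>node d N i\<bar> \<le> d"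
proof -
  assume *: "d > 0" "N \<ge> 1" "i \<le> N"
  have "\<bar>2 * real i / real N - 1\<bar> \<le> 1" using * by (simp add: abs_le_iff field_simps)
  then show ?thesis using * by (simp add: node_def abs_mult mult_left_le)
qed

lemma power_over_fact_le_exp: "x \<ge> 0 \<Longrightarrow> x ^ n / fact n \<le> exp (x::real)"
proof -
  assume x: "x \<ge> 0"
  have s: "(\<lambda>n. x ^ n / fact n) sums exp x" using exp_converges[of x] by (simp add: divide_inverse mult.commute)
  have "sum (\<lambda>n. x ^ n / fact n) {n} \<le> (\<Sum>n. x ^ n / fact n)"
    by (rule sum_le_suminf[OF sums_summable[OF s]]) (use x in auto)
  then show ?thesis using sums_unique[OF s] by simp
qed

text \<open>The Lebesgue constant of equispaced nodes grows only exponentially, also off the real axis.\<close>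

lemma lebesgue_bound:
  assumes d: "d > 0" and N: "N \<ge> 1" and z: "cmod z \<le> d"
  shows "(\<Sum>i\<le>N. cmod (lag d N i z)) \<le> exp 2 ^ N"
proof -
  have "cmod (lag d N i z) \<le> real N ^ N / fact N * real (N choose i)" if i: "i \<le> N" for i
  proof -
    have "cmod (lag d N i z) = (\<Prod>l\<in>{..N}-{i}. cmod (z - of_real (node d N l)) / \<bar>node d N i - node d N l\<bar>)"
    proof -
      have "cmod (complex_of_real x - complex_of_real y) = \<bar>x - y\<bar>" for x y
        by (metis norm_of_real of_real_diff)
      then show ?thesis by (simp only: lag_def poly_lagrange_poly prod_norm[symmetric] norm_divide)
    qed
    also have "\<dots> \<le> (\<Prod>l\<in>{..N}-{i}. real N / \<bar>real i - real l\<bar>)"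
    proof (intro prod_mono conjI)
      fix l assume l: "l \<in> {..N} - {i}"
      have A: "cmod (z - of_real (node d N l)) \<le> 2 * d"
        using norm_triangle_ineq4[of z "of_real (node d N l)"] z abs_node_le[OF d N, of l] l by simp
      have B: "\<bar>node d N i - node d N l\<bar> = 2 * d * (\<bar>real i - real l\<bar> / real N)"
      proof -
        have "node d N i - node d N l = 2 * d * ((real i - real l) / real N)"
          using N by (simp add: node_def field_simps)
        then show ?thesis using d by (simp add: abs_mult)
      qed
      have r: "\<bar>real i - real l\<bar> > 0" using l by auto
      have "cmod (z - of_real (node d N l)) / \<bar>node d N i - node d N l\<bar> \<le> 2 * d / (2 * d * (\<bar>real i - real l\<bar> / real N))"
        unfolding B using A r d N by (intro divide_right_mono) auto
      also have "\<dots> = real N / \<bar>real i - real l\<bar>" using d N r by simp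
      finally show "cmod (z - of_real (node d N l)) / \<bar>node d N i - node d N l\<bar> \<le> real N / \<bar>real i - real l\<bar>" .
    qed simp
    also have "\<dots> = real N ^ N / \<bar>\<Prod>l\<in>{..N}-{i}. real i - real l\<bar>"
      using i by (simp add: prod_dividef abs_prod)
    also have "\<bar>\<Prod>l\<in>{..N}-{i}. real i - real l\<bar> = fact i * fact (N - i)"
      using prod_nat_nodes[OF i, where ?'a=real] by (simp add: abs_mult power_abs)
    also have "real N ^ N / (fact i * fact (N - i)) = real N ^ N / fact N * real (N choose i)"
      using i by (simp add: binomial_fact)
    finally show ?thesis .
  qed
  then have "(\<Sum>i\<le>N. cmod (lag d N i z)) \<le> (\<Sum>i\<le>N. real N ^ N / fact N * real (N choose i))"
    by (intro sum_mono) auto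
  also have "\<dots> = real N ^ N / fact N * real (\<Sum>i\<le>N. N choose i)"
    by (simp add: sum_distrib_left)
  also have "\<dots> = (2 * real N) ^ N / fact N" by (simp add: choose_row_sum power_mult_distrib)
  also have "\<dots> \<le> exp (2 * real N)" by (rule power_over_fact_le_exp) simp
  also have "\<dots> = exp 2 ^ N" by (simp add: exp_of_nat_mult mult.commute)
  finally show ?thesis .
qed

lemma lag_reproduces:
  assumes "d > 0" "N \<ge> 1" "k \<le> N"
  shows "(\<Sum>i\<le>N. lag d N i z * of_real (node d N i) ^ k) = z ^ k"
proof -
  have inj: "inj_on (\<lambda>i. complex_of_real (node d N i)) {..N}"
    using assms by (auto simp: inj_on_def node_def)
  have "monom 1 k = (\<Sum>i\<le>N. smult (poly (monom 1 k) (complex_of_real (node d N i)))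
      (lagrange_poly (\<lambda>i. complex_of_real (node d N i)) {..N} i))"
    by (rule lagrange_interpolation[OF _ inj]) (use assms in \<open>auto simp: degree_monom_eq\<close>)
  then have "poly (monom 1 k) z = poly (\<Sum>i\<le>N. smult (poly (monom 1 k) (complex_of_real (node d N i)))
      (lagrange_poly (\<lambda>i. complex_of_real (node d N i)) {..N} i)) z" by simp
  then show ?thesis by (simp add: poly_monom poly_sum lag_def mult.commute)
qed

text \<open>Expand \<open>V\<close> in a power series: interpolation reproduces the terms up to \<open>z\<^sup>N\<close>, and on the smaller
  disc of radius \<open>\<theta> \<eta>\<close> the remaining ones gain \<open>\<theta>\<^sup>N\<close> against the Lebesgue constant.\<close>

lemma interpolation_error:
  assumes V: "V holomorphic_on ball 0 (2*\<eta>)" and C: "\<And>z. cmod z \<le> \<eta> \<Longrightarrow> cmod (V z) \<le> C"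
    and \<eta>: "\<eta> > 0" and th: "0 < \<theta>" "\<theta> \<le> 1/2" and N: "N \<ge> 1" and z: "cmod z \<le> \<theta> * \<eta>"
  shows "cmod ((\<Sum>i\<le>N. lag (\<theta> * \<eta>) N i z * V (of_real (node (\<theta> * \<eta>) N i))) - V z) \<le> 2 * C * exp 2 ^ N * \<theta> ^ N"
proof -
  let ?d = "\<theta> * \<eta>"
  have d: "?d > 0" using \<eta> th by simp
  have C0: "C \<ge> 0" using order_trans[OF norm_ge_zero C[of 0]] \<eta> by simp
  define v where "v k = (deriv ^^ k) V 0 / fact k" for k
  have vb: "cmod (v k) \<le> C / \<eta> ^ k" for k
  proof -
    have "cmod ((deriv ^^ k) V 0) \<le> fact k * C / \<eta> ^ k"
    proof (rule Cauchy_inequality)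
      show "V holomorphic_on ball 0 \<eta>" by (rule holomorphic_on_subset[OF V]) (use \<eta> in auto)
      show "continuous_on (cball 0 \<eta>) V"
        by (rule continuous_on_subset[OF holomorphic_on_imp_continuous_on[OF V]]) (use \<eta> in auto)
    qed (use C \<eta> in auto)
    then show ?thesis by (simp add: v_def norm_divide field_simps)
  qed
  have vs: "(\<lambda>k. v k * x ^ k) sums V x" if "cmod x \<le> ?d" for x
  proof -
    have "?d < 2 * \<eta>" using th \<eta> by simp
    then have "x \<in> ball 0 (2*\<eta>)" using that by simp
    from holomorphic_power_series[OF V this] show ?thesis by (simp add: v_def)
  qed
  define E where "E k = (\<Sum>i\<le>N. lag ?d N i z * of_real (node ?d N i) ^ k)" for k
  have Ek: "E k = z ^ k" if "k \<le> N" for k unfolding E_def by (rule lag_reproduces[OF d N that])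
  have Eb: "cmod (E k) \<le> exp 2 ^ N * ?d ^ k" for k
  proof -
    have "cmod (E k) \<le> (\<Sum>i\<le>N. cmod (lag ?d N i z) * ?d ^ k)"
      unfolding E_def
      by (rule order_trans[OF norm_sum sum_mono])
        (use abs_node_le[OF d N] in \<open>auto simp: norm_mult norm_power intro!: mult_left_mono power_mono\<close>)
    also have "\<dots> \<le> exp 2 ^ N * ?d ^ k"
      unfolding sum_distrib_right[symmetric] using lebesgue_bound[OF d N z] d by (intro mult_right_mono) auto
    finally show ?thesis .
  qed
  have "(\<lambda>k. \<Sum>i\<le>N. lag ?d N i z * (v k * of_real (node ?d N i) ^ k)) sums
      (\<Sum>i\<le>N. lag ?d N i z * V (of_real (node ?d N i)))"
    by (intro sums_sum sums_mult vs) (use abs_node_le[OF d N] in simp)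
  moreover have "(\<Sum>i\<le>N. lag ?d N i z * (v k * of_real (node ?d N i) ^ k)) = v k * E k" for k
    by (simp add: E_def sum_distrib_left ac_simps)
  ultimately have "(\<lambda>k. v k * E k) sums (\<Sum>i\<le>N. lag ?d N i z * V (of_real (node ?d N i)))" by simp
  from sums_diff[OF this vs[OF z]]
  have D: "(\<lambda>k. v k * (E k - z ^ k)) sums ((\<Sum>i\<le>N. lag ?d N i z * V (of_real (node ?d N i))) - V z)"
    by (simp add: right_diff_distrib)
  have e1: "(1::real) \<le> exp 2 ^ N" by (rule one_le_power) simp
  have b: "norm (v (k + Suc N) * (E (k + Suc N) - z ^ (k + Suc N))) \<le> (2 * C * exp 2 ^ N * \<theta> ^ Suc N) * (1/2) ^ k" for k
  proof -
    let ?k = "k + Suc N"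
    have "cmod (z ^ ?k) \<le> 1 * ?d ^ ?k" using z by (simp add: norm_power power_mono del: power_Suc)
    also have "\<dots> \<le> exp 2 ^ N * ?d ^ ?k" using e1 d by (intro mult_right_mono) auto
    finally have "cmod (E ?k - z ^ ?k) \<le> 2 * (exp 2 ^ N * ?d ^ ?k)"
      using norm_triangle_ineq4[of "E ?k" "z ^ ?k"] Eb[of ?k] by linarith
    then have "norm (v ?k * (E ?k - z ^ ?k)) \<le> (C / \<eta> ^ ?k) * (2 * (exp 2 ^ N * ?d ^ ?k))"
      unfolding norm_mult using vb[of ?k] C0 \<eta> by (intro mult_mono) auto
    also have "\<dots> = 2 * C * exp 2 ^ N * \<theta> ^ ?k" using \<eta> by (simp add: power_mult_distrib del: power_Suc)
    also have "\<dots> = (2 * C * exp 2 ^ N * \<theta> ^ Suc N) * \<theta> ^ k" by (simp only: power_add mult_ac)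
    also have "\<dots> \<le> (2 * C * exp 2 ^ N * \<theta> ^ Suc N) * (1/2) ^ k"
      using C0 th by (intro mult_left_mono power_mono) auto
    finally show ?thesis .
  qed
  have geo: "(\<lambda>k. (2 * C * exp 2 ^ N * \<theta> ^ Suc N) * (1/2) ^ k) sums ((2 * C * exp 2 ^ N * \<theta> ^ Suc N) * 2)"
  proof -
    have "(\<lambda>k. (1/2::real) ^ k) sums 2" using geometric_sums[of "1/2::real"] by simp
    then show ?thesis by (rule sums_mult)
  qed
  have D': "(\<lambda>k. v (k + Suc N) * (E (k + Suc N) - z ^ (k + Suc N))) sums
      ((\<Sum>i\<le>N. lag ?d N i z * V (of_real (node ?d N i))) - V z)"
    using sums_iff_shift[of "\<lambda>k. v k * (E k - z ^ k)" "Suc N"] D by (simp add: Ek)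
  have sn: "summable (\<lambda>k. norm (v (k + Suc N) * (E (k + Suc N) - z ^ (k + Suc N))))"
    by (rule summable_comparison_test'[OF sums_summable[OF geo], of 0]) (use b in simp)
  have "cmod ((\<Sum>i\<le>N. lag ?d N i z * V (of_real (node ?d N i))) - V z) \<le> (2 * C * exp 2 ^ N * \<theta> ^ Suc N) * 2"
    using order_trans[OF summable_norm[OF sn] suminf_le[OF b sn sums_summable[OF geo]]]
      sums_unique[OF geo] sums_unique[OF D'] by simp
  also have "\<dots> = 2 * C * exp 2 ^ N * \<theta> ^ N * (2 * \<theta>)" by simp
  also have "\<dots> \<le> 2 * C * exp 2 ^ N * \<theta> ^ N * 1" using C0 th by (intro mult_left_mono) auto
  finally show ?thesis by simp
qed

subsection \<open>Kraus functions on the strip\<close>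

lemma kraus_strip:
  fixes h :: "complex \<Rightarrow> complex"
  assumes h: "h holomorphic_on ball 0 1" "\<And>w. \<bar>w\<bar> \<le> 1/8 \<Longrightarrow> h (complex_of_real w) = f (2 * w / (1 + w\<^sup>2))"
  shows "(\<lambda>z. h (jouk z)) holomorphic_on strip 1" "\<bar>t\<bar> \<le> 1/8 \<Longrightarrow> h (jouk (complex_of_real t)) = f t"
proof -
  show "(\<lambda>z. h (jouk z)) holomorphic_on strip 1"
  proof -
    have "jouk ` strip 1 \<subseteq> ball 0 1" using jouk(1) by (auto simp: strip_def)
    from holomorphic_on_compose_gen[OF jouk_holomorphic h(1) this] show ?thesis by (simp add: o_def)
  qed
  assume t: "\<bar>t\<bar> \<le> 1/8"
  obtain w where w: "jouk (complex_of_real t) = complex_of_real w" "\<bar>w\<bar> \<le> \<bar>t\<bar>"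
    using jouk_of_real[of t] t by auto
  have "complex_of_real (2 * w / (1 + w\<^sup>2)) = complex_of_real t"
    using jouk(2)[of "complex_of_real t"] t w(1) by simp
  then have "2 * w / (1 + w\<^sup>2) = t" by (simp only: of_real_eq_iff)
  then show "h (jouk (complex_of_real t)) = f t" using h(2)[of w] w t by simp
qed

text \<open>The bound for the continuation in the disc degenerates only at the boundary of the strip.\<close>

lemma jouk_compact_bound:
  assumes "compact K" "K \<subseteq> strip 1"
  obtains B where "B \<ge> 0" "\<And>z. z \<in> K \<Longrightarrow> 1 / (1 - cmod (jouk z)) ^ 4 \<le> B"
proof -
  have "continuous_on K (\<lambda>z. 1 / (1 - cmod (jouk z)) ^ 4)"
  proof (intro continuous_intros)
    show "continuous_on K jouk"
      using holomorphic_on_imp_continuous_on[OF jouk_holomorphic] assms(2) by (rule continuous_on_subset)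
    have "cmod (jouk z) < 1" if "z \<in> K" for z using jouk(1)[of z] that assms(2) by (auto simp: strip_def)
    then show "\<forall>z\<in>K. (1 - cmod (jouk z)) ^ 4 \<noteq> 0" by fastforce
  qed
  then have "compact ((\<lambda>z. 1 / (1 - cmod (jouk z)) ^ 4) ` K)"
    using assms(1) by (rule compact_continuous_image)
  then obtain B where "\<And>x. x \<in> (\<lambda>z. 1 / (1 - cmod (jouk z)) ^ 4) ` K \<Longrightarrow> norm x \<le> B"
    using compact_imp_bounded bounded_iff by metis
  then have "\<And>z. z \<in> K \<Longrightarrow> 1 / (1 - cmod (jouk z)) ^ 4 \<le> max 0 B"
    by (metis (no_types, lifting) abs_le_D1 image_eqI max.coboundedI2 real_norm_def)
  then show thesis using that[of "max 0 B"] by simp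
qed

subsection \<open>From separate to joint analyticity\<close>

lemma holomorphic_limit_geometric:
  assumes "open S" "\<And>n::nat. F n holomorphic_on S" "\<And>n z. z \<in> S \<Longrightarrow> cmod (F n z - G z) \<le> B * (1/2) ^ n"
  shows "G holomorphic_on S"
proof (rule holomorphic_uniform_sequence[OF assms(1,2)])
  fix x assume "x \<in> S"
  then obtain d where d: "d > 0" "cball x d \<subseteq> S" using assms(1) open_contains_cball by blast
  have "uniform_limit (cball x d) F G sequentially"
  proof (rule uniform_limitI)
    fix e :: real assume e: "e > 0"
    have "(\<lambda>n. B * (1/2) ^ n) \<longlonglongrightarrow> B * 0" by (intro tendsto_mult_left LIMSEQ_power_zero) simp
    then have "\<forall>\<^sub>F n in sequentially. B * (1/2) ^ n < e" using e by (intro order_tendstoD) auto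
    then show "\<forall>\<^sub>F n in sequentially. \<forall>z\<in>cball x d. dist (F n z) (G z) < e"
    proof eventually_elim
      case (elim n)
      then show ?case using assms(3)[of _ n] d(2) by (force simp: dist_norm)
    qed
  qed
  then show "\<exists>d>0. cball x d \<subseteq> S \<and> uniform_limit (cball x d) F G sequentially" using d by blast
qed

lemma geometric_Cauchy_limit:
  fixes p :: "nat \<Rightarrow> complex"
  assumes "\<And>n. cmod (p (Suc n) - p n) \<le> B * (1/2) ^ n"
  shows "cmod (p n - lim p) \<le> 2 * B * (1/2) ^ n" "p \<longlonglongrightarrow> lim p"
proof -
  have B: "B \<ge> 0" using order_trans[OF norm_ge_zero assms[of 0]] by simp
  have step: "cmod (p (n + k) - p n) \<le> 2 * B * (1/2) ^ n * (1 - (1/2) ^ k)" for n k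
  proof (induction k)
    case (Suc k)
    have "cmod (p (n + Suc k) - p n) \<le> cmod (p (Suc (n + k)) - p (n + k)) + cmod (p (n + k) - p n)"
      using norm_triangle_ineq[of "p (Suc (n + k)) - p (n + k)" "p (n + k) - p n"] by simp
    also have "\<dots> \<le> B * (1/2) ^ (n + k) + 2 * B * (1/2) ^ n * (1 - (1/2) ^ k)"
      using assms[of "n + k"] Suc by (rule add_mono)
    also have "\<dots> = 2 * B * (1/2) ^ n * (1 - (1/2) ^ Suc k)" by (simp add: power_add algebra_simps)
    finally show ?case .
  qed simp
  have le: "cmod (p m - p n) \<le> 2 * B * (1/2) ^ n" if "m \<ge> n" for m n
  proof -
    have "cmod (p m - p n) \<le> 2 * B * (1/2) ^ n * (1 - (1/2) ^ (m - n))" using step[of n "m - n"] that by simp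
    also have "\<dots> \<le> 2 * B * (1/2) ^ n * 1" using B by (intro mult_left_mono) auto
    finally show ?thesis by simp
  qed
  have "Cauchy p"
  proof (rule metric_CauchyI)
    fix e :: real assume e: "e > 0"
    have "(\<lambda>n. 4 * B * (1/2) ^ n) \<longlonglongrightarrow> 4 * B * 0" by (intro tendsto_mult_left LIMSEQ_power_zero) simp
    then have "\<forall>\<^sub>F n in sequentially. 4 * B * (1/2) ^ n < e" using e by (intro order_tendstoD) auto
    then obtain N where N: "4 * B * (1/2) ^ N < e" by (auto simp: eventually_sequentially)
    have "dist (p m) (p n) < e" if "m \<ge> N" "n \<ge> N" for m n
      using le[OF that(1)] le[OF that(2)] N norm_triangle_ineq4[of "p m - p N" "p n - p N"]
      by (simp add: dist_norm)
    then show "\<exists>M. \<forall>m\<ge>M. \<forall>n\<ge>M. dist (p m) (p n) < e" by blast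
  qed
  then show lim: "p \<longlonglongrightarrow> lim p" by (simp add: Cauchy_convergent_iff convergent_LIMSEQ_iff)
  have "(\<lambda>m. cmod (p n - p m)) \<longlonglongrightarrow> cmod (p n - lim p)" by (intro tendsto_intros lim)
  then show "cmod (p n - lim p) \<le> 2 * B * (1/2) ^ n"
    by (rule LIMSEQ_le_const2) (use le norm_minus_commute in metis)
qed

text \<open>Here \<open>U\<close> and \<open>V\<close> continue \<open>u(t, s)\<close> in the first and in the second variable, and \<open>W\<close> continues it
  along the lines \<open>t \<mapsto> (t, s + t r)\<close>. Interpolating \<open>U\<close> in \<open>s\<close> gives functions \<open>p\<^sub>n\<close> that are
  holomorphic in both variables. For real \<open>t\<close> consecutive ones differ by a geometrically small
  amount, since they interpolate \<open>V t\<close>; for complex \<open>t\<close> they grow at most geometrically. The theorem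
  on two constants, with an interpolation disc small enough, turns this into convergence for complex
  \<open>t\<close>, and the limit \<open>P\<close> agrees with \<open>W\<close> on each line. At \<open>t = \<i>\<close> the point of the line is
  \<open>s + \<i> r\<close>, so \<open>W\<close> becomes the holomorphic function \<open>P \<i>\<close>.\<close>

theorem continuation_along_lines:
  fixes u :: "real \<Rightarrow> real \<Rightarrow> complex" and U V :: "real \<Rightarrow> complex \<Rightarrow> complex" and W :: "real \<Rightarrow> real \<Rightarrow> complex \<Rightarrow> complex"
  assumes a: "0 < a" "a \<le> 1" and \<eta>: "\<eta> > 0" and \<rho>: "\<rho> > 0"
    and U: "\<And>\<sigma>. \<bar>\<sigma>\<bar> \<le> \<eta> \<Longrightarrow> U \<sigma> holomorphic_on strip (2*a)"
      "\<And>\<sigma> z. \<bar>\<sigma>\<bar> \<le> \<eta> \<Longrightarrow> \<bar>Re z\<bar> \<le> a \<Longrightarrow> \<bar>Im z\<bar> \<le> 2 \<Longrightarrow> cmod (U \<sigma> z) \<le> C"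
      "\<And>\<sigma> t. \<bar>\<sigma>\<bar> \<le> \<eta> \<Longrightarrow> \<bar>t\<bar> \<le> a \<Longrightarrow> U \<sigma> (of_real t) = u t \<sigma>"
    and V: "\<And>t. \<bar>t\<bar> \<le> a \<Longrightarrow> V t holomorphic_on ball 0 (2*\<eta>)"
      "\<And>t z. \<bar>t\<bar> \<le> a \<Longrightarrow> cmod z \<le> \<eta> \<Longrightarrow> cmod (V t z) \<le> C"
      "\<And>t \<sigma>. \<bar>t\<bar> \<le> a \<Longrightarrow> \<bar>\<sigma>\<bar> \<le> \<eta> \<Longrightarrow> V t (of_real \<sigma>) = u t \<sigma>"
    and W: "\<And>s r. \<bar>s\<bar> \<le> \<eta> \<Longrightarrow> \<bar>r\<bar> \<le> \<eta> \<Longrightarrow> W s r holomorphic_on strip (2*a)"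
      "\<And>s r t. \<bar>s\<bar> \<le> \<eta> \<Longrightarrow> \<bar>r\<bar> \<le> \<eta> \<Longrightarrow> \<bar>t\<bar> \<le> \<rho> \<Longrightarrow> W s r (of_real t) = u t (s + t * r)"
  shows "\<exists>\<delta>>0. (\<lambda>\<zeta>. W (Re \<zeta>) (Im \<zeta>) \<i>) holomorphic_on ball 0 \<delta>"
proof -
  define s0 where "s0 = two_const a"
  have s0: "s0 > 0" using a by (simp add: s0_def two_const_pos)
  define \<Lambda> :: real where "\<Lambda> = exp 2"
  have \<Lambda>: "\<Lambda> \<ge> 1" by (simp add: \<Lambda>_def)
  \<comment> \<open>the shrinking factor for which the small constant beats the Lebesgue constant \<open>\<Lambda>\<close> after applying the two-constants theorem\<close>
  define \<theta> where "\<theta> = min (1/2) ((1 / (2 * \<Lambda>)) powr (1 / s0))"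
  have \<theta>: "0 < \<theta>" "\<theta> \<le> 1/2" using \<Lambda> by (auto simp: \<theta>_def)
  have \<theta>s: "\<Lambda> * \<theta> powr s0 \<le> 1/2"
  proof -
    have "\<theta> powr s0 \<le> ((1 / (2 * \<Lambda>)) powr (1 / s0)) powr s0"
      using \<theta> s0 by (intro powr_mono2) (auto simp: \<theta>_def)
    also have "\<dots> = 1 / (2 * \<Lambda>)" using s0 \<Lambda> by (simp add: powr_powr)
    finally show ?thesis using \<Lambda> by (simp add: field_simps)
  qed
  define d where "d = \<theta> * \<eta>"
  have d: "0 < d" "d \<le> \<eta>" using \<theta> \<eta> by (auto simp: d_def)
  have C0: "C \<ge> 0" using order_trans[OF norm_ge_zero V(2)[of 0 0]] a \<eta> by simp
  define C1 where "C1 = C + 1"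
  have C1: "C1 > 0" "C \<le> C1" using C0 by (auto simp: C1_def)
  define p where "p n z \<sigma> = (\<Sum>i\<le>Suc n. lag d (Suc n) i \<sigma> * U (node d (Suc n) i) z)" for n z \<sigma>
  have nd: "\<bar>node d (Suc n) i\<bar> \<le> \<eta>" if "i \<le> Suc n" for n i
    using abs_node_le[OF d(1) _ that] d(2) by simp
  have err: "cmod (p n (of_real t) \<sigma> - V t \<sigma>) \<le> 2 * C1 * \<Lambda> ^ Suc n * \<theta> ^ Suc n"
    if t: "\<bar>t\<bar> \<le> a" and \<sigma>: "cmod \<sigma> \<le> d" for n t \<sigma>
  proof -
    have "p n (of_real t) \<sigma> = (\<Sum>i\<le>Suc n. lag d (Suc n) i \<sigma> * V t (of_real (node d (Suc n) i)))"
      unfolding p_def using U(3) V(3) t nd by (intro sum.cong refl) simp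
    also have "cmod (\<dots> - V t \<sigma>) \<le> 2 * C1 * exp 2 ^ Suc n * \<theta> ^ Suc n"
      unfolding d_def using \<sigma> C1
      by (intro interpolation_error[OF V(1)[OF t] _ \<eta> \<theta>] order_trans[OF V(2)[OF t]]) (auto simp: d_def)
    finally show ?thesis by (simp add: \<Lambda>_def)
  qed
  have big: "cmod (p n z \<sigma>) \<le> C1 * \<Lambda> ^ Suc n" if z: "\<bar>Re z\<bar> \<le> a" "\<bar>Im z\<bar> \<le> 2" and \<sigma>: "cmod \<sigma> \<le> d" for n z \<sigma>
  proof -
    have "cmod (p n z \<sigma>) \<le> (\<Sum>i\<le>Suc n. cmod (lag d (Suc n) i \<sigma>) * C1)"
      unfolding p_def
    proof (rule order_trans[OF norm_sum sum_mono])
      fix i assume "i \<in> {..Suc n}"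
      then have "cmod (U (node d (Suc n) i) z) \<le> C1" using U(2)[OF nd z] C1 by fastforce
      then show "cmod (lag d (Suc n) i \<sigma> * U (node d (Suc n) i) z) \<le> cmod (lag d (Suc n) i \<sigma>) * C1"
        by (simp add: norm_mult mult_left_mono)
    qed
    also have "\<dots> \<le> \<Lambda> ^ Suc n * C1"
      unfolding sum_distrib_right[symmetric] \<Lambda>_def using lebesgue_bound[OF d(1) _ \<sigma>, of "Suc n"] C1
      by (intro mult_right_mono) auto
    finally show ?thesis by (simp add: mult.commute)
  qed
  have phol: "(\<lambda>z. p n z \<sigma>) holomorphic_on strip (2*a)" for n \<sigma>
    unfolding p_def by (intro holomorphic_intros U(1) nd) auto
  define B where "B = 4 * C1 * \<Lambda>\<^sup>2"
  have diff: "cmod (p (Suc n) z \<sigma> - p n z \<sigma>) \<le> B * (1/2) ^ n"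
    if z: "\<bar>Re z\<bar> \<le> a/2" "\<bar>Im z\<bar> \<le> 3/2" and \<sigma>: "cmod \<sigma> \<le> d" for n z \<sigma>
  proof -
    define M where "M = 4 * C1 * \<Lambda> ^ Suc (Suc n)"
    define m where "m = M * \<theta> ^ n"
    have L1: "\<Lambda> ^ Suc n \<le> \<Lambda> ^ Suc (Suc n)" using \<Lambda> by (intro power_increasing) auto
    have M0: "M > 0" using C1 \<Lambda> by (simp add: M_def)
    have "\<theta> ^ n \<le> 1" using \<theta> by (intro power_le_one) auto
    then have m: "0 < m" "m \<le> M" using \<theta> M0 by (auto simp: m_def mult_left_le)
    have "cmod (p (Suc n) z \<sigma> - p n z \<sigma>) \<le> M * (m / M) powr two_const a"
    proof (rule two_constants[OF a(1) _ _ _ m z])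
      show "(\<lambda>z. p (Suc n) z \<sigma> - p n z \<sigma>) holomorphic_on strip (2*a)"
        by (intro holomorphic_intros phol)
      fix z assume z: "\<bar>Re z\<bar> \<le> a" "\<bar>Im z\<bar> \<le> 2"
      have "cmod (p (Suc n) z \<sigma> - p n z \<sigma>) \<le> C1 * \<Lambda> ^ Suc (Suc n) + C1 * \<Lambda> ^ Suc n"
        using norm_triangle_ineq4 big[OF z \<sigma>] by (meson add_mono order_trans)
      also have "\<dots> \<le> M"
        using mult_left_mono[OF L1, of C1] C1 M0 unfolding M_def by linarith
      finally show "cmod (p (Suc n) z \<sigma> - p n z \<sigma>) \<le> M" .
    next
      fix t assume t: "\<bar>t\<bar> \<le> a"
      have "cmod (p (Suc n) (of_real t) \<sigma> - p n (of_real t) \<sigma>)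
         = cmod ((p (Suc n) (of_real t) \<sigma> - V t \<sigma>) - (p n (of_real t) \<sigma> - V t \<sigma>))" by simp
      also have "\<dots> \<le> 2 * C1 * \<Lambda> ^ Suc (Suc n) * \<theta> ^ Suc (Suc n) + 2 * C1 * \<Lambda> ^ Suc n * \<theta> ^ Suc n"
        using norm_triangle_ineq4 err[OF t \<sigma>] by (meson add_mono order_trans)
      also have "\<dots> \<le> 2 * C1 * \<Lambda> ^ Suc (Suc n) * \<theta> ^ n + 2 * C1 * \<Lambda> ^ Suc (Suc n) * \<theta> ^ n"
      proof -
        have T: "\<theta> ^ Suc (Suc n) \<le> \<theta> ^ n" "\<theta> ^ Suc n \<le> \<theta> ^ n"
          using \<theta> by (intro power_decreasing; simp)+
        have "0 \<le> 2 * C1 * \<Lambda> ^ Suc (Suc n)" "0 \<le> \<theta> ^ Suc n" using C1 \<Lambda> \<theta> by auto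
        moreover have "2 * C1 * \<Lambda> ^ Suc n \<le> 2 * C1 * \<Lambda> ^ Suc (Suc n)"
          using L1 C1 by (intro mult_left_mono) auto
        ultimately show ?thesis by (intro add_mono mult_left_mono[OF T(1)] mult_mono[OF _ T(2)])
      qed
      also have "\<dots> = m" by (simp add: m_def M_def)
      finally show "cmod (p (Suc n) (of_real t) \<sigma> - p n (of_real t) \<sigma>) \<le> m" .
    qed
    also have "m / M = \<theta> powr real n" using M0 \<theta> by (simp add: m_def powr_realpow)
    also have "M * (\<theta> powr real n) powr two_const a = B * (\<Lambda> * \<theta> powr s0) ^ n"
    proof -
      have "(\<theta> powr real n) powr two_const a = (\<theta> powr s0) powr real n"
        by (simp add: powr_powr s0_def mult.commute)
      also have "\<dots> = (\<theta> powr s0) ^ n" using \<theta> by (simp add: powr_realpow)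
      finally show ?thesis by (simp add: M_def B_def power_mult_distrib power2_eq_square)
    qed
    also have "\<dots> \<le> B * (1/2) ^ n"
      using \<theta>s \<Lambda> C1 by (intro mult_left_mono power_mono) (auto simp: B_def)
    finally show ?thesis .
  qed
  define P where "P z \<sigma> = lim (\<lambda>n. p n z \<sigma>)" for z \<sigma>
  have Plim: "cmod (p n z \<sigma> - P z \<sigma>) \<le> 2 * B * (1/2) ^ n" "(\<lambda>n. p n z \<sigma>) \<longlonglongrightarrow> P z \<sigma>"
    if "\<bar>Re z\<bar> \<le> a/2" "\<bar>Im z\<bar> \<le> 3/2" "cmod \<sigma> \<le> d" for n z \<sigma>
    using geometric_Cauchy_limit[of "\<lambda>n. p n z \<sigma>" B, OF diff[OF that]] by (simp_all add: P_def)
  have Preal: "P (of_real t) \<sigma> = V t \<sigma>" if t: "\<bar>t\<bar> \<le> a/2" and \<sigma>: "cmod \<sigma> \<le> d" for t \<sigma>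
  proof -
    have "(\<lambda>n. p n (of_real t) \<sigma> - V t \<sigma>) \<longlonglongrightarrow> 0"
    proof (rule Lim_null_comparison)
      have "(\<lambda>n. p n (of_real t) \<sigma>) \<longlonglongrightarrow> P (of_real t) \<sigma>" using t \<sigma> by (intro Plim) auto
      show "\<forall>\<^sub>F n in sequentially. norm (p n (of_real t) \<sigma> - V t \<sigma>) \<le> 2 * C1 * (\<Lambda> * \<theta>) ^ Suc n"
        using err[of t \<sigma>] t a(1) \<sigma> by (intro always_eventually allI) (simp add: power_mult_distrib mult_ac)
      have "\<Lambda> * \<theta> < 1"
      proof -
        have "s0 \<le> 1"
        proof -
          have sinh_mono: "sinh (x / 2) \<le> sinh (2 * x)" if "0 < x" for x :: real using that by simp
          have "0 < pi / (2*a)" using a by simp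
          then have "sinh (pi / (2*a) / 2) \<le> sinh (2 * (pi / (2*a)))" by (rule sinh_mono)
          moreover have "cos (pi/4) \<le> (1::real)" by simp
          moreover have "sinh (pi / (2*a) / 2) > 0" "sinh (2 * (pi / (2*a))) > 0" using a by auto
          ultimately have "cos (pi/4) * sinh (pi / (2*a) / 2) \<le> 1 * sinh (2 * (pi / (2*a)))"
            by (intro mult_mono) linarith+
          then show ?thesis unfolding s0_def two_const_def
            using \<open>sinh (2 * (pi / (2*a))) > 0\<close> by (subst divide_le_eq_1_pos) linarith+
        qed
        then have "\<theta> powr 1 \<le> \<theta> powr s0" using \<theta> by (intro powr_mono') auto
        then have "\<Lambda> * \<theta> \<le> \<Lambda> * \<theta> powr s0" using \<Lambda> \<theta> by (intro mult_left_mono) auto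
        then show ?thesis using \<theta>s by linarith
      qed
      then have "(\<lambda>n. (\<Lambda> * \<theta>) ^ Suc n) \<longlonglongrightarrow> 0"
        using \<Lambda> \<theta> by (intro LIMSEQ_Suc LIMSEQ_power_zero) auto
      then show "(\<lambda>n. 2 * C1 * (\<Lambda> * \<theta>) ^ Suc n) \<longlonglongrightarrow> 0" by (rule tendsto_mult_right_zero)
    qed
    then have "(\<lambda>n. p n (of_real t) \<sigma>) \<longlonglongrightarrow> V t \<sigma>" by (rule LIM_zero_cancel)
    then show ?thesis using Plim(2)[of "of_real t" \<sigma>] t \<sigma> LIMSEQ_unique by auto
  qed
  have key: "W s r \<i> = P \<i> (of_real s + \<i> * of_real r)" if sr: "\<bar>s\<bar> \<le> d/4" "\<bar>r\<bar> \<le> d/4" for s r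
  proof -
    define Q where "Q = box (Complex (-a/2) (-3/2)) (Complex (a/2) (3/2))"
    have inQ: "z \<in> Q \<longleftrightarrow> \<bar>Re z\<bar> < a/2 \<and> \<bar>Im z\<bar> < 3/2" for z
      by (auto simp: Q_def in_box_complex_iff abs_less_iff)
    have Qstrip: "Q \<subseteq> strip (2*a)" using a by (auto simp: inQ strip_def)
    have arg: "cmod (of_real s + z * of_real r) \<le> d" if "z \<in> Q" for z
    proof -
      have "cmod z \<le> 2" using cmod_le[of z] that a by (simp add: inQ)
      then have "cmod z * \<bar>r\<bar> \<le> 2 * (d/4)" using sr by (intro mult_mono) auto
      then show ?thesis using sr norm_triangle_ineq[of "of_real s" "z * of_real r"] d
        by (simp add: norm_mult)
    qed
    have "(\<lambda>z. P z (of_real s + z * of_real r)) holomorphic_on Q"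
    proof (rule holomorphic_limit_geometric)
      show "(\<lambda>z. p n z (of_real s + z * of_real r)) holomorphic_on Q" for n
        unfolding p_def
      proof (intro holomorphic_on_sum holomorphic_on_mult)
        fix i assume "i \<in> {..Suc n}"
        then show "U (node d (Suc n) i) holomorphic_on Q"
          using holomorphic_on_subset[OF U(1)[OF nd] Qstrip] by simp
        have "(lag d (Suc n) i \<circ> (\<lambda>z. of_real s + z * of_real r)) holomorphic_on Q"
          by (intro holomorphic_on_compose lag_holomorphic holomorphic_intros)
        then show "(\<lambda>z. lag d (Suc n) i (of_real s + z * of_real r)) holomorphic_on Q" by (simp add: o_def)
      qed
      show "cmod (p n z (of_real s + z * of_real r) - P z (of_real s + z * of_real r)) \<le> 2 * B * (1/2) ^ n"
        if "z \<in> Q" for n z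
        using that arg by (intro Plim) (auto simp: inQ)
    qed (simp add: Q_def open_box)
    moreover have "W s r holomorphic_on Q"
      using holomorphic_on_subset[OF W(1) Qstrip] sr d by simp
    ultimately have "P \<i> (of_real s + \<i> * of_real r) = W s r \<i>"
    proof (rule holomorphic_eq_of_real[where r = "min (a/2) \<rho>"])
      show "open Q" "convex Q" by (auto simp: Q_def open_box)
      show "0 \<in> Q" "\<i> \<in> Q" "min (a/2) \<rho> > 0" using a \<rho> by (auto simp: inQ)
      fix t assume t: "\<bar>t\<bar> < min (a/2) \<rho>"
      have st: "of_real s + of_real t * of_real r = complex_of_real (s + t * r)" by simp
      have tQ: "of_real t \<in> Q" using t by (simp add: inQ)
      have ct: "cmod (complex_of_real (s + t * r)) \<le> d" using arg[OF tQ] unfolding st[symmetric] .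
      then have "\<bar>s + t * r\<bar> \<le> d" by (simp only: norm_of_real)
      then have "P (of_real t) (of_real (s + t * r)) = u t (s + t * r)"
        using Preal[of t "of_real (s + t * r)", OF _ ct] V(3)[of t "s + t * r"] t d a by simp
      also have "\<dots> = W s r (of_real t)" using W(2)[of s r t] sr d t by simp
      finally show "P (of_real t) (of_real s + of_real t * of_real r) = W s r (of_real t)" unfolding st .
    qed
    then show ?thesis by simp
  qed
  have "(\<lambda>\<zeta>. P \<i> \<zeta>) holomorphic_on ball 0 (d/4)"
  proof (rule holomorphic_limit_geometric)
    show "(\<lambda>\<zeta>. p n \<i> \<zeta>) holomorphic_on ball 0 (d/4)" for n
      unfolding p_def by (intro holomorphic_on_sum holomorphic_on_mult lag_holomorphic holomorphic_on_const)
    show "cmod (p n \<i> z - P \<i> z) \<le> 2 * B * (1/2) ^ n" if "z \<in> ball 0 (d/4)" for n z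
      using that a d by (intro Plim) auto
  qed simp
  moreover have "W (Re \<zeta>) (Im \<zeta>) \<i> = P \<i> \<zeta>" if "\<zeta> \<in> ball 0 (d/4)" for \<zeta>
  proof -
    have "\<bar>Re \<zeta>\<bar> \<le> d/4" "\<bar>Im \<zeta>\<bar> \<le> d/4"
      using that abs_Re_le_cmod[of \<zeta>] abs_Im_le_cmod[of \<zeta>] by auto
    then show ?thesis using key complex_eq[of \<zeta>] by metis
  qed
  ultimately have "(\<lambda>\<zeta>. W (Re \<zeta>) (Im \<zeta>) \<i>) holomorphic_on ball 0 (d/4)"
    by (subst holomorphic_cong[OF refl]) (auto simp: dist_norm)
  then show ?thesis using d by (intro exI[of _ "d/4"]) auto
qed

section \<open>Matrices over a C*-algebra\<close>

lemma state_add: "state \<omega> \<Longrightarrow> \<omega> (x + y) = \<omega> x + \<omega> y"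
  and state_scaleC: "state \<omega> \<Longrightarrow> \<omega> (z *\<^sub>C x) = z * \<omega> x"
  and state_star: "state \<omega> \<Longrightarrow> \<omega> (star x) = cnj (\<omega> x)"
  and state_bound: "state \<omega> \<Longrightarrow> cmod (\<omega> x) \<le> 2 * norm x"
  and state_pos: "state \<omega> \<Longrightarrow> 0 \<le> Re (\<omega> (star x * x))"
  unfolding state_def by blast+

lemma state_zero: "state \<omega> \<Longrightarrow> \<omega> 0 = 0"
  using state_scaleC[of \<omega> 0 0] by simp

lemma state_minus: "state \<omega> \<Longrightarrow> \<omega> (- x) = - \<omega> x"
  using state_scaleC[of \<omega> "-1" x] by (simp add: scaleC_minus_left)

lemma state_diff: "state \<omega> \<Longrightarrow> \<omega> (x - y) = \<omega> x - \<omega> y"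
  using state_add[of \<omega> x "-y"] by (simp add: state_minus)

lemma state_sum: "state \<omega> \<Longrightarrow> \<omega> (\<Sum>i\<in>I. g i) = (\<Sum>i\<in>I. \<omega> (g i))"
  by (induction I rule: infinite_finite_induct) (simp_all add: state_zero state_add)

subsection \<open>The operator norm and the entry norm\<close>

text \<open>The sum of the norms of the entries. For a fixed size it is equivalent to the operator norm, so
  that continuity and differentiability can be checked entrywise.\<close>

definition enorm :: "nat \<Rightarrow> 'a::cstar_algebra mat \<Rightarrow> real" where
  "enorm n X = (\<Sum>i<n. \<Sum>j<n. norm (X $$ (i, j)))"

lemma enorm_nonneg: "enorm n X \<ge> 0"
  unfolding enorm_def by (intro sum_nonneg) auto

text \<open>The summand of one entry is dominated, in the order of the cone, by the whole sum.\<close>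

lemma norm_entry_le_module_norm:
  assumes "i < dim_vec v" shows "norm (vec_index v i) \<le> module_norm v"
proof -
  let ?s = "\<lambda>j. star (vec_index v j) * vec_index v j"
  have "(\<Sum>j<dim_vec v. ?s j) - ?s i = (\<Sum>j\<in>{..<dim_vec v}-{i}. ?s j)"
    using assms by (subst sum.remove[of "{..<dim_vec v}" i]) auto
  moreover have "cpos (\<Sum>j\<in>{..<dim_vec v}-{i}. ?s j)" by (intro cpos_sum cpos_star_mult)
  ultimately have "norm (?s i) \<le> norm (\<Sum>j<dim_vec v. ?s j)"
    by (intro norm_le_of_cpos_le cpos_star_mult) simp
  then have "sqrt ((norm (vec_index v i))\<^sup>2) \<le> module_norm v"
    unfolding module_norm_def by (simp only: cstar_identity real_sqrt_le_iff)
  then show ?thesis by simp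
qed

lemma module_norm_le: "module_norm v \<le> (\<Sum>i<dim_vec v. norm (vec_index v i))"
proof -
  have "norm (\<Sum>i<dim_vec v. star (vec_index v i) * vec_index v i) \<le> (\<Sum>i<dim_vec v. (norm (vec_index v i))\<^sup>2)"
    by (rule order_trans[OF norm_sum]) (simp add: cstar_identity)
  then have "module_norm v \<le> L2_set (\<lambda>i. norm (vec_index v i)) {..<dim_vec v}"
    unfolding module_norm_def L2_set_def by simp
  also have "\<dots> \<le> (\<Sum>i<dim_vec v. norm (vec_index v i))" by (rule L2_set_le_sum) simp
  finally show ?thesis .
qed

lemma module_norm_nonneg: "module_norm v \<ge> 0"
  by (simp add: module_norm_def)

lemma module_norm_mult_le:
  assumes "X \<in> carrier_mat n n" "v \<in> carrier_vec n"
  shows "module_norm (X *\<^sub>v v) \<le> enorm n X * module_norm v"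
proof -
  have "module_norm (X *\<^sub>v v) \<le> (\<Sum>i<n. norm (vec_index (X *\<^sub>v v) i))"
    using module_norm_le[of "X *\<^sub>v v"] assms by simp
  also have "\<dots> \<le> (\<Sum>i<n. \<Sum>j<n. norm (X $$ (i, j)) * module_norm v)"
  proof (intro sum_mono)
    fix i assume "i \<in> {..<n}"
    then have "vec_index (X *\<^sub>v v) i = (\<Sum>j<n. X $$ (i, j) * vec_index v j)"
      using assms by (simp add: scalar_prod_def atLeast0LessThan)
    also have "norm \<dots> \<le> (\<Sum>j<n. norm (X $$ (i, j)) * module_norm v)"
    proof (rule order_trans[OF norm_sum sum_mono])
      fix j assume "j \<in> {..<n}"
      then have "norm (vec_index v j) \<le> module_norm v" using assms by (intro norm_entry_le_module_norm) simp
      then show "norm (X $$ (i, j) * vec_index v j) \<le> norm (X $$ (i, j)) * module_norm v"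
        using norm_mult_ineq by (meson mult_left_mono norm_ge_zero order_trans)
    qed
    finally show "norm (vec_index (X *\<^sub>v v) i) \<le> (\<Sum>j<n. norm (X $$ (i, j)) * module_norm v)" .
  qed
  also have "\<dots> = enorm n X * module_norm v" by (simp add: enorm_def sum_distrib_right)
  finally show ?thesis .
qed

lemma module_norm_ratio_le:
  assumes "X \<in> carrier_mat n n" "v \<in> carrier_vec n"
  shows "module_norm (X *\<^sub>v v) / module_norm v \<le> enorm n X"
proof (cases "module_norm v = 0")
  case False
  then have "module_norm v > 0" using module_norm_nonneg[of v] by simp
  then show ?thesis using module_norm_mult_le[OF assms] by (simp add: divide_le_eq)
qed (simp add: enorm_nonneg)

lemma mat_norm_le_enorm: "X \<in> carrier_mat n n \<Longrightarrow> mat_norm X \<le> enorm n X"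
  unfolding mat_norm_def by (intro cSUP_least) (auto intro: module_norm_ratio_le zero_carrier_vec)

lemma entry_le_mat_norm:
  assumes X: "X \<in> carrier_mat n n" and ij: "i < n" "j < n"
  shows "norm (X $$ (i, j)) \<le> mat_norm X"
proof -
  let ?e = "unit_vec n j :: 'a Matrix.vec"
  have "(\<Sum>k<n. star (vec_index ?e k) * vec_index ?e k) = (\<Sum>k<n. if k = j then 1 else 0)"
    using ij by (intro sum.cong) auto
  then have e: "module_norm ?e = 1" using ij by (simp add: module_norm_def)
  have "X *\<^sub>v ?e = Matrix.col X j" by (rule eq_vecI) (use X ij in auto)
  then have "norm (X $$ (i, j)) \<le> module_norm (X *\<^sub>v ?e)"
    using norm_entry_le_module_norm[of i "Matrix.col X j"] X ij by simp
  also have "\<dots> = module_norm (X *\<^sub>v ?e) / module_norm ?e" by (simp add: e)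
  also have "\<dots> \<le> mat_norm X"
    unfolding mat_norm_def using X module_norm_ratio_le[OF X]
    by (intro cSUP_upper bdd_aboveI2[of _ _ "enorm n X"]) auto
  finally show ?thesis .
qed

lemma enorm_le_mat_norm: "X \<in> carrier_mat n n \<Longrightarrow> enorm n X \<le> real n * real n * mat_norm X"
proof -
  assume X: "X \<in> carrier_mat n n"
  have "enorm n X \<le> (\<Sum>i<n. \<Sum>j<n. mat_norm X)"
    unfolding enorm_def by (intro sum_mono entry_le_mat_norm[OF X]) auto
  then show ?thesis by (simp add: mult.assoc)
qed

lemma mat_norm_nonneg: "X \<in> carrier_mat n n \<Longrightarrow> n \<ge> 1 \<Longrightarrow> mat_norm X \<ge> 0"
  by (rule order_trans[OF norm_ge_zero entry_le_mat_norm[of X n 0 0]]) auto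

lemma enorm_add: "X \<in> carrier_mat n n \<Longrightarrow> Y \<in> carrier_mat n n \<Longrightarrow> enorm n (X + Y) \<le> enorm n X + enorm n Y"
  unfolding enorm_def sum.distrib[symmetric] by (intro sum_mono) (auto intro: norm_triangle_ineq)

lemma enorm_scaleC: "X \<in> carrier_mat n n \<Longrightarrow> enorm n (z *\<^sub>C\<^sub>m X) = cmod z * enorm n X"
  unfolding enorm_def mat_scaleC_def by (simp add: norm_scaleC sum_distrib_left)

subsection \<open>Tensor levels\<close>

lemma scaleC_mat_index [simp]:
  "i < dim_row X \<Longrightarrow> j < dim_col X \<Longrightarrow> (z *\<^sub>C\<^sub>m X) $$ (i, j) = z *\<^sub>C X $$ (i, j)"
  by (simp add: mat_scaleC_def)

lemma scaleC_mat_carrier [simp]: "z *\<^sub>C\<^sub>m X \<in> carrier_mat n m \<longleftrightarrow> X \<in> carrier_mat n m"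
  by (simp add: mat_scaleC_def)

lemma scaleC_mat_dim [simp]: "dim_row (z *\<^sub>C\<^sub>m X) = dim_row X" "dim_col (z *\<^sub>C\<^sub>m X) = dim_col X"
  by (simp_all add: mat_scaleC_def)

lemma tensor_levelE:
  assumes "X \<in> tensor_level n V R"
  obtains m :: nat and H r where "X = Matrix.mat n n (\<lambda>(i, j). \<Sum>k<m. (H k $$ (i, j)) *\<^sub>C r k)"
    "\<And>k. k < m \<Longrightarrow> H k \<in> V" "\<And>k. k < m \<Longrightarrow> r k \<in> R"
  using assms unfolding tensor_level_def by blast

lemma tensor_level_carrier: "X \<in> tensor_level n V R \<Longrightarrow> X \<in> carrier_mat n n"
  by (elim tensor_levelE) simp

lemma tensor_levelI:
  fixes m :: nat
  assumes "\<And>k. k < m \<Longrightarrow> H k \<in> V" "\<And>k. k < m \<Longrightarrow> r k \<in> R" "X \<in> carrier_mat n n"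
    "\<And>i j. i < n \<Longrightarrow> j < n \<Longrightarrow> X $$ (i, j) = (\<Sum>k<m. (H k $$ (i, j)) *\<^sub>C r k)"
  shows "X \<in> tensor_level n V R"
proof -
  have "X = Matrix.mat n n (\<lambda>(i, j). \<Sum>k<m. (H k $$ (i, j)) *\<^sub>C r k)"
    using assms(3,4) by (intro eq_matI) auto
  then show ?thesis unfolding tensor_level_def using assms(1,2) by blast
qed

lemma tensor_level_add:
  assumes "X \<in> tensor_level n V R" "Y \<in> tensor_level n V R" shows "X + Y \<in> tensor_level n V R"
proof -
  obtain m :: nat and H r where X: "X = Matrix.mat n n (\<lambda>(i, j). \<Sum>k<m. (H k $$ (i, j)) *\<^sub>C r k)"
    "\<And>k. k < m \<Longrightarrow> H k \<in> V" "\<And>k. k < m \<Longrightarrow> r k \<in> R"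
    using assms(1) by (rule tensor_levelE) (rule that)
  obtain m' :: nat and H' r' where Y: "Y = Matrix.mat n n (\<lambda>(i, j). \<Sum>k<m'. (H' k $$ (i, j)) *\<^sub>C r' k)"
    "\<And>k. k < m' \<Longrightarrow> H' k \<in> V" "\<And>k. k < m' \<Longrightarrow> r' k \<in> R"
    using assms(2) by (rule tensor_levelE) (rule that)
  show ?thesis
  proof (rule tensor_levelI[of "m + m'" "\<lambda>k. if k < m then H k else H' (k - m)" _ "\<lambda>k. if k < m then r k else r' (k - m)"])
    fix i j assume ij: "i < n" "j < n"
    let ?g = "\<lambda>k. ((if k < m then H k else H' (k - m)) $$ (i, j)) *\<^sub>C (if k < m then r k else r' (k - m))"
    have "(\<Sum>k<m+m'. ?g k) = (\<Sum>k<m. ?g k) + (\<Sum>k=m..<m+m'. ?g k)"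
      using sum.atLeastLessThan_concat[of 0 m "m + m'" ?g] by (simp only: lessThan_atLeast0 le0 le_add1)
    also have "(\<Sum>k=m..<m+m'. ?g k) = (\<Sum>k<m'. ?g (k + m))"
      using sum.shift_bounds_nat_ivl[of ?g 0 m m'] by (simp add: lessThan_atLeast0 add.commute)
    finally show "(X + Y) $$ (i, j) = (\<Sum>k<m+m'. ?g k)" using ij by (simp add: X(1) Y(1))
  qed (use X Y in auto)
qed

text \<open>The shape shared by the closure properties other than sums: a map of the complex factors.\<close>

lemma tensor_level_map:
  assumes "X \<in> tensor_level n V R" "Z \<in> carrier_mat n n"
    and "\<And>H. H \<in> V \<Longrightarrow> \<Phi> H \<in> V'"
    and "\<And>(m::nat) H r i j. (\<And>k. k < m \<Longrightarrow> H k \<in> V) \<Longrightarrow> (\<And>k. k < m \<Longrightarrow> r k \<in> R) \<Longrightarrow> i < n \<Longrightarrow> j < n \<Longrightarrow>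
       X = Matrix.mat n n (\<lambda>(i, j). \<Sum>k<m. (H k $$ (i, j)) *\<^sub>C r k) \<Longrightarrow>
       Z $$ (i, j) = (\<Sum>k<m. (\<Phi> (H k) $$ (i, j)) *\<^sub>C r k)"
  shows "Z \<in> tensor_level n V' R"
proof -
  obtain m :: nat and H r where X: "X = Matrix.mat n n (\<lambda>(i, j). \<Sum>k<m. (H k $$ (i, j)) *\<^sub>C r k)"
    "\<And>k. k < m \<Longrightarrow> H k \<in> V" "\<And>k. k < m \<Longrightarrow> r k \<in> R"
    using assms(1) by (rule tensor_levelE) (rule that)
  show ?thesis
    by (rule tensor_levelI[of m "\<lambda>k. \<Phi> (H k)" _ r]) (use X assms in auto)
qed

lemma M_level_carrier: "X \<in> M_level R n \<Longrightarrow> X \<in> carrier_mat n n"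
  and S_level_carrier: "X \<in> S_level R n \<Longrightarrow> X \<in> carrier_mat n n"
  unfolding M_level_def S_level_def by (rule tensor_level_carrier; assumption)+

lemma hermitian_carrier: "H \<in> hermitian_cmats n \<Longrightarrow> H \<in> carrier_mat n n"
  by (simp add: hermitian_cmats_def)

lemma hermitian_entry:
  assumes "H \<in> hermitian_cmats n" "i < n" "j < n" shows "cnj (H $$ (j, i)) = H $$ (i, j)"
proof -
  have "mat_star H $$ (i, j) = cnj (H $$ (j, i))"
    using assms(2,3) carrier_matD[OF hermitian_carrier[OF assms(1)]]
    by (simp add: mat_star_def star_complex_def)
  then show ?thesis using assms(1) by (simp add: hermitian_cmats_def)
qed

lemma hermitianI:
  assumes "H \<in> carrier_mat n n" "\<And>i j. i < n \<Longrightarrow> j < n \<Longrightarrow> cnj (H $$ (j, i)) = H $$ (i, j)"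
  shows "H \<in> hermitian_cmats n"
  using assms by (auto simp: hermitian_cmats_def mat_star_def star_complex_def intro!: eq_matI)

lemma S_subset_M: "X \<in> S_level R n \<Longrightarrow> X \<in> M_level R n"
  unfolding S_level_def M_level_def
  by (rule tensor_level_map[where \<Phi> = "\<lambda>H. H" and X = X and V = "hermitian_cmats n"])
     (auto dest: tensor_level_carrier hermitian_carrier)

lemma M_level_add: "X \<in> M_level R n \<Longrightarrow> Y \<in> M_level R n \<Longrightarrow> X + Y \<in> M_level R n"
  and S_level_add: "X \<in> S_level R n \<Longrightarrow> Y \<in> S_level R n \<Longrightarrow> X + Y \<in> S_level R n"
  unfolding M_level_def S_level_def by (rule tensor_level_add; assumption)+

lemma M_level_scaleC: "X \<in> M_level R n \<Longrightarrow> z *\<^sub>C\<^sub>m X \<in> M_level R n"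
  unfolding M_level_def
  by (rule tensor_level_map[where \<Phi> = "\<lambda>H. Matrix.mat n n (\<lambda>(i, j). z * H $$ (i, j))"])
     (auto dest: tensor_level_carrier simp: scaleC_sum_right scaleC_scaleC)

lemma S_level_scaleC:
  assumes X: "X \<in> S_level R n" shows "complex_of_real t *\<^sub>C\<^sub>m X \<in> S_level R n"
  unfolding S_level_def
proof (rule tensor_level_map[where \<Phi> = "\<lambda>H. Matrix.mat n n (\<lambda>(i, j). complex_of_real t * H $$ (i, j))"])
  show "X \<in> tensor_level n (hermitian_cmats n) R" using X by (simp add: S_level_def)
  show "complex_of_real t *\<^sub>C\<^sub>m X \<in> carrier_mat n n" using S_level_carrier[OF X] by simp
  show "Matrix.mat n n (\<lambda>(i, j). complex_of_real t * H $$ (i, j)) \<in> hermitian_cmats n"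
    if H: "H \<in> hermitian_cmats n" for H
    by (rule hermitianI) (simp_all add: hermitian_entry[OF H])
qed (simp add: scaleC_sum_right scaleC_scaleC)

lemma S_level_star:
  assumes "real_operator_system R" "X \<in> S_level R n" "i < n" "j < n"
  shows "star (X $$ (j, i)) = X $$ (i, j)"
proof -
  obtain m :: nat and H r where X: "X = Matrix.mat n n (\<lambda>(i, j). \<Sum>k<m. (H k $$ (i, j)) *\<^sub>C r k)"
    "\<And>k. k < m \<Longrightarrow> H k \<in> hermitian_cmats n" "\<And>k. k < m \<Longrightarrow> r k \<in> R"
    using assms(2)[unfolded S_level_def] by (rule tensor_levelE) (rule that)
  have "star (r k) = r k" if "k < m" for k using X(3)[OF that] assms(1) by (simp add: real_operator_system_def)
  then show ?thesis using assms(3,4) hermitian_entry[OF X(2)]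
    by (simp add: X(1) star_sum star_scaleC)
qed

definition re_mat :: "'a::cstar_algebra mat \<Rightarrow> 'a mat" where
  "re_mat Z = Matrix.mat (dim_row Z) (dim_col Z) (\<lambda>(i, j). (1/2) *\<^sub>C (Z $$ (i, j) + star (Z $$ (j, i))))"

definition im_mat :: "'a::cstar_algebra mat \<Rightarrow> 'a mat" where
  "im_mat Z = Matrix.mat (dim_row Z) (dim_col Z) (\<lambda>(i, j). (- \<i>/2) *\<^sub>C (Z $$ (i, j) - star (Z $$ (j, i))))"

lemma re_mat_carrier [simp]: "Z \<in> carrier_mat n n \<Longrightarrow> re_mat Z \<in> carrier_mat n n"
  and im_mat_carrier [simp]: "Z \<in> carrier_mat n n \<Longrightarrow> im_mat Z \<in> carrier_mat n n"
  by (auto simp: re_mat_def im_mat_def)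

text \<open>Taking real and imaginary parts acts on the complex factors, since the elements of a real operator
  system are self-adjoint.\<close>

lemma re_im_mat_S_level:
  assumes R: "real_operator_system R" and Z: "Z \<in> M_level R n"
  shows "re_mat Z \<in> S_level R n" "im_mat Z \<in> S_level R n"
proof -
  note c = M_level_carrier[OF Z]
  have st: "star (r k) = r k" if "r k \<in> R" for r :: "nat \<Rightarrow> 'a" and k
    using that R by (simp add: real_operator_system_def)
  show "re_mat Z \<in> S_level R n"
    unfolding S_level_def
  proof (rule tensor_level_map[where \<Phi> = "\<lambda>H. Matrix.mat n n (\<lambda>(i, j). (1/2) * (H $$ (i, j) + cnj (H $$ (j, i))))"])
    show "Z \<in> tensor_level n (carrier_mat n n) R" using Z by (simp add: M_level_def)
    fix m :: nat and H r i j
    assume a: "\<And>k. k < m \<Longrightarrow> r k \<in> R" "i < n" "j < n" "Z = Matrix.mat n n (\<lambda>(i, j). \<Sum>k<m. (H k $$ (i, j)) *\<^sub>C r k)"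
    have "re_mat Z $$ (i, j) = (1/2) *\<^sub>C (\<Sum>k<m. (H k $$ (i, j)) *\<^sub>C r k + cnj (H k $$ (j, i)) *\<^sub>C r k)"
      using a by (simp add: re_mat_def star_sum star_scaleC st sum.distrib)
    also have "\<dots> = (\<Sum>k<m. ((1/2) * (H k $$ (i, j) + cnj (H k $$ (j, i)))) *\<^sub>C r k)"
      by (simp only: scaleC_sum_right scaleC_add_left[symmetric] scaleC_scaleC)
    finally show "re_mat Z $$ (i, j) = (\<Sum>k<m. (Matrix.mat n n (\<lambda>(i, j). (1/2) * (H k $$ (i, j) + cnj (H k $$ (j, i)))) $$ (i, j)) *\<^sub>C r k)"
      using a by simp
  qed (use c in \<open>auto intro!: hermitianI\<close>)
  show "im_mat Z \<in> S_level R n"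
    unfolding S_level_def
  proof (rule tensor_level_map[where \<Phi> = "\<lambda>H. Matrix.mat n n (\<lambda>(i, j). (- \<i>/2) * (H $$ (i, j) + (- 1) * cnj (H $$ (j, i))))"])
    show "Z \<in> tensor_level n (carrier_mat n n) R" using Z by (simp add: M_level_def)
    fix m :: nat and H r i j
    assume a: "\<And>k. k < m \<Longrightarrow> r k \<in> R" "i < n" "j < n" "Z = Matrix.mat n n (\<lambda>(i, j). \<Sum>k<m. (H k $$ (i, j)) *\<^sub>C r k)"
    have "im_mat Z $$ (i, j) = (- \<i>/2) *\<^sub>C (\<Sum>k<m. (H k $$ (i, j)) *\<^sub>C r k + ((- 1) * cnj (H k $$ (j, i))) *\<^sub>C r k)"
      using a by (simp add: im_mat_def star_sum star_scaleC st sum.distrib sum_subtractf scaleC_minus_left)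
    also have "\<dots> = (\<Sum>k<m. ((- \<i>/2) * (H k $$ (i, j) + (- 1) * cnj (H k $$ (j, i)))) *\<^sub>C r k)"
      by (simp only: scaleC_sum_right scaleC_add_left[symmetric] scaleC_scaleC)
    finally show "im_mat Z $$ (i, j) = (\<Sum>k<m. (Matrix.mat n n (\<lambda>(i, j). (- \<i>/2) * (H k $$ (i, j) + (- 1) * cnj (H k $$ (j, i)))) $$ (i, j)) *\<^sub>C r k)"
      using a by simp
  qed (use c in \<open>auto intro!: hermitianI simp: algebra_simps\<close>)
qed

lemma re_im_decomposition:
  assumes "Z \<in> carrier_mat n n" shows "Z = re_mat Z + \<i> *\<^sub>C\<^sub>m im_mat Z"
proof (rule eq_matI)
  fix i j assume "i < dim_row (re_mat Z + \<i> *\<^sub>C\<^sub>m im_mat Z)" "j < dim_col (re_mat Z + \<i> *\<^sub>C\<^sub>m im_mat Z)"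
  then have ij: "i < dim_row Z" "j < dim_col Z" by (simp_all add: im_mat_def)
  have "x = (1/2) *\<^sub>C (x + y) + (1/2) *\<^sub>C (x - y)" for x y :: 'a
  proof -
    have "(1/2) *\<^sub>C (x + y) + (1/2) *\<^sub>C (x - y) = (1/2 + 1/2) *\<^sub>C x"
      by (simp only: scaleC_add_left) (simp add: scaleC_add_right scaleC_diff_right)
    then show ?thesis by simp
  qed
  then show "Z $$ (i, j) = (re_mat Z + \<i> *\<^sub>C\<^sub>m im_mat Z) $$ (i, j)"
    using ij by (simp add: re_mat_def im_mat_def scaleC_scaleC)
qed (simp_all add: im_mat_def)

lemma re_im_unique:
  assumes R: "real_operator_system R" and X: "X \<in> S_level R n" and Y: "Y \<in> S_level R n"
  shows "re_mat (X + \<i> *\<^sub>C\<^sub>m Y) = X" "im_mat (X + \<i> *\<^sub>C\<^sub>m Y) = Y"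
proof -
  note c = S_level_carrier[OF X] S_level_carrier[OF Y]
  have half: "(1/2) *\<^sub>C (x + x) = x" for x :: 'a
    by (simp add: scaleC_add_right scaleC_add_left[symmetric])
  show "re_mat (X + \<i> *\<^sub>C\<^sub>m Y) = X"
  proof (rule eq_matI)
    fix i j assume "i < dim_row X" "j < dim_col X"
    then show "re_mat (X + \<i> *\<^sub>C\<^sub>m Y) $$ (i, j) = X $$ (i, j)"
      using c half by (simp add: re_mat_def star_add star_scaleC scaleC_minus_left
          S_level_star[OF R X] S_level_star[OF R Y])
  qed (use c in \<open>auto simp: re_mat_def\<close>)
  show "im_mat (X + \<i> *\<^sub>C\<^sub>m Y) = Y"
  proof (rule eq_matI)
    fix i j assume "i < dim_row Y" "j < dim_col Y"
    then show "im_mat (X + \<i> *\<^sub>C\<^sub>m Y) $$ (i, j) = Y $$ (i, j)"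
      using c half[of "Y $$ (i,j)"] by (simp add: im_mat_def star_add star_scaleC scaleC_minus_left
          S_level_star[OF R X] S_level_star[OF R Y] scaleC_add_right scaleC_scaleC)
  qed (use c in \<open>auto simp: im_mat_def\<close>)
qed

lemma enorm_re_im_mat:
  assumes "Z \<in> carrier_mat n n"
  shows "enorm n (re_mat Z) \<le> enorm n Z" "enorm n (im_mat Z) \<le> enorm n Z"
proof -
  have swap: "(\<Sum>i<n. \<Sum>j<n. norm (Z $$ (j, i))) = enorm n Z"
    unfolding enorm_def by (rule sum.swap)
  have "enorm n (re_mat Z) \<le> (\<Sum>i<n. \<Sum>j<n. (norm (Z $$ (i, j)) + norm (Z $$ (j, i))) / 2)"
    unfolding enorm_def
  proof (intro sum_mono)
    fix i j assume "i \<in> {..<n}" "j \<in> {..<n}"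
    then show "norm (re_mat Z $$ (i, j)) \<le> (norm (Z $$ (i, j)) + norm (Z $$ (j, i))) / 2"
      using assms norm_triangle_ineq[of "Z $$ (i, j)" "star (Z $$ (j, i))"]
      by (simp add: re_mat_def norm_scaleC)
  qed
  also have "\<dots> = enorm n Z"
    using swap by (simp add: sum_divide_distrib[symmetric] sum.distrib) (simp add: enorm_def)
  finally show "enorm n (re_mat Z) \<le> enorm n Z" .
  have "enorm n (im_mat Z) \<le> (\<Sum>i<n. \<Sum>j<n. (norm (Z $$ (i, j)) + norm (Z $$ (j, i))) / 2)"
    unfolding enorm_def
  proof (intro sum_mono)
    fix i j assume "i \<in> {..<n}" "j \<in> {..<n}"
    then show "norm (im_mat Z $$ (i, j)) \<le> (norm (Z $$ (i, j)) + norm (Z $$ (j, i))) / 2"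
      using assms norm_triangle_ineq4[of "Z $$ (i, j)" "star (Z $$ (j, i))"]
      by (simp add: im_mat_def norm_scaleC norm_mult)
  qed
  also have "\<dots> = enorm n Z"
    using swap by (simp add: sum_divide_distrib[symmetric] sum.distrib) (simp add: enorm_def)
  finally show "enorm n (im_mat Z) \<le> enorm n Z" .
qed

subsection \<open>Block matrices\<close>

lemma sum_blocks:
  fixes g :: "nat \<Rightarrow> 'b::comm_monoid_add"
  shows "(\<Sum>p<m*n. g p) = (\<Sum>j<m. \<Sum>a<n. g (j * n + a))"
proof -
  have "(\<Sum>p<m*n. g p) = (\<Sum>j<m. sum g {j*n..<j*n+n})" by (rule sum.nat_group[symmetric])
  moreover have "sum g {k..<k+n} = (\<Sum>a<n. g (k + a))" for k
    using sum.shift_bounds_nat_ivl[of g 0 k n] by (simp add: lessThan_atLeast0 add.commute)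
  ultimately show ?thesis by (simp only:)
qed

lemma sum_blocks_mod:
  fixes g :: "nat \<Rightarrow> 'b::comm_monoid_add"
  assumes "b < n"
  shows "(\<Sum>p<m*n. if p mod n = b then g p else 0) = (\<Sum>j<m. g (j * n + b))"
proof -
  have "(\<Sum>p<m*n. if p mod n = b then g p else 0) = (\<Sum>j<m. \<Sum>a<n. if a = b then g (j * n + a) else 0)"
    unfolding sum_blocks by (intro sum.cong) auto
  also have "\<dots> = (\<Sum>j<m. g (j * n + b))" using assms by simp
  finally show ?thesis .
qed

lemma div_less_blocks: "p < m * n \<Longrightarrow> p div n < (m::nat)"
  by (simp add: less_mult_imp_div_less)

lemma mod_less_blocks: "p < m * n \<Longrightarrow> p mod n < (n::nat)"
  by (cases "n = 0") auto

definition block_diag :: "nat \<Rightarrow> nat \<Rightarrow> (nat \<Rightarrow> 'a::zero mat) \<Rightarrow> 'a mat" where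
  "block_diag n m A = Matrix.mat (m * n) (m * n)
     (\<lambda>(p, q). if p div n = q div n then A (p div n) $$ (p mod n, q mod n) else 0)"

lemma block_diag_carrier [simp]: "block_diag n m A \<in> carrier_mat (m * n) (m * n)"
  by (simp add: block_diag_def)

lemma block_diag_index:
  "p < m * n \<Longrightarrow> q < m * n \<Longrightarrow> block_diag n m A $$ (p, q) =
     (if p div n = q div n then A (p div n) $$ (p mod n, q mod n) else 0)"
  by (simp add: block_diag_def)

lemma block_diag_one: "A 0 \<in> carrier_mat n n \<Longrightarrow> block_diag n (Suc 0) A = A 0"
  by (intro eq_matI) (auto simp: block_diag_def)

lemma block_diag_Suc:
  assumes "A m \<in> carrier_mat n n" "n > 0"
  shows "block_diag n (Suc m) A = block_diag n m A \<oplus>\<^sub>m A m"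
proof (rule eq_matI)
  fix p q assume pq: "p < dim_row (block_diag n m A \<oplus>\<^sub>m A m)" "q < dim_col (block_diag n m A \<oplus>\<^sub>m A m)"
  have d: "dim_row (A m) = n" "dim_col (A m) = n" using assms by auto
  have dd: "dim_row (block_diag n m A \<oplus>\<^sub>m A m) = n + m * n" "dim_col (block_diag n m A \<oplus>\<^sub>m A m) = n + m * n"
    by (simp_all add: Defs.dsum_def block_diag_def d)
  have pq': "p < n + m * n" "q < n + m * n" using pq dd by simp_all
  have div: "(r < m * n \<longleftrightarrow> r div n < m)" for r using assms(2) by (simp add: div_less_iff_less_mult)
  have big: "r div n = m \<and> r mod n = r - m * n" if "r < n + m * n" "\<not> r < m * n" for r
  proof -
    have "r div n = m" using that assms(2) by (intro div_nat_eqI) (auto simp: mult.commute)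
    then show ?thesis using minus_mult_div_eq_mod[of r n] by (simp add: mult.commute)
  qed
  have l: "block_diag n (Suc m) A $$ (p, q) = (if p div n = q div n then A (p div n) $$ (p mod n, q mod n) else 0)"
    by (rule block_diag_index) (use pq' in simp_all)
  have dB: "dim_row (block_diag n m A) = m * n" "dim_col (block_diag n m A) = m * n"
    by (simp_all add: block_diag_def)
  have r: "(block_diag n m A \<oplus>\<^sub>m A m) $$ (p, q) = (if p < m * n then if q < m * n then block_diag n m A $$ (p, q) else 0
      else if q < m * n then 0 else A m $$ (p - m * n, q - m * n))"
    unfolding Defs.dsum_def using pq' by (subst index_mat_four_block) (simp_all add: dB d add.commute)
  consider "p < m * n" "q < m * n" | "p < m * n" "\<not> q < m * n" | "\<not> p < m * n" "q < m * n" | "\<not> p < m * n" "\<not> q < m * n"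
    by blast
  then show "block_diag n (Suc m) A $$ (p, q) = (block_diag n m A \<oplus>\<^sub>m A m) $$ (p, q)"
  proof cases
    case 1 then show ?thesis unfolding l r by (simp add: block_diag_index)
  next
    case 2 then show ?thesis unfolding l r using big[OF pq'(2)] div[of p] by simp
  next
    case 3 then show ?thesis unfolding l r using big[OF pq'(1)] div[of q] by simp
  next
    case 4 then show ?thesis unfolding l r using big[OF pq'(1)] big[OF pq'(2)] by simp
  qed
qed (use assms in \<open>auto simp: Defs.dsum_def block_diag_def\<close>)

text \<open>\<open>W \<otimes> 1\<^sub>n\<close> for a real matrix \<open>W\<close>.\<close>

definition kron_one :: "nat \<Rightarrow> nat \<Rightarrow> (nat \<Rightarrow> nat \<Rightarrow> real) \<Rightarrow> complex mat" where
  "kron_one n m W = Matrix.mat (m * n) (m * n)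
     (\<lambda>(p, q). if p mod n = q mod n then of_real (W (p div n) (q div n)) else 0)"

lemma kron_one_carrier [simp]: "kron_one n m W \<in> carrier_mat (m * n) (m * n)"
  by (simp add: kron_one_def)

lemma kron_one_index:
  "p < m * n \<Longrightarrow> q < m * n \<Longrightarrow> kron_one n m W $$ (p, q) =
     (if p mod n = q mod n then of_real (W (p div n) (q div n)) else 0)"
  by (simp add: kron_one_def)

lemma mat_star_kron_one: "mat_star (kron_one n m W) = kron_one n m (\<lambda>i j. W j i)"
  by (intro eq_matI) (auto simp: mat_star_def kron_one_def star_complex_def)

lemma mat_mult_index:
  assumes "A \<in> carrier_mat k k" "B \<in> carrier_mat k k" "p < k" "q < k"
  shows "(A * B) $$ (p, q) = (\<Sum>r<k. A $$ (p, r) * B $$ (r, q))"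
  using assms by (simp add: scalar_prod_def lessThan_atLeast0)

definition orthogonal_real :: "nat \<Rightarrow> (nat \<Rightarrow> nat \<Rightarrow> real) \<Rightarrow> bool" where
  "orthogonal_real m W \<longleftrightarrow> (\<forall>i<m. \<forall>k<m. (\<Sum>j<m. W j i * W j k) = (if i = k then 1 else 0)) \<and>
     (\<forall>i<m. \<forall>k<m. (\<Sum>j<m. W i j * W k j) = (if i = k then 1 else 0))"

lemma kron_one_mult:
  assumes "p < m * n" "q < m * n"
  shows "(kron_one n m V * kron_one n m W) $$ (p, q) =
    (if p mod n = q mod n then of_real (\<Sum>j<m. V (p div n) j * W j (q div n)) else 0)"
proof -
  have b: "p mod n < n" using mod_less_blocks[OF assms(1)] .
  have "(kron_one n m V * kron_one n m W) $$ (p, q) =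
     (\<Sum>r<m*n. if r mod n = p mod n then
        of_real (V (p div n) (r div n)) * (if p mod n = q mod n then of_real (W (r div n) (q div n)) else 0) else 0)"
    unfolding mat_mult_index[OF kron_one_carrier kron_one_carrier assms]
    using assms by (intro sum.cong) (auto simp: kron_one_index)
  also have "\<dots> = (\<Sum>j<m. of_real (V (p div n) j) * (if p mod n = q mod n then of_real (W j (q div n)) else 0))"
    unfolding sum_blocks_mod[OF b] using b by (intro sum.cong) auto
  finally show ?thesis by simp
qed

lemma unitary_kron_one:
  assumes "orthogonal_real m W" shows "unitary_cmat (m * n) (kron_one n m W)"
proof -
  have eqiff: "p = q \<longleftrightarrow> p div n = q div n \<and> p mod n = q mod n" for p q :: nat
    by (metis div_mult_mod_eq)
  have "kron_one n m (\<lambda>i j. W j i) * kron_one n m W = 1\<^sub>m (m * n)"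
  proof (rule eq_matI)
    fix p q assume "p < dim_row (1\<^sub>m (m * n) :: complex mat)" "q < dim_col (1\<^sub>m (m * n) :: complex mat)"
    then have pq: "p < m * n" "q < m * n" by auto
    then show "(kron_one n m (\<lambda>i j. W j i) * kron_one n m W) $$ (p, q) = 1\<^sub>m (m * n) $$ (p, q)"
      using assms div_less_blocks[OF pq(1)] div_less_blocks[OF pq(2)] eqiff[of p q]
      by (simp add: kron_one_mult orthogonal_real_def)
  qed (simp_all add: kron_one_def)
  moreover have "kron_one n m W * kron_one n m (\<lambda>i j. W j i) = 1\<^sub>m (m * n)"
  proof (rule eq_matI)
    fix p q assume "p < dim_row (1\<^sub>m (m * n) :: complex mat)" "q < dim_col (1\<^sub>m (m * n) :: complex mat)"
    then have pq: "p < m * n" "q < m * n" by auto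
    then show "(kron_one n m W * kron_one n m (\<lambda>i j. W j i)) $$ (p, q) = 1\<^sub>m (m * n) $$ (p, q)"
      using assms div_less_blocks[OF pq(1)] div_less_blocks[OF pq(2)] eqiff[of p q]
      by (simp add: kron_one_mult orthogonal_real_def)
  qed (simp_all add: kron_one_def)
  ultimately show ?thesis by (simp add: unitary_cmat_def mat_star_kron_one)
qed

text \<open>Conjugation by \<open>W \<otimes> 1\<close>, the operation that a free function respects.\<close>

definition rotate_by :: "nat \<Rightarrow> nat \<Rightarrow> (nat \<Rightarrow> nat \<Rightarrow> real) \<Rightarrow> 'a::cstar_algebra mat \<Rightarrow> 'a mat" where
  "rotate_by n m W X = embed_cmat (mat_star (kron_one n m W)) * X * embed_cmat (kron_one n m W)"

lemma embed_carrier [simp]: "embed_cmat S \<in> carrier_mat k l \<longleftrightarrow> S \<in> carrier_mat k l"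
  by (simp add: embed_cmat_def)

lemma embed_index: "p < dim_row S \<Longrightarrow> q < dim_col S \<Longrightarrow> embed_cmat S $$ (p, q) = (S $$ (p, q)) *\<^sub>C 1"
  by (simp add: embed_cmat_def)

lemma rotate_by_carrier [simp]: "X \<in> carrier_mat (m * n) (m * n) \<Longrightarrow> rotate_by n m W X \<in> carrier_mat (m * n) (m * n)"
  unfolding rotate_by_def mat_star_kron_one by (intro mult_carrier_mat[of _ _ "m*n"]) auto

lemma rotate_by_index:
  fixes X :: "'a::cstar_algebra mat"
  assumes X: "X \<in> carrier_mat (m * n) (m * n)" and pq: "p < m * n" "q < m * n"
  shows "rotate_by n m W X $$ (p, q) =
    (\<Sum>j<m. \<Sum>l<m. complex_of_real (W j (p div n) * W l (q div n)) *\<^sub>C X $$ (j * n + p mod n, l * n + q mod n))"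
proof -
  let ?k = "m * n" and ?K = "kron_one n m W" and ?K' = "kron_one n m (\<lambda>i j. W j i)"
  have b: "p mod n < n" "q mod n < n" using mod_less_blocks pq by auto
  have idx: "j * n + a < m * n" if "j < m" "a < n" for j a
  proof -
    have "j * n + a < Suc j * n" using that by simp
    also have "\<dots> \<le> m * n" using that by (intro mult_le_mono1) simp
    finally show ?thesis .
  qed
  have c: "embed_cmat ?K' * X \<in> carrier_mat ?k ?k" using X by (intro mult_carrier_mat[of _ _ ?k]) auto
  have left: "(embed_cmat ?K' * X) $$ (p, s) = (\<Sum>j<m. complex_of_real (W j (p div n)) *\<^sub>C X $$ (j * n + p mod n, s))"
    if s: "s < ?k" for s
  proof -
    have "(embed_cmat ?K' * X) $$ (p, s) = (\<Sum>r<?k. embed_cmat ?K' $$ (p, r) * X $$ (r, s))"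
      by (rule mat_mult_index) (use X pq s in auto)
    also have "\<dots> = (\<Sum>r<?k. if r mod n = p mod n then complex_of_real (W (r div n) (p div n)) *\<^sub>C X $$ (r, s) else 0)"
    proof (intro sum.cong refl)
      fix r assume "r \<in> {..<?k}"
      then have r: "r < ?k" by simp
      have "(embed_cmat ?K' :: 'a mat) $$ (p, r) = (?K' $$ (p, r)) *\<^sub>C 1"
        using pq r by (intro embed_index) (auto simp: kron_one_def)
      then show "embed_cmat ?K' $$ (p, r) * X $$ (r, s)
          = (if r mod n = p mod n then complex_of_real (W (r div n) (p div n)) *\<^sub>C X $$ (r, s) else 0)"
        using pq r by (auto simp: kron_one_index mult_scaleC_left)
    qed
    also have "\<dots> = (\<Sum>j<m. complex_of_real (W j (p div n)) *\<^sub>C X $$ (j * n + p mod n, s))"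
      unfolding sum_blocks_mod[OF b(1)] using b by (intro sum.cong) auto
    finally show ?thesis .
  qed
  have "rotate_by n m W X $$ (p, q) = (\<Sum>s<?k. (embed_cmat ?K' * X) $$ (p, s) * embed_cmat ?K $$ (s, q))"
    unfolding rotate_by_def mat_star_kron_one by (rule mat_mult_index[OF c]) (use pq in auto)
  also have "\<dots> = (\<Sum>s<?k. if s mod n = q mod n then complex_of_real (W (s div n) (q div n)) *\<^sub>C (embed_cmat ?K' * X) $$ (p, s) else 0)"
  proof (intro sum.cong refl)
    fix s assume "s \<in> {..<?k}"
    then have s: "s < ?k" by simp
    have "(embed_cmat ?K :: 'a mat) $$ (s, q) = (?K $$ (s, q)) *\<^sub>C 1"
      using pq s by (intro embed_index) (auto simp: kron_one_def)
    then show "(embed_cmat ?K' * X) $$ (p, s) * embed_cmat ?K $$ (s, q)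
        = (if s mod n = q mod n then complex_of_real (W (s div n) (q div n)) *\<^sub>C (embed_cmat ?K' * X) $$ (p, s) else 0)"
      using pq s by (auto simp: kron_one_index mult_scaleC_right)
  qed
  also have "\<dots> = (\<Sum>l<m. complex_of_real (W l (q div n)) *\<^sub>C (embed_cmat ?K' * X) $$ (p, l * n + q mod n))"
    unfolding sum_blocks_mod[OF b(2)] using b by (intro sum.cong) auto
  also have "\<dots> = (\<Sum>l<m. \<Sum>j<m. complex_of_real (W j (p div n) * W l (q div n)) *\<^sub>C X $$ (j * n + p mod n, l * n + q mod n))"
    using idx b by (intro sum.cong refl) (simp add: left scaleC_sum_right scaleC_scaleC mult.commute)
  finally show ?thesis by (subst sum.swap)
qed

lemma rotate_block_diag_index:
  fixes A :: "nat \<Rightarrow> 'a::cstar_algebra mat"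
  assumes pq: "p < m * n" "q < m * n"
  shows "rotate_by n m W (block_diag n m A) $$ (p, q) =
    (\<Sum>j<m. complex_of_real (W j (p div n) * W j (q div n)) *\<^sub>C A j $$ (p mod n, q mod n))"
proof -
  have b: "p mod n < n" "q mod n < n" using mod_less_blocks pq by auto
  have idx: "j * n + a < m * n" if "j < m" "a < n" for j a
  proof -
    have "j * n + a < Suc j * n" using that by simp
    also have "\<dots> \<le> m * n" using that by (intro mult_le_mono1) simp
    finally show ?thesis .
  qed
  have "rotate_by n m W (block_diag n m A) $$ (p, q) =
    (\<Sum>j<m. \<Sum>l<m. if l = j then complex_of_real (W j (p div n) * W j (q div n)) *\<^sub>C A j $$ (p mod n, q mod n) else 0)"
    unfolding rotate_by_index[OF block_diag_carrier pq]
    by (intro sum.cong refl) (use b idx in \<open>auto simp: block_diag_index\<close>)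
  then show ?thesis by simp
qed

definition signature :: "nat \<Rightarrow> nat \<Rightarrow> nat \<Rightarrow> real" where
  "signature m i j = (if i = j then (if Suc i = m then -1 else 1) else 0)"

lemma orthogonal_signature: "orthogonal_real m (signature m)"
proof -
  have "(\<Sum>j<m. signature m j i * signature m j k) = (if i = k then 1 else 0)" if "i < m" for i k
  proof -
    have "(\<Sum>j<m. signature m j i * signature m j k) = (\<Sum>j<m. if j = i then (if i = k then 1 else 0) else 0)"
      by (intro sum.cong) (auto simp: signature_def)
    then show ?thesis using that by simp
  qed
  moreover have "(\<Sum>j<m. signature m i j * signature m k j) = (\<Sum>j<m. signature m j i * signature m j k)" for i k
    by (intro sum.cong refl) (auto simp: signature_def)
  ultimately show ?thesis unfolding orthogonal_real_def by simp
qed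

lemma rotate_signature_index:
  fixes X :: "'a::cstar_algebra mat"
  assumes X: "X \<in> carrier_mat (m * n) (m * n)" and pq: "p < m * n" "q < m * n"
  shows "rotate_by n m (signature m) X $$ (p, q) =
    complex_of_real ((if Suc (p div n) = m then -1 else 1) * (if Suc (q div n) = m then -1 else 1)) *\<^sub>C X $$ (p, q)"
proof -
  let ?d = "\<lambda>i. if Suc i = m then -1 else (1::real)"
  have "rotate_by n m (signature m) X $$ (p, q) =
    (\<Sum>j<m. \<Sum>l<m. if l = q div n then (if j = p div n then
       complex_of_real (?d (p div n) * ?d (q div n)) *\<^sub>C X $$ (p, q) else 0) else 0)"
    unfolding rotate_by_index[OF assms] by (intro sum.cong refl) (auto simp: signature_def)
  also have "\<dots> = complex_of_real (?d (p div n) * ?d (q div n)) *\<^sub>C X $$ (p, q)"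
    using div_less_blocks[OF pq(1)] div_less_blocks[OF pq(2)] by simp
  finally show ?thesis .
qed

subsection \<open>Quadratic forms\<close>

text \<open>The compression \<open>v\<^sup>* E v\<close>, an element of the algebra.\<close>

definition qform :: "nat \<Rightarrow> (nat \<Rightarrow> complex) \<Rightarrow> 'a::cstar_algebra mat \<Rightarrow> 'a" where
  "qform k v E = (\<Sum>a<k. \<Sum>b<k. (cnj (v a) * v b) *\<^sub>C E $$ (a, b))"

text \<open>The compression of \<open>Y\<^sup>* Y\<close> is a sum of the elements \<open>y\<^sub>r\<^sup>* y\<^sub>r\<close>.\<close>

lemma qform_star_mult_nonneg:
  assumes w: "state \<omega>" and Y: "Y \<in> carrier_mat k k"
  shows "0 \<le> Re (\<omega> (qform k v (mat_star Y * Y)))"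
proof -
  define y where "y r = (\<Sum>b<k. v b *\<^sub>C Y $$ (r, b))" for r
  have "qform k v (mat_star Y * Y) = (\<Sum>a<k. \<Sum>b<k. \<Sum>r<k. (cnj (v a) *\<^sub>C star (Y $$ (r, a))) * (v b *\<^sub>C Y $$ (r, b)))"
    unfolding qform_def
  proof (intro sum.cong refl)
    fix a b assume ab: "a \<in> {..<k}" "b \<in> {..<k}"
    have sY: "mat_star Y \<in> carrier_mat k k" using Y by (auto simp: mat_star_def)
    have "(mat_star Y * Y) $$ (a, b) = (\<Sum>r<k. star (Y $$ (r, a)) * Y $$ (r, b))"
      using ab Y by (subst mat_mult_index[OF sY Y]) (auto simp: mat_star_def intro!: sum.cong)
    then show "(cnj (v a) * v b) *\<^sub>C (mat_star Y * Y) $$ (a, b)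
       = (\<Sum>r<k. (cnj (v a) *\<^sub>C star (Y $$ (r, a))) * (v b *\<^sub>C Y $$ (r, b)))"
      by (simp add: scaleC_sum_right mult_scaleC_left mult_scaleC_right scaleC_scaleC mult.commute)
  qed
  also have "\<dots> = (\<Sum>a<k. \<Sum>r<k. \<Sum>b<k. (cnj (v a) *\<^sub>C star (Y $$ (r, a))) * (v b *\<^sub>C Y $$ (r, b)))"
    by (rule sum.cong[OF refl], rule sum.swap)
  also have "\<dots> = (\<Sum>r<k. \<Sum>a<k. \<Sum>b<k. (cnj (v a) *\<^sub>C star (Y $$ (r, a))) * (v b *\<^sub>C Y $$ (r, b)))"
    by (rule sum.swap)
  also have "\<dots> = (\<Sum>r<k. star (y r) * y r)"
    by (simp add: y_def star_sum star_scaleC sum_product)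
  finally show ?thesis using state_pos[OF w] by (simp add: state_sum[OF w] sum_nonneg)
qed

lemma qform_diff:
  assumes "A \<in> carrier_mat k k" "B \<in> carrier_mat k k"
  shows "qform k v (A - B) = qform k v A - qform k v B"
  unfolding qform_def sum_subtractf[symmetric]
  by (intro sum.cong refl) (use assms in \<open>simp add: scaleC_diff_right\<close>)

lemma qform_add:
  assumes "A \<in> carrier_mat k k" "B \<in> carrier_mat k k"
  shows "qform k v (A + B) = qform k v A + qform k v B"
  unfolding qform_def sum.distrib[symmetric]
  by (intro sum.cong refl) (use assms in \<open>simp add: scaleC_add_right\<close>)

lemma qform_scaleC:
  assumes "A \<in> carrier_mat k k"
  shows "qform k v (z *\<^sub>C\<^sub>m A) = z *\<^sub>C qform k v A"
  unfolding qform_def scaleC_sum_right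
  by (intro sum.cong refl) (use assms in \<open>simp add: scaleC_scaleC mult.commute\<close>)

text \<open>The test vector is \<open>c \<otimes> v\<close>. Block \<open>j\<close> sees it with the weight \<open>(W c)\<^sub>j\<close>.\<close>

lemma qform_rotate_block_diag:
  fixes A :: "nat \<Rightarrow> 'a::cstar_algebra mat"
  shows "qform (m * n) (\<lambda>p. of_real (c (p div n)) * v (p mod n)) (rotate_by n m W (block_diag n m A))
    = (\<Sum>j<m. complex_of_real ((\<Sum>i<m. c i * W j i)\<^sup>2) *\<^sub>C qform n v (A j))"
proof -
  define \<xi> where "\<xi> p = complex_of_real (c (p div n)) * v (p mod n)" for p
  have idx: "j * n + a < m * n" if "j < m" "a < n" for j a
  proof -
    have "j * n + a < Suc j * n" using that by simp
    also have "\<dots> \<le> m * n" using that by (intro mult_le_mono1) simp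
    finally show ?thesis .
  qed
  have "qform (m * n) \<xi> (rotate_by n m W (block_diag n m A)) =
    (\<Sum>p<m*n. \<Sum>q<m*n. \<Sum>j<m. (cnj (\<xi> p) * \<xi> q * of_real (W j (p div n) * W j (q div n))) *\<^sub>C A j $$ (p mod n, q mod n))"
    unfolding qform_def
    by (intro sum.cong refl) (simp add: rotate_block_diag_index scaleC_sum_right scaleC_scaleC)
  also have "\<dots> = (\<Sum>i<m. \<Sum>a<n. \<Sum>k<m. \<Sum>b<n. \<Sum>j<m.
      (of_real (c i * W j i) * of_real (c k * W j k) * (cnj (v a) * v b)) *\<^sub>C A j $$ (a, b))"
    unfolding sum_blocks by (intro sum.cong refl) (simp add: \<xi>_def mult_ac)
  also have "\<dots> = (\<Sum>j<m. \<Sum>a<n. \<Sum>b<n. \<Sum>i<m. \<Sum>k<m.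
      (of_real (c i * W j i) * of_real (c k * W j k) * (cnj (v a) * v b)) *\<^sub>C A j $$ (a, b))"
  proof -
    let ?t = "\<lambda>i a k b j. (of_real (c i * W j i) * of_real (c k * W j k) * (cnj (v a) * v b)) *\<^sub>C A j $$ (a, b)"
    have "(\<Sum>i<m. \<Sum>a<n. \<Sum>k<m. \<Sum>b<n. \<Sum>j<m. ?t i a k b j) = (\<Sum>(i,a,k,b,j)\<in>{..<m}\<times>{..<n}\<times>{..<m}\<times>{..<n}\<times>{..<m}. ?t i a k b j)"
      by (simp add: sum.cartesian_product)
    also have "\<dots> = (\<Sum>(j,a,b,i,k)\<in>{..<m}\<times>{..<n}\<times>{..<n}\<times>{..<m}\<times>{..<m}. ?t i a k b j)"
      by (rule sum.reindex_bij_witness[of _ "\<lambda>(j,a,b,i,k). (i,a,k,b,j)" "\<lambda>(i,a,k,b,j). (j,a,b,i,k)"]) auto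
    also have "\<dots> = (\<Sum>j<m. \<Sum>a<n. \<Sum>b<n. \<Sum>i<m. \<Sum>k<m. ?t i a k b j)"
      by (simp add: sum.cartesian_product)
    finally show ?thesis .
  qed
  also have "\<dots> = (\<Sum>j<m. complex_of_real ((\<Sum>i<m. c i * W j i)\<^sup>2) *\<^sub>C qform n v (A j))"
  proof (intro sum.cong refl)
    fix j
    have "(\<Sum>i<m. \<Sum>k<m. (of_real (c i * W j i) * of_real (c k * W j k) * z) *\<^sub>C x)
        = complex_of_real ((\<Sum>i<m. c i * W j i)\<^sup>2) *\<^sub>C (z *\<^sub>C x)" for z and x :: 'a
    proof -
      have "(\<Sum>i<m. \<Sum>k<m. (of_real (c i * W j i) * of_real (c k * W j k) * z) *\<^sub>C x)
         = ((\<Sum>i<m. \<Sum>k<m. of_real (c i * W j i) * of_real (c k * W j k)) * z) *\<^sub>C x"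
        by (simp only: scaleC_sum_left[symmetric] sum_distrib_right)
      also have "(\<Sum>i<m. \<Sum>k<m. of_real (c i * W j i) * of_real (c k * W j k)) = complex_of_real ((\<Sum>i<m. c i * W j i)\<^sup>2)"
        by (simp only: power2_eq_square of_real_mult of_real_sum sum_product)
      finally show ?thesis by (simp only: scaleC_scaleC)
    qed
    then show "(\<Sum>a<n. \<Sum>b<n. \<Sum>i<m. \<Sum>k<m.
      (of_real (c i * W j i) * of_real (c k * W j k) * (cnj (v a) * v b)) *\<^sub>C A j $$ (a, b))
      = complex_of_real ((\<Sum>i<m. c i * W j i)\<^sup>2) *\<^sub>C qform n v (A j)"
      unfolding qform_def scaleC_sum_right by (simp only:)
  qed
  finally show ?thesis unfolding \<xi>_def .
qed

lemma qform_block_diag: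
  fixes A :: "nat \<Rightarrow> 'a::cstar_algebra mat"
  shows "qform (m * n) (\<lambda>p. of_real (c (p div n)) * v (p mod n)) (block_diag n m A)
    = (\<Sum>j<m. complex_of_real ((c j)\<^sup>2) *\<^sub>C qform n v (A j))"
proof -
  let ?I = "\<lambda>i j. if i = j then 1 else (0::real)"
  have "rotate_by n m ?I (block_diag n m A) = block_diag n m A"
  proof (rule eq_matI)
    fix p q assume "p < dim_row (block_diag n m A)" "q < dim_col (block_diag n m A)"
    then have pq: "p < m * n" "q < m * n" by (auto simp: block_diag_def)
    have "rotate_by n m ?I (block_diag n m A) $$ (p, q) =
       (\<Sum>j<m. if j = p div n then (if p div n = q div n then A j $$ (p mod n, q mod n) else 0) else 0)"
      unfolding rotate_block_diag_index[OF pq] by (intro sum.cong) auto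
    then show "rotate_by n m ?I (block_diag n m A) $$ (p, q) = block_diag n m A $$ (p, q)"
      using div_less_blocks[OF pq(1)] pq by (simp add: block_diag_index)
  qed (simp_all only: carrier_matD[OF rotate_by_carrier[OF block_diag_carrier]] carrier_matD[OF block_diag_carrier])
  then have "qform (m * n) (\<lambda>p. of_real (c (p div n)) * v (p mod n)) (block_diag n m A)
     = (\<Sum>j<m. complex_of_real ((\<Sum>i<m. c i * ?I j i)\<^sup>2) *\<^sub>C qform n v (A j))"
    using qform_rotate_block_diag[of m n c v ?I A] by simp
  also have "\<dots> = (\<Sum>j<m. complex_of_real ((c j)\<^sup>2) *\<^sub>C qform n v (A j))"
    by (intro sum.cong refl) (simp add: if_distrib cong: if_cong)
  finally show ?thesis .
qed

section \<open>Matrix convexity along lines\<close>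

subsection \<open>An orthogonal matrix diagonalising multiplication by the variable\<close>

lemma orthogonal_real_of_columns:
  assumes "\<And>i k. i < m \<Longrightarrow> k < m \<Longrightarrow> (\<Sum>j<m. W j i * W j k) = (if i = k then 1 else (0::real))"
  shows "orthogonal_real m W"
proof -
  define B where "B = Matrix.mat m m (\<lambda>(i, j). W i j)"
  define A where "A = Matrix.mat m m (\<lambda>(i, j). W j i)"
  have c: "A \<in> carrier_mat m m" "B \<in> carrier_mat m m" by (simp_all add: A_def B_def)
  have "A * B = 1\<^sub>m m"
    by (intro eq_matI) (simp_all add: A_def B_def scalar_prod_def lessThan_atLeast0[symmetric] assms)
  then have "B * A = 1\<^sub>m m" by (rule mat_mult_left_right_inverse[OF c])
  then have BA: "(B * A) $$ (i, k) = (1\<^sub>m m :: real mat) $$ (i, k)" for i k by simp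
  have "(\<Sum>j<m. W i j * W k j) = (if i = k then 1 else 0)" if "i < m" "k < m" for i k
  proof -
    have "(B * A) $$ (i, k) = (\<Sum>j<m. W i j * W k j)"
      using that by (simp add: A_def B_def scalar_prod_def lessThan_atLeast0[symmetric])
    then show ?thesis unfolding BA using that by simp
  qed
  then show ?thesis using assms unfolding orthogonal_real_def by blast
qed

lemma sum_even_odd:
  fixes g :: "nat \<Rightarrow> 'b::comm_monoid_add"
  shows "(\<Sum>i\<le>2*N. g i) = (\<Sum>j<Suc N. g (2*j)) + (\<Sum>i<N. g (2*i+1))"
  by (induction N) (simp_all add: ac_simps)

lemma even_nodes_eq_odd_nodes:
  fixes Q :: "real poly"
  assumes "degree Q < 2 * N"
  shows "(\<Sum>j<Suc N. real (2*N choose (2*j)) * poly Q (real (2*j)))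
    = (\<Sum>i<N. real (2*N choose (2*i+1)) * poly Q (real (2*i+1)))"
proof -
  have "(\<Sum>j<Suc N. real (2*N choose (2*j)) * poly Q (real (2*j)))
    + (\<Sum>i<N. - (real (2*N choose (2*i+1)) * poly Q (real (2*i+1)))) = 0"
    using alternating_sum_even[OF assms] unfolding sum_even_odd by simp
  then show ?thesis by (simp add: sum_negf)
qed

text \<open>The first \<open>N\<close> columns are \<open>\<alpha>\<^sub>2\<^sub>j P\<^sub>i(2j)\<close>, where \<open>\<alpha>\<^sub>l\<^sup>2 = (2N choose l)\<close> and \<open>P\<^sub>i\<close> is the Lagrange
  polynomial of the odd nodes divided by \<open>\<alpha>\<close> at its node. Sums weighted with these binomial
  coefficients agree for even and odd nodes up to degree \<open>2N - 1\<close>, and over the odd nodes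
  the \<open>P\<^sub>i\<close> are orthonormal; this leaves room for one factor of the variable. The last column is orthogonal to the others because it annihilates polynomials of
  degree less than \<open>N\<close> at the even nodes.\<close>

lemma kraus_matrix:
  assumes N: "N \<ge> 1"
  obtains W where "orthogonal_real (Suc N) W"
    "\<And>i k. i < N \<Longrightarrow> k < N \<Longrightarrow> (\<Sum>j<Suc N. W j i * W j k * real (2*j)) = (if i = k then real (2*i+1) else 0)"
    "\<And>P j. degree P < N \<Longrightarrow> j \<le> N \<Longrightarrow>
       (\<Sum>i<N. sqrt (real (2*N choose (2*i+1))) * poly P (real (2*i+1)) * W j i) = sqrt (real (2*N choose (2*j))) * poly P (real (2*j))"
proof -
  define \<alpha> where "\<alpha> l = sqrt (real (2*N choose l))" for l
  have \<alpha>: "\<alpha> l > 0" "(\<alpha> l)\<^sup>2 = real (2*N choose l)" if "l \<le> 2*N" for l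
    using that by (simp_all add: \<alpha>_def zero_less_binomial)
  define z where "z i = real (2*i+1)" for i :: nat
  have inj: "inj_on z {..<N}" by (auto simp: inj_on_def z_def)
  define p where "p i = smult (1 / \<alpha> (2*i+1)) (lagrange_poly z {..<N} i)" for i
  have pz: "poly (p i) (real (2*k+1)) = (if k = i then 1 / \<alpha> (2*i+1) else 0)" if "i < N" "k < N" for i k
    using poly_lagrange_poly_node[OF _ inj, of i k] that by (simp add: p_def z_def)
  have dp: "degree (p i) < N" if "i < N" for i
    using degree_lagrange_poly[of "{..<N}" i z] that degree_smult_le[of "1 / \<alpha> (2*i+1)" "lagrange_poly z {..<N} i"]
    by (simp add: p_def)
  define \<gamma> where "\<gamma> = 1 / sqrt (\<Sum>j<Suc N. (real (N choose j) / \<alpha> (2*j))\<^sup>2)"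
  have S: "(\<Sum>j<Suc N. (real (N choose j) / \<alpha> (2*j))\<^sup>2) > 0"
  proof (rule sum_pos)
    fix j assume "j \<in> {..<Suc N}"
    then have "j \<le> N" by simp
    then show "0 < (real (N choose j) / \<alpha> (2*j))\<^sup>2" using \<alpha>(1)[of "2*j"] by (simp add: zero_less_binomial)
  qed auto
  define W where "W j i = (if i < N then \<alpha> (2*j) * poly (p i) (real (2*j))
     else \<gamma> * ((-1)^j * real (N choose j) / \<alpha> (2*j)))" for j i :: nat
  have Wsq: "W j i * W j k = real (2*N choose (2*j)) * poly (p i * p k) (real (2*j))" if "i < N" "k < N" "j < Suc N" for i j k
    using that \<alpha>(2)[of "2*j"] by (simp add: W_def power2_eq_square mult_ac)
  have moment: "(\<Sum>j<Suc N. W j i * W j k * poly q (real (2*j))) = (if i = k then poly q (real (2*i+1)) else 0)"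
    if ik: "i < N" "k < N" and q: "degree q \<le> 1" for i k q
  proof -
    have "degree (p i * p k * q) \<le> degree (p i) + degree (p k) + degree q"
      by (rule order_trans[OF degree_mult_le]) (simp add: degree_mult_le)
    then have d: "degree (p i * p k * q) < 2 * N" using dp[OF ik(1)] dp[OF ik(2)] q by linarith
    have "(\<Sum>j<Suc N. W j i * W j k * poly q (real (2*j)))
       = (\<Sum>j<Suc N. real (2*N choose (2*j)) * poly (p i * p k * q) (real (2*j)))"
      by (intro sum.cong refl) (use ik in \<open>simp add: Wsq mult.assoc\<close>)
    also have "\<dots> = (\<Sum>l<N. real (2*N choose (2*l+1)) * poly (p i * p k * q) (real (2*l+1)))"
      by (rule even_nodes_eq_odd_nodes[OF d])
    also have "\<dots> = (\<Sum>l<N. if l = i then (if i = k then poly q (real (2*i+1)) else 0) else 0)"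
    proof (intro sum.cong refl)
      fix l assume "l \<in> {..<N}"
      then have l: "l < N" by simp
      have "real (2*N choose (2*l+1)) = \<alpha> (2*l+1) * \<alpha> (2*l+1)" using \<alpha>(2)[of "2*l+1"] l by (simp add: power2_eq_square)
      moreover have "\<alpha> (2*l+1) \<noteq> 0" using \<alpha>(1)[of "2*l+1"] l by simp
      ultimately show "real (2*N choose (2*l+1)) * poly (p i * p k * q) (real (2*l+1))
         = (if l = i then (if i = k then poly q (real (2*i+1)) else 0) else 0)"
        unfolding poly_mult pz[OF ik(1) l] pz[OF ik(2) l] by auto
    qed
    also have "\<dots> = (if i = k then poly q (real (2*i+1)) else 0)" using ik by simp
    finally show ?thesis .
  qed
  have mixed: "(\<Sum>j<Suc N. W j i * W j N) = 0" if i: "i < N" for i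
  proof -
    have dd: "degree (pcompose (p i) [:0, 2:]) < N" using dp[OF i] by (simp add: degree_pcompose)
    have "(\<Sum>j\<le>N. (-1) ^ (N - j) * real (N choose j) * poly (pcompose (p i) [:0, 2:]) (real j)) = 0"
      using finite_difference_poly[of "pcompose (p i) [:0, 2:]" N] dd by (simp add: coeff_eq_0)
    then have "(-1)^N * (\<Sum>j\<le>N. (-1) ^ (N - j) * real (N choose j) * poly (p i) (real (2*j))) = 0"
      by (simp add: poly_pcompose mult.commute)
    also have "(-1)^N * (\<Sum>j\<le>N. (-1) ^ (N - j) * real (N choose j) * poly (p i) (real (2*j)))
       = (\<Sum>j\<le>N. (-1) ^ j * real (N choose j) * poly (p i) (real (2*j)))"
      unfolding sum_distrib_left by (intro sum.cong refl) (auto simp: minus_one_power_iff)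
    finally have 0: "(\<Sum>j<Suc N. (-1) ^ j * real (N choose j) * poly (p i) (real (2*j))) = 0"
      by (simp add: lessThan_Suc_atMost)
    have "(\<Sum>j<Suc N. W j i * W j N) = (\<Sum>j<Suc N. \<gamma> * ((-1) ^ j * real (N choose j) * poly (p i) (real (2*j))))"
    proof (intro sum.cong refl)
      fix j assume "j \<in> {..<Suc N}"
      then have "\<alpha> (2*j) \<noteq> 0" using \<alpha>(1)[of "2*j"] by simp
      then show "W j i * W j N = \<gamma> * ((-1) ^ j * real (N choose j) * poly (p i) (real (2*j)))"
        using i by (simp add: W_def)
    qed
    then show ?thesis using 0 by (simp only: sum_distrib_left[symmetric] mult_zero_right)
  qed
  have last: "(\<Sum>j<Suc N. W j N * W j N) = 1"
  proof -
    have "(\<Sum>j<Suc N. W j N * W j N) = (\<Sum>j<Suc N. \<gamma>\<^sup>2 * (real (N choose j) / \<alpha> (2*j))\<^sup>2)"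
      by (intro sum.cong refl) (simp add: W_def power2_eq_square minus_one_power_iff)
    also have "\<dots> = 1" using S unfolding sum_distrib_left[symmetric] by (simp add: \<gamma>_def power_divide)
    finally show ?thesis .
  qed
  have "orthogonal_real (Suc N) W"
  proof (rule orthogonal_real_of_columns)
    fix i k assume "i < Suc N" "k < Suc N"
    then consider "i < N" "k < N" | "i < N" "k = N" | "i = N" "k < N" | "i = N" "k = N" by linarith
    then show "(\<Sum>j<Suc N. W j i * W j k) = (if i = k then 1 else 0)"
    proof cases
      case 1 then show ?thesis using moment[of i k 1] by simp
    next
      case 2 then show ?thesis using mixed[of i] by simp
    next
      case 3
      have "(\<Sum>j<Suc N. W j i * W j k) = (\<Sum>j<Suc N. W j k * W j i)" by (intro sum.cong refl) (rule mult.commute)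
      then have "(\<Sum>j<Suc N. W j i * W j k) = 0" using mixed[of k] 3 by (simp only: 3)
      then show ?thesis using 3 by simp
    next
      case 4 then show ?thesis using last by simp
    qed
  qed
  moreover have "(\<Sum>j<Suc N. W j i * W j k * real (2*j)) = (if i = k then real (2*i+1) else 0)" if "i < N" "k < N" for i k
    using moment[OF that, of "[:0, 1:]"] by simp
  moreover have "(\<Sum>i<N. sqrt (real (2*N choose (2*i+1))) * poly P (real (2*i+1)) * W j i) = sqrt (real (2*N choose (2*j))) * poly P (real (2*j))"
    if P: "degree P < N" and j: "j \<le> N" for P j
  proof -
    have "(\<Sum>i<N. sqrt (real (2*N choose (2*i+1))) * poly P (real (2*i+1)) * W j i)
       = (\<Sum>i<N. \<alpha> (2*j) * poly (smult (poly P (z i)) (lagrange_poly z {..<N} i)) (real (2*j)))"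
    proof (intro sum.cong refl)
      fix i assume "i \<in> {..<N}"
      then have "i < N" "\<alpha> (2*i+1) \<noteq> 0" using \<alpha>(1)[of "2*i+1"] by simp_all
      then show "sqrt (real (2*N choose (2*i+1))) * poly P (real (2*i+1)) * W j i
         = \<alpha> (2*j) * poly (smult (poly P (z i)) (lagrange_poly z {..<N} i)) (real (2*j))"
        unfolding W_def p_def z_def \<alpha>_def[symmetric] by simp
    qed
    also have "\<dots> = \<alpha> (2*j) * poly (\<Sum>i\<in>{..<N}. smult (poly P (z i)) (lagrange_poly z {..<N} i)) (real (2*j))"
      by (simp only: poly_sum sum_distrib_left)
    also have "\<dots> = \<alpha> (2*j) * poly P (real (2*j))"
      using lagrange_interpolation[OF _ inj, of P] P by simp
    finally show ?thesis by (simp only: \<alpha>_def)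
  qed
  ultimately show ?thesis using that by blast
qed

subsection \<open>Jensen's inequality for matrix convex functions\<close>

definition line :: "'a::cstar_algebra mat \<Rightarrow> 'a mat \<Rightarrow> real \<Rightarrow> 'a mat" where
  "line X Y t = X + complex_of_real t *\<^sub>C\<^sub>m Y"

locale matrix_convex_function =
  fixes R\<^sub>1 :: "'a::cstar_algebra set" and R\<^sub>2 :: "'b::cstar_algebra set"
    and G :: "'a mat set" and f :: "'a mat \<Rightarrow> 'b mat"
  assumes R1: "real_operator_system R\<^sub>1" and R2: "real_operator_system R\<^sub>2"
    and G: "free_domain R\<^sub>1 G" and f: "free_function G R\<^sub>2 f" and conv: "matrix_convex G f"
    and bdd: "locally_bounded G f"
begin

lemma G_S_level: "X \<in> level G n \<Longrightarrow> X \<in> S_level R\<^sub>1 n"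
  and G_level_pos: "X \<in> level G n \<Longrightarrow> n \<ge> 1"
proof -
  assume X: "X \<in> level G n"
  then obtain m where m: "m \<ge> 1" "X \<in> S_level R\<^sub>1 m"
    using G unfolding level_def free_domain_def S_union_def by blast
  moreover have "m = n" using S_level_carrier[OF m(2)] X by (auto simp: level_def)
  ultimately show "X \<in> S_level R\<^sub>1 n" "n \<ge> 1" by auto
qed

lemma G_carrier: "X \<in> level G n \<Longrightarrow> X \<in> carrier_mat n n"
  by (simp add: level_def)

lemma f_S_level: "X \<in> level G n \<Longrightarrow> f X \<in> S_level R\<^sub>2 n"
  using f unfolding free_function_def by blast

lemma f_carrier: "X \<in> level G n \<Longrightarrow> f X \<in> carrier_mat n n"
  using f_S_level S_level_carrier by blast

lemma block_diag_mem:
  assumes n: "n \<ge> 1" and A: "\<And>j. j < m \<Longrightarrow> A j \<in> level G n" and m: "m \<ge> 1"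
  shows "block_diag n m A \<in> level G (m * n) \<and> f (block_diag n m A) = block_diag n m (\<lambda>j. f (A j))"
  using m A
proof (induction m rule: dec_induct)
  case base
  then have "A 0 \<in> level G n" by simp
  then show ?case using f_carrier[of "A 0"] G_carrier[of "A 0"] by (simp add: block_diag_one)
next
  case (step m)
  have IH: "block_diag n m A \<in> level G (m * n)" "f (block_diag n m A) = block_diag n m (\<lambda>j. f (A j))"
    using step by auto
  have Am: "A m \<in> level G n" using step.prems by simp
  have e: "block_diag n (Suc m) A = block_diag n m A \<oplus>\<^sub>m A m" using n by (intro block_diag_Suc G_carrier[OF Am]) simp
  have e': "block_diag n (Suc m) (\<lambda>j. f (A j)) = block_diag n m (\<lambda>j. f (A j)) \<oplus>\<^sub>m f (A m)"
    using n by (intro block_diag_Suc f_carrier[OF Am]) simp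
  have g: "block_diag n m A \<in> G" "A m \<in> G" using IH Am by (simp_all add: level_def)
  moreover have "block_diag n m A \<in> S_union R\<^sub>1" "A m \<in> S_union R\<^sub>1" using g G unfolding free_domain_def by blast+
  ultimately have "block_diag n m A \<oplus>\<^sub>m A m \<in> G" using G unfolding free_domain_def by blast
  moreover have "f (block_diag n m A \<oplus>\<^sub>m A m) = f (block_diag n m A) \<oplus>\<^sub>m f (A m)"
    using f g unfolding free_function_def by blast
  ultimately show ?case unfolding e e' IH(2) using block_diag_carrier[of n "Suc m" A] unfolding e by (simp add: level_def)
qed

lemma rotate_mem:
  assumes W: "orthogonal_real m W" and X: "X \<in> level G (m * n)"
  shows "rotate_by n m W X \<in> level G (m * n)" "f (rotate_by n m W X) = rotate_by n m W (f X)"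
proof -
  have u: "unitary_cmat (m * n) (kron_one n m W)" by (rule unitary_kron_one[OF W])
  then have "rotate_by n m W X \<in> G" using X G unfolding rotate_by_def free_domain_def by blast
  moreover show "rotate_by n m W X \<in> level G (m * n)"
    using calculation rotate_by_carrier[OF G_carrier[OF X]] by (simp add: level_def)
  moreover have "inverts_mat (kron_one n m W) (mat_star (kron_one n m W))"
    "inverts_mat (mat_star (kron_one n m W)) (kron_one n m W)"
    "kron_one n m W \<in> carrier_mat (m * n) (m * n)" "mat_star (kron_one n m W) \<in> carrier_mat (m * n) (m * n)"
    using u carrier_matD[OF kron_one_carrier[of n m W]] carrier_matD[OF kron_one_carrier[of n m "\<lambda>i j. W j i"]]
    unfolding inverts_mat_def unitary_cmat_def mat_star_kron_one by simp_all
  ultimately show "f (rotate_by n m W X) = rotate_by n m W (f X)"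
    using f X unfolding rotate_by_def free_function_def by metis
qed

text \<open>The signature changes the sign of the last block, and the test vector does not meet that block.\<close>

lemma qform_rotate_signature:
  fixes X :: "'c::cstar_algebra mat"
  assumes X: "X \<in> carrier_mat (m * n) (m * n)" and c: "c (m - 1) = 0"
  shows "qform (m * n) (\<lambda>p. of_real (c (p div n)) * v (p mod n)) (rotate_by n m (signature m) X)
    = qform (m * n) (\<lambda>p. of_real (c (p div n)) * v (p mod n)) X"
  unfolding qform_def
proof (intro sum.cong refl)
  fix p q assume pq: "p \<in> {..<m * n}" "q \<in> {..<m * n}"
  show "(cnj (of_real (c (p div n)) * v (p mod n)) * (of_real (c (q div n)) * v (q mod n))) *\<^sub>C
      rotate_by n m (signature m) X $$ (p, q) =
      (cnj (of_real (c (p div n)) * v (p mod n)) * (of_real (c (q div n)) * v (q mod n))) *\<^sub>C X $$ (p, q)"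
  proof (cases "Suc (p div n) = m \<or> Suc (q div n) = m")
    case True
    then have "c (p div n) = 0 \<or> c (q div n) = 0" using c by auto
    then show ?thesis by (auto simp: scaleC_zero_left)
  next
    case False
    then show ?thesis using rotate_signature_index[OF X, of p q] pq by (simp add: scaleC_one)
  qed
qed

text \<open>The average of \<open>W\<^sup>T diag(A) W\<close> with its conjugate by the signature keeps the entries inside the
  first \<open>m - 1\<close> blocks and the last diagonal block, and deletes the rest of the last block row and
  column; so the hypothesis on the remaining entries makes it block diagonal.\<close>

theorem jensen:
  assumes n: "n \<ge> 1" and m: "m \<ge> 1" and W: "orthogonal_real m W"
    and A: "\<And>j. j < m \<Longrightarrow> A j \<in> level G n" and B: "\<And>i. i < m \<Longrightarrow> B i \<in> level G n"
    and AB: "\<And>i k a b. i < m \<Longrightarrow> k < m \<Longrightarrow> i = k \<or> (Suc i < m \<and> Suc k < m) \<Longrightarrow> a < n \<Longrightarrow> b < n \<Longrightarrow>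
       (\<Sum>j<m. complex_of_real (W j i * W j k) *\<^sub>C A j $$ (a, b)) = (if i = k then B i $$ (a, b) else 0)"
    and c: "c (m - 1) = 0" and w: "state \<omega>"
  shows "(\<Sum>i<m. (c i)\<^sup>2 * Re (\<omega> (qform n v (f (B i))))) \<le>
     (\<Sum>j<m. (\<Sum>i<m. c i * W j i)\<^sup>2 * Re (\<omega> (qform n v (f (A j)))))"
proof -
  let ?k = "m * n" and ?\<xi> = "\<lambda>p. complex_of_real (c (p div n)) * v (p mod n)"
  define A1 where "A1 = rotate_by n m W (block_diag n m A)"
  define A2 where "A2 = rotate_by n m (signature m) A1"
  have bdA: "block_diag n m A \<in> level G ?k \<and> f (block_diag n m A) = block_diag n m (\<lambda>j. f (A j))"
    and bdB: "block_diag n m B \<in> level G ?k \<and> f (block_diag n m B) = block_diag n m (\<lambda>j. f (B j))"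
    using block_diag_mem[OF n _ m, of A] block_diag_mem[OF n _ m, of B] A B by blast+
  have A1: "A1 \<in> level G ?k" "f A1 = rotate_by n m W (block_diag n m (\<lambda>j. f (A j)))"
    using rotate_mem[OF W, of "block_diag n m A" n] bdA by (auto simp: A1_def)
  have A2: "A2 \<in> level G ?k" "f A2 = rotate_by n m (signature m) (f A1)"
    using rotate_mem[OF orthogonal_signature A1(1)] by (auto simp: A2_def)
  note cA = G_carrier[OF A1(1)] G_carrier[OF A2(1)] f_carrier[OF A1(1)] f_carrier[OF A2(1)]
  have mid: "(1/2) *\<^sub>C\<^sub>m (A1 + A2) = block_diag n m B"
  proof (rule eq_matI)
    fix p q assume "p < dim_row (block_diag n m B)" "q < dim_col (block_diag n m B)"
    then have pq: "p < ?k" "q < ?k" by (auto simp: block_diag_def)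
    let ?s = "\<lambda>p. if Suc (p div n) = m then -1 else (1::real)"
    have "((1/2) *\<^sub>C\<^sub>m (A1 + A2)) $$ (p, q) = (1/2) *\<^sub>C (A1 $$ (p, q) + complex_of_real (?s p * ?s q) *\<^sub>C A1 $$ (p, q))"
      using pq cA rotate_signature_index[OF cA(1) pq] by (simp add: A2_def[symmetric])
    also have "\<dots> = complex_of_real ((1 + ?s p * ?s q) / 2) *\<^sub>C A1 $$ (p, q)"
      by (simp add: scaleC_add_right scaleC_scaleC scaleC_add_left[symmetric] add_divide_distrib)
    also have "\<dots> = block_diag n m B $$ (p, q)"
    proof (cases "(Suc (p div n) = m) = (Suc (q div n) = m)")
      case False
      then have "p div n \<noteq> q div n" by auto
      then show ?thesis using False pq by (auto simp: block_diag_index scaleC_zero_left)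
    next
      case True
      have d: "p div n < m" "q div n < m" using pq by (auto intro: div_less_blocks)
      have "complex_of_real ((1 + ?s p * ?s q) / 2) = 1" using True by auto
      moreover have "A1 $$ (p, q) = (if p div n = q div n then B (p div n) $$ (p mod n, q mod n) else 0)"
        unfolding A1_def rotate_block_diag_index[OF pq]
        using True d mod_less_blocks[OF pq(1)] mod_less_blocks[OF pq(2)] by (intro AB) auto
      ultimately show ?thesis using pq by (simp only: block_diag_index scaleC_one)
    qed
    finally show "((1/2) *\<^sub>C\<^sub>m (A1 + A2)) $$ (p, q) = block_diag n m B $$ (p, q)" .
  qed (use cA in \<open>auto simp: block_diag_def\<close>)
  have fB: "f (block_diag n m B) \<in> carrier_mat ?k ?k" using bdB f_carrier by blast
  have "mat_le ?k (f (block_diag n m B)) ((1/2) *\<^sub>C\<^sub>m (f A1 + f A2))"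
    using conv A1(1) A2(1) unfolding matrix_convex_def mid[symmetric] by blast
  then obtain Y where Y: "Y \<in> carrier_mat ?k ?k"
    "(1/2) *\<^sub>C\<^sub>m (f A1 + f A2) - f (block_diag n m B) = mat_star Y * Y"
    unfolding mat_le_def mat_pos_def by blast
  have "qform ?k ?\<xi> ((1/2) *\<^sub>C\<^sub>m (f A1 + f A2) - f (block_diag n m B))
     = (1/2) *\<^sub>C (qform ?k ?\<xi> (f A1) + qform ?k ?\<xi> (f A2)) - qform ?k ?\<xi> (f (block_diag n m B))"
    using cA fB by (simp add: qform_diff qform_scaleC[of "f A1 + f A2" ?k] qform_add[of "f A1" ?k "f A2"])
  also have "qform ?k ?\<xi> (f A2) = qform ?k ?\<xi> (f A1)"
    unfolding A2(2) by (rule qform_rotate_signature[where c = c and v = v, OF cA(3) c])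
  also have "(1/2) *\<^sub>C (qform ?k ?\<xi> (f A1) + qform ?k ?\<xi> (f A1)) = qform ?k ?\<xi> (f A1)"
    by (simp add: scaleC_add_right scaleC_add_left[symmetric] scaleC_one)
  finally have "0 \<le> Re (\<omega> (qform ?k ?\<xi> (f A1) - qform ?k ?\<xi> (f (block_diag n m B))))"
    using qform_star_mult_nonneg[OF w Y(1), of ?\<xi>] unfolding Y(2)[symmetric] by simp
  moreover have "Re (\<omega> (qform ?k ?\<xi> (f A1))) = (\<Sum>j<m. (\<Sum>i<m. c i * W j i)\<^sup>2 * Re (\<omega> (qform n v (f (A j)))))"
    unfolding A1(2) qform_rotate_block_diag state_sum[OF w] state_scaleC[OF w] by simp
  moreover have "f (block_diag n m B) = block_diag n m (\<lambda>j. f (B j))" using bdB by simp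
  then have "Re (\<omega> (qform ?k ?\<xi> (f (block_diag n m B)))) = (\<Sum>i<m. (c i)\<^sup>2 * Re (\<omega> (qform n v (f (B i)))))"
    by (simp only: qform_block_diag state_sum[OF w] state_scaleC[OF w]) simp
  ultimately show ?thesis by (simp add: state_diff[OF w])
qed

text \<open>Apply Jensen's inequality with \<open>A\<^sub>j\<close> at the even and \<open>B\<^sub>i\<close> at the odd points of the grid. Choosing
  the weights \<open>c\<^sub>i = \<alpha>\<^sub>2\<^sub>i\<^sub>+\<^sub>1 P(2i + 1)\<close> makes \<open>(W c)\<^sub>j = \<alpha>\<^sub>2\<^sub>j P(2j)\<close>, and the inequality is the
  alternating sum of the Kraus condition.\<close>

theorem kraus_of_matrix_convex:
  assumes X: "X \<in> carrier_mat n n" and Y: "Y \<in> carrier_mat n n"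
    and L: "\<And>t. \<bar>t\<bar> \<le> 2 \<Longrightarrow> line X Y t \<in> level G n" and w: "state \<omega>"
  shows "kraus (\<lambda>t. Re (\<omega> (qform n v (f (line X Y t)))))"
  unfolding kraus_def
proof (intro allI impI)
  fix N x e and P :: "real poly"
  assume dP: "degree P < N" and e: "0 < e" and x: "-2 \<le> x" "x + real (2 * N) * e \<le> 2"
  define \<phi> where "\<phi> t = Re (\<omega> (qform n v (f (line X Y t))))" for t
  have N: "N \<ge> 1" using dP by simp
  have n: "n \<ge> 1" using G_level_pos L[of 0] by simp
  obtain W where W: "orthogonal_real (Suc N) W"
    "\<And>i k. i < N \<Longrightarrow> k < N \<Longrightarrow> (\<Sum>j<Suc N. W j i * W j k * real (2*j)) = (if i = k then real (2*i+1) else 0)"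
    "\<And>P j. degree P < N \<Longrightarrow> j \<le> N \<Longrightarrow>
       (\<Sum>i<N. sqrt (real (2*N choose (2*i+1))) * poly P (real (2*i+1)) * W j i) = sqrt (real (2*N choose (2*j))) * poly P (real (2*j))"
    by (rule kraus_matrix[OF N]) (rule that)
  have Wcol: "(\<Sum>j<Suc N. W j i * W j k) = (if i = k then 1 else 0)" if "i < Suc N" "k < Suc N" for i k
    using W(1) that unfolding orthogonal_real_def by blast
  \<comment> \<open>the point of the line on which the last diagonal block sits\<close>
  define s where "s = (\<Sum>j<Suc N. (W j N)\<^sup>2 * (x + real (2*j) * e))"
  define \<tau> where "\<tau> i = (if i < N then x + real (2*i+1) * e else s)" for i
  define c where "c i = (if i < N then sqrt (real (2*N choose (2*i+1))) * poly P (real (2*i+1)) else 0)" for i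
  have pt: "-2 \<le> x + real l * e \<and> x + real l * e \<le> 2" if "l \<le> 2 * N" for l
  proof -
    have "real l * e \<le> real (2 * N) * e" using that e by (intro mult_right_mono) auto
    moreover have "0 \<le> real l * e" using e by simp
    ultimately show ?thesis using x by linarith
  qed
  have W2: "(\<Sum>j<Suc N. (W j N)\<^sup>2) = 1" using Wcol[of N N] by (simp add: power2_eq_square)
  have pte: "-2 \<le> x + real (2*j) * e \<and> x + real (2*j) * e \<le> 2" if "j \<in> {..<Suc N}" for j
    using that by (intro pt) simp
  have s: "-2 \<le> s \<and> s \<le> 2"
  proof
    have "(\<Sum>j<Suc N. (W j N)\<^sup>2 * (-2)) \<le> s" unfolding s_def
      by (intro sum_mono mult_left_mono) (use pte in \<open>auto simp del: of_nat_mult\<close>)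
    then show "-2 \<le> s" using W2 by (simp only: sum_distrib_right[symmetric])
    have "s \<le> (\<Sum>j<Suc N. (W j N)\<^sup>2 * 2)" unfolding s_def
      by (intro sum_mono mult_left_mono) (use pte in \<open>auto simp del: of_nat_mult\<close>)
    then show "s \<le> 2" using W2 by (simp only: sum_distrib_right[symmetric])
  qed
  have AB: "(\<Sum>j<Suc N. complex_of_real (W j i * W j k) *\<^sub>C line X Y (x + real (2*j) * e) $$ (a, b))
      = (if i = k then line X Y (\<tau> i) $$ (a, b) else 0)"
    if ik: "i < Suc N" "k < Suc N" "i = k \<or> (Suc i < Suc N \<and> Suc k < Suc N)" and ab: "a < n" "b < n" for i k a b
  proof -
    have li: "line X Y t $$ (a, b) = X $$ (a, b) + complex_of_real t *\<^sub>C Y $$ (a, b)" for t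
      using X Y ab by (simp add: line_def)
    have mom: "(\<Sum>j<Suc N. W j i * W j k * (x + real (2*j) * e)) = (if i = k then \<tau> i else 0)"
    proof (cases "i = N")
      case True
      then have "k = N" using ik by auto
      then show ?thesis using True by (simp add: \<tau>_def s_def power2_eq_square)
    next
      case False
      then have ik': "i < N" "k < N" using ik by auto
      have "(\<Sum>j<Suc N. W j i * W j k * (x + real (2*j) * e))
         = (\<Sum>j<Suc N. W j i * W j k) * x + (\<Sum>j<Suc N. W j i * W j k * real (2*j)) * e"
        unfolding sum_distrib_right sum.distrib[symmetric] by (intro sum.cong refl) (simp only: distrib_left mult.assoc)
      then show ?thesis unfolding W(2)[OF ik'] Wcol[OF ik(1,2)] using ik' by (simp add: \<tau>_def)
    qed
    have "(\<Sum>j<Suc N. complex_of_real (W j i * W j k) *\<^sub>C line X Y (x + real (2*j) * e) $$ (a, b))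
       = (\<Sum>j<Suc N. complex_of_real (W j i * W j k) *\<^sub>C X $$ (a, b)
          + complex_of_real (W j i * W j k * (x + real (2*j) * e)) *\<^sub>C Y $$ (a, b))"
      unfolding li scaleC_add_right scaleC_scaleC of_real_mult[symmetric] ..
    also have "\<dots> = complex_of_real (\<Sum>j<Suc N. W j i * W j k) *\<^sub>C X $$ (a, b)
          + complex_of_real (\<Sum>j<Suc N. W j i * W j k * (x + real (2*j) * e)) *\<^sub>C Y $$ (a, b)"
      by (simp only: sum.distrib scaleC_sum_left of_real_sum)
    also have "\<dots> = (if i = k then line X Y (\<tau> i) $$ (a, b) else 0)"
      unfolding mom Wcol[OF ik(1,2)] li by (simp add: scaleC_one scaleC_zero_left)
    finally show ?thesis .
  qed
  have "(\<Sum>i<Suc N. (c i)\<^sup>2 * Re (\<omega> (qform n v (f (line X Y (\<tau> i)))))) \<le>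
     (\<Sum>j<Suc N. (\<Sum>i<Suc N. c i * W j i)\<^sup>2 * Re (\<omega> (qform n v (f (line X Y (x + real (2*j) * e))))))"
  proof (rule jensen[OF n _ W(1) _ _ _ _ w])
    show "line X Y (x + real (2 * j) * e) \<in> level G n" if "j < Suc N" for j
      using pt[of "2*j"] that by (intro L) auto
    show "line X Y (\<tau> i) \<in> level G n" if "i < Suc N" for i
      using pt[of "2*i+1"] that s by (intro L) (auto simp: \<tau>_def)
  qed (use AB in \<open>auto simp: c_def\<close>)
  also have "(\<Sum>i<Suc N. (c i)\<^sup>2 * Re (\<omega> (qform n v (f (line X Y (\<tau> i))))))
      = (\<Sum>i<N. real (2*N choose (2*i+1)) * (poly P (real (2*i+1)))\<^sup>2 * \<phi> (x + real (2*i+1) * e))"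
    by (simp add: c_def \<tau>_def \<phi>_def power_mult_distrib)
  also have "(\<Sum>j<Suc N. (\<Sum>i<Suc N. c i * W j i)\<^sup>2 * Re (\<omega> (qform n v (f (line X Y (x + real (2*j) * e))))))
      = (\<Sum>j<Suc N. real (2*N choose (2*j)) * (poly P (real (2*j)))\<^sup>2 * \<phi> (x + real (2*j) * e))"
  proof (intro sum.cong refl)
    fix j assume "j \<in> {..<Suc N}"
    then have j: "j \<le> N" by simp
    have "(\<Sum>i<Suc N. c i * W j i) = (\<Sum>i<N. sqrt (real (2*N choose (2*i+1))) * poly P (real (2*i+1)) * W j i)"
      by (simp add: c_def)
    then have "(\<Sum>i<Suc N. c i * W j i)\<^sup>2 = real (2*N choose (2*j)) * (poly P (real (2*j)))\<^sup>2"
      unfolding W(3)[OF dP j] by (simp add: power_mult_distrib)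
    then show "(\<Sum>i<Suc N. c i * W j i)\<^sup>2 * Re (\<omega> (qform n v (f (line X Y (x + real (2*j) * e)))))
      = real (2*N choose (2*j)) * (poly P (real (2*j)))\<^sup>2 * \<phi> (x + real (2*j) * e)" by (simp only: \<phi>_def)
  qed
  finally have "0 \<le> (\<Sum>j<Suc N. real (2*N choose (2*j)) * (poly P (real (2*j)))\<^sup>2 * \<phi> (x + real (2*j) * e))
     - (\<Sum>i<N. real (2*N choose (2*i+1)) * (poly P (real (2*i+1)))\<^sup>2 * \<phi> (x + real (2*i+1) * e))" by simp
  also have "\<dots> = (\<Sum>i\<le>2*N. (-1) ^ i * real (2*N choose i) * (poly P (real i))\<^sup>2 * \<phi> (x + real i * e))"
    unfolding sum_even_odd by (simp add: sum_negf)
  finally show "0 \<le> (\<Sum>i\<le>2*N. (-1) ^ i * real (2*N choose i) * (poly P (real i))\<^sup>2 *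
      Re (\<omega> (qform n v (f (line X Y (x + real i * e))))))" unfolding \<phi>_def .
qed

end

section \<open>The continuation to the tube\<close>

subsection \<open>Elements determined by states\<close>

lemma bounded_linear_state: assumes w: "state \<omega>" shows "bounded_linear \<omega>"
proof (rule bounded_linear_intro[where K = 2])
  show "\<omega> (x + y) = \<omega> x + \<omega> y" for x y by (rule state_add[OF w])
  show "\<omega> (r *\<^sub>R x) = r *\<^sub>R \<omega> x" for r x
    using state_scaleC[OF w, of "of_real r" x] by (simp add: scaleC_of_real scaleR_conv_of_real)
  show "norm (\<omega> x) \<le> norm x * 2" for x using state_bound[OF w, of x] by simp
qed

text \<open>Convergence in every state at a common rate is norm convergence, because states detect norms.\<close>

lemma element_of_state_limits:
  fixes x :: "nat \<Rightarrow> 'a::cstar_algebra"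
  assumes x: "\<And>k \<omega>. state \<omega> \<Longrightarrow> cmod (\<omega> (x k) - c \<omega>) \<le> K / real (Suc k)"
  obtains l where "\<And>\<omega>. state \<omega> \<Longrightarrow> \<omega> l = c \<omega>"
proof -
  have diff: "norm (x k - x l) \<le> 2 * (K / real (Suc k) + K / real (Suc l))" for k l
  proof (rule norm_le_of_states)
    fix \<omega> :: "'a \<Rightarrow> complex" assume w: "state \<omega>"
    show "cmod (\<omega> (x k - x l)) \<le> K / real (Suc k) + K / real (Suc l)"
      using x[OF w, of k] x[OF w, of l] norm_triangle_ineq4[of "\<omega> (x k) - c \<omega>" "\<omega> (x l) - c \<omega>"]
      by (simp add: state_diff[OF w])
  qed
  have "K / real (Suc k) \<ge> 0" if "state \<omega>" for \<omega> :: "'a \<Rightarrow> complex" and k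
    using order_trans[OF norm_ge_zero x[OF that]] .
  have lim0: "(\<lambda>k. K / real (Suc k)) \<longlonglongrightarrow> 0"
    using LIMSEQ_Suc[OF lim_const_over_n[of K]] by simp
  have "Cauchy x"
  proof (rule metric_CauchyI)
    fix e :: real assume e: "e > 0"
    have "\<forall>\<^sub>F k in sequentially. K / real (Suc k) < e / 4" using lim0 e by (intro order_tendstoD) auto
    then obtain N where N: "\<And>k. k \<ge> N \<Longrightarrow> K / real (Suc k) < e / 4" unfolding eventually_sequentially by blast
    have "dist (x k) (x l) < e" if "k \<ge> N" "l \<ge> N" for k l
    proof -
      have "2 * (p + q) < e" if "p < e / 4" "q < e / 4" for p q :: real using that by (simp add: field_simps)
      from this[OF N[OF that(1)] N[OF that(2)]] show ?thesis
        unfolding dist_norm by (rule le_less_trans[OF diff])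
    qed
    then show "\<exists>M. \<forall>m\<ge>M. \<forall>n\<ge>M. dist (x m) (x n) < e" by blast
  qed
  then obtain l where l: "x \<longlonglongrightarrow> l" using Cauchy_convergent_iff convergent_def by blast
  have "\<omega> l = c \<omega>" if w: "state \<omega>" for \<omega>
  proof (rule LIMSEQ_unique)
    show "(\<lambda>k. \<omega> (x k)) \<longlonglongrightarrow> \<omega> l" by (rule bounded_linear.tendsto[OF bounded_linear_state[OF w] l])
    have "(\<lambda>k. \<omega> (x k) - c \<omega>) \<longlonglongrightarrow> 0"
      by (rule Lim_null_comparison[OF _ lim0]) (use x[OF w] in \<open>simp add: always_eventually\<close>)
    then show "(\<lambda>k. \<omega> (x k)) \<longlonglongrightarrow> c \<omega>" by (rule LIM_zero_cancel)
  qed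
  then show thesis using that by blast
qed

lemma disc_Taylor:
  fixes h :: "complex \<Rightarrow> complex"
  assumes h: "h holomorphic_on ball 0 1" and b: "\<And>w. cmod w < 1 \<Longrightarrow> cmod (h w) \<le> C / (1 - cmod w) ^ 4"
  shows "cmod w < 1 \<Longrightarrow> (\<lambda>j. ((deriv ^^ j) h 0 / fact j) * w ^ j) sums h w"
    and "0 < r \<Longrightarrow> r < 1 \<Longrightarrow> cmod ((deriv ^^ j) h 0 / fact j) \<le> C / (1 - r) ^ 4 / r ^ j"
proof -
  show "(\<lambda>j. ((deriv ^^ j) h 0 / fact j) * w ^ j) sums h w" if "cmod w < 1"
    using holomorphic_power_series[OF h, of w] that by simp
  assume r: "0 < r" "r < 1"
  have "cmod ((deriv ^^ j) h 0) \<le> fact j * (C / (1 - r) ^ 4) / r ^ j"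
  proof (rule Cauchy_inequality[OF _ _ r(1)])
    have s: "cball 0 r \<subseteq> ball (0::complex) 1" using r by auto
    then show "h holomorphic_on ball 0 r" using h ball_subset_cball by (blast intro: holomorphic_on_subset)
    show "continuous_on (cball 0 r) h"
      using holomorphic_on_imp_continuous_on[OF h] s by (rule continuous_on_subset)
    show "cmod (h x) \<le> C / (1 - r) ^ 4" if "cmod (0 - x) = r" for x using b[of x] that r by simp
  qed
  then show "cmod ((deriv ^^ j) h 0 / fact j) \<le> C / (1 - r) ^ 4 / r ^ j"
    by (simp add: norm_divide divide_le_eq mult.commute)
qed

text \<open>The Taylor coefficients of the scalar functions are limits of finite differences of \<open>S\<close>, at a rate
  that does not depend on the state; so they come from elements of the algebra, and the power series of
  these elements converges at \<open>w\<close>.\<close>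

theorem element_of_disc_functions:
  fixes S :: "real \<Rightarrow> 'a::cstar_algebra" and h :: "('a \<Rightarrow> complex) \<Rightarrow> complex \<Rightarrow> complex"
  assumes h: "\<And>\<omega>. state \<omega> \<Longrightarrow> h \<omega> holomorphic_on ball 0 1"
    and b: "\<And>\<omega> w. state \<omega> \<Longrightarrow> cmod w < 1 \<Longrightarrow> cmod (h \<omega> w) \<le> C / (1 - cmod w) ^ 4"
    and S: "\<And>\<omega> w. state \<omega> \<Longrightarrow> \<bar>w\<bar> \<le> 1/8 \<Longrightarrow> h \<omega> (complex_of_real w) = \<omega> (S w)"
    and C: "C \<ge> 0" and w: "cmod w < 1"
  obtains E where "\<And>\<omega>. state \<omega> \<Longrightarrow> \<omega> E = h \<omega> w"
proof -
  define c where "c \<omega> j = (deriv ^^ j) (h \<omega>) 0 / fact j" for \<omega> :: "'a \<Rightarrow> complex" and j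
  have T: "cmod z < 1 \<Longrightarrow> (\<lambda>j. c \<omega> j * z ^ j) sums h \<omega> z"
    "0 < r \<Longrightarrow> r < 1 \<Longrightarrow> cmod (c \<omega> j) \<le> C / (1 - r) ^ 4 / r ^ j" if s: "state \<omega>" for \<omega> z r j
    using disc_Taylor[OF h[OF s] b[OF s], folded c_def] by blast+
  have c2: "cmod (c \<omega> j) \<le> 16 * C * 2 ^ j" if "state \<omega>" for \<omega> j
    using T(2)[OF that, of "1/2" j] by (simp add: power_divide field_simps)
  have "\<exists>y. \<forall>\<omega>. state \<omega> \<longrightarrow> \<omega> y = c \<omega> m" for m
  proof -
    define e where "e k = 1 / (8 * real (Suc m) * real (Suc k))" for k
    define x where "x k = complex_of_real (1 / (fact m * e k ^ m)) *\<^sub>C (\<Sum>i\<le>m. complex_of_real ((-1) ^ (m - i) * real (m choose i)) *\<^sub>C S (real i * e k))" for k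
    define K where "K = 16 * C * (2 * (8 * real (Suc m)) ^ Suc m) / (8 * real (Suc m))"
    have e: "0 < e k" "4 * real (Suc m) * e k \<le> 1" "i \<le> m \<Longrightarrow> real i * e k \<le> 1/8" for k i
    proof -
      show "0 < e k" by (simp add: e_def)
      have ek: "e k * (8 * real (Suc m) * real (Suc k)) = 1" by (simp add: e_def)
      have "e k * (8 * real (Suc m)) * 1 \<le> e k * (8 * real (Suc m)) * real (Suc k)"
        using \<open>0 < e k\<close> by (intro mult_left_mono) auto
      then have *: "e k * (8 * real (Suc m)) \<le> 1" using ek by (simp only: mult.assoc mult_1_right)
      then show "4 * real (Suc m) * e k \<le> 1" using \<open>0 < e k\<close> by (simp add: algebra_simps)
      assume "i \<le> m"
      then have "real i * e k \<le> real (Suc m) * e k" using \<open>0 < e k\<close> by (intro mult_right_mono) auto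
      also have "\<dots> \<le> 1/8" using * by (simp add: field_simps)
      finally show "real i * e k \<le> 1/8" .
    qed
    have "cmod (\<omega> (x k) - c \<omega> m) \<le> K / real (Suc k)" if s: "state \<omega>" for k \<omega>
    proof -
      have "cmod ((\<Sum>i\<le>m. (-1) ^ (m - i) * of_nat (m choose i) * \<omega> (S (real i * e k))) / of_real (e k) ^ m - fact m * c \<omega> m)
         \<le> (16 * C) * (2 * (8 * real (Suc m)) ^ Suc m) * e k"
      proof (rule finite_difference_series[where S = "\<lambda>t. \<omega> (S t)", OF _ e(1,2)])
        show "cmod (c \<omega> j) \<le> 16 * C * 2 ^ j" for j by (rule c2[OF s])
        fix i assume i: "i \<le> m"
        have t: "\<bar>real i * e k\<bar> \<le> 1/8" using e(3)[OF i, of k] e(1)[of k] by (simp add: abs_mult)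
        then have "cmod (complex_of_real (real i * e k)) < 1" by (simp only: norm_of_real)
        from T(1)[OF s this] have "(\<lambda>j. c \<omega> j * complex_of_real (real i * e k) ^ j) sums \<omega> (S (real i * e k))"
          unfolding S[OF s t] .
        then show "\<omega> (S (real i * e k)) = (\<Sum>j. c \<omega> j * complex_of_real (real i * e k) ^ j)" by (rule sums_unique)
      qed
      also have "(16 * C) * (2 * (8 * real (Suc m)) ^ Suc m) * e k = K / real (Suc k)"
        by (simp add: K_def e_def)
      also have "(\<Sum>i\<le>m. (-1) ^ (m - i) * of_nat (m choose i) * \<omega> (S (real i * e k))) / of_real (e k) ^ m = fact m * \<omega> (x k)"
        using e(1)[of k] by (simp add: x_def state_scaleC[OF s] state_sum[OF s])
      finally have "cmod (fact m * (\<omega> (x k) - c \<omega> m)) \<le> K / real (Suc k)" by (simp only: right_diff_distrib)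
      moreover have "1 * cmod (\<omega> (x k) - c \<omega> m) \<le> fact m * cmod (\<omega> (x k) - c \<omega> m)"
        by (intro mult_right_mono) (auto simp: fact_ge_1)
      ultimately show ?thesis by (simp add: norm_mult)
    qed
    then show ?thesis using element_of_state_limits[of x "\<lambda>\<omega>. c \<omega> m" K] by metis
  qed
  then obtain y where y: "\<And>m \<omega>. state \<omega> \<Longrightarrow> \<omega> (y m) = c \<omega> m" by metis
  define r where "r = (1 + cmod w) / 2"
  have r: "0 < r" "r < 1" "cmod w < r" using w norm_ge_zero[of w] by (simp_all add: r_def field_simps del: norm_ge_zero)
  have ny: "norm (y m) \<le> 2 * (C / (1 - r) ^ 4 / r ^ m)" for m
    by (rule norm_le_of_states) (use T(2)[OF _ r(1,2)] y in simp)
  have "summable (\<lambda>m. w ^ m *\<^sub>C y m)"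
  proof (rule summable_comparison_test)
    have "norm (w ^ m *\<^sub>C y m) \<le> 2 * C / (1 - r) ^ 4 * (cmod w / r) ^ m" for m
    proof -
      have "norm (w ^ m *\<^sub>C y m) \<le> cmod w ^ m * (2 * (C / (1 - r) ^ 4 / r ^ m))"
        unfolding norm_scaleC norm_power by (intro mult_left_mono ny) simp
      then show ?thesis by (simp add: power_divide mult_ac)
    qed
    then show "\<exists>N. \<forall>m\<ge>N. norm (w ^ m *\<^sub>C y m) \<le> 2 * C / (1 - r) ^ 4 * (cmod w / r) ^ m" by blast
    show "summable (\<lambda>m. 2 * C / (1 - r) ^ 4 * (cmod w / r) ^ m)"
      using r by (intro summable_mult summable_geometric) simp
  qed
  then obtain E where E: "(\<lambda>m. w ^ m *\<^sub>C y m) sums E" by (auto simp: summable_def)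
  have "\<omega> E = h \<omega> w" if s: "state \<omega>" for \<omega>
  proof (rule sums_unique2)
    show "(\<lambda>m. \<omega> (w ^ m *\<^sub>C y m)) sums \<omega> E" by (rule bounded_linear.sums[OF bounded_linear_state[OF s] E])
    show "(\<lambda>m. \<omega> (w ^ m *\<^sub>C y m)) sums h \<omega> w"
      using T(1)[OF s w] by (simp add: state_scaleC[OF s] y[OF s] mult.commute)
  qed
  then show thesis using that by blast
qed

subsection \<open>Quadratic remainder of a separately holomorphic function\<close>

lemma Schwarz_ball:
  fixes f :: "complex \<Rightarrow> complex"
  assumes f: "f holomorphic_on ball 0 \<rho>" and f0: "f 0 = 0" and B: "\<And>z. cmod z < \<rho> \<Longrightarrow> cmod (f z) \<le> B" and z: "cmod z < \<rho>"
  shows "cmod (f z) \<le> 2 * B * cmod z / \<rho>"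
proof -
  have \<rho>: "\<rho> > 0" using z norm_ge_zero[of z] by linarith
  have B0: "B \<ge> 0" using order_trans[OF norm_ge_zero B[OF z]] .
  show ?thesis
  proof (cases "B = 0")
    case True
    then show ?thesis using B[OF z] by simp
  next
    case False
    then have B1: "B > 0" using B0 by simp
    define g where "g w = f (of_real \<rho> * w) / of_real (2 * B)" for w
    have im: "(\<lambda>w. of_real \<rho> * w) ` ball 0 1 \<subseteq> ball (0::complex) \<rho>"
      using \<rho> by (auto simp: norm_mult)
    have "(f \<circ> (\<lambda>w. of_real \<rho> * w)) holomorphic_on ball 0 1"
      by (rule holomorphic_on_compose_gen[OF _ f im]) (intro holomorphic_intros)
    then have g: "g holomorphic_on ball 0 1"
      unfolding g_def[abs_def] o_def using B1 by (intro holomorphic_on_divide) auto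
    have g1: "cmod (g w) < 1" if "cmod w < 1" for w
    proof -
      have "cmod (f (of_real \<rho> * w)) \<le> B" using that \<rho> by (intro B) (simp add: norm_mult)
      then show ?thesis using B1 by (simp add: g_def norm_divide)
    qed
    have zl: "cmod (z / of_real \<rho>) < 1" using z \<rho> by (simp add: norm_divide)
    have "g 0 = 0" using f0 by (simp add: g_def)
    from Schwarz_Lemma(1)[OF g this g1 zl] have "cmod (g (z / of_real \<rho>)) \<le> cmod (z / of_real \<rho>)" .
    then show ?thesis using \<rho> B1 by (simp add: g_def norm_divide field_simps)
  qed
qed

text \<open>Two applications of the Schwarz lemma to the function without its affine part.\<close>

lemma quadratic_remainder:
  fixes g :: "complex \<Rightarrow> complex"
  assumes g: "g holomorphic_on ball 0 \<rho>" and L: "\<And>z. cmod z < \<rho> \<Longrightarrow> cmod (g z) \<le> L" and \<rho>: "\<rho> > 0"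
  shows "cmod (deriv g 0) \<le> 2 * L / \<rho>"
    "cmod z < \<rho> \<Longrightarrow> cmod (g z - g 0 - z * deriv g 0) \<le> 16 * L * (cmod z)\<^sup>2 / \<rho>\<^sup>2"
proof -
  have L0: "L \<ge> 0" using order_trans[OF norm_ge_zero L[of 0]] \<rho> by simp
  show d: "cmod (deriv g 0) \<le> 2 * L / \<rho>"
  proof -
    have "cmod ((deriv ^^ 1) g 0) \<le> fact 1 * L / (\<rho>/2) ^ 1"
    proof (rule Cauchy_inequality)
      show "g holomorphic_on ball 0 (\<rho>/2)" using g \<rho> by (auto intro: holomorphic_on_subset)
      show "continuous_on (cball 0 (\<rho>/2)) g"
        by (rule continuous_on_subset[OF holomorphic_on_imp_continuous_on[OF g]]) (use \<rho> in auto)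
    qed (use \<rho> L in auto)
    then show ?thesis by (simp add: mult.commute)
  qed
  define k where "k z = g z - g 0 - z * deriv g 0" for z
  define q where "q z = (if z = 0 then deriv k 0 else (k z - k 0) / (z - 0))" for z
  have k: "k holomorphic_on ball 0 \<rho>" unfolding k_def[abs_def] by (intro holomorphic_intros g)
  have "k analytic_on {0}" unfolding analytic_at_ball using k \<rho> by blast
  have gd: "g field_differentiable at 0"
    using holomorphic_on_imp_differentiable_at[OF g] \<rho> by simp
  have "(k has_field_derivative (deriv g 0 - 0 - 1 * deriv g 0)) (at 0)"
    unfolding k_def[abs_def]
    by (rule derivative_eq_intros DERIV_deriv_iff_field_differentiable[THEN iffD2, OF gd] refl | simp)+
  then have dk: "deriv k 0 = 0" using DERIV_imp_deriv by force
  have q: "q holomorphic_on ball 0 \<rho>"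
    unfolding q_def[abs_def] by (rule pole_lemma[OF k]) (use \<rho> in simp)
  have k0: "k 0 = 0" by (simp add: k_def)
  have q0: "q 0 = 0" by (simp add: q_def dk)
  have kb: "cmod (k z) \<le> 4 * L" if z: "cmod z < \<rho>" for z
  proof -
    have "cmod (z * deriv g 0) \<le> \<rho> * (2 * L / \<rho>)"
      unfolding norm_mult using z d \<rho> by (intro mult_mono) auto
    then have "cmod (z * deriv g 0) \<le> 2 * L" using \<rho> by simp
    moreover have "cmod (k z) \<le> cmod (g z) + cmod (g 0) + cmod (z * deriv g 0)"
      unfolding k_def by (rule order_trans[OF norm_triangle_ineq4 add_right_mono[OF norm_triangle_ineq4]])
    ultimately show ?thesis using L[OF z] L[of 0] \<rho> by simp
  qed
  have qb: "cmod (q z) \<le> 8 * L / \<rho>" if z: "cmod z < \<rho>" for z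
  proof (cases "z = 0")
    case True
    then show ?thesis using q0 L0 \<rho> by simp
  next
    case False
    have "cmod (k z) \<le> 2 * (4 * L) * cmod z / \<rho>" by (rule Schwarz_ball[OF k k0 kb z])
    then show ?thesis using False by (simp add: q_def k0 norm_divide divide_le_eq mult_ac)
  qed
  assume z: "cmod z < \<rho>"
  have "cmod (q z) \<le> 2 * (8 * L / \<rho>) * cmod z / \<rho>" by (rule Schwarz_ball[OF q q0 qb z])
  then have "cmod z * cmod (q z) \<le> cmod z * (2 * (8 * L / \<rho>) * cmod z / \<rho>)" by (intro mult_left_mono) auto
  moreover have "k z = z * q z" using k0 by (simp add: q_def)
  ultimately show "cmod (g z - g 0 - z * deriv g 0) \<le> 16 * L * (cmod z)\<^sup>2 / \<rho>\<^sup>2"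
    unfolding k_def[symmetric] by (simp add: norm_mult power2_eq_square mult_ac)
qed

text \<open>The mixed difference \<open>g x y - g x 0 - g 0 y + g 0 0\<close> vanishes on both axes; the Schwarz lemma in
  each variable bounds it by a multiple of \<open>|x| |y|\<close>.\<close>

lemma two_variable_remainder:
  fixes g :: "complex \<Rightarrow> complex \<Rightarrow> complex"
  assumes g1: "\<And>y. cmod y < \<rho> \<Longrightarrow> (\<lambda>x. g x y) holomorphic_on ball 0 \<rho>"
    and g2: "\<And>x. cmod x < \<rho> \<Longrightarrow> (\<lambda>y. g x y) holomorphic_on ball 0 \<rho>"
    and L: "\<And>x y. cmod x < \<rho> \<Longrightarrow> cmod y < \<rho> \<Longrightarrow> cmod (g x y) \<le> L" and \<rho>: "\<rho> > 0"
    and xy: "cmod x < \<rho>" "cmod y < \<rho>"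
  shows "cmod (g x y - g 0 0 - x * deriv (\<lambda>x. g x 0) 0 - y * deriv (\<lambda>y. g 0 y) 0)
     \<le> 16 * L * ((cmod x)\<^sup>2 + cmod x * cmod y + (cmod y)\<^sup>2) / \<rho>\<^sup>2"
proof -
  define h where "h x y = g x y - g x 0 - (g 0 y - g 0 0)" for x y
  have z: "cmod 0 < \<rho>" using \<rho> by simp
  have hb: "cmod (h x y) \<le> 4 * L" if "cmod x < \<rho>" "cmod y < \<rho>" for x y
  proof -
    have "cmod (h x y) \<le> cmod (g x y) + cmod (g x 0) + (cmod (g 0 y) + cmod (g 0 0))"
      unfolding h_def by (rule order_trans[OF norm_triangle_ineq4 add_mono[OF norm_triangle_ineq4 norm_triangle_ineq4]])
    then show ?thesis using L[OF that] L[OF that(1) z] L[OF z that(2)] L[OF z z] by simp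
  qed
  have h2: "cmod (h x y) \<le> 2 * (4 * L) * cmod y / \<rho>" if x: "cmod x < \<rho>" for x
  proof (rule Schwarz_ball[where f = "h x"])
    show "h x holomorphic_on ball 0 \<rho>"
      unfolding h_def[abs_def] by (intro holomorphic_intros g2 x z)
  qed (use hb x xy in \<open>auto simp: h_def\<close>)
  have "cmod (h x y) \<le> 2 * (2 * (4 * L) * cmod y / \<rho>) * cmod x / \<rho>"
  proof (rule Schwarz_ball[where f = "\<lambda>x. h x y"])
    show "(\<lambda>x. h x y) holomorphic_on ball 0 \<rho>"
      unfolding h_def by (intro holomorphic_intros g1 xy z)
  qed (use h2 xy in \<open>auto simp: h_def\<close>)
  then have hh: "cmod (h x y) \<le> 16 * L * (cmod x * cmod y) / \<rho>\<^sup>2" by (simp add: power2_eq_square mult_ac)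
  have r1: "cmod (g x 0 - g 0 0 - x * deriv (\<lambda>x. g x 0) 0) \<le> 16 * L * (cmod x)\<^sup>2 / \<rho>\<^sup>2"
    by (rule quadratic_remainder(2)[where g = "\<lambda>x. g x 0", OF g1[OF z] _ \<rho> xy(1)]) (rule L[OF _ z])
  have r2: "cmod (g 0 y - g 0 0 - y * deriv (\<lambda>y. g 0 y) 0) \<le> 16 * L * (cmod y)\<^sup>2 / \<rho>\<^sup>2"
    by (rule quadratic_remainder(2)[where g = "\<lambda>y. g 0 y", OF g2[OF z] _ \<rho> xy(2)]) (rule L[OF z])
  have eq: "g x y - g 0 0 - x * deriv (\<lambda>x. g x 0) 0 - y * deriv (\<lambda>y. g 0 y) 0
     = (g x 0 - g 0 0 - x * deriv (\<lambda>x. g x 0) 0) + h x y + (g 0 y - g 0 0 - y * deriv (\<lambda>y. g 0 y) 0)"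
    by (simp add: h_def)
  have "cmod (g x y - g 0 0 - x * deriv (\<lambda>x. g x 0) 0 - y * deriv (\<lambda>y. g 0 y) 0)
     \<le> 16 * L * (cmod x)\<^sup>2 / \<rho>\<^sup>2 + 16 * L * (cmod x * cmod y) / \<rho>\<^sup>2 + 16 * L * (cmod y)\<^sup>2 / \<rho>\<^sup>2"
    unfolding eq by (rule norm_triangle_mono[OF norm_triangle_mono[OF r1 hh] r2])
  then show ?thesis by (simp add: add_divide_distrib distrib_left)
qed

lemma deriv_of_quadratic_remainder:
  fixes k :: "complex \<Rightarrow> complex"
  assumes "r > 0" "\<And>z. cmod z < r \<Longrightarrow> cmod (k z - k 0 - z * d) \<le> C * (cmod z)\<^sup>2"
  shows "deriv k 0 = d"
proof -
  have "((\<lambda>z. (k z - k 0) / (z - 0) - d) \<longlongrightarrow> 0) (at 0)"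
  proof (rule Lim_null_comparison)
    show "\<forall>\<^sub>F z in at 0. cmod ((k z - k 0) / (z - 0) - d) \<le> C * cmod z"
      unfolding eventually_at
    proof (intro exI[of _ r] conjI ballI impI)
      fix z :: complex assume z: "z \<noteq> 0 \<and> dist z 0 < r"
      have "(k z - k 0) / (z - 0) - d = (k z - k 0 - z * d) / z" using z by (simp add: field_simps)
      then show "cmod ((k z - k 0) / (z - 0) - d) \<le> C * cmod z"
        using assms(2)[of z] z by (simp add: norm_divide divide_le_eq power2_eq_square mult_ac)
    qed (rule assms(1))
    show "((\<lambda>z. C * cmod z) \<longlongrightarrow> 0) (at 0)" by (auto intro!: tendsto_eq_intros)
  qed
  then have "(k has_field_derivative d) (at 0)" unfolding has_field_derivative_iff by (simp add: LIM_zero_iff)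
  then show ?thesis by (rule DERIV_imp_deriv)
qed

subsection \<open>Lines\<close>

lemma line_carrier: "X \<in> carrier_mat n n \<Longrightarrow> Y \<in> carrier_mat n n \<Longrightarrow> line X Y t \<in> carrier_mat n n"
  by (simp add: line_def)

lemma line_S_level: "X \<in> S_level R n \<Longrightarrow> Y \<in> S_level R n \<Longrightarrow> line X Y t \<in> S_level R n"
  unfolding line_def by (intro S_level_add S_level_scaleC)

lemma enorm_line_diff:
  assumes "X \<in> carrier_mat n n" "Y \<in> carrier_mat n n" "Z \<in> carrier_mat n n"
  shows "enorm n (line X Y t - Z) \<le> enorm n (X - Z) + \<bar>t\<bar> * enorm n Y"
proof -
  have "line X Y t - Z = (X - Z) + complex_of_real t *\<^sub>C\<^sub>m Y"
    by (intro eq_matI) (use assms in \<open>auto simp: line_def\<close>)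
  then show ?thesis
    using enorm_add[of "X - Z" n "complex_of_real t *\<^sub>C\<^sub>m Y"] enorm_scaleC[of Y n "complex_of_real t"] assms
      minus_carrier_mat[of Z n n X] by simp
qed

lemma enorm_line:
  assumes "X \<in> carrier_mat n n" "Y \<in> carrier_mat n n"
  shows "enorm n (line X Y t) \<le> enorm n X + \<bar>t\<bar> * enorm n Y"
  unfolding line_def
  using enorm_add[of X n "complex_of_real t *\<^sub>C\<^sub>m Y"] enorm_scaleC[of Y n "complex_of_real t"] assms by simp

lemma enorm_diff_self: "X \<in> carrier_mat n n \<Longrightarrow> enorm n (X - X) = 0"
  by (simp add: enorm_def)

lemma line_line:
  assumes "X \<in> carrier_mat n n" "Y \<in> carrier_mat n n" "U \<in> carrier_mat n n"
  shows "line (line X U s) (line Y U r) t = line (line X Y t) U (s + t * r)"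
  by (intro eq_matI)
     (use assms in \<open>auto simp: line_def scaleC_add_right scaleC_add_left scaleC_scaleC\<close>)

lemma line_zero: assumes "X \<in> carrier_mat n n" "Y \<in> carrier_mat n n" shows "line X Y 0 = X"
  by (intro eq_matI) (use assms in \<open>auto simp: line_def scaleC_zero_left\<close>)

lemma line_commute:
  assumes "X \<in> carrier_mat n n" "Y \<in> carrier_mat n n" "U \<in> carrier_mat n n"
  shows "line (line X U s) Y t = line (line X Y t) U s"
  by (intro eq_matI) (use assms in \<open>auto simp: line_def\<close>)

lemma line_scale:
  assumes "X \<in> carrier_mat n n" "Y \<in> carrier_mat n n"
  shows "line X (complex_of_real R *\<^sub>C\<^sub>m Y) t = line X Y (R * t)"
  by (intro eq_matI) (use assms in \<open>auto simp: line_def scaleC_scaleC mult.commute\<close>)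

subsection \<open>Polarisation\<close>

text \<open>The vector \<open>e\<^sub>a + z e\<^sub>b\<close>. For \<open>a = b\<close> it is \<open>(1 + z) e\<^sub>a\<close>, and the polarisation identity still
  holds.\<close>

definition polar :: "nat \<Rightarrow> nat \<Rightarrow> complex \<Rightarrow> nat \<Rightarrow> complex" where
  "polar a b z c = (if c = a then 1 else 0) + (if c = b then z else 0)"

lemma qform_polar:
  fixes E :: "'a::cstar_algebra mat"
  assumes "a < n" "b < n"
  shows "qform n (polar a b z) E = E $$ (a, a) + z *\<^sub>C E $$ (a, b) + cnj z *\<^sub>C E $$ (b, a) + (cnj z * z) *\<^sub>C E $$ (b, b)"
proof -
  have delta: "(\<Sum>c<n. \<Sum>d<n. (if c = p then if d = q then w else 0 else 0) *\<^sub>C E $$ (c, d)) = w *\<^sub>C E $$ (p, q)"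
    if "p < n" "q < n" for p q and w :: complex
  proof -
    have "(\<Sum>c<n. \<Sum>d<n. (if c = p then if d = q then w else 0 else 0) *\<^sub>C E $$ (c, d))
       = (\<Sum>c<n. if c = p then (\<Sum>d<n. if d = q then w *\<^sub>C E $$ (p, q) else 0) else 0)"
    proof (intro sum.cong refl)
      fix c
      show "(\<Sum>d<n. (if c = p then if d = q then w else 0 else 0) *\<^sub>C E $$ (c, d))
         = (if c = p then (\<Sum>d<n. if d = q then w *\<^sub>C E $$ (p, q) else 0) else 0)"
      proof (cases "c = p")
        case True
        have "(\<Sum>d<n. (if d = q then w else 0) *\<^sub>C E $$ (p, d)) = (\<Sum>d<n. if d = q then w *\<^sub>C E $$ (p, q) else 0)"
          by (rule sum.cong) (auto simp: scaleC_zero_left)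
        then show ?thesis unfolding True by (simp only: refl if_True)
      qed (simp add: scaleC_zero_left)
    qed
    also have "(\<Sum>d<n. if d = q then w *\<^sub>C E $$ (p, q) else 0) = w *\<^sub>C E $$ (p, q)" using that by simp
    finally show ?thesis using that by simp
  qed
  have split: "cnj (polar a b z c) * polar a b z d =
      (if c = a then if d = a then 1 else 0 else 0) + (if c = a then if d = b then z else 0 else 0)
    + (if c = b then if d = a then cnj z else 0 else 0) + (if c = b then if d = b then cnj z * z else 0 else 0)" for c d
    by (auto simp: polar_def algebra_simps)
  show ?thesis
    unfolding qform_def split scaleC_add_left sum.distrib
    by (simp only: delta[OF assms(1) assms(1)] delta[OF assms] delta[OF assms(2,1)] delta[OF assms(2) assms(2)] scaleC_one)
qed

lemma polarization_sum:
  fixes A B C D :: complex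
  shows "(\<Sum>k<4. (- \<i>) ^ k * (A + \<i> ^ k * B + cnj (\<i> ^ k) * C + D)) = 4 * B"
  by (simp add: eval_nat_numeral algebra_simps)

lemma state_entry_polarization:
  assumes w: "state \<omega>" and ab: "a < n" "b < n"
  shows "\<omega> (E $$ (a, b)) = (1/4) * (\<Sum>k<4. (- \<i>) ^ k * \<omega> (qform n (polar a b (\<i> ^ k)) E))"
proof -
  have u: "cnj (\<i> ^ k) * \<i> ^ k = 1" for k
    by (simp add: power_mult_distrib[symmetric])
  have "\<omega> (qform n (polar a b (\<i> ^ k)) E)
     = \<omega> (E $$ (a, a)) + \<i> ^ k * \<omega> (E $$ (a, b)) + cnj (\<i> ^ k) * \<omega> (E $$ (b, a)) + \<omega> (E $$ (b, b))" for k
    unfolding qform_polar[OF ab] u by (simp only: state_add[OF w] state_scaleC[OF w] scaleC_one)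
  then show ?thesis by (simp only: polarization_sum) simp
qed

lemma norm_qform_polar_le:
  fixes E :: "'a::cstar_algebra mat"
  assumes ab: "a < n" "b < n" and z: "cmod z = 1"
    and K: "\<And>c d. c < n \<Longrightarrow> d < n \<Longrightarrow> norm (E $$ (c, d)) \<le> K"
  shows "norm (qform n (polar a b z) E) \<le> 4 * K"
proof -
  have "norm (qform n (polar a b z) E)
     \<le> norm (E $$ (a, a)) + norm (z *\<^sub>C E $$ (a, b)) + norm (cnj z *\<^sub>C E $$ (b, a)) + norm ((cnj z * z) *\<^sub>C E $$ (b, b))"
    unfolding qform_polar[OF ab] by (intro norm_triangle_mono order_refl)
  also have "\<dots> \<le> K + K + K + K"
    unfolding norm_scaleC using z K ab by (intro add_mono) (auto simp: norm_mult)
  finally show ?thesis by simp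
qed

lemma star_qform:
  fixes E :: "'a::cstar_algebra mat"
  assumes "\<And>i j. i < n \<Longrightarrow> j < n \<Longrightarrow> star (E $$ (j, i)) = E $$ (i, j)"
  shows "star (qform n v E) = qform n v E"
proof -
  have "star (qform n v E) = (\<Sum>a<n. \<Sum>b<n. (cnj (v b) * v a) *\<^sub>C E $$ (b, a))"
    unfolding qform_def star_sum by (intro sum.cong refl) (simp add: star_scaleC assms mult.commute)
  also have "\<dots> = qform n v E" unfolding qform_def by (rule sum.swap)
  finally show ?thesis .
qed

context matrix_convex_function
begin

text \<open>Kraus functions are real valued; the values of \<open>f\<close> are hermitian.\<close>

lemma state_qform_real:
  assumes "Z \<in> level G n" "state \<omega>"
  shows "\<omega> (qform n v (f Z)) = complex_of_real (Re (\<omega> (qform n v (f Z))))"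
proof -
  have "star (qform n v (f Z)) = qform n v (f Z)"
    by (rule star_qform) (rule S_level_star[OF R2 f_S_level[OF assms(1)]])
  then have "cnj (\<omega> (qform n v (f Z))) = \<omega> (qform n v (f Z))" using state_star[OF assms(2)] by metis
  then show ?thesis by (simp add: complex_eq_iff)
qed

text \<open>A matrix entry is a combination of four compressions, each of which is a Kraus function.\<close>

lemma entry_disc:
  assumes X: "X \<in> carrier_mat n n" and Y: "Y \<in> carrier_mat n n"
    and L: "\<And>t. \<bar>t\<bar> \<le> 2 \<Longrightarrow> line X Y t \<in> level G n"
    and K: "\<And>t c d. \<bar>t\<bar> \<le> 2 \<Longrightarrow> c < n \<Longrightarrow> d < n \<Longrightarrow> norm (f (line X Y t) $$ (c, d)) \<le> K"
    and ab: "a < n" "b < n" and s: "state \<omega>"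
  shows "\<exists>h. h holomorphic_on ball 0 1 \<and> (\<forall>w. cmod w < 1 \<longrightarrow> cmod (h w) \<le> 456 * K / (1 - cmod w) ^ 4) \<and>
    (\<forall>w. \<bar>w\<bar> \<le> 1/8 \<longrightarrow> h (complex_of_real w) = \<omega> (f (line X Y (2 * w / (1 + w\<^sup>2))) $$ (a, b)))"
proof -
  define \<phi> where "\<phi> k t = Re (\<omega> (qform n (polar a b (\<i> ^ k)) (f (line X Y t))))" for k t
  have "\<exists>h. h holomorphic_on ball 0 1 \<and> (\<forall>w. cmod w < 1 \<longrightarrow> cmod (h w) \<le> 57 * (8 * K) / (1 - cmod w) ^ 4) \<and>
    (\<forall>w. \<bar>w\<bar> \<le> 1/8 \<longrightarrow> h (complex_of_real w) = complex_of_real (\<phi> k (2 * w / (1 + w\<^sup>2))))" for k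
  proof -
    have kr: "kraus (\<phi> k)" unfolding \<phi>_def[abs_def] by (rule kraus_of_matrix_convex[OF X Y L s])
    have "\<bar>\<phi> k t\<bar> \<le> 8 * K" if t: "t \<in> {-2..2}" for t
    proof -
      have "\<bar>t\<bar> \<le> 2" using t by auto
      then have "norm (qform n (polar a b (\<i> ^ k)) (f (line X Y t))) \<le> 4 * K"
        by (intro norm_qform_polar_le ab K) (auto simp: norm_power)
      then show ?thesis
        using abs_Re_le_cmod[of "\<omega> (qform n (polar a b (\<i> ^ k)) (f (line X Y t)))"]
          state_bound[OF s, of "qform n (polar a b (\<i> ^ k)) (f (line X Y t))"] by (simp add: \<phi>_def)
    qed
    from kraus_disc[OF kr this] show ?thesis by metis
  qed
  then obtain h where h: "\<And>k. h k holomorphic_on ball 0 1"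
    "\<And>k w. cmod w < 1 \<Longrightarrow> cmod (h k w) \<le> 57 * (8 * K) / (1 - cmod w) ^ 4"
    "\<And>k w. \<bar>w\<bar> \<le> 1/8 \<Longrightarrow> h k (complex_of_real w) = complex_of_real (\<phi> k (2 * w / (1 + w\<^sup>2)))"
    by metis
  define H where "H w = (1/4) * (\<Sum>k<(4::nat). (- \<i>) ^ k * h k w)" for w
  have "H holomorphic_on ball 0 1" unfolding H_def[abs_def] by (intro holomorphic_intros h)
  moreover have "cmod (H w) \<le> 456 * K / (1 - cmod w) ^ 4" if "cmod w < 1" for w
  proof -
    have "cmod (\<Sum>k<(4::nat). (- \<i>) ^ k * h k w) \<le> (\<Sum>k<(4::nat). 57 * (8 * K) / (1 - cmod w) ^ 4)"
      using h(2)[OF that] by (intro sum_norm_le) (simp add: norm_mult norm_power)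
    then show ?thesis by (simp add: H_def norm_mult norm_divide)
  qed
  moreover have "H (complex_of_real w) = \<omega> (f (line X Y (2 * w / (1 + w\<^sup>2))) $$ (a, b))" if w: "\<bar>w\<bar> \<le> 1/8" for w
  proof -
    have "\<bar>2 * w / (1 + w\<^sup>2)\<bar> \<le> \<bar>2 * w\<bar> / 1" unfolding abs_divide by (intro divide_left_mono) (auto simp: add_pos_nonneg)
    then have t: "\<bar>2 * w / (1 + w\<^sup>2)\<bar> \<le> 2" using w by (simp add: abs_mult)
    have "\<omega> (qform n v (f (line X Y (2 * w / (1 + w\<^sup>2))))) = complex_of_real (Re (\<omega> (qform n v (f (line X Y (2 * w / (1 + w\<^sup>2)))))))" for v
      by (rule state_qform_real[OF L[OF t] s])
    then show ?thesis
      unfolding state_entry_polarization[OF s ab] H_def h(3)[OF w] \<phi>_def by (simp only:)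
  qed
  ultimately show ?thesis by blast
qed

text \<open>Rescale the line so that the segment of half-length \<open>2R\<close> becomes \<open>[-2, 2]\<close>.\<close>

lemma entry_strip:
  assumes X: "X \<in> carrier_mat n n" and Y: "Y \<in> carrier_mat n n" and R: "R > 0"
    and L: "\<And>t. \<bar>t\<bar> \<le> 2 * R \<Longrightarrow> line X Y t \<in> level G n"
    and K: "\<And>t c d. \<bar>t\<bar> \<le> 2 * R \<Longrightarrow> c < n \<Longrightarrow> d < n \<Longrightarrow> norm (f (line X Y t) $$ (c, d)) \<le> K"
    and ab: "a < n" "b < n"
  obtains \<Phi> where "\<And>\<omega>. state \<omega> \<Longrightarrow> \<Phi> \<omega> holomorphic_on strip R"
    "\<And>\<omega> t. state \<omega> \<Longrightarrow> \<bar>t\<bar> \<le> R / 8 \<Longrightarrow> \<Phi> \<omega> (complex_of_real t) = \<omega> (f (line X Y t) $$ (a, b))"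
    "\<And>\<omega> z. state \<omega> \<Longrightarrow> z \<in> strip R \<Longrightarrow> cmod (\<Phi> \<omega> z) \<le> 456 * K * (1 / (1 - cmod (jouk (z / of_real R))) ^ 4)"
    "\<And>z. z \<in> strip R \<Longrightarrow> \<exists>E. \<forall>\<omega>. state \<omega> \<longrightarrow> \<omega> E = \<Phi> \<omega> z"
proof -
  let ?Y = "complex_of_real R *\<^sub>C\<^sub>m Y"
  have ls: "line X ?Y t = line X Y (R * t)" for t by (rule line_scale[OF X Y])
  have Rt: "\<bar>R * t\<bar> \<le> 2 * R" if "\<bar>t\<bar> \<le> 2" for t using that R by (simp add: abs_mult)
  have K0: "K \<ge> 0" using order_trans[OF norm_ge_zero K[of 0 a b]] R ab by simp
  have "\<exists>h. h holomorphic_on ball 0 1 \<and> (\<forall>w. cmod w < 1 \<longrightarrow> cmod (h w) \<le> 456 * K / (1 - cmod w) ^ 4) \<and>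
    (\<forall>w. \<bar>w\<bar> \<le> 1/8 \<longrightarrow> h (complex_of_real w) = \<omega> (f (line X Y (R * (2 * w / (1 + w\<^sup>2)))) $$ (a, b)))"
    if "state \<omega>" for \<omega>
    using entry_disc[of X n ?Y K a b \<omega>] X Y L K Rt ab that unfolding ls by simp
  then obtain h where h: "\<And>\<omega>. state \<omega> \<Longrightarrow> h \<omega> holomorphic_on ball 0 1"
    "\<And>\<omega> w. state \<omega> \<Longrightarrow> cmod w < 1 \<Longrightarrow> cmod (h \<omega> w) \<le> 456 * K / (1 - cmod w) ^ 4"
    "\<And>\<omega> w. state \<omega> \<Longrightarrow> \<bar>w\<bar> \<le> 1/8 \<Longrightarrow> h \<omega> (complex_of_real w) = \<omega> (f (line X Y (R * (2 * w / (1 + w\<^sup>2)))) $$ (a, b))"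
    by metis
  have sc: "z / of_real R \<in> strip 1 \<longleftrightarrow> z \<in> strip R" for z
    using R by (simp add: strip_def abs_divide)
  have im: "(\<lambda>z. z / of_real R) ` strip R \<subseteq> strip 1" using sc by blast
  define \<Phi> where "\<Phi> \<omega> z = h \<omega> (jouk (z / of_real R))" for \<omega> z
  show thesis
  proof (rule that[of \<Phi>])
    fix \<omega> :: "'b \<Rightarrow> complex" assume s: "state \<omega>"
    have ks: "(\<lambda>z. h \<omega> (jouk z)) holomorphic_on strip 1"
      "\<bar>t\<bar> \<le> 1/8 \<Longrightarrow> h \<omega> (jouk (complex_of_real t)) = \<omega> (f (line X Y (R * t)) $$ (a, b))" for t
      using kraus_strip[OF h(1)[OF s], of "\<lambda>t. \<omega> (f (line X Y (R * t)) $$ (a, b))"] h(3)[OF s] by blast+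
    have "((\<lambda>z. h \<omega> (jouk z)) \<circ> (\<lambda>z. z / of_real R)) holomorphic_on strip R"
      by (rule holomorphic_on_compose_gen[OF _ ks(1) im]) (use R in \<open>auto intro!: holomorphic_intros\<close>)
    then show "\<Phi> \<omega> holomorphic_on strip R" by (simp add: \<Phi>_def[abs_def] o_def)
    show "\<Phi> \<omega> (complex_of_real t) = \<omega> (f (line X Y t) $$ (a, b))" if t: "\<bar>t\<bar> \<le> R / 8" for t
    proof -
      have "\<bar>t / R\<bar> \<le> 1/8" using t R by (simp add: abs_divide field_simps)
      from ks(2)[OF this] show ?thesis using R by (simp add: \<Phi>_def)
    qed
    show "cmod (\<Phi> \<omega> z) \<le> 456 * K * (1 / (1 - cmod (jouk (z / of_real R))) ^ 4)" if "z \<in> strip R" for z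
      using h(2)[OF s, of "jouk (z / of_real R)"] jouk(1)[of "z / of_real R"] that sc[of z]
      by (simp add: \<Phi>_def strip_def)
  next
    fix z assume "z \<in> strip R"
    then have "cmod (jouk (z / of_real R)) < 1" using jouk(1)[of "z / of_real R"] sc[of z] by (simp add: strip_def)
    from element_of_disc_functions[where S = "\<lambda>w. f (line X Y (R * (2 * w / (1 + w\<^sup>2)))) $$ (a, b)", OF h _ this] K0
    show "\<exists>E. \<forall>\<omega>. state \<omega> \<longrightarrow> \<omega> E = \<Phi> \<omega> z" unfolding \<Phi>_def by (metis mult_nonneg_nonneg zero_le_numeral)
  qed
qed

subsection \<open>The value at a point of the tube\<close>

text \<open>\<open>E\<close> is the value at \<open>\<i>\<close> of the continuation of \<open>t \<mapsto> f(X + t Y)\<close> at entry \<open>(a, b)\<close>, seen through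
  every state. The width of the strip may depend on the state; the identity theorem makes \<open>E\<close>
  unique nevertheless.\<close>

definition continuation :: "nat \<Rightarrow> nat \<Rightarrow> 'a mat \<Rightarrow> 'a mat \<Rightarrow> 'b \<Rightarrow> bool" where
  "continuation a b X Y E \<longleftrightarrow> (\<forall>\<omega>. state \<omega> \<longrightarrow> (\<exists>\<rho>>0. \<exists>r>0. \<exists>\<Phi>. \<Phi> holomorphic_on strip \<rho> \<and>
     (\<forall>t. \<bar>t\<bar> < r \<longrightarrow> \<Phi> (complex_of_real t) = \<omega> (f (line X Y t) $$ (a, b))) \<and> \<Phi> \<i> = \<omega> E))"

lemma continuation_eval:
  assumes c: "continuation a b X Y E" and s: "state \<omega>" and pos: "\<rho> > 0" "r > 0"
    and \<Phi>: "\<Phi> holomorphic_on strip \<rho>"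
    and eq: "\<And>t. \<bar>t\<bar> < r \<Longrightarrow> \<Phi> (complex_of_real t) = \<omega> (f (line X Y t) $$ (a, b))"
  shows "\<Phi> \<i> = \<omega> E"
proof -
  obtain \<rho>' r' \<Phi>' where p: "\<rho>' > 0" "r' > 0" "\<Phi>' holomorphic_on strip \<rho>'" "\<Phi>' \<i> = \<omega> E"
    "\<And>t. \<bar>t\<bar> < r' \<Longrightarrow> \<Phi>' (complex_of_real t) = \<omega> (f (line X Y t) $$ (a, b))"
    using c s unfolding continuation_def by metis
  have "\<Phi> \<i> = \<Phi>' \<i>"
  proof (rule holomorphic_eq_of_real[where f = \<Phi> and g = \<Phi>' and z = \<i> and S = "strip (min \<rho> \<rho>')" and r = "min r r'"])
    show "\<Phi> holomorphic_on strip (min \<rho> \<rho>')" "\<Phi>' holomorphic_on strip (min \<rho> \<rho>')"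
      using \<Phi> p(3) by (auto simp: strip_def intro: holomorphic_on_subset)
    show "open (strip (min \<rho> \<rho>'))" "convex (strip (min \<rho> \<rho>'))" by (rule open_strip convex_strip)+
  qed (use p pos eq in \<open>auto simp: strip_def\<close>)
  then show ?thesis using p(4) by simp
qed

lemma continuation_unique:
  assumes "continuation a b X Y E" "continuation a b X Y E'" shows "E = E'"
proof (rule eq_of_states)
  fix \<omega> :: "'b \<Rightarrow> complex" assume s: "state \<omega>"
  then obtain \<rho> r \<Phi> where "\<rho> > 0" "r > 0" "\<Phi> holomorphic_on strip \<rho>" "\<Phi> \<i> = \<omega> E'"
    "\<And>t. \<bar>t\<bar> < r \<Longrightarrow> \<Phi> (complex_of_real t) = \<omega> (f (line X Y t) $$ (a, b))"
    using assms(2) unfolding continuation_def by metis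
  then show "\<omega> E = \<omega> E'" using continuation_eval[OF assms(1) s] by metis
qed

text \<open>The entry \<open>(a, b)\<close> of the continued function at \<open>X + \<i> Y\<close>, for \<open>X\<close> in the domain and
  \<open>Y\<close> in the corresponding hermitian level.\<close>

definition F :: "nat \<Rightarrow> nat \<Rightarrow> 'a mat \<Rightarrow> 'a mat \<Rightarrow> 'b" where
  "F a b X Y = (SOME E. continuation a b X Y E)"

lemma F_eq: "continuation a b X Y E \<Longrightarrow> F a b X Y = E"
  unfolding F_def by (rule some_equality) (auto intro: continuation_unique)

text \<open>Only the length of the segment and the bound on it enter the estimate, not the size of \<open>Y\<close>.\<close>

lemma F_line:
  assumes X: "X \<in> carrier_mat n n" and Y: "Y \<in> carrier_mat n n" and R: "R > 0"
    and L: "\<And>t. \<bar>t\<bar> \<le> 2 * R \<Longrightarrow> line X Y t \<in> level G n"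
    and K: "\<And>t c d. \<bar>t\<bar> \<le> 2 * R \<Longrightarrow> c < n \<Longrightarrow> d < n \<Longrightarrow> norm (f (line X Y t) $$ (c, d)) \<le> K"
    and ab: "a < n" "b < n"
  shows "continuation a b X Y (F a b X Y)"
    and "norm (F a b X Y) \<le> 2 * (456 * K * (1 / (1 - cmod (jouk (\<i> / of_real R))) ^ 4))"
proof -
  obtain \<Phi> where \<Phi>: "\<And>\<omega>. state \<omega> \<Longrightarrow> \<Phi> \<omega> holomorphic_on strip R"
    "\<And>\<omega> t. state \<omega> \<Longrightarrow> \<bar>t\<bar> \<le> R / 8 \<Longrightarrow> \<Phi> \<omega> (complex_of_real t) = \<omega> (f (line X Y t) $$ (a, b))"
    "\<And>\<omega> z. state \<omega> \<Longrightarrow> z \<in> strip R \<Longrightarrow> cmod (\<Phi> \<omega> z) \<le> 456 * K * (1 / (1 - cmod (jouk (z / of_real R))) ^ 4)"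
    "\<And>z. z \<in> strip R \<Longrightarrow> \<exists>E. \<forall>\<omega>. state \<omega> \<longrightarrow> \<omega> E = \<Phi> \<omega> z"
    by (rule entry_strip[OF X Y R L K ab]) (assumption | rule that)+
  have i: "\<i> \<in> strip R" using R by (simp add: strip_def)
  obtain E where E: "\<And>\<omega>. state \<omega> \<Longrightarrow> \<omega> E = \<Phi> \<omega> \<i>" using \<Phi>(4)[OF i] by blast
  have "continuation a b X Y E"
    unfolding continuation_def
  proof (intro allI impI)
    fix \<omega> :: "'b \<Rightarrow> complex" assume s: "state \<omega>"
    show "\<exists>\<rho>>0. \<exists>r>0. \<exists>\<Phi>. \<Phi> holomorphic_on strip \<rho> \<and>
      (\<forall>t. \<bar>t\<bar> < r \<longrightarrow> \<Phi> (complex_of_real t) = \<omega> (f (line X Y t) $$ (a, b))) \<and> \<Phi> \<i> = \<omega> E"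
      using \<Phi>(1,2)[OF s] E[OF s] R by (intro exI[of _ R] conjI exI[of _ "R/8"] exI[of _ "\<Phi> \<omega>"]) auto
  qed
  then show "continuation a b X Y (F a b X Y)" using F_eq by metis
  have FE: "F a b X Y = E" by (rule F_eq) fact
  show "norm (F a b X Y) \<le> 2 * (456 * K * (1 / (1 - cmod (jouk (\<i> / of_real R))) ^ 4))"
    unfolding FE by (rule norm_le_of_states) (use E \<Phi>(3)[OF _ i] in simp)
qed

lemma F_real:
  assumes "X \<in> level G n" "a < n" "b < n" shows "F a b X (0\<^sub>m n n) = f X $$ (a, b)"
proof (rule F_eq)
  have "line X (0\<^sub>m n n) t = X" for t
    by (intro eq_matI) (use G_carrier[OF assms(1)] in \<open>auto simp: line_def scaleC_zero_right\<close>)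
  then show "continuation a b X (0\<^sub>m n n) (f X $$ (a, b))"
    unfolding continuation_def
    by (auto intro!: exI[of _ "1::real"] exI[of _ "\<lambda>_. \<omega> (f X $$ (a, b))" for \<omega>] holomorphic_intros)
qed

text \<open>Openness and local boundedness of the hypotheses, restated for the entry norm.\<close>

lemma locally_bounded_entries:
  assumes X0: "X\<^sub>0 \<in> level G n"
  obtains \<epsilon> K where "\<epsilon> > 0" "K \<ge> 0"
    "\<And>Z. Z \<in> S_level R\<^sub>1 n \<Longrightarrow> enorm n (Z - X\<^sub>0) < \<epsilon> \<Longrightarrow> Z \<in> level G n"
    "\<And>Z c d. Z \<in> S_level R\<^sub>1 n \<Longrightarrow> enorm n (Z - X\<^sub>0) < \<epsilon> \<Longrightarrow> c < n \<Longrightarrow> d < n \<Longrightarrow> norm (f Z $$ (c, d)) \<le> K"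
proof -
  obtain e1 where e1: "e1 > 0" "\<And>Z. Z \<in> S_level R\<^sub>1 n \<Longrightarrow> mat_norm (Z - X\<^sub>0) < e1 \<Longrightarrow> Z \<in> G"
    using G X0 unfolding free_domain_def by blast
  obtain e2 K where e2: "e2 > 0" "\<And>Z. Z \<in> level G n \<Longrightarrow> mat_norm (Z - X\<^sub>0) < e2 \<Longrightarrow> mat_norm (f Z) \<le> K"
    using bdd X0 unfolding locally_bounded_def by blast
  have le: "mat_norm (Z - X\<^sub>0) \<le> enorm n (Z - X\<^sub>0)" if "Z \<in> S_level R\<^sub>1 n" for Z
    using S_level_carrier[OF that] G_carrier[OF X0] by (intro mat_norm_le_enorm minus_carrier_mat)
  have G': "Z \<in> level G n" if "Z \<in> S_level R\<^sub>1 n" "enorm n (Z - X\<^sub>0) < min e1 e2" for Z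
    using e1(2)[OF that(1)] le[OF that(1)] that(2) S_level_carrier[OF that(1)] by (simp add: level_def)
  show thesis
  proof (rule that[of "min e1 e2" "max K 0"])
    fix Z c d assume Z: "Z \<in> S_level R\<^sub>1 n" "enorm n (Z - X\<^sub>0) < min e1 e2" and cd: "c < n" "d < n"
    have "norm (f Z $$ (c, d)) \<le> mat_norm (f Z)" by (rule entry_le_mat_norm[OF f_carrier[OF G'[OF Z]] cd])
    also have "\<dots> \<le> K" using e2(2)[OF G'[OF Z]] le[OF Z(1)] Z(2) by simp
    finally show "norm (f Z $$ (c, d)) \<le> max K 0" by simp
  qed (use e1 e2 G' in auto)
qed

text \<open>Near \<open>(X\<^sub>0, Y\<^sub>0)\<close> one segment length serves all lines: it is chosen inversely proportional to a
  bound for the norm of \<open>Y\<close>.\<close>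

lemma F_locally_bounded:
  assumes X0: "X\<^sub>0 \<in> level G n" and Y0: "Y\<^sub>0 \<in> S_level R\<^sub>1 n"
  obtains \<delta> L where "\<delta> > 0" "L \<ge> 0"
    "\<And>X. X \<in> S_level R\<^sub>1 n \<Longrightarrow> enorm n (X - X\<^sub>0) < \<delta> \<Longrightarrow> X \<in> level G n"
    "\<And>X Y a b. X \<in> S_level R\<^sub>1 n \<Longrightarrow> Y \<in> S_level R\<^sub>1 n \<Longrightarrow> enorm n (X - X\<^sub>0) < \<delta> \<Longrightarrow> enorm n (Y - Y\<^sub>0) < \<delta> \<Longrightarrow>
       a < n \<Longrightarrow> b < n \<Longrightarrow> norm (F a b X Y) \<le> L"
proof -
  note cX0 = G_carrier[OF X0] and cY0 = S_level_carrier[OF Y0]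
  obtain \<epsilon> K where \<epsilon>: "\<epsilon> > 0" "K \<ge> 0"
    "\<And>Z. Z \<in> S_level R\<^sub>1 n \<Longrightarrow> enorm n (Z - X\<^sub>0) < \<epsilon> \<Longrightarrow> Z \<in> level G n"
    "\<And>Z c d. Z \<in> S_level R\<^sub>1 n \<Longrightarrow> enorm n (Z - X\<^sub>0) < \<epsilon> \<Longrightarrow> c < n \<Longrightarrow> d < n \<Longrightarrow> norm (f Z $$ (c, d)) \<le> K"
    by (rule locally_bounded_entries[OF X0]) (rule that)
  define N where "N = enorm n Y\<^sub>0 + 1"
  have N: "N \<ge> 1" using enorm_nonneg[of n Y\<^sub>0] by (simp add: N_def)
  define R where "R = \<epsilon> / (4 * N)"
  have R: "R > 0" "2 * R * N = \<epsilon> / 2" using \<epsilon>(1) N by (simp_all add: R_def)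
  define B where "B = 1 / (1 - cmod (jouk (\<i> / of_real R))) ^ 4"
  have "B \<ge> 0" by (simp add: B_def)
  show thesis
  proof (rule that[of "min 1 (\<epsilon> / 2)" "2 * (456 * K * B)"])
    fix X Y a b
    assume X: "X \<in> S_level R\<^sub>1 n" "enorm n (X - X\<^sub>0) < min 1 (\<epsilon> / 2)"
      and Y: "Y \<in> S_level R\<^sub>1 n" "enorm n (Y - Y\<^sub>0) < min 1 (\<epsilon> / 2)" and ab: "a < n" "b < n"
    note c = S_level_carrier[OF X(1)] S_level_carrier[OF Y(1)]
    have "Y = (Y - Y\<^sub>0) + Y\<^sub>0" by (intro eq_matI) (use c cY0 in auto)
    then have "enorm n Y \<le> enorm n (Y - Y\<^sub>0) + enorm n Y\<^sub>0"
      using enorm_add[of "Y - Y\<^sub>0" n Y\<^sub>0] minus_carrier_mat[OF cY0, of Y] cY0 by simp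
    then have YN: "enorm n Y \<le> N" using Y(2) by (simp add: N_def)
    have near: "enorm n (line X Y t - X\<^sub>0) < \<epsilon>" if "\<bar>t\<bar> \<le> 2 * R" for t
    proof -
      have "\<bar>t\<bar> * enorm n Y \<le> 2 * R * N" using that YN R by (intro mult_mono enorm_nonneg) auto
      then show ?thesis using enorm_line_diff[OF c cX0, of t] X(2) R(2) by simp
    qed
    have S: "line X Y t \<in> S_level R\<^sub>1 n" for t by (rule line_S_level[OF X(1) Y(1)])
    show "norm (F a b X Y) \<le> 2 * (456 * K * B)"
      unfolding B_def by (rule F_line(2)[OF c R(1) _ _ ab]) (use \<epsilon>(3,4) S near in blast)+
  next
    fix X assume "X \<in> S_level R\<^sub>1 n" "enorm n (X - X\<^sub>0) < min 1 (\<epsilon> / 2)"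
    then show "X \<in> level G n" using \<epsilon>(1) by (intro \<epsilon>(3)) auto
  qed (use \<epsilon> \<open>B \<ge> 0\<close> in auto)
qed

text \<open>All lines in question lie in the real plane through \<open>X\<close> spanned by \<open>Y\<close> and \<open>U\<close>, so that
  \<open>continuation_along_lines\<close> applies with \<open>W\<close> the continuation along \<open>X + s U + t (Y + r U)\<close>.\<close>

lemma F_holomorphic_at:
  assumes X: "X \<in> level G n" and Y: "Y \<in> S_level R\<^sub>1 n" and U: "U \<in> S_level R\<^sub>1 n" and s: "state \<omega>"
    and ab: "a < n" "b < n"
  shows "\<exists>\<delta>>0. (\<lambda>\<zeta>. \<omega> (F a b (line X U (Re \<zeta>)) (line Y U (Im \<zeta>)))) holomorphic_on ball 0 \<delta>"
proof -
  note XS = G_S_level[OF X]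
  note c = S_level_carrier[OF XS] S_level_carrier[OF Y] S_level_carrier[OF U]
  obtain \<epsilon> K where \<epsilon>: "\<epsilon> > 0" "K \<ge> 0"
    "\<And>Z. Z \<in> S_level R\<^sub>1 n \<Longrightarrow> enorm n (Z - X) < \<epsilon> \<Longrightarrow> Z \<in> level G n"
    "\<And>Z c d. Z \<in> S_level R\<^sub>1 n \<Longrightarrow> enorm n (Z - X) < \<epsilon> \<Longrightarrow> c < n \<Longrightarrow> d < n \<Longrightarrow> norm (f Z $$ (c, d)) \<le> K"
    by (rule locally_bounded_entries[OF X]) (rule that)
  define N where "N = enorm n Y + enorm n U + 1"
  have N: "N \<ge> 1" "enorm n Y \<le> N" "enorm n U \<le> N" using enorm_nonneg[of n Y] enorm_nonneg[of n U] by (simp_all add: N_def)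
  define R where "R = \<epsilon> / (4 * N)"
  have R: "R > 0" "4 * (R * N) = \<epsilon>" using \<epsilon>(1) N by (simp_all add: R_def)
  define \<alpha> where "\<alpha> = min 1 (R / 16)"
  have \<alpha>: "0 < \<alpha>" "\<alpha> \<le> 1" "\<alpha> \<le> R / 16" using R by (simp_all add: \<alpha>_def)
  have near: "enorm n (line (line X V p) W t - X) < \<epsilon>"
    if "V \<in> S_level R\<^sub>1 n" "W \<in> S_level R\<^sub>1 n" "enorm n V \<le> N" "enorm n W \<le> N" "\<bar>p\<bar> \<le> \<alpha>" "\<bar>t\<bar> \<le> 2 * R" for V W p t
  proof -
    note cc = S_level_carrier[OF that(1)] S_level_carrier[OF that(2)]
    have 1: "\<bar>p\<bar> * enorm n V \<le> R * N" "\<bar>t\<bar> * enorm n W \<le> (2 * R) * N"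
      using that \<alpha> R N by (auto intro!: mult_mono enorm_nonneg)
    have "enorm n (line (line X V p) W t - X) \<le> enorm n (line X V p - X) + \<bar>t\<bar> * enorm n W"
      by (rule enorm_line_diff[OF line_carrier[OF c(1) cc(1)] cc(2) c(1)])
    also have "enorm n (line X V p - X) \<le> enorm n (X - X) + \<bar>p\<bar> * enorm n V"
      by (rule enorm_line_diff[OF c(1) cc(1) c(1)])
    finally have "enorm n (line (line X V p) W t - X) \<le> \<bar>p\<bar> * enorm n V + \<bar>t\<bar> * enorm n W"
      using enorm_diff_self[OF c(1)] by simp
    moreover have "R * N > 0" using R(1) N(1) by simp
    ultimately show ?thesis using 1 R(2) by linarith
  qed
  have lines: "line (line X V p) W t \<in> level G n"
      "c' < n \<Longrightarrow> d' < n \<Longrightarrow> norm (f (line (line X V p) W t) $$ (c', d')) \<le> K"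
    if "V \<in> S_level R\<^sub>1 n" "W \<in> S_level R\<^sub>1 n" "enorm n V \<le> N" "enorm n W \<le> N" "\<bar>p\<bar> \<le> \<alpha>" "\<bar>t\<bar> \<le> 2 * R" for V W p t c' d'
    using \<epsilon>(3)[OF _ near[OF that]] \<epsilon>(4)[OF _ near[OF that]] line_S_level[OF line_S_level[OF XS that(1)] that(2)] by blast+
  define Q where "Q = (\<lambda>z. z / of_real R) ` cbox (Complex (- \<alpha>) (-2)) (Complex \<alpha> 2)"
  have inbox: "z \<in> cbox (Complex (- \<alpha>) (-2)) (Complex \<alpha> 2) \<longleftrightarrow> \<bar>Re z\<bar> \<le> \<alpha> \<and> \<bar>Im z\<bar> \<le> 2" for z
    by (auto simp: in_cbox_complex_iff abs_le_iff)
  have "compact Q" unfolding Q_def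
    by (rule compact_continuous_image) (use R in \<open>auto intro!: continuous_intros\<close>)
  moreover have "Q \<subseteq> strip 1"
  proof
    fix w assume "w \<in> Q"
    then obtain z where z: "w = z / of_real R" "\<bar>Re z\<bar> \<le> \<alpha>" unfolding Q_def using inbox by blast
    then show "w \<in> strip 1" using \<alpha> R by (simp add: strip_def abs_divide)
  qed
  ultimately obtain B where B: "B \<ge> 0" "\<And>w. w \<in> Q \<Longrightarrow> 1 / (1 - cmod (jouk w)) ^ 4 \<le> B"
    by (rule jouk_compact_bound) (rule that)
  \<comment> \<open>continuations along all the lines involved, with one bound\<close>
  have ext: "\<exists>\<Phi>. \<Phi> holomorphic_on strip R \<and> (\<forall>t. \<bar>t\<bar> \<le> R / 8 \<longrightarrow> \<Phi> (complex_of_real t) = \<omega> (f (line (line X V p) W t) $$ (a, b)))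
      \<and> (\<forall>z. \<bar>Re z\<bar> \<le> \<alpha> \<longrightarrow> \<bar>Im z\<bar> \<le> 2 \<longrightarrow> cmod (\<Phi> z) \<le> 456 * K * B)"
    if V: "V \<in> S_level R\<^sub>1 n" and W: "W \<in> S_level R\<^sub>1 n" and VN: "enorm n V \<le> N" and WN: "enorm n W \<le> N" and p: "\<bar>p\<bar> \<le> \<alpha>" for V W p
  proof -
    have cc: "line X V p \<in> carrier_mat n n" "W \<in> carrier_mat n n"
      using line_carrier c S_level_carrier V W by blast+
    obtain \<Phi> where \<Phi>: "\<And>\<omega>. state \<omega> \<Longrightarrow> \<Phi> \<omega> holomorphic_on strip R"
      "\<And>\<omega> t. state \<omega> \<Longrightarrow> \<bar>t\<bar> \<le> R / 8 \<Longrightarrow> \<Phi> \<omega> (complex_of_real t) = \<omega> (f (line (line X V p) W t) $$ (a, b))"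
      "\<And>\<omega> z. state \<omega> \<Longrightarrow> z \<in> strip R \<Longrightarrow> cmod (\<Phi> \<omega> z) \<le> 456 * K * (1 / (1 - cmod (jouk (z / of_real R))) ^ 4)"
      by (rule entry_strip[OF cc R(1) lines(1)[OF V W VN WN p] lines(2)[OF V W VN WN p] ab]) (assumption | rule that)+
    have "cmod (\<Phi> \<omega> z) \<le> 456 * K * B" if z: "\<bar>Re z\<bar> \<le> \<alpha>" "\<bar>Im z\<bar> \<le> 2" for z
    proof -
      have "z \<in> strip R" using z \<alpha> R by (simp add: strip_def)
      moreover have "z / of_real R \<in> Q" unfolding Q_def using inbox z by blast
      ultimately show ?thesis
        using \<Phi>(3)[OF s, of z] mult_left_mono[OF B(2)[of "z / of_real R"], of "456 * K"] \<epsilon>(2) by simp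
    qed
    then show ?thesis using \<Phi>(1,2)[OF s] by blast
  qed
  define u where "u t \<sigma> = \<omega> (f (line (line X Y t) U \<sigma>) $$ (a, b))" for t \<sigma>
  have "\<exists>\<U>. \<forall>\<sigma>. \<bar>\<sigma>\<bar> \<le> \<alpha> \<longrightarrow> \<U> \<sigma> holomorphic_on strip R \<and> (\<forall>t. \<bar>t\<bar> \<le> R / 8 \<longrightarrow> \<U> \<sigma> (complex_of_real t) = u t \<sigma>)
      \<and> (\<forall>z. \<bar>Re z\<bar> \<le> \<alpha> \<longrightarrow> \<bar>Im z\<bar> \<le> 2 \<longrightarrow> cmod (\<U> \<sigma> z) \<le> 456 * K * B)"
    using ext[OF U Y N(3,2)] unfolding u_def line_commute[OF c, symmetric] by metis
  then obtain \<U> where \<U>: "\<And>\<sigma>. \<bar>\<sigma>\<bar> \<le> \<alpha> \<Longrightarrow> \<U> \<sigma> holomorphic_on strip R"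
    "\<And>\<sigma> t. \<bar>\<sigma>\<bar> \<le> \<alpha> \<Longrightarrow> \<bar>t\<bar> \<le> R / 8 \<Longrightarrow> \<U> \<sigma> (complex_of_real t) = u t \<sigma>"
    "\<And>\<sigma> z. \<bar>\<sigma>\<bar> \<le> \<alpha> \<Longrightarrow> \<bar>Re z\<bar> \<le> \<alpha> \<Longrightarrow> \<bar>Im z\<bar> \<le> 2 \<Longrightarrow> cmod (\<U> \<sigma> z) \<le> 456 * K * B" by blast
  have "\<exists>\<V>. \<forall>t. \<bar>t\<bar> \<le> \<alpha> \<longrightarrow> \<V> t holomorphic_on strip R \<and> (\<forall>\<sigma>. \<bar>\<sigma>\<bar> \<le> R / 8 \<longrightarrow> \<V> t (complex_of_real \<sigma>) = u t \<sigma>)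
      \<and> (\<forall>z. \<bar>Re z\<bar> \<le> \<alpha> \<longrightarrow> \<bar>Im z\<bar> \<le> 2 \<longrightarrow> cmod (\<V> t z) \<le> 456 * K * B)"
    using ext[OF Y U N(2,3)] unfolding u_def by metis
  then obtain \<V> where \<V>: "\<And>t. \<bar>t\<bar> \<le> \<alpha> \<Longrightarrow> \<V> t holomorphic_on strip R"
    "\<And>t \<sigma>. \<bar>t\<bar> \<le> \<alpha> \<Longrightarrow> \<bar>\<sigma>\<bar> \<le> R / 8 \<Longrightarrow> \<V> t (complex_of_real \<sigma>) = u t \<sigma>"
    "\<And>t z. \<bar>t\<bar> \<le> \<alpha> \<Longrightarrow> \<bar>Re z\<bar> \<le> \<alpha> \<Longrightarrow> \<bar>Im z\<bar> \<le> 2 \<Longrightarrow> cmod (\<V> t z) \<le> 456 * K * B" by blast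
  have WN: "enorm n (line Y U r) \<le> N" if "\<bar>r\<bar> \<le> \<alpha>" for r
  proof -
    have "\<bar>r\<bar> * enorm n U \<le> 1 * enorm n U" using that \<alpha> by (intro mult_right_mono enorm_nonneg) auto
    then show ?thesis using enorm_line[OF c(2,3), of r] by (simp add: N_def)
  qed
  define \<W> where "\<W> p r = (SOME \<Phi>. \<Phi> holomorphic_on strip R \<and>
      (\<forall>t. \<bar>t\<bar> \<le> R / 8 \<longrightarrow> \<Phi> (complex_of_real t) = \<omega> (f (line (line X U p) (line Y U r) t) $$ (a, b))))" for p r
  have \<W>: "\<W> p r holomorphic_on strip R"
    "\<bar>t\<bar> \<le> R / 8 \<Longrightarrow> \<W> p r (complex_of_real t) = \<omega> (f (line (line X U p) (line Y U r) t) $$ (a, b))"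
    if "\<bar>p\<bar> \<le> \<alpha>" "\<bar>r\<bar> \<le> \<alpha>" for p r t
  proof -
    have "\<exists>\<Phi>. \<Phi> holomorphic_on strip R \<and>
      (\<forall>t. \<bar>t\<bar> \<le> R / 8 \<longrightarrow> \<Phi> (complex_of_real t) = \<omega> (f (line (line X U p) (line Y U r) t) $$ (a, b)))"
      using ext[OF U line_S_level[OF Y U] N(3) WN[OF that(2)] that(1)] by blast
    from someI_ex[OF this, folded \<W>_def]
    show "\<W> p r holomorphic_on strip R"
      "\<bar>t\<bar> \<le> R / 8 \<Longrightarrow> \<W> p r (complex_of_real t) = \<omega> (f (line (line X U p) (line Y U r) t) $$ (a, b))" by blast+
  qed
  have sub: "strip (2 * \<alpha>) \<subseteq> strip R" "ball 0 (2 * \<alpha>) \<subseteq> strip R"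
  proof -
    show 1: "strip (2 * \<alpha>) \<subseteq> strip R" using \<alpha> R by (auto simp: strip_def)
    have "ball 0 (2 * \<alpha>) \<subseteq> strip (2 * \<alpha>)"
      by (auto simp: strip_def intro: le_less_trans[OF abs_Re_le_cmod])
    then show "ball 0 (2 * \<alpha>) \<subseteq> strip R" using 1 by blast
  qed
  have small: "\<bar>t\<bar> \<le> R / 8" if "\<bar>t\<bar> \<le> \<alpha>" for t using that \<alpha> R by linarith
  have "\<exists>\<delta>>0. (\<lambda>\<zeta>. \<W> (Re \<zeta>) (Im \<zeta>) \<i>) holomorphic_on ball 0 \<delta>"
  proof (rule continuation_along_lines[where a = \<alpha> and \<eta> = \<alpha> and \<rho> = \<alpha> and U = \<U> and V = \<V> and u = u and C = "456 * K * B"])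
    show "\<V> t holomorphic_on ball 0 (2 * \<alpha>)" if "\<bar>t\<bar> \<le> \<alpha>" for t
      using holomorphic_on_subset[OF \<V>(1)[OF that] sub(2)] .
    show "cmod (\<V> t z) \<le> 456 * K * B" if "\<bar>t\<bar> \<le> \<alpha>" "cmod z \<le> \<alpha>" for t z
      using \<V>(3)[OF that(1), of z] abs_Re_le_cmod[of z] abs_Im_le_cmod[of z] that \<alpha> by linarith
    show "\<U> \<sigma> holomorphic_on strip (2 * \<alpha>)" if "\<bar>\<sigma>\<bar> \<le> \<alpha>" for \<sigma>
      using holomorphic_on_subset[OF \<U>(1)[OF that] sub(1)] .
    show "\<W> p r holomorphic_on strip (2 * \<alpha>)" if "\<bar>p\<bar> \<le> \<alpha>" "\<bar>r\<bar> \<le> \<alpha>" for p r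
      using holomorphic_on_subset[OF \<W>(1)[OF that] sub(1)] .
    show "\<W> p r (complex_of_real t) = u t (p + t * r)" if "\<bar>p\<bar> \<le> \<alpha>" "\<bar>r\<bar> \<le> \<alpha>" "\<bar>t\<bar> \<le> \<alpha>" for p r t
      using \<W>(2)[OF that(1,2) small[OF that(3)]] unfolding u_def line_line[OF c] .
  qed (use \<alpha> \<U>(2,3) \<V>(2) small in auto)
  then obtain \<delta> where \<delta>: "\<delta> > 0" "(\<lambda>\<zeta>. \<W> (Re \<zeta>) (Im \<zeta>) \<i>) holomorphic_on ball 0 \<delta>" by blast
  have eq: "\<W> (Re \<zeta>) (Im \<zeta>) \<i> = \<omega> (F a b (line X U (Re \<zeta>)) (line Y U (Im \<zeta>)))" if "\<zeta> \<in> ball 0 (min \<delta> \<alpha>)" for \<zeta>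
  proof -
    have b: "\<bar>Re \<zeta>\<bar> \<le> \<alpha>" "\<bar>Im \<zeta>\<bar> \<le> \<alpha>" using that abs_Re_le_cmod[of \<zeta>] abs_Im_le_cmod[of \<zeta>] by auto
    have "continuation a b (line X U (Re \<zeta>)) (line Y U (Im \<zeta>)) (F a b (line X U (Re \<zeta>)) (line Y U (Im \<zeta>)))"
      by (rule F_line(1)[OF line_carrier[OF c(1,3)] line_carrier[OF c(2,3)] R(1)
            lines(1)[OF U line_S_level[OF Y U] N(3) WN[OF b(2)] b(1)]
            lines(2)[OF U line_S_level[OF Y U] N(3) WN[OF b(2)] b(1)] ab])
    from continuation_eval[OF this s R(1), of "R/8" "\<W> (Re \<zeta>) (Im \<zeta>)"] show ?thesis
      using \<W>[OF b] R by simp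
  qed
  have "(\<lambda>\<zeta>. \<omega> (F a b (line X U (Re \<zeta>)) (line Y U (Im \<zeta>)))) holomorphic_on ball 0 (min \<delta> \<alpha>)"
    by (subst holomorphic_cong[OF refl eq[symmetric]]) (auto intro: holomorphic_on_subset[OF \<delta>(2)])
  then show ?thesis using \<delta>(1) \<alpha>(1) by (intro exI[of _ "min \<delta> \<alpha>"]) auto
qed

subsection \<open>Complex differentiability\<close>

definition bounded_near :: "nat \<Rightarrow> 'a mat \<Rightarrow> 'a mat \<Rightarrow> real \<Rightarrow> real \<Rightarrow> bool" where
  "bounded_near n X\<^sub>0 Y\<^sub>0 \<delta> L \<longleftrightarrow> \<delta> > 0 \<and> L \<ge> 0 \<and>
     (\<forall>X\<in>S_level R\<^sub>1 n. enorm n (X - X\<^sub>0) < \<delta> \<longrightarrow> X \<in> level G n) \<and>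
     (\<forall>X\<in>S_level R\<^sub>1 n. \<forall>Y\<in>S_level R\<^sub>1 n. enorm n (X - X\<^sub>0) < \<delta> \<longrightarrow> enorm n (Y - Y\<^sub>0) < \<delta> \<longrightarrow>
        (\<forall>a<n. \<forall>b<n. norm (F a b X Y) \<le> L))"

text \<open>The derivative at \<open>X + \<i> Y\<close> in the self-adjoint direction \<open>U\<close>, seen through a state.\<close>

definition state_deriv :: "('b \<Rightarrow> complex) \<Rightarrow> nat \<Rightarrow> nat \<Rightarrow> 'a mat \<Rightarrow> 'a mat \<Rightarrow> 'a mat \<Rightarrow> complex" where
  "state_deriv \<omega> a b X Y U = deriv (\<lambda>\<zeta>. \<omega> (F a b (line X U (Re \<zeta>)) (line Y U (Im \<zeta>)))) 0"

lemma line_add: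
  fixes X :: "'c::cstar_algebra mat"
  assumes "X \<in> carrier_mat n n" "U \<in> carrier_mat n n"
  shows "line (line X U s) U t = line X U (s + t)"
  by (intro eq_matI) (use assms in \<open>auto simp: line_def scaleC_add_left\<close>)

lemma F_holomorphic_on_ball:
  assumes bn: "bounded_near n X\<^sub>0 Y\<^sub>0 \<delta> L" and X0: "X\<^sub>0 \<in> carrier_mat n n"
    and S: "X \<in> S_level R\<^sub>1 n" "Y \<in> S_level R\<^sub>1 n" "U \<in> S_level R\<^sub>1 n"
    and near: "enorm n (X - X\<^sub>0) + \<rho> * enorm n U < \<delta>" and s: "state \<omega>" and ab: "a < n" "b < n"
  shows "(\<lambda>\<zeta>. \<omega> (F a b (line X U (Re \<zeta>)) (line Y U (Im \<zeta>)))) holomorphic_on ball 0 \<rho>"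
  unfolding holomorphic_on_def
proof
  fix z :: complex assume z: "z \<in> ball 0 \<rho>"
  note c = S_level_carrier[OF S(1)] S_level_carrier[OF S(2)] S_level_carrier[OF S(3)]
  let ?g = "\<lambda>\<zeta>. \<omega> (F a b (line X U (Re \<zeta>)) (line Y U (Im \<zeta>)))"
  have "\<bar>Re z\<bar> * enorm n U \<le> \<rho> * enorm n U"
    using abs_Re_le_cmod[of z] z by (intro mult_right_mono enorm_nonneg) auto
  then have "enorm n (line X U (Re z) - X\<^sub>0) < \<delta>"
    using enorm_line_diff[OF c(1,3) X0, of "Re z"] near by linarith
  then have "line X U (Re z) \<in> level G n"
    using bn line_S_level[OF S(1,3)] unfolding bounded_near_def by blast
  from F_holomorphic_at[OF this line_S_level[OF S(2,3)] S(3) s ab, of "Im z"]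
  obtain d where d: "d > 0" "(\<lambda>\<zeta>. ?g (z + \<zeta>)) holomorphic_on ball 0 d"
    unfolding line_add[OF c(1,3)] line_add[OF c(2,3)] by auto
  have "((\<lambda>\<zeta>. ?g (z + \<zeta>)) \<circ> (\<lambda>w. w - z)) holomorphic_on ball z d"
    by (rule holomorphic_on_compose_gen[OF _ d(2)]) (auto intro!: holomorphic_intros simp: dist_norm norm_minus_commute)
  then have "?g holomorphic_on ball z d" by (simp add: o_def)
  then have "?g field_differentiable at z" using d(1) by (intro holomorphic_on_imp_differentiable_at) auto
  then show "?g field_differentiable at z within ball 0 \<rho>" by (rule field_differentiable_at_within)
qed

text \<open>The larger \<open>\<sigma>\<close>, the smaller the polydisc on which both directions may be used; keeping \<open>\<sigma>\<close> free
  makes the remainder homogeneous of degree two in the increment.\<close>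

lemma F_remainder:
  assumes bn: "bounded_near n X\<^sub>0 Y\<^sub>0 \<delta> L"
    and S: "X\<^sub>0 \<in> S_level R\<^sub>1 n" "Y\<^sub>0 \<in> S_level R\<^sub>1 n" "U \<in> S_level R\<^sub>1 n" "V \<in> S_level R\<^sub>1 n"
    and s: "state \<omega>" and ab: "a < n" "b < n" and \<sigma>: "\<sigma> > 0" "enorm n U + enorm n V \<le> \<sigma>"
  shows "cmod x < \<delta> / (2 * \<sigma>) \<Longrightarrow> cmod y < \<delta> / (2 * \<sigma>) \<Longrightarrow>
    cmod (\<omega> (F a b (line (line X\<^sub>0 U (Re x)) V (Re y)) (line (line Y\<^sub>0 U (Im x)) V (Im y))) - \<omega> (F a b X\<^sub>0 Y\<^sub>0)
       - x * state_deriv \<omega> a b X\<^sub>0 Y\<^sub>0 U - y * state_deriv \<omega> a b X\<^sub>0 Y\<^sub>0 V)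
      \<le> 128 * L * \<sigma>\<^sup>2 / \<delta>\<^sup>2 * ((cmod x)\<^sup>2 + cmod x * cmod y + (cmod y)\<^sup>2)"
    and "cmod (state_deriv \<omega> a b X\<^sub>0 Y\<^sub>0 U) \<le> 8 * L * \<sigma> / \<delta>"
proof -
  note c = S_level_carrier[OF S(1)] S_level_carrier[OF S(2)] S_level_carrier[OF S(3)] S_level_carrier[OF S(4)]
  have \<delta>: "\<delta> > 0" and L: "L \<ge> 0"
    and bd: "\<And>X Y. X \<in> S_level R\<^sub>1 n \<Longrightarrow> Y \<in> S_level R\<^sub>1 n \<Longrightarrow> enorm n (X - X\<^sub>0) < \<delta> \<Longrightarrow> enorm n (Y - Y\<^sub>0) < \<delta> \<Longrightarrow>
      norm (F a b X Y) \<le> L"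
    using bn ab unfolding bounded_near_def by blast+
  define \<rho> where "\<rho> = \<delta> / (2 * \<sigma>)"
  have \<rho>: "\<rho> > 0" "\<rho> * \<sigma> = \<delta> / 2" using \<delta> \<sigma> by (simp_all add: \<rho>_def)
  have UV: "\<rho> * enorm n U + \<rho> * enorm n V < \<delta>"
  proof -
    have "\<rho> * (enorm n U + enorm n V) \<le> \<rho> * \<sigma>" using \<sigma> \<rho> by (intro mult_left_mono) auto
    then show ?thesis using \<rho>(2) \<delta> by (simp add: distrib_left)
  qed
  have step: "enorm n (line Z W t - Z\<^sub>0) \<le> enorm n (Z - Z\<^sub>0) + \<rho> * enorm n W"
    if "\<bar>t\<bar> < \<rho>" "Z \<in> carrier_mat n n" "W \<in> carrier_mat n n" "Z\<^sub>0 \<in> carrier_mat n n" for Z W Z\<^sub>0 :: "'a mat" and t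
  proof -
    have "\<bar>t\<bar> * enorm n W \<le> \<rho> * enorm n W" using that by (intro mult_right_mono enorm_nonneg) auto
    then show ?thesis using enorm_line_diff[OF that(2,3,4), of t] by linarith
  qed
  have step0: "enorm n (line Z W t - Z) \<le> \<rho> * enorm n W"
    if "\<bar>t\<bar> < \<rho>" "Z \<in> carrier_mat n n" "W \<in> carrier_mat n n" for Z W :: "'a mat" and t
    using step[OF that that(2)] enorm_diff_self[OF that(2)] by simp
  have re: "\<bar>Re x\<bar> < \<rho>" "\<bar>Im x\<bar> < \<rho>" if "cmod x < \<rho>" for x
    using that abs_Re_le_cmod[of x] abs_Im_le_cmod[of x] by linarith+
  define g where "g x y = \<omega> (F a b (line (line X\<^sub>0 U (Re x)) V (Re y)) (line (line Y\<^sub>0 U (Im x)) V (Im y)))" for x y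
  have g2: "(\<lambda>y. g x y) holomorphic_on ball 0 \<rho>" if x: "cmod x < \<rho>" for x
    unfolding g_def
  proof (rule F_holomorphic_on_ball[OF bn c(1) line_S_level[OF S(1,3)] line_S_level[OF S(2,3)] S(4) _ s ab])
    show "enorm n (line X\<^sub>0 U (Re x) - X\<^sub>0) + \<rho> * enorm n V < \<delta>"
      using step0[OF re(1)[OF x] c(1,3)] UV by linarith
  qed
  have g_swap: "g x y = \<omega> (F a b (line (line X\<^sub>0 V (Re y)) U (Re x)) (line (line Y\<^sub>0 V (Im y)) U (Im x)))" for x y
    unfolding g_def by (simp only: line_commute[OF c(1,3,4)] line_commute[OF c(2,3,4)])
  have g1: "(\<lambda>x. g x y) holomorphic_on ball 0 \<rho>" if y: "cmod y < \<rho>" for y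
    unfolding g_swap
  proof (rule F_holomorphic_on_ball[OF bn c(1) line_S_level[OF S(1,4)] line_S_level[OF S(2,4)] S(3) _ s ab])
    show "enorm n (line X\<^sub>0 V (Re y) - X\<^sub>0) + \<rho> * enorm n U < \<delta>"
      using step0[OF re(1)[OF y] c(1,4)] UV by linarith
  qed
  have gL: "cmod (g x y) \<le> 2 * L" if xy: "cmod x < \<rho>" "cmod y < \<rho>" for x y
  proof -
    have "norm (F a b (line (line X\<^sub>0 U (Re x)) V (Re y)) (line (line Y\<^sub>0 U (Im x)) V (Im y))) \<le> L"
    proof (rule bd)
      show "enorm n (line (line X\<^sub>0 U (Re x)) V (Re y) - X\<^sub>0) < \<delta>"
        using step[OF re(1)[OF xy(2)] line_carrier[OF c(1,3)] c(4) c(1)] step0[OF re(1)[OF xy(1)] c(1,3)] UV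
        by (meson add_right_mono le_less_trans)
      show "enorm n (line (line Y\<^sub>0 U (Im x)) V (Im y) - Y\<^sub>0) < \<delta>"
        using step[OF re(2)[OF xy(2)] line_carrier[OF c(2,3)] c(4) c(2)] step0[OF re(2)[OF xy(1)] c(2,3)] UV
        by (meson add_right_mono le_less_trans)
    qed (intro line_S_level S)+
    then show ?thesis unfolding g_def using state_bound[OF s, of "F a b (line (line X\<^sub>0 U (Re x)) V (Re y)) (line (line Y\<^sub>0 U (Im x)) V (Im y))"]
      by linarith
  qed
  have g00: "g 0 0 = \<omega> (F a b X\<^sub>0 Y\<^sub>0)"
    by (simp add: g_def line_zero[OF c(1,3)] line_zero[OF c(1,4)] line_zero[OF c(2,3)] line_zero[OF c(2,4)])
  have dU: "deriv (\<lambda>x. g x 0) 0 = state_deriv \<omega> a b X\<^sub>0 Y\<^sub>0 U"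
    by (simp add: g_swap state_deriv_def line_zero[OF c(1,4)] line_zero[OF c(2,4)])
  have dV: "deriv (\<lambda>y. g 0 y) 0 = state_deriv \<omega> a b X\<^sub>0 Y\<^sub>0 V"
    by (simp add: g_def state_deriv_def line_zero[OF c(1,3)] line_zero[OF c(2,3)])
  have const: "16 * (2 * L) * q / \<rho>\<^sup>2 = 128 * L * \<sigma>\<^sup>2 / \<delta>\<^sup>2 * q" for q
    using \<delta> \<sigma> by (simp add: \<rho>_def power_divide power_mult_distrib field_simps)
  show "cmod (\<omega> (F a b (line (line X\<^sub>0 U (Re x)) V (Re y)) (line (line Y\<^sub>0 U (Im x)) V (Im y))) - \<omega> (F a b X\<^sub>0 Y\<^sub>0)
       - x * state_deriv \<omega> a b X\<^sub>0 Y\<^sub>0 U - y * state_deriv \<omega> a b X\<^sub>0 Y\<^sub>0 V)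
      \<le> 128 * L * \<sigma>\<^sup>2 / \<delta>\<^sup>2 * ((cmod x)\<^sup>2 + cmod x * cmod y + (cmod y)\<^sup>2)"
    if "cmod x < \<delta> / (2 * \<sigma>)" "cmod y < \<delta> / (2 * \<sigma>)"
    using two_variable_remainder[where g = g, OF g1 g2 gL \<rho>(1) that[folded \<rho>_def]]
    unfolding g00 dU dV const by (simp only: g_def)
  have "cmod (deriv (\<lambda>x. g x 0) 0) \<le> 2 * (2 * L) / \<rho>"
    by (rule quadratic_remainder(1)[OF g1 gL \<rho>(1)]) (use \<rho> in auto)
  also have "\<dots> = 8 * L * \<sigma> / \<delta>" using \<delta> \<sigma> by (simp add: \<rho>_def field_simps)
  finally show "cmod (state_deriv \<omega> a b X\<^sub>0 Y\<^sub>0 U) \<le> 8 * L * \<sigma> / \<delta>" unfolding dU .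
qed

definition DF :: "nat \<Rightarrow> nat \<Rightarrow> 'a mat \<Rightarrow> 'a mat \<Rightarrow> 'a mat \<Rightarrow> 'b" where
  "DF a b X Y U = (SOME d. \<forall>\<omega>. state \<omega> \<longrightarrow> \<omega> d = state_deriv \<omega> a b X Y U)"

text \<open>Difference quotients converge in every state at a rate given by the quadratic remainder.\<close>

lemma DF_state:
  assumes bn: "bounded_near n X\<^sub>0 Y\<^sub>0 \<delta> L"
    and S: "X\<^sub>0 \<in> S_level R\<^sub>1 n" "Y\<^sub>0 \<in> S_level R\<^sub>1 n" "U \<in> S_level R\<^sub>1 n"
    and ab: "a < n" "b < n" and s: "state \<omega>"
  shows "\<omega> (DF a b X\<^sub>0 Y\<^sub>0 U) = state_deriv \<omega> a b X\<^sub>0 Y\<^sub>0 U"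
proof -
  note c = S_level_carrier[OF S(1)] S_level_carrier[OF S(2)] S_level_carrier[OF S(3)]
  have \<delta>: "\<delta> > 0" using bn unfolding bounded_near_def by blast
  define \<sigma> where "\<sigma> = 2 * enorm n U + 1"
  have \<sigma>: "\<sigma> > 0" "enorm n U + enorm n U \<le> \<sigma>" using enorm_nonneg[of n U] by (simp_all add: \<sigma>_def)
  define \<tau> where "\<tau> = \<delta> / (4 * \<sigma>)"
  define C where "C = 128 * L * \<sigma>\<^sup>2 / \<delta>\<^sup>2"
  have \<tau>: "\<tau> > 0" "\<tau> < \<delta> / (2 * \<sigma>)" using \<delta> \<sigma> by (simp_all add: \<tau>_def frac_less2)
  define t where "t k = \<tau> / real (Suc k)" for k
  have t: "0 < t k" "t k < \<delta> / (2 * \<sigma>)" for k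
  proof -
    show "0 < t k" using \<tau> by (simp add: t_def)
    have "t k \<le> \<tau> / 1" unfolding t_def using \<tau> by (intro divide_left_mono) auto
    then show "t k < \<delta> / (2 * \<sigma>)" using \<tau> by simp
  qed
  define x where "x k = complex_of_real (1 / t k) *\<^sub>C (F a b (line X\<^sub>0 U (t k)) Y\<^sub>0 - F a b X\<^sub>0 Y\<^sub>0)" for k
  have "cmod (\<omega> (x k) - state_deriv \<omega> a b X\<^sub>0 Y\<^sub>0 U) \<le> C * \<tau> / real (Suc k)" if s: "state \<omega>" for k \<omega>
  proof -
    let ?d = "state_deriv \<omega> a b X\<^sub>0 Y\<^sub>0 U"
    have "cmod (\<omega> (F a b (line X\<^sub>0 U (t k)) Y\<^sub>0) - \<omega> (F a b X\<^sub>0 Y\<^sub>0) - complex_of_real (t k) * ?d) \<le> C * (t k)\<^sup>2"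
      using F_remainder(1)[OF bn S S(3) s ab \<sigma>, of "complex_of_real (t k)" 0] t[of k]
        line_zero[OF line_carrier[OF c(1,3)] c(3), of "t k"] line_zero[OF c(2,3)] \<delta> \<sigma>
      by (simp add: C_def)
    moreover have "\<omega> (x k) - ?d = (\<omega> (F a b (line X\<^sub>0 U (t k)) Y\<^sub>0) - \<omega> (F a b X\<^sub>0 Y\<^sub>0) - complex_of_real (t k) * ?d) / complex_of_real (t k)"
      using t[of k] by (simp add: x_def state_scaleC[OF s] state_diff[OF s] field_simps)
    ultimately have "cmod (\<omega> (x k) - ?d) \<le> C * (t k)\<^sup>2 / t k"
      using t[of k] by (simp add: norm_divide divide_right_mono)
    also have "\<dots> = C * t k" using t(1)[of k] by (simp add: power2_eq_square)
    finally show ?thesis by (simp add: t_def)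
  qed
  then obtain l where "\<And>\<omega>. state \<omega> \<Longrightarrow> \<omega> l = state_deriv \<omega> a b X\<^sub>0 Y\<^sub>0 U"
    using element_of_state_limits[of x "\<lambda>\<omega>. state_deriv \<omega> a b X\<^sub>0 Y\<^sub>0 U"] by metis
  then have "\<exists>d. \<forall>\<omega>. state \<omega> \<longrightarrow> \<omega> d = state_deriv \<omega> a b X\<^sub>0 Y\<^sub>0 U" by blast
  from someI_ex[OF this] show ?thesis unfolding DF_def using s by blast
qed

text \<open>Both sides are derivatives of the function of one variable obtained by moving along \<open>p U\<close> and
  \<open>q V\<close> simultaneously.\<close>

lemma DF_linear:
  assumes bn: "bounded_near n X\<^sub>0 Y\<^sub>0 \<delta> L"
    and S: "X\<^sub>0 \<in> S_level R\<^sub>1 n" "Y\<^sub>0 \<in> S_level R\<^sub>1 n" "U \<in> S_level R\<^sub>1 n" "V \<in> S_level R\<^sub>1 n"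
    and ab: "a < n" "b < n"
  shows "DF a b X\<^sub>0 Y\<^sub>0 (line (complex_of_real p *\<^sub>C\<^sub>m U) V q)
    = complex_of_real p *\<^sub>C DF a b X\<^sub>0 Y\<^sub>0 U + complex_of_real q *\<^sub>C DF a b X\<^sub>0 Y\<^sub>0 V"
proof (rule eq_of_states)
  fix \<omega> :: "'b \<Rightarrow> complex" assume s: "state \<omega>"
  note c = S_level_carrier[OF S(1)] S_level_carrier[OF S(2)] S_level_carrier[OF S(3)] S_level_carrier[OF S(4)]
  let ?W = "line (complex_of_real p *\<^sub>C\<^sub>m U) V q"
  have W: "?W \<in> S_level R\<^sub>1 n" by (intro line_S_level S_level_scaleC S)
  have \<delta>: "\<delta> > 0" using bn unfolding bounded_near_def by blast
  define \<sigma> where "\<sigma> = enorm n U + enorm n V + 1"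
  have \<sigma>: "\<sigma> > 0" "enorm n U + enorm n V \<le> \<sigma>" using enorm_nonneg[of n U] enorm_nonneg[of n V] by (simp_all add: \<sigma>_def)
  define C where "C = 128 * L * \<sigma>\<^sup>2 / \<delta>\<^sup>2"
  have lW: "line Z ?W r = line (line Z U (p * r)) V (q * r)" if "Z \<in> carrier_mat n n" for Z r
    by (intro eq_matI) (use that c in \<open>auto simp: line_def scaleC_add_right scaleC_scaleC mult.commute\<close>)
  have "state_deriv \<omega> a b X\<^sub>0 Y\<^sub>0 ?W = complex_of_real p * state_deriv \<omega> a b X\<^sub>0 Y\<^sub>0 U + complex_of_real q * state_deriv \<omega> a b X\<^sub>0 Y\<^sub>0 V"
    unfolding state_deriv_def[of \<omega> a b X\<^sub>0 Y\<^sub>0 ?W]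
  proof (rule deriv_of_quadratic_remainder)
    let ?r = "\<delta> / (2 * \<sigma>) / (\<bar>p\<bar> + \<bar>q\<bar> + 1)"
    show "?r > 0" using \<delta> \<sigma> by (intro divide_pos_pos) auto
    fix z assume z: "cmod z < ?r"
    have "cmod z * (\<bar>p\<bar> + \<bar>q\<bar> + 1) < \<delta> / (2 * \<sigma>)"
      using z by (subst (asm) pos_less_divide_eq) auto
    moreover have "\<bar>p\<bar> * cmod z \<le> cmod z * (\<bar>p\<bar> + \<bar>q\<bar> + 1)" "\<bar>q\<bar> * cmod z \<le> cmod z * (\<bar>p\<bar> + \<bar>q\<bar> + 1)"
      by (simp_all add: algebra_simps)
    ultimately have "cmod (of_real p * z) < \<delta> / (2 * \<sigma>)" "cmod (of_real q * z) < \<delta> / (2 * \<sigma>)"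
      by (simp_all add: norm_mult)
    from F_remainder(1)[OF bn S s ab \<sigma> this]
    show "cmod (\<omega> (F a b (line X\<^sub>0 ?W (Re z)) (line Y\<^sub>0 ?W (Im z))) - \<omega> (F a b (line X\<^sub>0 ?W (Re 0)) (line Y\<^sub>0 ?W (Im 0)))
        - z * (complex_of_real p * state_deriv \<omega> a b X\<^sub>0 Y\<^sub>0 U + complex_of_real q * state_deriv \<omega> a b X\<^sub>0 Y\<^sub>0 V))
      \<le> (C * (\<bar>p\<bar>\<^sup>2 + \<bar>p\<bar> * \<bar>q\<bar> + \<bar>q\<bar>\<^sup>2)) * (cmod z)\<^sup>2"
      unfolding C_def[symmetric] lW[OF c(1)] lW[OF c(2)]
      by (simp add: norm_mult power2_eq_square line_zero[OF c(1,3)] line_zero[OF c(1,4)] line_zero[OF c(2,3)] line_zero[OF c(2,4)] algebra_simps)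
  qed
  then show "\<omega> (DF a b X\<^sub>0 Y\<^sub>0 ?W) = \<omega> (complex_of_real p *\<^sub>C DF a b X\<^sub>0 Y\<^sub>0 U + complex_of_real q *\<^sub>C DF a b X\<^sub>0 Y\<^sub>0 V)"
    using DF_state[OF bn S(1,2) _ ab s] W S(3,4) by (simp add: state_add[OF s] state_scaleC[OF s])
qed

lemma DF_bound:
  assumes bn: "bounded_near n X\<^sub>0 Y\<^sub>0 \<delta> L"
    and S: "X\<^sub>0 \<in> S_level R\<^sub>1 n" "Y\<^sub>0 \<in> S_level R\<^sub>1 n" "U \<in> S_level R\<^sub>1 n"
    and ab: "a < n" "b < n"
  shows "norm (DF a b X\<^sub>0 Y\<^sub>0 U) \<le> 32 * L / \<delta> * enorm n U"
proof (rule field_le_epsilon)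
  fix e :: real assume e: "e > 0"
  have \<delta>: "\<delta> > 0" and L: "L \<ge> 0" using bn unfolding bounded_near_def by blast+
  define e' where "e' = e / (16 * L / \<delta> + 1)"
  have d: "16 * L / \<delta> + 1 > 0" using \<delta> L by (simp add: add_nonneg_pos)
  have e': "e' > 0" using e d by (simp add: e'_def)
  define \<sigma> where "\<sigma> = 2 * enorm n U + e'"
  have \<sigma>: "\<sigma> > 0" "enorm n U + enorm n U \<le> \<sigma>" using enorm_nonneg[of n U] e' by (simp_all add: \<sigma>_def)
  have "norm (DF a b X\<^sub>0 Y\<^sub>0 U) \<le> 2 * (8 * L * \<sigma> / \<delta>)"
  proof (rule norm_le_of_states)
    fix \<omega> :: "'b \<Rightarrow> complex" assume s: "state \<omega>"
    show "cmod (\<omega> (DF a b X\<^sub>0 Y\<^sub>0 U)) \<le> 8 * L * \<sigma> / \<delta>"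
      using F_remainder(2)[OF bn S S(3) s ab \<sigma>] DF_state[OF bn S ab s] by simp
  qed
  also have "\<dots> = 32 * L / \<delta> * enorm n U + 16 * L / \<delta> * e'" by (simp add: \<sigma>_def distrib_left add_divide_distrib)
  also have "16 * L / \<delta> * e' \<le> (16 * L / \<delta> + 1) * e'" using e' by (intro mult_right_mono) auto
  also have "\<dots> = e" using d by (simp add: e'_def)
  finally show "norm (DF a b X\<^sub>0 Y\<^sub>0 U) \<le> 32 * L / \<delta> * enorm n U + e" by simp
qed

end

subsection \<open>Real and imaginary parts\<close>

lemma re_im_add:
  assumes "H \<in> carrier_mat n n" "K \<in> carrier_mat n n"
  shows "re_mat (H + K) = re_mat H + re_mat K" "im_mat (H + K) = im_mat H + im_mat K"
  by (intro eq_matI; use assms in \<open>auto simp: re_mat_def im_mat_def star_add scaleC_add_right scaleC_diff_right\<close>)+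

text \<open>Both identities hold in every state, where they concern complex numbers.\<close>

lemma re_im_scaleC:
  fixes H :: "'a::cstar_algebra mat"
  assumes H: "H \<in> carrier_mat n n"
  shows "re_mat (z *\<^sub>C\<^sub>m H) = line (complex_of_real (Re z) *\<^sub>C\<^sub>m re_mat H) (im_mat H) (- Im z)"
    "im_mat (z *\<^sub>C\<^sub>m H) = line (complex_of_real (Im z) *\<^sub>C\<^sub>m re_mat H) (im_mat H) (Re z)"
proof -
  have 1: "(1/2) *\<^sub>C (z *\<^sub>C h + cnj z *\<^sub>C k)
      = complex_of_real (Re z) *\<^sub>C ((1/2) *\<^sub>C (h + k)) + complex_of_real (- Im z) *\<^sub>C ((- \<i>/2) *\<^sub>C (h - k))" for h k :: 'a
  proof (rule eq_of_states)
    fix \<omega> :: "'a \<Rightarrow> complex" assume s: "state \<omega>"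
    show "\<omega> ((1/2) *\<^sub>C (z *\<^sub>C h + cnj z *\<^sub>C k))
      = \<omega> (complex_of_real (Re z) *\<^sub>C ((1/2) *\<^sub>C (h + k)) + complex_of_real (- Im z) *\<^sub>C ((- \<i>/2) *\<^sub>C (h - k)))"
      by (simp add: state_add[OF s] state_diff[OF s] state_scaleC[OF s] complex_eq_iff field_simps)
  qed
  have 2: "(- \<i>/2) *\<^sub>C (z *\<^sub>C h - cnj z *\<^sub>C k)
      = complex_of_real (Im z) *\<^sub>C ((1/2) *\<^sub>C (h + k)) + complex_of_real (Re z) *\<^sub>C ((- \<i>/2) *\<^sub>C (h - k))" for h k :: 'a
  proof (rule eq_of_states)
    fix \<omega> :: "'a \<Rightarrow> complex" assume s: "state \<omega>"
    show "\<omega> ((- \<i>/2) *\<^sub>C (z *\<^sub>C h - cnj z *\<^sub>C k))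
      = \<omega> (complex_of_real (Im z) *\<^sub>C ((1/2) *\<^sub>C (h + k)) + complex_of_real (Re z) *\<^sub>C ((- \<i>/2) *\<^sub>C (h - k)))"
      by (simp add: state_add[OF s] state_diff[OF s] state_scaleC[OF s] complex_eq_iff field_simps)
  qed
  note c = H re_mat_carrier[OF H] im_mat_carrier[OF H]
  have sc: "z *\<^sub>C\<^sub>m H \<in> carrier_mat n n" using H by simp
  note d = carrier_matD[OF H]
  show "re_mat (z *\<^sub>C\<^sub>m H) = line (complex_of_real (Re z) *\<^sub>C\<^sub>m re_mat H) (im_mat H) (- Im z)"
  proof (rule eq_matI)
    fix i j assume "i < dim_row (line (complex_of_real (Re z) *\<^sub>C\<^sub>m re_mat H) (im_mat H) (- Im z))"
      "j < dim_col (line (complex_of_real (Re z) *\<^sub>C\<^sub>m re_mat H) (im_mat H) (- Im z))"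
    then have ij: "i < n" "j < n" using c by (simp_all add: line_def im_mat_def)
    have "re_mat (z *\<^sub>C\<^sub>m H) $$ (i, j) = (1/2) *\<^sub>C (z *\<^sub>C H $$ (i, j) + cnj z *\<^sub>C star (H $$ (j, i)))"
      using ij d by (simp add: re_mat_def star_scaleC)
    also have "\<dots> = line (complex_of_real (Re z) *\<^sub>C\<^sub>m re_mat H) (im_mat H) (- Im z) $$ (i, j)"
      unfolding 1 using ij d by (simp add: line_def re_mat_def im_mat_def)
    finally show "re_mat (z *\<^sub>C\<^sub>m H) $$ (i, j) = line (complex_of_real (Re z) *\<^sub>C\<^sub>m re_mat H) (im_mat H) (- Im z) $$ (i, j)" .
  qed (simp_all add: line_def re_mat_def im_mat_def)
  show "im_mat (z *\<^sub>C\<^sub>m H) = line (complex_of_real (Im z) *\<^sub>C\<^sub>m re_mat H) (im_mat H) (Re z)"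
  proof (rule eq_matI)
    fix i j assume "i < dim_row (line (complex_of_real (Im z) *\<^sub>C\<^sub>m re_mat H) (im_mat H) (Re z))"
      "j < dim_col (line (complex_of_real (Im z) *\<^sub>C\<^sub>m re_mat H) (im_mat H) (Re z))"
    then have ij: "i < n" "j < n" using c by (simp_all add: line_def im_mat_def)
    have "im_mat (z *\<^sub>C\<^sub>m H) $$ (i, j) = (- \<i>/2) *\<^sub>C (z *\<^sub>C H $$ (i, j) - cnj z *\<^sub>C star (H $$ (j, i)))"
      using ij d by (simp add: im_mat_def star_scaleC)
    also have "\<dots> = line (complex_of_real (Im z) *\<^sub>C\<^sub>m re_mat H) (im_mat H) (Re z) $$ (i, j)"
      unfolding 2 using ij d by (simp add: line_def re_mat_def im_mat_def)
    finally show "im_mat (z *\<^sub>C\<^sub>m H) $$ (i, j) = line (complex_of_real (Im z) *\<^sub>C\<^sub>m re_mat H) (im_mat H) (Re z) $$ (i, j)" .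
  qed (simp_all add: line_def re_mat_def im_mat_def)
qed

lemma mat_norm_le_entries:
  assumes X: "X \<in> carrier_mat n n" and B: "\<And>a b. a < n \<Longrightarrow> b < n \<Longrightarrow> norm (X $$ (a, b)) \<le> B"
  shows "mat_norm X \<le> real n * real n * B"
proof -
  have "enorm n X \<le> (\<Sum>a<n. \<Sum>b<n. B)" unfolding enorm_def by (intro sum_mono B) auto
  then show ?thesis using mat_norm_le_enorm[OF X] by (simp add: mult.assoc)
qed

context matrix_convex_function
begin

subsection \<open>The continued function\<close>

definition tube_ext :: "nat \<Rightarrow> 'a mat \<Rightarrow> 'b mat" where
  "tube_ext n Z = Matrix.mat n n (\<lambda>(a, b). F a b (re_mat Z) (im_mat Z))"

text \<open>The complex linear extension of the real linear derivative in self-adjoint directions.\<close>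

definition tube_deriv :: "nat \<Rightarrow> 'a mat \<Rightarrow> 'a mat \<Rightarrow> 'a mat \<Rightarrow> 'b mat" where
  "tube_deriv n X Y H = Matrix.mat n n (\<lambda>(a, b). DF a b X Y (re_mat H) + \<i> *\<^sub>C DF a b X Y (im_mat H))"

lemma tube_levelE:
  assumes "Z \<in> level (tube R\<^sub>1 G) n"
  obtains X Y where "X \<in> level G n" "Y \<in> S_level R\<^sub>1 n" "Z = X + \<i> *\<^sub>C\<^sub>m Y"
proof -
  obtain m X Y where Z: "X \<in> level G m" "Y \<in> S_level R\<^sub>1 m" "Z = X + \<i> *\<^sub>C\<^sub>m Y" "Z \<in> carrier_mat n n"
    using assms unfolding level_def[of "tube R\<^sub>1 G"] unfolding tube_def by blast
  have "Z \<in> carrier_mat m m" using G_carrier[OF Z(1)] S_level_carrier[OF Z(2)] unfolding Z(3) by simp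
  then have "m = n" using Z(4) by auto
  then show thesis using that Z by blast
qed

lemma tube_levelI:
  assumes "X \<in> level G n" "Y \<in> S_level R\<^sub>1 n" shows "X + \<i> *\<^sub>C\<^sub>m Y \<in> level (tube R\<^sub>1 G) n"
  using assms G_carrier[OF assms(1)] S_level_carrier[OF assms(2)] unfolding level_def[of "tube R\<^sub>1 G"] unfolding tube_def by auto

lemma tube_ext_real:
  assumes X: "X \<in> level G n" shows "tube_ext n X = f X"
proof -
  have z: "complex_of_real 0 *\<^sub>C\<^sub>m X = 0\<^sub>m n n"
    by (intro eq_matI) (use G_carrier[OF X] in \<open>auto simp: scaleC_zero_left\<close>)
  have 0: "0\<^sub>m n n \<in> S_level R\<^sub>1 n" using S_level_scaleC[OF G_S_level[OF X], of 0] unfolding z .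
  have "X + \<i> *\<^sub>C\<^sub>m 0\<^sub>m n n = X"
    by (intro eq_matI) (use G_carrier[OF X] in \<open>auto simp: scaleC_zero_right\<close>)
  then have "re_mat X = X" "im_mat X = 0\<^sub>m n n" using re_im_unique[OF R1 G_S_level[OF X] 0] by simp_all
  then show ?thesis
    by (intro eq_matI) (use f_carrier[OF X] F_real[OF X] in \<open>auto simp: tube_ext_def\<close>)
qed

lemma tube_deriv_clinear:
  assumes bn: "bounded_near n X\<^sub>0 Y\<^sub>0 \<delta> L" and S: "X\<^sub>0 \<in> S_level R\<^sub>1 n" "Y\<^sub>0 \<in> S_level R\<^sub>1 n"
  shows "bounded_clinear_level R\<^sub>1 n (tube_deriv n X\<^sub>0 Y\<^sub>0)"
  unfolding bounded_clinear_level_def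
proof (intro conjI ballI allI)
  let ?D = "tube_deriv n X\<^sub>0 Y\<^sub>0"
  show "?D H \<in> carrier_mat n n" for H by (simp add: tube_deriv_def)
  have parts: "re_mat H \<in> S_level R\<^sub>1 n" "im_mat H \<in> S_level R\<^sub>1 n" if "H \<in> M_level R\<^sub>1 n" for H
    using re_im_mat_S_level[OF R1 that] .
  have one: "line (complex_of_real 1 *\<^sub>C\<^sub>m U) V 1 = U + V" if "U \<in> carrier_mat n n" "V \<in> carrier_mat n n" for U V :: "'a mat"
    by (intro eq_matI) (use that in \<open>auto simp: line_def scaleC_one\<close>)
  have add: "DF a b X\<^sub>0 Y\<^sub>0 (U + V) = DF a b X\<^sub>0 Y\<^sub>0 U + DF a b X\<^sub>0 Y\<^sub>0 V"
    if "U \<in> S_level R\<^sub>1 n" "V \<in> S_level R\<^sub>1 n" "a < n" "b < n" for U V a b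
    using DF_linear[OF bn S that, of 1 1] one[OF S_level_carrier[OF that(1)] S_level_carrier[OF that(2)]] by (simp add: scaleC_one)
  show "?D (H + K) = ?D H + ?D K" if "H \<in> M_level R\<^sub>1 n" "K \<in> M_level R\<^sub>1 n" for H K
    using re_im_add[OF M_level_carrier[OF that(1)] M_level_carrier[OF that(2)]] parts[OF that(1)] parts[OF that(2)]
    by (intro eq_matI) (auto simp: tube_deriv_def add scaleC_add_right)
  show "?D (z *\<^sub>C\<^sub>m H) = z *\<^sub>C\<^sub>m ?D H" if H: "H \<in> M_level R\<^sub>1 n" for z H
  proof (rule eq_matI)
    fix a b assume "a < dim_row (z *\<^sub>C\<^sub>m ?D H)" "b < dim_col (z *\<^sub>C\<^sub>m ?D H)"
    then have ab: "a < n" "b < n" by (simp_all add: tube_deriv_def)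
    have re: "DF a b X\<^sub>0 Y\<^sub>0 (re_mat (z *\<^sub>C\<^sub>m H))
       = complex_of_real (Re z) *\<^sub>C DF a b X\<^sub>0 Y\<^sub>0 (re_mat H) + complex_of_real (- Im z) *\<^sub>C DF a b X\<^sub>0 Y\<^sub>0 (im_mat H)"
      unfolding re_im_scaleC[OF M_level_carrier[OF H]] by (rule DF_linear[OF bn S parts[OF H] ab])
    have im: "DF a b X\<^sub>0 Y\<^sub>0 (im_mat (z *\<^sub>C\<^sub>m H))
       = complex_of_real (Im z) *\<^sub>C DF a b X\<^sub>0 Y\<^sub>0 (re_mat H) + complex_of_real (Re z) *\<^sub>C DF a b X\<^sub>0 Y\<^sub>0 (im_mat H)"
      unfolding re_im_scaleC[OF M_level_carrier[OF H]] by (rule DF_linear[OF bn S parts[OF H] ab])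
    have "DF a b X\<^sub>0 Y\<^sub>0 (re_mat (z *\<^sub>C\<^sub>m H)) + \<i> *\<^sub>C DF a b X\<^sub>0 Y\<^sub>0 (im_mat (z *\<^sub>C\<^sub>m H))
      = z *\<^sub>C (DF a b X\<^sub>0 Y\<^sub>0 (re_mat H) + \<i> *\<^sub>C DF a b X\<^sub>0 Y\<^sub>0 (im_mat H))"
    proof (rule eq_of_states)
      fix \<omega> :: "'b \<Rightarrow> complex" assume s: "state \<omega>"
      show "\<omega> (DF a b X\<^sub>0 Y\<^sub>0 (re_mat (z *\<^sub>C\<^sub>m H)) + \<i> *\<^sub>C DF a b X\<^sub>0 Y\<^sub>0 (im_mat (z *\<^sub>C\<^sub>m H)))
        = \<omega> (z *\<^sub>C (DF a b X\<^sub>0 Y\<^sub>0 (re_mat H) + \<i> *\<^sub>C DF a b X\<^sub>0 Y\<^sub>0 (im_mat H)))"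
        unfolding re im by (simp add: state_add[OF s] state_scaleC[OF s] complex_eq_iff algebra_simps)
    qed
    then show "?D (z *\<^sub>C\<^sub>m H) $$ (a, b) = (z *\<^sub>C\<^sub>m ?D H) $$ (a, b)" using ab by (simp add: tube_deriv_def)
  qed (simp_all add: tube_deriv_def)
  show "\<exists>C. \<forall>H\<in>M_level R\<^sub>1 n. mat_norm (?D H) \<le> C * mat_norm H"
  proof (intro exI ballI)
    fix H assume H: "H \<in> M_level R\<^sub>1 n"
    have L: "32 * L / \<delta> \<ge> 0" using bn unfolding bounded_near_def by (intro divide_nonneg_pos) auto
    have "norm (?D H $$ (a, b)) \<le> 32 * L / \<delta> * enorm n H + 32 * L / \<delta> * enorm n H" if ab: "a < n" "b < n" for a b
    proof -
      have "norm (?D H $$ (a, b)) \<le> norm (DF a b X\<^sub>0 Y\<^sub>0 (re_mat H)) + norm (DF a b X\<^sub>0 Y\<^sub>0 (im_mat H))"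
        using ab norm_triangle_ineq[of "DF a b X\<^sub>0 Y\<^sub>0 (re_mat H)" "\<i> *\<^sub>C DF a b X\<^sub>0 Y\<^sub>0 (im_mat H)"]
        by (simp add: tube_deriv_def norm_scaleC)
      also have "\<dots> \<le> 32 * L / \<delta> * enorm n (re_mat H) + 32 * L / \<delta> * enorm n (im_mat H)"
        by (intro add_mono DF_bound[OF bn S _ ab] parts[OF H])
      also have "\<dots> \<le> 32 * L / \<delta> * enorm n H + 32 * L / \<delta> * enorm n H"
        by (intro add_mono mult_left_mono enorm_re_im_mat[OF M_level_carrier[OF H]] L)
      finally show ?thesis .
    qed
    then have "mat_norm (?D H) \<le> real n * real n * (32 * L / \<delta> * enorm n H + 32 * L / \<delta> * enorm n H)"
      by (intro mat_norm_le_entries) (simp_all add: tube_deriv_def)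
    also have "\<dots> = real n * real n * (64 * L / \<delta>) * enorm n H" by (simp add: algebra_simps)
    also have "\<dots> \<le> real n * real n * (64 * L / \<delta>) * (real n * real n * mat_norm H)"
      using L by (intro mult_left_mono enorm_le_mat_norm[OF M_level_carrier[OF H]] mult_nonneg_nonneg) auto
    finally show "mat_norm (?D H) \<le> real n * real n * (64 * L / \<delta>) * (real n * real n) * mat_norm H" by (simp only: mult.assoc)
  qed
qed

text \<open>Use the two-variable remainder at \<open>x = 1\<close>, \<open>y = \<i>\<close>, for the real and the imaginary part of
  \<open>H\<close> as directions.\<close>

lemma tube_ext_remainder:
  assumes bn: "bounded_near n X\<^sub>0 Y\<^sub>0 \<delta> L" and S: "X\<^sub>0 \<in> S_level R\<^sub>1 n" "Y\<^sub>0 \<in> S_level R\<^sub>1 n"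
    and H: "H \<in> M_level R\<^sub>1 n" and \<sigma>: "\<sigma> > 0" "2 * enorm n H \<le> \<sigma>" "2 * \<sigma> < \<delta>"
  shows "X\<^sub>0 + \<i> *\<^sub>C\<^sub>m Y\<^sub>0 + H \<in> level (tube R\<^sub>1 G) n"
    "mat_norm (tube_ext n (X\<^sub>0 + \<i> *\<^sub>C\<^sub>m Y\<^sub>0 + H) - tube_ext n (X\<^sub>0 + \<i> *\<^sub>C\<^sub>m Y\<^sub>0) - tube_deriv n X\<^sub>0 Y\<^sub>0 H)
       \<le> real n * real n * (768 * L * \<sigma>\<^sup>2 / \<delta>\<^sup>2)"
proof -
  define U where "U = re_mat H"
  define V where "V = im_mat H"
  have UV: "U \<in> S_level R\<^sub>1 n" "V \<in> S_level R\<^sub>1 n" using re_im_mat_S_level[OF R1 H] by (simp_all add: U_def V_def)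
  note c = S_level_carrier[OF S(1)] S_level_carrier[OF S(2)] S_level_carrier[OF UV(1)] S_level_carrier[OF UV(2)]
  have le: "enorm n U \<le> enorm n H" "enorm n V \<le> enorm n H"
    using enorm_re_im_mat[OF M_level_carrier[OF H]] by (simp_all add: U_def V_def)
  have \<delta>: "\<delta> > 0" and L: "L \<ge> 0" using bn unfolding bounded_near_def by blast+
  have Hd: "H = U + \<i> *\<^sub>C\<^sub>m V" unfolding U_def V_def by (rule re_im_decomposition[OF M_level_carrier[OF H]])
  have ZH: "X\<^sub>0 + \<i> *\<^sub>C\<^sub>m Y\<^sub>0 + H = (X\<^sub>0 + U) + \<i> *\<^sub>C\<^sub>m (Y\<^sub>0 + V)"
    unfolding Hd by (intro eq_matI) (use c in \<open>auto simp: scaleC_add_right\<close>)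
  have "X\<^sub>0 + U - X\<^sub>0 = U" by (intro eq_matI) (use c in auto)
  then have "enorm n (X\<^sub>0 + U - X\<^sub>0) < \<delta>" using le(1) \<sigma> enorm_nonneg[of n H] by simp
  then have XU: "X\<^sub>0 + U \<in> level G n" using bn S_level_add[OF S(1) UV(1)] unfolding bounded_near_def by blast
  have YV: "Y\<^sub>0 + V \<in> S_level R\<^sub>1 n" by (rule S_level_add[OF S(2) UV(2)])
  show "X\<^sub>0 + \<i> *\<^sub>C\<^sub>m Y\<^sub>0 + H \<in> level (tube R\<^sub>1 G) n" unfolding ZH by (rule tube_levelI[OF XU YV])
  note parts = re_im_unique[OF R1 S] re_im_unique[OF R1 S_level_add[OF S(1) UV(1)] YV]
  have l: "line (line X\<^sub>0 U 1) V 0 = X\<^sub>0 + U" "line (line Y\<^sub>0 U 0) V 1 = Y\<^sub>0 + V"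
    by (intro eq_matI; use c in \<open>auto simp: line_def scaleC_one scaleC_zero_left\<close>)+
  have entry: "norm (F a b (X\<^sub>0 + U) (Y\<^sub>0 + V) - F a b X\<^sub>0 Y\<^sub>0 - (DF a b X\<^sub>0 Y\<^sub>0 U + \<i> *\<^sub>C DF a b X\<^sub>0 Y\<^sub>0 V)) \<le> 2 * (384 * L * \<sigma>\<^sup>2 / \<delta>\<^sup>2)"
    if ab: "a < n" "b < n" for a b
  proof (rule norm_le_of_states)
    fix \<omega> :: "'b \<Rightarrow> complex" assume s: "state \<omega>"
    have UVs: "enorm n U + enorm n V \<le> \<sigma>" using le \<sigma>(2) by linarith
    have one: "1 < \<delta> / (2 * \<sigma>)" using \<sigma> by simp
    have "cmod (\<omega> (F a b (X\<^sub>0 + U) (Y\<^sub>0 + V)) - \<omega> (F a b X\<^sub>0 Y\<^sub>0) - 1 * state_deriv \<omega> a b X\<^sub>0 Y\<^sub>0 U - \<i> * state_deriv \<omega> a b X\<^sub>0 Y\<^sub>0 V)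
      \<le> 128 * L * \<sigma>\<^sup>2 / \<delta>\<^sup>2 * ((cmod 1)\<^sup>2 + cmod 1 * cmod \<i> + (cmod \<i>)\<^sup>2)"
      using F_remainder(1)[OF bn S UV s ab \<sigma>(1) UVs, of 1 \<i>] one l by simp
    then show "cmod (\<omega> (F a b (X\<^sub>0 + U) (Y\<^sub>0 + V) - F a b X\<^sub>0 Y\<^sub>0 - (DF a b X\<^sub>0 Y\<^sub>0 U + \<i> *\<^sub>C DF a b X\<^sub>0 Y\<^sub>0 V))) \<le> 384 * L * \<sigma>\<^sup>2 / \<delta>\<^sup>2"
      using DF_state[OF bn S UV(1) ab s] DF_state[OF bn S UV(2) ab s]
      by (simp add: state_diff[OF s] state_add[OF s] state_scaleC[OF s] diff_diff_eq add.assoc mult.assoc)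
  qed
  show "mat_norm (tube_ext n (X\<^sub>0 + \<i> *\<^sub>C\<^sub>m Y\<^sub>0 + H) - tube_ext n (X\<^sub>0 + \<i> *\<^sub>C\<^sub>m Y\<^sub>0) - tube_deriv n X\<^sub>0 Y\<^sub>0 H)
       \<le> real n * real n * (768 * L * \<sigma>\<^sup>2 / \<delta>\<^sup>2)"
  proof (rule mat_norm_le_entries)
    fix a b assume ab: "a < n" "b < n"
    show "norm ((tube_ext n (X\<^sub>0 + \<i> *\<^sub>C\<^sub>m Y\<^sub>0 + H) - tube_ext n (X\<^sub>0 + \<i> *\<^sub>C\<^sub>m Y\<^sub>0) - tube_deriv n X\<^sub>0 Y\<^sub>0 H) $$ (a, b)) \<le> 768 * L * \<sigma>\<^sup>2 / \<delta>\<^sup>2"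
      using entry[OF ab] ab unfolding ZH by (simp add: tube_ext_def tube_deriv_def parts U_def[symmetric] V_def[symmetric])
  qed (intro minus_carrier_mat; simp add: tube_deriv_def)
qed

theorem tube_continuation: "continues_analytically_to_tube R\<^sub>1 G f"
  unfolding continues_analytically_to_tube_def
proof (intro allI impI)
  fix n :: nat assume n: "n \<ge> 1"
  have "analytic_level R\<^sub>1 n (level (tube R\<^sub>1 G) n) (tube_ext n)"
    unfolding analytic_level_def
  proof (intro conjI ballI subsetI)
    fix Z assume Z: "Z \<in> level (tube R\<^sub>1 G) n"
    obtain X Y where XY: "X \<in> level G n" "Y \<in> S_level R\<^sub>1 n" "Z = X + \<i> *\<^sub>C\<^sub>m Y" using tube_levelE[OF Z] .
    note S = G_S_level[OF XY(1)] XY(2)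
    show "Z \<in> M_level R\<^sub>1 n" unfolding XY(3) by (intro M_level_add M_level_scaleC S_subset_M S)
    show "tube_ext n Z \<in> carrier_mat n n" by (simp add: tube_ext_def)
    obtain \<delta> L where dL: "\<delta> > 0" "L \<ge> 0"
      "\<And>X'. X' \<in> S_level R\<^sub>1 n \<Longrightarrow> enorm n (X' - X) < \<delta> \<Longrightarrow> X' \<in> level G n"
      "\<And>X' Y' a b. X' \<in> S_level R\<^sub>1 n \<Longrightarrow> Y' \<in> S_level R\<^sub>1 n \<Longrightarrow> enorm n (X' - X) < \<delta> \<Longrightarrow> enorm n (Y' - Y) < \<delta> \<Longrightarrow>
         a < n \<Longrightarrow> b < n \<Longrightarrow> norm (F a b X' Y') \<le> L"
      by (rule F_locally_bounded[OF XY(1,2)]) (rule that)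
    then have bn: "bounded_near n X Y \<delta> L" unfolding bounded_near_def by blast
    define D where "D = tube_deriv n X Y"
    have D: "bounded_clinear_level R\<^sub>1 n D" unfolding D_def by (rule tube_deriv_clinear[OF bn S])
    have D0: "D (0\<^sub>m n n) = 0\<^sub>m n n" if "0\<^sub>m n n \<in> M_level R\<^sub>1 n"
    proof -
      have z: "0 *\<^sub>C\<^sub>m 0\<^sub>m n n = (0\<^sub>m n n :: 'a mat)" by (intro eq_matI) (auto simp: scaleC_zero_left)
      have "D (0 *\<^sub>C\<^sub>m 0\<^sub>m n n) = 0 *\<^sub>C\<^sub>m D (0\<^sub>m n n)" "D (0\<^sub>m n n) \<in> carrier_mat n n"
        using D that unfolding bounded_clinear_level_def by blast+
      moreover have "0 *\<^sub>C\<^sub>m D (0\<^sub>m n n) = 0\<^sub>m n n"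
        using calculation(2) by (intro eq_matI) (auto simp: scaleC_zero_left)
      ultimately show ?thesis unfolding z by simp
    qed
    define C where "C = real n * real n * (768 * L / \<delta>\<^sup>2) * (2 * real n * real n)\<^sup>2"
    have C: "C \<ge> 0" using dL by (simp add: C_def)
    have nn: "2 * real n * real n > 0" using n by simp
    have "\<exists>\<delta>'>0. \<forall>H\<in>M_level R\<^sub>1 n. mat_norm H < \<delta>' \<longrightarrow>
        Z + H \<in> level (tube R\<^sub>1 G) n \<and> mat_norm (tube_ext n (Z + H) - tube_ext n Z - D H) \<le> e * mat_norm H"
      if e: "e > 0" for e
    proof (intro exI[of _ "min (\<delta> / (2 * (2 * real n * real n))) (e / (C + 1))"] conjI ballI impI)
      show "min (\<delta> / (2 * (2 * real n * real n))) (e / (C + 1)) > 0" using e C nn dL by simp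
      fix H assume H: "H \<in> M_level R\<^sub>1 n" and small: "mat_norm H < min (\<delta> / (2 * (2 * real n * real n))) (e / (C + 1))"
      note cH = M_level_carrier[OF H]
      have h0: "mat_norm H \<ge> 0" by (rule mat_norm_nonneg[OF cH n])
      have "Z + H \<in> level (tube R\<^sub>1 G) n \<and> mat_norm (tube_ext n (Z + H) - tube_ext n Z - D H) \<le> e * mat_norm H"
      proof (cases "mat_norm H = 0")
        case True
        have H0: "H = 0\<^sub>m n n"
        proof (rule eq_matI)
          fix a b assume "a < dim_row (0\<^sub>m n n :: 'a mat)" "b < dim_col (0\<^sub>m n n :: 'a mat)"
          then have ab: "a < n" "b < n" by simp_all
          then show "H $$ (a, b) = 0\<^sub>m n n $$ (a, b)" using entry_le_mat_norm[OF cH ab] True by simp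
        qed (use cH in auto)
        have ZZ: "Z + H = Z" using Z unfolding H0 level_def by simp
        have DH: "D H = 0\<^sub>m n n" using D0 H unfolding H0 by blast
        have "mat_norm (tube_ext n Z - tube_ext n Z - 0\<^sub>m n n) \<le> real n * real n * 0"
        proof (rule mat_norm_le_entries)
          show "tube_ext n Z - tube_ext n Z - 0\<^sub>m n n \<in> carrier_mat n n" by (rule minus_carrier_mat) simp
        qed (simp add: tube_ext_def)
        then show ?thesis unfolding ZZ DH using Z True by simp
      next
        case False
        then have h: "mat_norm H > 0" using h0 by simp
        define \<sigma> where "\<sigma> = 2 * real n * real n * mat_norm H"
        have \<sigma>: "\<sigma> > 0" "2 * enorm n H \<le> \<sigma>" "2 * \<sigma> < \<delta>"
        proof -
          show "\<sigma> > 0" using h nn by (simp add: \<sigma>_def)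
          show "2 * enorm n H \<le> \<sigma>" using enorm_le_mat_norm[OF cH] by (simp add: \<sigma>_def mult.assoc)
          have "mat_norm H < \<delta> / (2 * (2 * real n * real n))" using small by simp
          then have "mat_norm H * (2 * (2 * real n * real n)) < \<delta>" using nn by (subst (asm) pos_less_divide_eq) auto
          then show "2 * \<sigma> < \<delta>" by (simp add: \<sigma>_def mult_ac)
        qed
        note rem = tube_ext_remainder[OF bn S H \<sigma>, folded XY(3)]
        have "mat_norm (tube_ext n (Z + H) - tube_ext n Z - D H) \<le> C * mat_norm H * mat_norm H"
          using rem(2) unfolding D_def C_def \<sigma>_def by (simp add: power2_eq_square mult_ac)
        also have "\<dots> \<le> e * mat_norm H"
        proof (intro mult_right_mono h0)
          have "mat_norm H < e / (C + 1)" using small by simp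
          then have "mat_norm H * (C + 1) < e" using C by (subst (asm) pos_less_divide_eq) auto
          then show "C * mat_norm H \<le> e" using h0 by (simp add: algebra_simps)
        qed
        finally show ?thesis using rem(1) by simp
      qed
      then show "Z + H \<in> level (tube R\<^sub>1 G) n" "mat_norm (tube_ext n (Z + H) - tube_ext n Z - D H) \<le> e * mat_norm H" by simp_all
    qed
    then show "\<exists>D. bounded_clinear_level R\<^sub>1 n D \<and> (\<forall>e>0. \<exists>\<delta>>0. \<forall>H\<in>M_level R\<^sub>1 n. mat_norm H < \<delta> \<longrightarrow>
        Z + H \<in> level (tube R\<^sub>1 G) n \<and> mat_norm (tube_ext n (Z + H) - tube_ext n Z - D H) \<le> e * mat_norm H)"
      using D by blast
  qed
  then show "\<exists>F. analytic_level R\<^sub>1 n (level (tube R\<^sub>1 G) n) F \<and> (\<forall>X\<in>level G n. F X = f X)"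
    using tube_ext_real by blast
qed

end

theorem theorem5p2:
  fixes R\<^sub>1 :: "'a::cstar_algebra set" and R\<^sub>2 :: "'b::cstar_algebra set"
    and G :: "'a mat set" and f :: "'a mat \<Rightarrow> 'b mat"
  assumes "real_operator_system R\<^sub>1" and "real_operator_system R\<^sub>2"
    and "free_domain R\<^sub>1 G" and "levelwise_convex G"
    and "free_function G R\<^sub>2 f"
    and "matrix_convex G f" and "locally_bounded G f"
  shows "continues_analytically_to_tube R\<^sub>1 G f"
proof -
  interpret matrix_convex_function R\<^sub>1 R\<^sub>2 G f
    by (unfold_locales) (fact assms)+
  show ?thesis by (rule tube_continuation)
qed

end
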